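(* Let $d\in\mathbb{N}$, $d\geq 2$. For $n\in\mathbb{N}$ let $\mathcal{F}_n$ denote the collection of all subsets $S\subset\mathbb{Z}^d$ with cardinality $|S|=n^d$, and for each $S\in\mathcal{F}_n$ let $$L_S:=\inf\left\{\operatorname{Lip}(f)\colon\ f\colon S\to\{1,\ldots,n\}^d\text{ is a bijection}\right\}.$$ Then the sequence $$C_n:=\sup\{L_S\colon S\in\mathcal{F}_n\},\qquad n\in\mathbb{N},$$ is unbounded.
   Context: $\operatorname{Lip}(f)$ denotes the Lipschitz constant of $f$ with respect to the Euclidean norm on $\mathbb{Z}^d\subset\mathbb{R}^d$, i.e. the smallest $L\ge 0$ with $\|f(x)-f(y)\|_2\leq L\|x-y\|_2$ for all $x,y$ in the domain. $\mathbb{N}=\{1,2,\ldots\}$. *)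

theory Defs
  imports "HOL-Analysis.Analysis"
begin

text \<open>
  The ambient space is \<^typ>\<open>real ^ 'd\<close> with its Euclidean metric; the dimension $d$ of the
  mathematics is \<^term>\<open>CARD('d)\<close>.
\<close>

definition int_lattice :: "(real ^ 'd::finite) set" where
  "int_lattice = {x. \<forall>i. x $ i \<in> \<int>}"

definition grid :: "nat \<Rightarrow> (real ^ 'd::finite) set" where
  "grid n = {x. \<forall>i. x $ i \<in> real ` {1..n}}"

text \<open>
  Only the values of \<open>f\<close> on \<open>S\<close> matter; \<^const>\<open>lipschitz_on\<close> includes the requirement \<open>0 \<le> L\<close>.
  The least constant exists whenever \<open>f\<close> is Lipschitz on \<open>S\<close> at all
  (lemma \<open>lipschitz_on_Lip\<close> below).
\<close>

definition Lip :: "(real ^ 'd::finite) set \<Rightarrow> (real ^ 'd \<Rightarrow> real ^ 'd) \<Rightarrow> real" where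
  "Lip S f = (LEAST L. L-lipschitz_on S f)"

text \<open>For \<open>n \<ge> 1\<close> the cardinality condition forces \<open>S\<close> to be finite.\<close>

definition lattice_sets :: "nat \<Rightarrow> (real ^ 'd::finite) set set" where
  "lattice_sets n = {S. S \<subseteq> int_lattice \<and> card S = n ^ CARD('d)}"

definition best_Lip :: "nat \<Rightarrow> (real ^ 'd::finite) set \<Rightarrow> real" where
  "best_Lip n S = Inf {Lip S f |f. bij_betw f S (grid n)}"

text \<open>
  The argument of type \<^typ>\<open>'d itself\<close> only carries the dimension. The infimum above and the
  supremum below are taken in \<^typ>\<open>real\<close>; the lemmas at the end show that for \<open>n \<ge> 1\<close> they range over
  nonempty bounded sets, so that no default value of \<^const>\<open>Inf\<close> or \<^const>\<open>Sup\<close> is involved.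
\<close>

definition worst_Lip :: "'d::finite itself \<Rightarrow> nat \<Rightarrow> real" where
  "worst_Lip d n = Sup (best_Lip n ` (lattice_sets n :: (real ^ 'd) set set))"

lemma Lip_properties:
  assumes "C-lipschitz_on S f"
  shows lipschitz_on_Lip: "(Lip S f)-lipschitz_on S f" and Lip_le: "Lip S f \<le> C"
proof -
  define A where "A = {L. L-lipschitz_on S f}"
  have ne: "A \<noteq> {}" using assms by (auto simp: A_def)
  have nonneg: "0 \<le> L" if "L \<in> A" for L
    using that lipschitz_on_nonneg by (auto simp: A_def)
  have bdd: "bdd_below A" using nonneg by (rule bdd_belowI)
  have 0: "(Inf A)-lipschitz_on S f"
  proof (rule lipschitz_onI)
    show "0 \<le> Inf A" using ne nonneg by (rule cInf_greatest)
    fix x y assume xy: "x \<in> S" "y \<in> S"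
    show "dist (f x) (f y) \<le> Inf A * dist x y"
    proof (cases "x = y")
      case False
      have "dist (f x) (f y) / dist x y \<le> Inf A"
        using ne
      proof (rule cInf_greatest)
        fix L assume "L \<in> A"
        then have "dist (f x) (f y) \<le> L * dist x y"
          using xy lipschitz_onD by (auto simp: A_def)
        then show "dist (f x) (f y) / dist x y \<le> L"
          using False by (simp add: divide_le_eq)
      qed
      then show ?thesis using False by (simp add: divide_le_eq)
    qed simp
  qed
  have least: "Inf A \<le> L" if "L-lipschitz_on S f" for L
    using that bdd by (auto simp: A_def intro: cInf_lower)
  have eq: "Lip S f = Inf A"
    unfolding Lip_def using 0 least by (rule Least_equality)
  show "(Lip S f)-lipschitz_on S f" "Lip S f \<le> C"
    using 0 least[OF assms] by (simp_all add: eq)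
qed

lemma card_grid: "card (grid n :: (real ^ 'd::finite) set) = n ^ CARD('d)"
proof -
  let ?P = "PiE (UNIV :: 'd set) (\<lambda>_. real ` {1..n})"
  have "grid n = vec_lambda ` ?P"
  proof (intro equalityI subsetI)
    fix x :: "real ^ 'd" assume "x \<in> grid n"
    then have "vec_nth x \<in> ?P" by (auto simp: grid_def)
    then show "x \<in> vec_lambda ` ?P" by (metis image_eqI vec_nth_inverse)
  qed (auto simp: grid_def PiE_def Pi_def)
  moreover have "inj_on vec_lambda ?P"
    by (auto simp: inj_on_def vec_lambda_inject)
  ultimately have "card (grid n :: (real ^ 'd) set) = card ?P"
    by (simp add: card_image)
  also have "\<dots> = n ^ CARD('d)"
    by (simp add: card_PiE card_image)
  finally show ?thesis .
qed

lemma lattice_sets_nonempty: "(lattice_sets n :: (real ^ 'd::finite) set set) \<noteq> {}"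
proof -
  have "(grid n :: (real ^ 'd) set) \<in> lattice_sets n"
    unfolding lattice_sets_def
  proof (intro CollectI conjI subsetI)
    fix x :: "real ^ 'd" assume x: "x \<in> grid n"
    have "x $ i \<in> \<int>" for i
    proof -
      have "x $ i \<in> real ` {1..n}" using x by (simp add: grid_def)
      then show ?thesis by auto
    qed
    then show "x \<in> int_lattice" by (simp add: int_lattice_def)
  qed (rule card_grid)
  then show ?thesis by blast
qed

lemma bijection_to_grid_exists:
  fixes S :: "(real ^ 'd::finite) set"
  assumes "n \<ge> 1" "S \<in> lattice_sets n"
  shows "\<exists>f. bij_betw f S (grid n :: (real ^ 'd) set)"
proof (rule finite_same_card_bij)
  have pos: "n ^ CARD('d) > 0" using assms by simp
  show "finite S" using assms pos by (intro card_ge_0_finite) (simp add: lattice_sets_def)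
  show "finite (grid n :: (real ^ 'd) set)" using pos by (intro card_ge_0_finite) (simp add: card_grid)
  show "card S = card (grid n :: (real ^ 'd) set)"
    using assms by (simp add: lattice_sets_def card_grid)
qed

lemma bijection_to_grid_lipschitz:
  fixes S :: "(real ^ 'd::finite) set" and f :: "real ^ 'd \<Rightarrow> real ^ 'd"
  assumes S: "S \<in> lattice_sets n" and f: "bij_betw f S (grid n)"
  shows "(real CARD('d) * real n)-lipschitz_on S f"
proof (rule lipschitz_onI)
  fix x y assume xy: "x \<in> S" "y \<in> S"
  show "dist (f x) (f y) \<le> real CARD('d) * real n * dist x y"
  proof (cases "x = y")
    case False
    then obtain i where i: "x $ i \<noteq> y $ i" by (auto simp: vec_eq_iff)
    have "x \<in> int_lattice" "y \<in> int_lattice" using S xy by (auto simp: lattice_sets_def)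
    then have "x $ i - y $ i \<in> \<int>" by (simp add: int_lattice_def)
    then have "1 \<le> \<bar>x $ i - y $ i\<bar>" using i by (intro Ints_nonzero_abs_ge1) auto
    also have "\<dots> \<le> dist x y"
      using component_le_norm_cart[of "x - y" i] by (simp add: dist_norm)
    finally have 1: "1 \<le> dist x y" .
    have "f x \<in> grid n" "f y \<in> grid n" using f xy by (auto simp: bij_betw_def)
    then have le: "\<bar>(f x - f y) $ j\<bar> \<le> real n" for j
      unfolding grid_def by (auto dest!: spec[of _ j])
    have "dist (f x) (f y) \<le> (\<Sum>j\<in>UNIV. \<bar>(f x - f y) $ j\<bar>)"
      unfolding dist_norm by (rule norm_le_l1_cart)
    also have "\<dots> \<le> (\<Sum>j\<in>(UNIV :: 'd set). real n)" by (rule sum_mono) (rule le)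
    also have "\<dots> = real CARD('d) * real n * 1" by simp
    also have "\<dots> \<le> real CARD('d) * real n * dist x y"
      using 1 by (intro mult_left_mono) auto
    finally show ?thesis .
  qed simp
qed simp

lemma Lip_bounds:
  fixes S :: "(real ^ 'd::finite) set"
  assumes "S \<in> lattice_sets n" "bij_betw f S (grid n)"
  shows "0 \<le> Lip S f" "Lip S f \<le> real CARD('d) * real n"
  using Lip_properties[OF bijection_to_grid_lipschitz[OF assms]] lipschitz_on_nonneg by auto

lemma best_Lip_bounds:
  fixes S :: "(real ^ 'd::finite) set"
  assumes "n \<ge> 1" "S \<in> lattice_sets n"
  shows "0 \<le> best_Lip n S" "best_Lip n S \<le> real CARD('d) * real n"
proof -
  obtain f :: "real ^ 'd \<Rightarrow> real ^ 'd" where f: "bij_betw f S (grid n)"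
    using bijection_to_grid_exists[OF assms] by blast
  have bdd: "bdd_below {Lip S f |f. bij_betw f S (grid n)}"
    using Lip_bounds(1)[OF assms(2)] by (auto intro: bdd_belowI[of _ 0])
  have "best_Lip n S \<le> Lip S f"
    unfolding best_Lip_def using f bdd by (auto intro: cInf_lower)
  then show "best_Lip n S \<le> real CARD('d) * real n"
    using Lip_bounds(2)[OF assms(2) f] by linarith
  show "0 \<le> best_Lip n S"
    unfolding best_Lip_def using f Lip_bounds(1)[OF assms(2)] by (auto intro!: cInf_greatest)
qed

lemma bdd_above_best_Lip:
  assumes "n \<ge> 1"
  shows "bdd_above (best_Lip n ` (lattice_sets n :: (real ^ 'd::finite) set set))"
  using best_Lip_bounds(2)[OF assms] by (rule bdd_aboveI2)

end

theory Submission
  imports Defs "HOL-Complex_Analysis.Great_Picard"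
begin

text \<open>
  Suppose the constants were bounded. Then, for some \<open>L\<close>, every set of \<open>n^d\<close> lattice points has an
  \<open>L\<close>-Lipschitz bijection onto the grid \<open>{1..n}^d\<close>. This property passes to a scaling limit, where it
  becomes a statement about measures that is refuted by a density oscillating on many scales; the
  oscillation is a checkerboard pattern as in the work of Burago, Kleiner and McMullen on prescribed
  Jacobians.

  The scaling limit. Let \<open>\<rho>\<close> be a density on the unit cube with values in \<open>[1/2, 1]\<close>. If \<open>\<rho>\<close> is
  continuous, it is approximated by the counting measures of lattice sets of cardinality \<open>m^d\<close> at
  scale \<open>1/N\<close> (lemma \<open>discretise_density\<close>). The rescaled bijections, extended to the whole space,
  have uniformly bounded Lipschitz constants, so a subsequence converges to a Lipschitz map \<open>f\<close>, and
  \<open>f\<close> carries the measure with density \<open>\<rho>\<close> to Lebesgue measure on some cube \<open>[0, M]^d\<close> (lemmas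
  \<open>transport_limit\<close> and \<open>transport_continuous_density\<close>). The same compactness gives such an \<open>f\<close> for every
  \<open>\<rho>\<close> that agrees with continuous densities off sets of arbitrarily small volume (lemma
  \<open>transport_limit_density\<close>). The limit \<open>f\<close> may fold the cube, because injectivity is lost, and this is
  the main difficulty.

  Sheets. Because \<open>\<rho> \<ge> 1/2\<close>, preimages of small sets are small, and a packing argument bounds the number
  of disjoint compact sets whose images under \<open>f\<close> overlap in an open set. In a family with the largest
  possible number of members, \<open>f\<close> is injective on each member over a suitable ball of the target: a
  further fold would produce one more member. Two facts enter here. Every open set contains a ball on
  which \<open>f\<close> is close to an invertible affine map (lemma \<open>affine_ball\<close>), and such a map covers an open
  set stably, by the fixed point theorem of Brouwer (lemma \<open>near_affine_surjective\<close>). Hence over some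
  ball \<open>U\<close> the cube consists of finitely many disjoint sheets, on each of which \<open>f\<close> is a homeomorphism
  onto \<open>U\<close> with Lipschitz inverse (lemma \<open>sheets_exist\<close>).

  Near translations. Fix one sheet and a coordinate direction \<open>e\<close>, and consider \<open>f\<close> together with the maps
  that send a point of this sheet to the point of another sheet with the same image. Choose a segment in
  direction \<open>e\<close> for which the sum of the squared difference quotients of all these maps is nearly
  maximal, and cut it into \<open>N\<close> cells. No cell can have much larger difference quotients than the whole
  segment, so the variance of the increments along the row is small, and on some pair of adjacent cells
  all these maps change by a nearly constant vector (lemma \<open>row_near_translation\<close>).

  The contradiction. The volume of the image of a cell is the sum of the masses of the copies of that
  cell in all the sheets (lemma \<open>vol_image_sheets\<close>). For the two adjacent cells the images have nearly
  the same volume, and so have their copies in the other sheets. If \<open>\<rho>\<close> is nearly constant near those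
  copies, then the two cells themselves must have nearly the same mass (lemma \<open>cell_comparison\<close>). But a
  checkered density takes the values \<open>1\<close> and \<open>1/2\<close> on alternate cells of rows along a dense set of
  segments, with arbitrarily many cells, and at the scale of those cells it is nearly constant away from
  the row. Such a density is obtained by inserting rows one after another, each confined to a thin tube
  around its segment (lemma \<open>checkered_density_exists\<close>). This is where \<open>d \<ge> 2\<close> is used: segments are null
  sets, so that the tubes can be given as little volume as desired.
\<close>

section \<open>Balls on which a Lipschitz map is nearly affine\<close>

text \<open>
  The right-hand side is the linearisation of the norm at \<open>(l/2) u\<close> plus a quadratic error: seen from
  near the midpoint of a segment, the distance to an endpoint is almost a linear function.
\<close>
lemma norm_add_le_inner:
  fixes u z :: "'a::real_inner"
  assumes u: "norm u = 1" and l: "l > 0" and z: "norm z \<le> l/4"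
  shows "norm ((l/2) *\<^sub>R u + z) \<le> l/2 + u \<bullet> z + (norm z)\<^sup>2 / l"
proof -
  have uz: "\<bar>u \<bullet> z\<bar> \<le> norm z" using Cauchy_Schwarz_ineq2[of u z] u by simp
  have pos: "0 \<le> l/2 + u \<bullet> z + (norm z)\<^sup>2 / l"
    using uz z l by (auto intro!: add_nonneg_nonneg)
  have uu: "u \<bullet> u = 1" using u by (simp add: dot_square_norm)
  have "(norm ((l/2) *\<^sub>R u + z))\<^sup>2 = (l/2)\<^sup>2 + l * (u \<bullet> z) + (norm z)\<^sup>2"
    unfolding power2_norm_eq_inner
    by (simp add: algebra_simps inner_commute[of z u] uu power2_eq_square)
  also have "\<dots> \<le> (l/2)\<^sup>2 + l * (u \<bullet> z) + (norm z)\<^sup>2 + (u \<bullet> z + (norm z)\<^sup>2 / l)\<^sup>2" by simp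
  also have "\<dots> = (l/2 + u \<bullet> z + (norm z)\<^sup>2 / l)\<^sup>2"
    using l by (simp add: power2_eq_square field_simps)
  finally show ?thesis using pos by (rule power2_le_imp_le)
qed

text \<open>
  Among all balls in the given one, take a ball \<open>cball v \<rho>\<close> on which the Lipschitz constant \<open>s\<close> of \<open>h\<close> is
  almost the infimum. On the concentric ball of half the radius the constant cannot be much smaller, so
  some pair \<open>a\<close>, \<open>b\<close> there has slope almost \<open>s\<close>. The bounds \<open>h x \<le> h a + s * dist x a\<close> and
  \<open>h x \<ge> h b - s * dist b x\<close> then nearly coincide on the segment, and near its midpoint both are affine up
  to a quadratic error.
\<close>
lemma scalar_near_affine:
  fixes h :: "'a::euclidean_space \<Rightarrow> real"
  assumes lip: "L-lipschitz_on (cball x0 R) h" and R: "R > 0" and e: "e > 0"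
  obtains c r g where "r > 0" "cball c r \<subseteq> cball x0 R"
    "\<And>x. x \<in> cball c r \<Longrightarrow> \<bar>h x - h c - g \<bullet> (x - c)\<bar> \<le> e * r"
proof -
  define A where "A = {s. \<exists>v \<rho>. \<rho> > 0 \<and> cball v \<rho> \<subseteq> cball x0 R \<and> s-lipschitz_on (cball v \<rho>) h}"
  have LA: "L \<in> A" unfolding A_def using lip R by blast
  have A0: "s \<ge> 0" if "s \<in> A" for s using that lipschitz_on_nonneg by (auto simp: A_def)
  then have bdd: "bdd_below A" by (rule bdd_belowI)
  have L0: "L \<ge> 0" using A0 LA by blast
  \<comment> \<open>with \<open>r = \<theta> l\<close>, the quadratic error \<open>(L + 1) r^2 / l\<close> and the slope defect \<open>2 \<eta> l\<close> are at most \<open>e r / 2\<close> each\<close>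
  define \<theta> where "\<theta> = min (1/4) (e / (2 * (L+1)))"
  have th: "\<theta> > 0" "\<theta> \<le> 1/4" "\<theta> \<le> e / (2 * (L+1))" proof -
    have "e / (2 * (L+1)) > 0" using e L0 by simp
    then show "\<theta> > 0" unfolding \<theta>_def by (metis min_less_iff_conj zero_less_divide_1_iff zero_less_numeral)
  qed (unfold \<theta>_def, rule min.cobounded1, rule min.cobounded2)
  define \<eta> where "\<eta> = min 1 (e * \<theta> / 4)"
  have eta: "\<eta> > 0" "\<eta> \<le> 1" "\<eta> \<le> e * \<theta> / 4" using e th by (auto simp: \<eta>_def)
  have "Inf A < Inf A + \<eta>" using eta by simp
  then obtain s where s: "s \<in> A" "s < Inf A + \<eta>"
    using cInf_lessD[of A "Inf A + \<eta>"] LA by blast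
  have InfL: "Inf A \<le> L" using LA bdd by (rule cInf_lower)
  have sL: "s \<le> L + 1" using s InfL eta by linarith
  have s0: "s \<ge> 0" using s A0 by blast
  obtain v \<rho> where v: "\<rho> > 0" "cball v \<rho> \<subseteq> cball x0 R" "s-lipschitz_on (cball v \<rho>) h"
    using s(1) by (auto simp: A_def)
  show thesis
  \<comment> \<open>for tiny \<open>s\<close> the function itself is nearly constant\<close>
  proof (cases "s < 2 * \<eta>")
    case True
    show thesis
    proof (rule that[of \<rho> v 0])
      fix x assume "x \<in> cball v \<rho>"
      then have "\<bar>h x - h v\<bar> \<le> s * dist x v"
        using lipschitz_onD[OF v(3), of x v] v(1) by (auto simp: dist_real_def)
      also have "\<dots> \<le> e * \<rho>"
      proof (rule mult_mono)
        have "e * \<theta> \<le> e * (1/4)" using th e by (intro mult_left_mono) auto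
        then show "s \<le> e" using True eta(3) e by linarith
      qed (use \<open>x \<in> _\<close> e in \<open>auto simp: dist_commute\<close>)
      finally show "\<bar>h x - h v - 0 \<bullet> (x - v)\<bar> \<le> e * \<rho>" by simp
    qed (use v in auto)
  next
    case False
    have sub: "cball v (\<rho>/2) \<subseteq> cball v \<rho>" using v(1) by (intro subset_cball) auto
    have "s - 2 * \<eta> \<notin> A"
      using cInf_lower[OF _ bdd, of "s - 2*\<eta>"] s eta by fastforce
    then have "\<not> (s - 2*\<eta>)-lipschitz_on (cball v (\<rho>/2)) h"
      using v sub unfolding A_def by (auto dest!: spec[of _ v] spec[of _ "\<rho>/2"])
    then obtain a b where ab: "a \<in> cball v (\<rho>/2)" "b \<in> cball v (\<rho>/2)"
      "dist (h a) (h b) > (s - 2*\<eta>) * dist a b"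
      using False unfolding lipschitz_on_def by force
    \<comment> \<open>orient the pair so that \<open>h\<close> increases from \<open>a\<close> to \<open>b\<close>\<close>
    obtain a b where ab: "a \<in> cball v (\<rho>/2)" "b \<in> cball v (\<rho>/2)"
      "h b - h a \<ge> (s - 2*\<eta>) * dist a b" "a \<noteq> b"
    proof (cases "h a \<le> h b")
      case True
      moreover have "a \<noteq> b" using ab(3) by auto
      ultimately show ?thesis using that[of a b] ab by (auto simp: dist_real_def)
    next
      case False
      moreover have "a \<noteq> b" using ab(3) by auto
      ultimately show ?thesis using that[of b a] ab by (auto simp: dist_real_def dist_commute)
    qed
    define l where "l = dist a b"
    have l: "l > 0" using ab by (simp add: l_def)
    define u where "u = (1/l) *\<^sub>R (b - a)"
    have u1: "norm u = 1" using l by (simp add: u_def l_def dist_norm norm_minus_commute)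
    define c where "c = midpoint a b"
    have ca: "c - a = (l/2) *\<^sub>R u" "b - c = (l/2) *\<^sub>R u"
      using l by (simp_all add: c_def midpoint_def u_def algebra_simps flip: scaleR_add_left)
    have cv: "c \<in> cball v (\<rho>/2)" unfolding c_def midpoint_def
      using convexD[OF convex_cball ab(1,2), of "1/2" "1/2"] by (simp add: scaleR_add_right)
    have l\<rho>: "l \<le> \<rho>" using ab(1,2) dist_triangle[of a b v] by (simp add: l_def dist_commute)
    define r where "r = \<theta> * l"
    have r: "r > 0" "r \<le> l/4" using th l mult_right_mono[of \<theta> "1/4" l] by (auto simp: r_def)
    have cr: "cball c r \<subseteq> cball v \<rho>"
    proof
      fix x assume "x \<in> cball c r"
      then show "x \<in> cball v \<rho>" using cv r l\<rho> dist_triangle[of v x c] by simp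
    qed
    have va: "a \<in> cball v \<rho>" "b \<in> cball v \<rho>" using ab(1,2) sub by auto
    have est: "h x - h a \<le> s * (l/2 + u \<bullet> (x-c) + (norm (x-c))\<^sup>2 / l)"
      "h x - h a \<ge> s * (l/2 + u \<bullet> (x-c) - (norm (x-c))\<^sup>2 / l) - 2*\<eta>*l" if x: "x \<in> cball c r" for x
    proof -
      have z: "norm (x - c) \<le> l/4" using x r by (simp add: dist_norm norm_minus_commute)
      have "h x - h a \<le> s * dist x a"
        using lipschitz_onD[OF v(3), of x a] x cr va by (auto simp: dist_real_def)
      also have "dist x a = norm ((l/2) *\<^sub>R u + (x - c))"
        using ca by (simp add: dist_norm algebra_simps)
      also have "s * \<dots> \<le> s * (l/2 + u \<bullet> (x-c) + (norm (x-c))\<^sup>2 / l)"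
        by (intro mult_left_mono norm_add_le_inner u1 l z s0)
      finally show "h x - h a \<le> s * (l/2 + u \<bullet> (x-c) + (norm (x-c))\<^sup>2 / l)" .
      have "h b - h x \<le> s * dist b x"
        using lipschitz_onD[OF v(3), of b x] x cr va by (auto simp: dist_real_def)
      also have "dist b x = norm ((l/2) *\<^sub>R u + (c - x))"
        using ca by (simp add: dist_norm algebra_simps)
      also have "s * \<dots> \<le> s * (l/2 + u \<bullet> (c-x) + (norm (c-x))\<^sup>2 / l)"
        using z by (intro mult_left_mono norm_add_le_inner u1 l s0) (simp add: norm_minus_commute)
      finally have "h b - h x \<le> s * (l/2 - u \<bullet> (x-c) + (norm (x-c))\<^sup>2 / l)"
        by (simp add: inner_diff_right norm_minus_commute[of c x] algebra_simps)
      moreover have "h b - h a \<ge> (s - 2*\<eta>) * l" using ab by (simp add: l_def)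
      ultimately show "h x - h a \<ge> s * (l/2 + u \<bullet> (x-c) - (norm (x-c))\<^sup>2 / l) - 2*\<eta>*l"
        by (simp add: algebra_simps)
    qed
    show thesis
    proof (rule that[of r c "s *\<^sub>R u"])
      fix x assume x: "x \<in> cball c r"
      have cc: "c \<in> cball c r" using r by simp
      have "\<bar>h x - h c - s * (u \<bullet> (x - c))\<bar> \<le> s * ((norm (x-c))\<^sup>2 / l) + 2*\<eta>*l"
        using est[OF x] est[OF cc] by (simp add: algebra_simps)
      also have "\<dots> \<le> e * r"
      proof -
        have "(norm (x-c))\<^sup>2 \<le> r\<^sup>2" using x by (intro power_mono) (auto simp: dist_norm norm_minus_commute)
        then have "(norm (x-c))\<^sup>2 / l \<le> r\<^sup>2 / l" using l by (intro divide_right_mono) auto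
        also have "r\<^sup>2 / l = \<theta> * r" using l by (simp add: r_def power2_eq_square)
        finally have "s * ((norm (x-c))\<^sup>2 / l) \<le> (L+1) * (\<theta> * r)" using s0 sL l th r
          by (intro mult_mono) auto
        also have "\<dots> \<le> (L+1) * (e / (2 * (L+1)) * r)"
          using th r L0 by (intro mult_left_mono mult_right_mono) auto
        also have "\<dots> = e * r / 2" using L0 by (simp add: field_simps)
        finally have 1: "s * ((norm (x-c))\<^sup>2 / l) \<le> e * r / 2" .
        have "2 * \<eta> * l \<le> 2 * (e * \<theta> / 4) * l" using eta l by (intro mult_right_mono mult_left_mono) auto
        also have "\<dots> = e * r / 2" by (simp add: r_def)
        finally show ?thesis using 1 by linarith
      qed
      finally show "\<bar>h x - h c - s *\<^sub>R u \<bullet> (x - c)\<bar> \<le> e * r" by simp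
    qed (use r cr v in auto)
  qed
qed

lemma lipschitz_on_imp_equicont:
  assumes "\<And>n::nat. L-lipschitz_on S (F n)" "x \<in> S" "0 < (e::real)"
  shows "\<exists>d. 0 < d \<and> (\<forall>n y. y \<in> S \<and> norm(x - y) < d \<longrightarrow> norm(F n x - F n y :: 'b::real_normed_vector) < e)"
proof (intro exI[of _ "e/(L+1)"] conjI allI impI)
  have L: "L \<ge> 0" using assms(1) lipschitz_on_nonneg by blast
  then show "0 < e/(L+1)" using assms by simp
  fix n y assume y: "y \<in> S \<and> norm(x - y) < e/(L+1)"
  have "norm (F n x - F n y) \<le> L * norm (x - y)"
    using lipschitz_onD[OF assms(1)] assms(2) y by (simp add: dist_norm)
  also have "\<dots> \<le> (L+1) * norm (x - y)" by (intro mult_right_mono) auto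
  also have "\<dots> < e" using y L by (simp add: field_simps)
  finally show "norm(F n x - F n y) < e" .
qed

text \<open>
  If no positive lower bound for the radius existed, there would be functions \<open>h\<close> that admit no ball of
  radius \<open>1/(n+1)\<close>. After subtraction of their values at \<open>0\<close> they subconverge uniformly, and a ball that
  is good for the limit with tolerance \<open>e/2\<close> is good for all late members with tolerance \<open>e\<close>.
\<close>
lemma scalar_near_affine_unit:
  assumes L: "L \<ge> 0" and e: "e > 0"
  shows "\<exists>\<tau>>0. \<forall>h :: 'a::euclidean_space \<Rightarrow> real. L-lipschitz_on (cball 0 1) h \<longrightarrow>
    (\<exists>c r g. r \<ge> \<tau> \<and> cball c r \<subseteq> cball 0 1 \<and> (\<forall>x\<in>cball c r. \<bar>h x - h c - g \<bullet> (x - c)\<bar> \<le> e * r))"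
proof (rule ccontr)
  define bad where "bad \<tau> h \<longleftrightarrow> L-lipschitz_on (cball 0 1) h \<and>
    \<not> (\<exists>c r g. r \<ge> \<tau> \<and> cball c r \<subseteq> cball 0 1 \<and> (\<forall>x\<in>cball c r. \<bar>h x - h c - g \<bullet> (x - c)\<bar> \<le> e * r))"
    for \<tau> and h :: "'a \<Rightarrow> real"
  assume "\<not> ?thesis"
  then have "\<forall>\<tau>>0. \<exists>h. bad \<tau> h" unfolding bad_def by meson
  then have "\<forall>n. \<exists>h. bad (inverse (real (Suc n))) h" by simp
  then obtain H where H: "bad (inverse (real (Suc n))) (H n)" for n by metis
  define F where "F n x = H n x - H n 0" for n x
  have lipH: "L-lipschitz_on (cball 0 1) (H n)" for n using H by (simp add: bad_def)
  have lipF: "L-lipschitz_on (cball 0 1) (F n)" for n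
    using lipH[of n] by (simp add: lipschitz_on_def F_def dist_real_def)
  have bnd: "norm (F n x) \<le> L" if "x \<in> cball 0 1" for n x
  proof -
    have "dist (F n x) (F n 0) \<le> L * dist x 0" using that by (intro lipschitz_onD[OF lipF]) simp_all
    also have "\<dots> \<le> L * 1" using that L by (intro mult_left_mono) auto
    finally show ?thesis by (simp add: F_def)
  qed
  obtain g k where gk: "continuous_on (cball 0 1) g" "strict_mono (k :: nat \<Rightarrow> nat)"
    "\<And>e. 0 < e \<Longrightarrow> \<exists>N. \<forall>n x. n \<ge> N \<and> x \<in> cball 0 1 \<longrightarrow> norm (F (k n) x - g x) < e"
  proof (rule Arzela_Ascoli[of "cball (0::'a) 1" F L])
    show "\<exists>d. 0 < d \<and> (\<forall>n y. y \<in> cball 0 1 \<and> norm (x - y) < d \<longrightarrow> norm (F n x - F n y) < e)"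
      if "x \<in> cball 0 1" "0 < e" for x e using lipschitz_on_imp_equicont[OF lipF that] .
  qed (use bnd in auto)
  have "L-lipschitz_on (cball 0 1) g"
  proof (rule lipschitz_onI[OF _ L])
    fix x y :: 'a assume xy: "x \<in> cball 0 1" "y \<in> cball 0 1"
    show "dist (g x) (g y) \<le> L * dist x y"
    proof (rule field_le_epsilon)
      fix d :: real assume "d > 0"
      then obtain N where N: "\<And>n x. n \<ge> N \<Longrightarrow> x \<in> cball 0 1 \<Longrightarrow> norm (F (k n) x - g x) < d/2"
        using gk(3)[of "d/2"] by auto
      have "dist (F (k N) x) (F (k N) y) \<le> L * dist x y" using lipschitz_onD[OF lipF] xy by blast
      then show "dist (g x) (g y) \<le> L * dist x y + d"
        using N[of N x] N[of N y] xy by (simp add: dist_real_def abs_if split: if_splits)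
    qed
  qed
  then obtain c r q where crq: "r > 0" "cball c r \<subseteq> cball 0 1"
    "\<And>x. x \<in> cball c r \<Longrightarrow> \<bar>g x - g c - q \<bullet> (x - c)\<bar> \<le> (e/2) * r"
    using scalar_near_affine[OF \<open>L-lipschitz_on (cball 0 1) g\<close> zero_less_one half_gt_zero[OF e]] by metis
  obtain N where N: "\<And>n x. n \<ge> N \<Longrightarrow> x \<in> cball 0 1 \<Longrightarrow> norm (F (k n) x - g x) < e/4*r"
    using gk(3)[of "e/4*r"] e crq(1) by (metis mult_pos_pos zero_less_divide_iff zero_less_numeral)
  obtain n0 where n0: "inverse (real (Suc n0)) < r" using crq(1) reals_Archimedean by blast
  define n where "n = max N n0"
  have kn: "k n \<ge> n0" using seq_suble[OF gk(2), of n] by (simp add: n_def)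
  have "inverse (real (Suc (k n))) \<le> inverse (real (Suc n0))" using kn by simp
  then have rn: "r \<ge> inverse (real (Suc (k n)))" using n0 by linarith
  have "\<bar>H (k n) x - H (k n) c - q \<bullet> (x - c)\<bar> \<le> e * r" if "x \<in> cball c r" for x
  proof -
    have "c \<in> cball c r" using crq(1) by simp
    then have "c \<in> cball 0 1" "x \<in> cball 0 1" using that crq(2) by blast+
    then have "\<bar>F (k n) x - g x\<bar> < e/4*r" "\<bar>F (k n) c - g c\<bar> < e/4*r"
      using N[of n x] N[of n c] by (auto simp: n_def)
    then show ?thesis using crq(3)[OF that] by (simp add: F_def abs_if split: if_splits)
  qed
  then show False using H[of "k n"] rn crq(2) unfolding bad_def by blast
qed

text \<open>
  Both the hypothesis and the conclusion are invariant under rescaling of argument and value, which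
  reduces everything to the unit ball.
\<close>
lemma scalar_near_affine_uniform:
  assumes L: "L \<ge> 0" and e: "e > 0"
  shows "\<exists>\<tau>>0. \<forall>(h :: 'a::euclidean_space \<Rightarrow> real) x0 R. R > 0 \<longrightarrow> L-lipschitz_on (cball x0 R) h \<longrightarrow>
    (\<exists>c r g. r \<ge> \<tau> * R \<and> cball c r \<subseteq> cball x0 R \<and> (\<forall>x\<in>cball c r. \<bar>h x - h c - g \<bullet> (x - c)\<bar> \<le> e * r))"
proof -
  obtain \<tau> where \<tau>: "\<tau> > 0" and un: "\<And>h :: 'a \<Rightarrow> real. L-lipschitz_on (cball 0 1) h \<Longrightarrow>
    (\<exists>c r g. r \<ge> \<tau> \<and> cball c r \<subseteq> cball 0 1 \<and> (\<forall>x\<in>cball c r. \<bar>h x - h c - g \<bullet> (x - c)\<bar> \<le> e * r))"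
    using scalar_near_affine_unit[OF assms] by blast
  show ?thesis
  proof (intro exI[of _ \<tau>] conjI \<tau> allI impI)
    fix h :: "'a \<Rightarrow> real" and x0 and R :: real assume R: "R > 0" and lip: "L-lipschitz_on (cball x0 R) h"
    define h' where "h' y = h (x0 + R *\<^sub>R y) / R" for y
    have "L-lipschitz_on (cball 0 1) h'"
    proof (rule lipschitz_onI[OF _ L])
      fix x y :: 'a assume "x \<in> cball 0 1" "y \<in> cball 0 1"
      then have "dist (h (x0 + R *\<^sub>R x)) (h (x0 + R *\<^sub>R y)) \<le> L * dist (x0 + R *\<^sub>R x) (x0 + R *\<^sub>R y)"
        using R by (intro lipschitz_onD[OF lip]) (auto simp: dist_norm)
      also have "dist (x0 + R *\<^sub>R x) (x0 + R *\<^sub>R y) = R * dist x y"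
        using R by (simp add: dist_norm flip: scaleR_diff_right)
      finally show "dist (h' x) (h' y) \<le> L * dist x y"
        using R by (simp add: h'_def dist_real_def field_simps flip: diff_divide_distrib)
    qed
    from un[OF this] obtain c r g where crg: "r \<ge> \<tau>" "cball c r \<subseteq> cball 0 1"
      "\<And>x. x \<in> cball c r \<Longrightarrow> \<bar>h' x - h' c - g \<bullet> (x - c)\<bar> \<le> e * r" by blast
    have tr: "(1/R) *\<^sub>R (x - x0) \<in> cball c r" if "x \<in> cball (x0 + R *\<^sub>R c) (R * r)" for x
    proof -
      have "x - (x0 + R *\<^sub>R c) = R *\<^sub>R ((1/R) *\<^sub>R (x - x0) - c)" using R by (simp add: algebra_simps)
      then have "R * norm ((1/R) *\<^sub>R (x - x0) - c) \<le> R * r"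
        using that R by (simp add: dist_norm norm_minus_commute)
      then show ?thesis using R by (simp add: dist_norm norm_minus_commute)
    qed
    have rec: "x0 + R *\<^sub>R ((1/R) *\<^sub>R (x - x0)) = x" for x using R by simp
    show "\<exists>c r g. r \<ge> \<tau> * R \<and> cball c r \<subseteq> cball x0 R \<and> (\<forall>x\<in>cball c r. \<bar>h x - h c - g \<bullet> (x - c)\<bar> \<le> e * r)"
    proof (rule exI[of _ "x0 + R *\<^sub>R c"], rule exI[of _ "R * r"], rule exI[of _ g], intro conjI ballI subsetI)
      show "\<tau> * R \<le> R * r" using crg(1) R by simp
      fix x assume x: "x \<in> cball (x0 + R *\<^sub>R c) (R * r)"
      define y where "y = (1/R) *\<^sub>R (x - x0)"
      have y: "y \<in> cball c r" "x = x0 + R *\<^sub>R y" using tr[OF x] rec[of x] by (auto simp: y_def)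
      have "norm y \<le> 1" using y crg(2) by auto
      then show "x \<in> cball x0 R" using y R by (simp add: dist_norm)
      have "\<bar>h' y - h' c - g \<bullet> (y - c)\<bar> \<le> e * r" using crg(3) y by blast
      then have "R * \<bar>h' y - h' c - g \<bullet> (y - c)\<bar> \<le> R * (e * r)" using R by simp
      moreover have "R * \<bar>h' y - h' c - g \<bullet> (y - c)\<bar> = \<bar>h x - h (x0 + R *\<^sub>R c) - g \<bullet> (x - (x0 + R *\<^sub>R c))\<bar>"
      proof -
        have "R * \<bar>h' y - h' c - g \<bullet> (y - c)\<bar> = \<bar>R * (h' y - h' c - g \<bullet> (y - c))\<bar>"
          using R by (simp add: abs_mult)
        also have "R * (h' y - h' c - g \<bullet> (y - c)) = h x - h (x0 + R *\<^sub>R c) - R * (g \<bullet> (y - c))"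
          using R by (simp add: h'_def y(2) right_diff_distrib)
        also have "R * (g \<bullet> (y - c)) = g \<bullet> (x - (x0 + R *\<^sub>R c))"
          by (simp add: y(2) inner_diff_right inner_add_right algebra_simps)
        finally show ?thesis .
      qed
      ultimately show "\<bar>h x - h (x0 + R *\<^sub>R c) - g \<bullet> (x - (x0 + R *\<^sub>R c))\<bar> \<le> e * (R * r)"
        by (simp add: mult_ac)
    qed
  qed
qed

text \<open>
  The coordinates are treated one after another. Inside a ball that is good for \<open>D\<close>, with a sharper
  tolerance, there is a ball good for one more coordinate. Since its radius is smaller by at most the
  fixed factor \<open>\<tau>1\<close>, the errors of the earlier coordinates remain small relative to the new radius; this
  is what the uniformity in the radius is for.
\<close>
lemma coordinates_near_affine:
  fixes D :: "'b::euclidean_space set"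
  assumes "finite D" "D \<subseteq> Basis" and L: "L \<ge> 0" and e: "e > 0"
  shows "\<exists>\<tau>>0. \<forall>(f :: 'a::euclidean_space \<Rightarrow> 'b) x0 R. R > 0 \<longrightarrow> L-lipschitz_on (cball x0 R) f \<longrightarrow>
    (\<exists>c r. r \<ge> \<tau> * R \<and> cball c r \<subseteq> cball x0 R \<and>
      (\<forall>b\<in>D. \<exists>g. \<forall>x\<in>cball c r. \<bar>(f x - f c) \<bullet> b - g \<bullet> (x - c)\<bar> \<le> e * r))"
  using assms(1,2) e
proof (induction D arbitrary: e rule: finite_induct)
  case empty
  show ?case by (rule exI[of _ 1]) auto
next
  case (insert k D)
  obtain \<tau>1 where \<tau>1: "\<tau>1 > 0" and t1: "\<And>(h :: 'a \<Rightarrow> real) x0 R. R > 0 \<Longrightarrow> L-lipschitz_on (cball x0 R) h \<Longrightarrow>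
    (\<exists>c r g. r \<ge> \<tau>1 * R \<and> cball c r \<subseteq> cball x0 R \<and> (\<forall>x\<in>cball c r. \<bar>h x - h c - g \<bullet> (x - c)\<bar> \<le> e * r))"
    using scalar_near_affine_uniform[OF L \<open>e > 0\<close>] by blast
  \<comment> \<open>the factor \<open>\<tau>1\<close> compensates for the smaller radius, the factor \<open>1/2\<close> for the change of centre\<close>
  define e' where "e' = e * \<tau>1 / 2"
  have e': "e' > 0" using insert.prems \<tau>1 by (simp add: e'_def)
  obtain \<tau>2 where \<tau>2: "\<tau>2 > 0" and t2: "\<And>(f :: 'a \<Rightarrow> 'b) x0 R. R > 0 \<Longrightarrow> L-lipschitz_on (cball x0 R) f \<Longrightarrow>
    (\<exists>c r. r \<ge> \<tau>2 * R \<and> cball c r \<subseteq> cball x0 R \<and>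
      (\<forall>b\<in>D. \<exists>g. \<forall>x\<in>cball c r. \<bar>(f x - f c) \<bullet> b - g \<bullet> (x - c)\<bar> \<le> e' * r))"
    using insert.IH[OF _ e'] insert.prems by blast
  show ?case
  proof (intro exI[of _ "\<tau>1 * \<tau>2"] conjI allI impI)
    show "\<tau>1 * \<tau>2 > 0" using \<tau>1 \<tau>2 by simp
    fix f :: "'a \<Rightarrow> 'b" and x0 and R :: real assume R: "R > 0" and lip: "L-lipschitz_on (cball x0 R) f"
    obtain c r where cr: "r \<ge> \<tau>2 * R" "cball c r \<subseteq> cball x0 R"
      "\<And>b. b \<in> D \<Longrightarrow> \<exists>g. \<forall>x\<in>cball c r. \<bar>(f x - f c) \<bullet> b - g \<bullet> (x - c)\<bar> \<le> e' * r"
      using t2[OF R lip] by blast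
    have r: "r > 0" using cr(1) \<tau>2 R by (meson less_le_trans mult_pos_pos)
    have nk: "norm k = 1" using insert.prems by auto
    have "L-lipschitz_on (cball c r) (\<lambda>x. f x \<bullet> k)"
    proof (rule lipschitz_onI[OF _ L])
      fix x y assume "x \<in> cball c r" "y \<in> cball c r"
      then have "norm (f x - f y) \<le> L * dist x y"
        using lipschitz_onD[OF lip subsetD[OF cr(2)] subsetD[OF cr(2)]] by (metis dist_norm)
      moreover have "\<bar>(f x - f y) \<bullet> k\<bar> \<le> norm (f x - f y)"
        using Cauchy_Schwarz_ineq2[of "f x - f y" k] nk by simp
      ultimately show "dist (f x \<bullet> k) (f y \<bullet> k) \<le> L * dist x y"
        by (simp add: dist_real_def inner_diff_left)
    qed
    from t1[OF r this] obtain c' r' g where c': "r' \<ge> \<tau>1 * r" "cball c' r' \<subseteq> cball c r"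
      "\<And>x. x \<in> cball c' r' \<Longrightarrow> \<bar>f x \<bullet> k - f c' \<bullet> k - g \<bullet> (x - c')\<bar> \<le> e * r'" by blast
    have r': "r' > 0" using c'(1) \<tau>1 r by (meson less_le_trans mult_pos_pos)
    show "\<exists>c r. r \<ge> \<tau>1 * \<tau>2 * R \<and> cball c r \<subseteq> cball x0 R \<and>
      (\<forall>b\<in>insert k D. \<exists>g. \<forall>x\<in>cball c r. \<bar>(f x - f c) \<bullet> b - g \<bullet> (x - c)\<bar> \<le> e * r)"
    proof (rule exI[of _ c'], rule exI[of _ r'], intro conjI ballI)
      have "\<tau>1 * (\<tau>2 * R) \<le> \<tau>1 * r" using cr(1) \<tau>1 by simp
      then show "\<tau>1 * \<tau>2 * R \<le> r'" using c'(1) by (simp add: mult.assoc)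
      show "cball c' r' \<subseteq> cball x0 R" using c'(2) cr(2) by blast
      fix b assume "b \<in> insert k D"
      then consider "b = k" | "b \<in> D" by blast
      then show "\<exists>g. \<forall>x\<in>cball c' r'. \<bar>(f x - f c') \<bullet> b - g \<bullet> (x - c')\<bar> \<le> e * r'"
      proof cases
        case 1
        then show ?thesis using c'(3) by (auto simp: inner_diff_left intro!: exI[of _ g])
      next
        case 2
        then obtain q where q: "\<And>x. x \<in> cball c r \<Longrightarrow> \<bar>(f x - f c) \<bullet> b - q \<bullet> (x - c)\<bar> \<le> e' * r"
          using cr(3) by blast
        have "\<bar>(f x - f c') \<bullet> b - q \<bullet> (x - c')\<bar> \<le> e * r'" if "x \<in> cball c' r'" for x
        proof -
          have "c' \<in> cball c' r'" using r' by simp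
          then have "x \<in> cball c r" "c' \<in> cball c r" using that c'(2) by blast+
          then have "\<bar>(f x - f c) \<bullet> b - q \<bullet> (x - c)\<bar> \<le> e' * r" "\<bar>(f c' - f c) \<bullet> b - q \<bullet> (c' - c)\<bar> \<le> e' * r"
            using q by blast+
          then have "\<bar>(f x - f c') \<bullet> b - q \<bullet> (x - c')\<bar> \<le> 2 * e' * r"
            by (simp add: inner_diff_left inner_diff_right abs_if split: if_splits)
          also have "\<dots> = e * (\<tau>1 * r)" by (simp add: e'_def)
          also have "\<dots> \<le> e * r'" using c'(1) insert.prems by (intro mult_left_mono) auto
          finally show ?thesis .
        qed
        then show ?thesis by blast
      qed
    qed
  qed
qed

lemma lipschitz_near_affine:
  fixes f :: "'a::euclidean_space \<Rightarrow> 'b::euclidean_space"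
  assumes lip: "L-lipschitz_on (cball x0 R) f" and R: "R > 0" and e: "e > 0"
  obtains c r M where "r > 0" "cball c r \<subseteq> cball x0 R" "linear M"
    "\<And>x. x \<in> cball c r \<Longrightarrow> norm (f x - f c - M (x - c)) \<le> e * r"
proof -
  have L: "L \<ge> 0" using lip by (rule lipschitz_on_nonneg)
  define e' where "e' = e / real DIM('b)"
  have e': "e' > 0" using e by (simp add: e'_def)
  obtain \<tau> c r where cr: "\<tau> > 0" "r \<ge> \<tau> * R" "cball c r \<subseteq> cball x0 R"
      "\<And>b. b \<in> (Basis :: 'b set) \<Longrightarrow> \<exists>g. \<forall>x\<in>cball c r. \<bar>(f x - f c) \<bullet> b - g \<bullet> (x - c)\<bar> \<le> e' * r"
    using coordinates_near_affine[of "Basis :: 'b set" L e', OF finite_Basis order_refl L e'] lip R by (metis (no_types, lifting))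
  have r: "r > 0" using cr R by (meson less_le_trans mult_pos_pos)
  obtain g where g: "\<And>b x. b \<in> (Basis :: 'b set) \<Longrightarrow> x \<in> cball c r \<Longrightarrow> \<bar>(f x - f c) \<bullet> b - g b \<bullet> (x - c)\<bar> \<le> e' * r"
    using cr(4) by metis
  define M where "M u = (\<Sum>b\<in>Basis. (g b \<bullet> u) *\<^sub>R b)" for u
  have "linear M" unfolding M_def
    by (intro linear_compose_sum ballI linearI) (auto simp: inner_right_distrib scaleR_add_left)
  moreover have "norm (f x - f c - M (x - c)) \<le> e * r" if x: "x \<in> cball c r" for x
  proof -
    have "(f x - f c - M (x - c)) \<bullet> b = (f x - f c) \<bullet> b - g b \<bullet> (x - c)" if "b \<in> Basis" for b
      using that by (simp add: M_def inner_diff_left inner_sum_left inner_Basis if_distrib sum.delta cong: if_cong)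
    then have "norm (f x - f c - M (x - c)) \<le> (\<Sum>b\<in>Basis. \<bar>(f x - f c) \<bullet> b - g b \<bullet> (x - c)\<bar>)"
      using norm_le_l1[of "f x - f c - M (x - c)"] by simp
    also have "\<dots> \<le> (\<Sum>b\<in>(Basis::'b set). e' * r)" using g x by (intro sum_mono) auto
    also have "\<dots> = e * r" by (simp add: e'_def)
    finally show ?thesis .
  qed
  ultimately show thesis using that[of r c M] r cr by blast
qed

section \<open>Nearly affine maps that keep volume\<close>

text \<open>
  The \<open>n + 1\<close> translates of the slab by multiples of \<open>3 \<kappa> v\<close> are disjoint and stay in the ball of
  radius \<open>2 R\<close>.
\<close>
lemma slab_measure:
  fixes v :: "'a::euclidean_space"
  assumes v: "norm v = 1" and \<kappa>: "\<kappa> > 0" and n: "3 * \<kappa> * real n \<le> R"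
  shows "real (Suc n) * measure lebesgue {x. \<bar>v \<bullet> x\<bar> \<le> \<kappa> \<and> norm x \<le> R} \<le> measure lebesgue (cball (0::'a) (2*R))"
proof -
  let ?D = "{x. \<bar>v \<bullet> x\<bar> \<le> \<kappa> \<and> norm x \<le> R}"
  let ?T = "\<lambda>j::nat. (+) ((3 * \<kappa> * real j) *\<^sub>R v) ` ?D"
  have "?D = {x. \<bar>v \<bullet> x\<bar> \<le> \<kappa>} \<inter> cball 0 R" by auto
  moreover have "closed {x. \<bar>v \<bullet> x\<bar> \<le> \<kappa>}" by (intro closed_Collect_le continuous_intros)
  ultimately have cD: "compact ?D" by (metis closed_Int_compact compact_cball)
  have cT: "compact (?T j)" for j using cD by (rule compact_translation)
  have vv: "v \<bullet> v = 1" using v by (simp add: dot_square_norm)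
  have disj: "disjoint_family_on ?T {..n}"
  proof (unfold disjoint_family_on_def, intro ballI impI)
    fix i j assume ij: "i \<in> {..n}" "j \<in> {..n}" "i \<noteq> j"
    show "?T i \<inter> ?T j = {}"
    proof (rule ccontr)
      assume "?T i \<inter> ?T j \<noteq> {}"
      then obtain x y where xy: "\<bar>v \<bullet> x\<bar> \<le> \<kappa>" "\<bar>v \<bullet> y\<bar> \<le> \<kappa>"
        "(3 * \<kappa> * real i) *\<^sub>R v + x = (3 * \<kappa> * real j) *\<^sub>R v + y" by auto
      from arg_cong[OF xy(3), of "\<lambda>w. v \<bullet> w"]
      have eq: "3 * \<kappa> * real i + v \<bullet> x = 3 * \<kappa> * real j + v \<bullet> y" by (simp add: inner_add_right vv)
      then have "3 * \<kappa> * \<bar>real i - real j\<bar> = \<bar>v \<bullet> y - v \<bullet> x\<bar>"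
      proof -
        have "v \<bullet> y - v \<bullet> x = 3 * \<kappa> * (real i - real j)" using eq by (simp add: algebra_simps)
        then show ?thesis using \<kappa> by (simp add: abs_mult)
      qed
      also have "\<dots> \<le> 2 * \<kappa>" using xy by linarith
      finally have "3 * \<kappa> * \<bar>real i - real j\<bar> \<le> 2 * \<kappa>" .
      moreover have "1 \<le> \<bar>real i - real j\<bar>" using ij(3) by linarith
      then have "3 * \<kappa> * 1 \<le> 3 * \<kappa> * \<bar>real i - real j\<bar>" using \<kappa> by (intro mult_left_mono) auto
      ultimately show False using \<kappa> by linarith
    qed
  qed
  have R: "R \<ge> 0" using n \<kappa> by (meson mult_nonneg_nonneg of_nat_0_le_iff order_trans zero_le_numeral less_imp_le)
  have sub: "?T j \<subseteq> cball 0 (2*R)" if "j \<le> n" for j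
  proof
    fix x assume "x \<in> ?T j"
    then obtain y where y: "norm y \<le> R" "x = (3 * \<kappa> * real j) *\<^sub>R v + y" by auto
    have "3 * \<kappa> * real j \<le> 3 * \<kappa> * real n" using that \<kappa> by simp
    then have "3 * \<kappa> * real j \<le> R" using n by linarith
    then have "norm ((3 * \<kappa> * real j) *\<^sub>R v) \<le> R" using v \<kappa> by (simp add: abs_mult)
    then show "x \<in> cball 0 (2*R)" using y norm_triangle_ineq[of "(3 * \<kappa> * real j) *\<^sub>R v" y] by simp
  qed
  have lm: "?T j \<in> lmeasurable" for j using cT by (rule lmeasurable_compact)
  have fin: "emeasure lebesgue (?T j) \<noteq> \<infinity>" for j
    using fmeasurableD2[OF lm] unfolding infinity_ennreal_def .
  have meas: "measure lebesgue (?T j) = measure lebesgue ?D" for j by (rule measure_translation)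
  have "real (Suc n) * measure lebesgue ?D = (\<Sum>j\<le>n. measure lebesgue (?T j))" by (simp add: meas)
  also have "\<dots> = measure lebesgue (\<Union>j\<le>n. ?T j)"
    using lm disj by (intro measure_finite_Union[symmetric]) (use fmeasurableD[OF lm] fin in blast)+
  also have "\<dots> \<le> measure lebesgue (cball (0::'a) (2*R))"
    using sub lm by (intro measure_mono_fmeasurable) (auto intro!: sets.finite_UN lmeasurable_cball dest: fmeasurableD)
  finally show ?thesis .
qed

lemma measure_cball_scale:
  fixes c :: "'a::euclidean_space"
  assumes "r \<ge> 0"
  shows "measure lebesgue (cball c r) = r ^ DIM('a) * measure lebesgue (cball (0::'a) 1)"
proof -
  have "measure lebesgue (cball x s) = unit_ball_vol (real DIM('a)) * s ^ DIM('a)" if "s \<ge> 0" for x :: 'a and s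
    using content_cball[OF that, of x] by (simp add: measure_completion)
  from this[OF assms, of c] this[of 1 0] show ?thesis by simp
qed

text \<open>
  A lower bound for the linear part of a nearly affine \<open>L\<close>-Lipschitz map in dimension \<open>d\<close> whose image
  keeps half of the volume. The value makes the slab in the proof of \<open>affine_part_bounded_below\<close> so thin
  that more than \<open>2 (2 (L + 1))^d\<close> disjoint translates of it fit into the ball of twice its radius.
\<close>
definition nondegeneracy :: "nat \<Rightarrow> real \<Rightarrow> real" where
  "nondegeneracy d L = (L + 1) / (6 * (2 * (2 * (L+1))^d + 1))"

lemma nondegeneracy_pos: "L \<ge> 0 \<Longrightarrow> nondegeneracy d L > 0"
  by (simp add: nondegeneracy_def add_nonneg_pos)

text \<open>
  If \<open>M\<close> shrinks some unit vector \<open>w\<close> below the bound, then \<open>M\<close> is close to a singular map, and the image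
  of the ball lies near a hyperplane. By \<open>slab_measure\<close> such a slab has less than half the volume of the
  ball.
\<close>
lemma affine_part_bounded_below:
  fixes f :: "'a::euclidean_space \<Rightarrow> 'a"
  assumes lip: "L-lipschitz_on (cball c r) f" and r: "r > 0"
    and M: "linear M" and near: "\<And>x. x \<in> cball c r \<Longrightarrow> norm (f x - f c - M (x - c)) \<le> e * r"
    and big: "measure lebesgue (cball c r) \<le> 2 * measure lebesgue (f ` cball c r)"
    and e: "e \<le> nondegeneracy DIM('a) L"
  shows "nondegeneracy DIM('a) L * norm u \<le> norm (M u)"
proof (rule ccontr)
  define m where "m = nondegeneracy DIM('a) L"
  have L: "L \<ge> 0" using lip by (rule lipschitz_on_nonneg)
  have m: "m > 0" using L by (simp add: m_def nondegeneracy_pos)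
  assume "\<not> nondegeneracy DIM('a) L * norm u \<le> norm (M u)"
  then have u: "norm (M u) < m * norm u" by (simp add: m_def)
  have u0: "u \<noteq> 0" using u norm_ge_zero[of "M u"] by auto
  define w where "w = u /\<^sub>R norm u"
  have w: "norm w = 1" using u0 by (simp add: w_def)
  have "M w = M u /\<^sub>R norm u" by (simp add: w_def linear_scale[OF M])
  then have Mw: "norm (M w) \<le> m" using u u0 by (simp add: divide_inverse[symmetric] pos_divide_le_eq mult.commute[of "inverse _"])
  \<comment> \<open>\<open>M'\<close> kills \<open>w\<close>, so its range is orthogonal to some unit vector \<open>v\<close>, and \<open>M'\<close> differs from \<open>M\<close> by at most \<open>m\<close>\<close>
  define M' where "M' x = M (x - (w \<bullet> x) *\<^sub>R w)" for x
  have M'lin: "linear M'" unfolding M'_def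
  proof (rule linearI)
    fix x y :: 'a and a :: real
    have "x + y - (w \<bullet> (x + y)) *\<^sub>R w = (x - (w \<bullet> x) *\<^sub>R w) + (y - (w \<bullet> y) *\<^sub>R w)"
      by (simp add: inner_add_right scaleR_add_left)
    then show "M (x + y - (w \<bullet> (x + y)) *\<^sub>R w) = M (x - (w \<bullet> x) *\<^sub>R w) + M (y - (w \<bullet> y) *\<^sub>R w)"
      by (simp only: linear_add[OF M])
    have "a *\<^sub>R x - (w \<bullet> (a *\<^sub>R x)) *\<^sub>R w = a *\<^sub>R (x - (w \<bullet> x) *\<^sub>R w)"
      by (simp add: scaleR_diff_right)
    then show "M (a *\<^sub>R x - (w \<bullet> (a *\<^sub>R x)) *\<^sub>R w) = a *\<^sub>R M (x - (w \<bullet> x) *\<^sub>R w)"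
      by (simp only: linear_scale[OF M])
  qed
  have "M' w = 0" using w by (simp add: M'_def dot_square_norm linear_0[OF M])
  then have "\<not> inj M'" using linear_0[OF M'lin] w by (metis injD norm_zero zero_neq_one)
  then have "range M' \<noteq> UNIV" using linear_surjective_imp_injective[OF M'lin] by auto
  then have "span (range M') \<noteq> UNIV" using M'lin by (simp add: linear_subspace_image span_eq_iff[THEN iffD2])
  then obtain a where a: "a \<noteq> 0" "span (range M') \<subseteq> {x. a \<bullet> x = 0}"
    using span_not_univ_subset_hyperplane by blast
  define v where "v = a /\<^sub>R norm a"
  have v: "norm v = 1" using a by (simp add: v_def)
  have vM': "v \<bullet> M' x = 0" for x using a(2) span_base[of "M' x" "range M'"] by (auto simp: v_def)
  have vM: "\<bar>v \<bullet> M x\<bar> \<le> m * norm x" for x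
  proof -
    have "M x = M' x + (w \<bullet> x) *\<^sub>R M w"
      by (simp add: M'_def linear_diff[OF M] linear_scale[OF M])
    then have "\<bar>v \<bullet> M x\<bar> = \<bar>w \<bullet> x\<bar> * \<bar>v \<bullet> M w\<bar>" using vM' by (simp add: inner_add_right abs_mult)
    also have "\<dots> \<le> norm x * m"
      using Cauchy_Schwarz_ineq2[of w x] Cauchy_Schwarz_ineq2[of v "M w"] w v Mw
      by (intro mult_mono) auto
    finally show ?thesis by (simp add: mult.commute)
  qed
  define K where "K = 2 * (2 * (L+1))^DIM('a)"
  have K: "K > 0" using L by (simp add: K_def)
  define n where "n = nat \<lfloor>K\<rfloor>"
  have n: "real n \<le> K" "K < real (Suc n)" using K by (simp_all add: n_def) linarith+
  define D where "D = {x. \<bar>v \<bullet> x\<bar> \<le> 2*m*r \<and> norm x \<le> (L+1)*r}"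
  have mK: "m * (6 * (K + 1)) = L + 1" unfolding m_def nondegeneracy_def K_def[symmetric] using K by simp
  have D: "real (Suc n) * measure lebesgue D \<le> measure lebesgue (cball (0::'a) (2*((L+1)*r)))"
    unfolding D_def
  proof (rule slab_measure[OF v])
    show "0 < 2 * m * r" using m r by simp
    have "6 * m * real n \<le> 6 * m * (K + 1)" using n m by simp
    also have "\<dots> = L + 1" using mK by (simp add: mult_ac)
    finally have "6 * m * real n * r \<le> (L+1) * r" using r by (intro mult_right_mono) auto
    then show "3 * (2 * m * r) * real n \<le> (L + 1) * r" by (simp add: mult_ac)
  qed
  have "D = {x. \<bar>v \<bullet> x\<bar> \<le> 2*m*r} \<inter> cball 0 ((L+1)*r)" by (auto simp: D_def)
  moreover have "closed {x. \<bar>v \<bullet> x\<bar> \<le> 2*m*r}" by (intro closed_Collect_le continuous_intros)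
  ultimately have cD: "compact D" by (metis closed_Int_compact compact_cball)
  have sub: "f ` cball c r \<subseteq> (+) (f c) ` D"
  proof
    fix y assume "y \<in> f ` cball c r"
    then obtain x where x: "x \<in> cball c r" "y = f x" by blast
    have nx: "norm (x - c) \<le> r" using x by (simp add: dist_norm norm_minus_commute)
    have "norm (f x - f c) \<le> L * norm (x - c)"
      using lipschitz_onD[OF lip, of x c] x r by (simp add: dist_norm)
    also have "\<dots> \<le> (L+1) * r" using nx L by (intro mult_mono) auto
    finally have 1: "norm (f x - f c) \<le> (L+1)*r" .
    have "f x - f c = (f x - f c - M (x - c)) + M (x - c)" by simp
    then have "\<bar>v \<bullet> (f x - f c)\<bar> \<le> \<bar>v \<bullet> (f x - f c - M (x - c))\<bar> + \<bar>v \<bullet> M (x - c)\<bar>"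
      by (metis abs_triangle_ineq inner_add_right)
    also have "\<dots> \<le> e * r + m * r"
    proof (rule add_mono)
      show "\<bar>v \<bullet> (f x - f c - M (x - c))\<bar> \<le> e * r"
        using Cauchy_Schwarz_ineq2[of v "f x - f c - M (x - c)"] v near[OF x(1)] by simp
      have "m * norm (x - c) \<le> m * r" using nx m by simp
      then show "\<bar>v \<bullet> M (x - c)\<bar> \<le> m * r" using vM[of "x - c"] by linarith
    qed
    also have "\<dots> \<le> 2*m*r" using e r by (simp add: m_def)
    finally have "f x - f c \<in> D" using 1 by (simp add: D_def)
    then have "f c + (f x - f c) \<in> (+) (f c) ` D" by (rule imageI)
    then show "y \<in> (+) (f c) ` D" using x by simp
  qed
  have "measure lebesgue (f ` cball c r) \<le> measure lebesgue ((+) (f c) ` D)"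
  proof (rule measure_mono_fmeasurable[OF sub])
    have "compact (f ` cball c r)" using lip by (intro compact_continuous_image lipschitz_on_continuous_on) auto
    then show "f ` cball c r \<in> sets lebesgue" by (simp add: lmeasurable_compact fmeasurableD)
    show "(+) (f c) ` D \<in> lmeasurable" using cD by (intro lmeasurable_compact compact_translation)
  qed
  then have "measure lebesgue (cball c r) \<le> 2 * measure lebesgue D"
    using big by (simp add: measure_translation)
  then have 1: "measure lebesgue (cball c r) * real (Suc n) \<le> 2 * measure lebesgue (cball (0::'a) (2*((L+1)*r)))"
  proof -
    have "measure lebesgue (cball c r) * real (Suc n) \<le> 2 * measure lebesgue D * real (Suc n)"
      using \<open>measure lebesgue (cball c r) \<le> 2 * measure lebesgue D\<close> by (intro mult_right_mono) auto
    then show ?thesis using D by (simp only: mult_ac)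
  qed
  define \<omega> where "\<omega> = measure lebesgue (cball (0::'a) 1)"
  have \<omega>: "\<omega> > 0" using content_cball_pos[of 1 "0::'a"] by (simp add: \<omega>_def measure_completion)
  have mc: "measure lebesgue (cball c r) = r ^ DIM('a) * \<omega>"
    unfolding \<omega>_def by (rule measure_cball_scale) (use r in simp)
  have mR: "2 * measure lebesgue (cball (0::'a) (2*((L+1)*r))) = K * (r ^ DIM('a) * \<omega>)"
  proof -
    have "measure lebesgue (cball (0::'a) (2*((L+1)*r))) = (2*((L+1)*r)) ^ DIM('a) * \<omega>"
      unfolding \<omega>_def by (rule measure_cball_scale) (use r L in simp)
    also have "(2*((L+1)*r)) ^ DIM('a) = (2*(L+1)) ^ DIM('a) * r ^ DIM('a)"
      by (simp only: power_mult_distrib mult_ac)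
    finally show ?thesis unfolding K_def by (simp only: mult_ac)
  qed
  have "r ^ DIM('a) * \<omega> * real (Suc n) \<le> r ^ DIM('a) * \<omega> * K" using 1 mc mR by (simp only: mult_ac)
  then have "real (Suc n) \<le> K" using r \<omega> by (simp add: mult_le_cancel_left_pos)
  then show False using n by linarith
qed

text \<open>
  Suppose that \<open>z\<close> is missed and pull back by the inverse \<open>N\<close> of \<open>M\<close>: the map \<open>k x = N (g x - z)\<close> has no
  zero, so \<open>x\<close> can be sent to the point of the sphere opposite to \<open>k x\<close>. A fixed point of this map lies on
  the sphere and has \<open>k x\<close> pointing opposite to \<open>x - c\<close>, whereas on the sphere \<open>k x\<close> is close to \<open>x - c\<close>.
  Only the values of \<open>g\<close> on the sphere need to be nearly affine.
\<close>
lemma near_affine_surjective: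
  fixes g :: "'a::euclidean_space \<Rightarrow> 'a"
  assumes r: "r > 0" and M: "linear M" and m: "m > 0" "\<And>u. m * norm u \<le> norm (M u)"
    and g: "continuous_on (cball c r) g"
    and near: "\<And>x. x \<in> sphere c r \<Longrightarrow> norm (g x - y - M (x - c)) \<le> m * r / 4"
    and z: "norm (z - y) \<le> m * r / 4"
  shows "z \<in> g ` cball c r"
proof (rule ccontr)
  assume z': "z \<notin> g ` cball c r"
  have "inj M"
  proof (rule injI)
    fix u v assume "M u = M v"
    then have "norm (M (u - v)) = 0" by (simp add: linear_diff[OF M])
    then have "m * norm (u - v) \<le> 0" using m(2)[of "u - v"] by simp
    then show "u = v" using m(1) by (simp add: mult_le_0_iff)
  qed
  then obtain N where N: "linear N" "\<And>x. M (N x) = x"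
    using linear_injective_imp_surjective[OF M] linear_surjective_right_inverse[OF M] by (metis comp_apply id_apply)
  have Nb: "norm (N x) \<le> norm x / m" for x using m(2)[of "N x"] N(2) m(1) by (simp add: field_simps)
  have N0: "N x = 0 \<longleftrightarrow> x = 0" for x using N(2)[of x] linear_0[OF N(1)] linear_0[OF M] by metis
  define k where "k x = N (g x - z)" for x
  have k0: "k x \<noteq> 0" if "x \<in> cball c r" for x using z' that by (auto simp: k_def N0)
  define \<phi> where "\<phi> x = c - (r / norm (k x)) *\<^sub>R k x" for x
  have "continuous_on (cball c r) k" unfolding k_def
    by (intro linear_continuous_on_compose[OF _ N(1)] continuous_intros g)
  then have "continuous_on (cball c r) \<phi>" unfolding \<phi>_def using k0 by (intro continuous_intros) auto
  moreover have sph: "\<phi> x \<in> sphere c r" if "x \<in> cball c r" for x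
    using k0[OF that] r by (simp add: \<phi>_def dist_norm)
  then have "\<phi> \<in> cball c r \<rightarrow> cball c r" by fastforce
  ultimately obtain x where x: "x \<in> cball c r" "\<phi> x = x" using brouwer_ball[OF r] by blast
  then have xs: "x \<in> sphere c r" using sph by metis
  have xc: "x - c = - ((r / norm (k x)) *\<^sub>R k x)" using x(2) by (simp add: \<phi>_def algebra_simps)
  have "k x - (x - c) = N (g x - z - M (x - c))"
  proof -
    have "N (M (x - c)) = x - c" using N(2) \<open>inj M\<close> by (metis injD)
    then show ?thesis by (simp add: k_def linear_diff[OF N(1)])
  qed
  then have "norm (k x - (x - c)) \<le> norm (g x - z - M (x - c)) / m" using Nb by simp
  also have "norm (g x - z - M (x - c)) \<le> m * r / 2"
    using near[OF xs] z norm_triangle_ineq4[of "g x - y - M (x - c)" "z - y"] by (simp add: algebra_simps)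
  finally have 1: "norm (k x - (x - c)) \<le> r / 2" using m(1) by (simp add: field_simps)
  have "k x - (x - c) = (1 + r / norm (k x)) *\<^sub>R k x" using xc by (simp add: algebra_simps)
  then have "norm (k x - (x - c)) = (1 + r / norm (k x)) * norm (k x)" using r by simp
  also have "\<dots> = norm (k x) + r" using k0[OF x(1)] by (simp add: field_simps)
  finally show False using 1 r by (smt (verit) norm_ge_zero field_sum_of_halves)
qed

text \<open>
  The values of \<open>f\<close> on the inner sphere extend over the inner ball without hitting \<open>z\<close>, provided that \<open>f\<close>
  misses \<open>z\<close> on the annulus and misses, on the whole outer ball, some value \<open>y0\<close> that can be joined to
  \<open>z\<close> away from the image of the outer sphere. The extension goes the other way round, through infinity. Outside the
  outer ball, \<open>f\<close> is continued by reflecting back into the ball and applying \<open>f\<close> followed by a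
  homeomorphism \<open>\<theta>\<close> that moves \<open>y0\<close> to \<open>z\<close>; on the outer sphere \<open>\<theta>\<close> changes nothing. The result is
  defined outside the inner ball, misses \<open>z\<close> and has a limit at infinity, and inversion in the inner
  sphere turns it into a map on the inner ball.
\<close>
lemma extend_from_annulus:
  fixes f :: "'a::euclidean_space \<Rightarrow> 'a"
  assumes f: "continuous_on (cball x0 t) f" and t: "t > 0" and r: "r > 0"
    and sub: "cball c r \<subseteq> ball x0 t" and z: "z \<notin> f ` (cball x0 t - ball c r)"
    and V: "open V" "connected V" "V \<inter> f ` sphere x0 t = {}" "z \<in> V" "y0 \<in> V" "y0 \<notin> f ` cball x0 t"
  obtains g where "continuous_on (cball c r) g" "\<And>x. x \<in> sphere c r \<Longrightarrow> g x = f x" "z \<notin> g ` cball c r"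
proof -
  have aff: "affine hull V = UNIV" using V by (intro affine_hull_open) auto
  have op: "openin (top_of_set (affine hull V)) V" unfolding aff using V(1) by (intro open_subset) auto
  have "UNIV \<subseteq> affine hull V" by (simp add: aff)
  then obtain \<theta> \<theta>' where th: "homeomorphism UNIV UNIV \<theta> \<theta>'" "\<theta> y0 = z"
     "{x. \<not> (\<theta> x = x \<and> \<theta>' x = x)} \<subseteq> V"
    by (rule homeomorphism_moving_point[OF op subset_UNIV _ V(2) V(5) V(4)]) (rule that)
  have th_cont: "continuous_on UNIV \<theta>" using th(1) by (simp add: homeomorphism_def)
  have th_inj: "inj \<theta>" using th(1) by (metis homeomorphism_apply1 inj_on_def iso_tuple_UNIV_I)
  have th_id: "\<theta> x = x" if "x \<notin> V" for x using th(3) that by blast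
  define ft where "ft x = \<theta> (f x)" for x
  have ft: "continuous_on (cball x0 t) ft" unfolding ft_def
    by (rule continuous_on_compose2[OF th_cont f]) auto
  have ftz: "ft x \<noteq> z" if "x \<in> cball x0 t" for x
    using that V(6) th(2) th_inj by (metis ft_def image_eqI injD)
  have ft_sph: "ft x = f x" if "x \<in> sphere x0 t" for x
  proof -
    have "f x \<notin> V" using that V(3) by blast
    then show ?thesis by (simp add: ft_def th_id)
  qed
  define inv0 where "inv0 x = x0 + (t\<^sup>2 / (norm (x - x0))\<^sup>2) *\<^sub>R (x - x0)" for x
  have inv0_dist: "dist x0 (inv0 x) = t\<^sup>2 / norm (x - x0)" for x
    by (simp add: inv0_def dist_norm power2_eq_square)
  have inv0_cont: "continuous_on (- {x0}) inv0" unfolding inv0_def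
    by (intro continuous_intros) auto
  have inv0_in: "inv0 x \<in> cball x0 t" if "x \<notin> ball x0 t" for x
  proof -
    have "t \<le> norm (x - x0)" using that by (simp add: dist_norm norm_minus_commute)
    then have "t\<^sup>2 / norm (x - x0) \<le> t\<^sup>2 / t" using t by (intro divide_left_mono mult_pos_pos) (auto intro: less_le_trans)
    then show ?thesis using t by (simp add: inv0_dist power2_eq_square)
  qed
  have inv0_sph: "inv0 x = x" if "x \<in> sphere x0 t" for x
    using that t by (simp add: inv0_def dist_norm norm_minus_commute)
  \<comment> \<open>the two definitions agree on the outer sphere, which \<open>inv0\<close> fixes and whose image is disjoint from \<open>V\<close>\<close>
  define F where "F x = (if x \<in> cball x0 t then f x else ft (inv0 x))" for x
  have Fz: "F x \<noteq> z" if "x \<notin> ball c r" for x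
    using that z ftz inv0_in[of x] by (auto simp: F_def)
  have F_cont: "continuous_on (- ball c r) F"
  proof -
    have 1: "- ball c r = (cball x0 t - ball c r) \<union> (- ball x0 t)"
      using sub ball_subset_cball[of c r] ball_subset_cball[of x0 t] by blast
    have "continuous_on ((cball x0 t - ball c r) \<union> (- ball x0 t)) F"
      unfolding F_def
    proof (rule continuous_on_cases)
      show "closed (cball x0 t - ball c r)" "closed (- ball x0 t)" by (auto simp: closed_Diff)
      show "continuous_on (cball x0 t - ball c r) f" using f by (rule continuous_on_subset) auto
      show "continuous_on (- ball x0 t) (\<lambda>x. ft (inv0 x))"
      proof (rule continuous_on_compose2[OF ft])
        show "continuous_on (- ball x0 t) inv0" by (rule continuous_on_subset[OF inv0_cont]) (use t in auto)
      qed (use inv0_in in auto)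
      show "\<forall>x. x \<in> cball x0 t - ball c r \<and> x \<notin> cball x0 t \<or> x \<in> - ball x0 t \<and> x \<in> cball x0 t \<longrightarrow> f x = ft (inv0 x)"
      proof (intro allI impI)
        fix x assume "x \<in> cball x0 t - ball c r \<and> x \<notin> cball x0 t \<or> x \<in> - ball x0 t \<and> x \<in> cball x0 t"
        then have "x \<in> sphere x0 t" by auto
        then show "f x = ft (inv0 x)" using inv0_sph ft_sph by simp
      qed
    qed
    then show ?thesis using 1 by simp
  qed
  define invc where "invc x = c + (r\<^sup>2 / (norm (x - c))\<^sup>2) *\<^sub>R (x - c)" for x
  have invc_dist: "norm (invc x - c) = r\<^sup>2 / norm (x - c)" for x
    by (simp add: invc_def power2_eq_square)
  have invc_out: "invc x \<notin> ball c r" if "x \<in> cball c r" "x \<noteq> c" for x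
  proof -
    have "norm (x - c) \<le> r" using that by (simp add: dist_norm norm_minus_commute)
    then have "r\<^sup>2 / r \<le> r\<^sup>2 / norm (x - c)" using r that by (intro divide_left_mono mult_pos_pos) auto
    then show ?thesis using r by (simp add: dist_norm norm_minus_commute[of c] invc_dist power2_eq_square)
  qed
  define g where "g x = (if x = c then ft x0 else F (invc x))" for x
  have lim_invc: "filterlim invc at_infinity (at c)"
  proof -
    have "((\<lambda>x. norm (x - c)) \<longlongrightarrow> 0) (at c)" by (intro tendsto_eq_intros) auto
    then have "filterlim (\<lambda>x. norm (x - c)) (at_right 0) (at c)"
      by (intro filterlim_at_withinI) (auto simp: eventually_at intro!: exI[of _ 1])
    then have "filterlim (\<lambda>x. inverse (norm (x - c))) at_top (at c)"
      by (rule filterlim_compose[OF filterlim_inverse_at_top_right])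
    then have "filterlim (\<lambda>x. r\<^sup>2 * inverse (norm (x - c))) at_top (at c)"
      using r by (intro filterlim_tendsto_pos_mult_at_top[OF tendsto_const]) auto
    then have "filterlim (\<lambda>x. norm (invc x - c)) at_top (at c)"
      by (simp add: invc_dist divide_inverse)
    then have "filterlim (\<lambda>x. invc x - c) at_infinity (at c)" by (rule filterlim_at_infinity_conv_norm_at_top[THEN iffD2])
    then have "filterlim (\<lambda>x. (invc x - c) + c) at_infinity (at c)"
      by (rule tendsto_add_filterlim_at_infinity'[OF _ tendsto_const])
    then show ?thesis by simp
  qed
  have lim_inv0: "(inv0 \<longlongrightarrow> x0) at_infinity"
  proof (rule tendsto_dist_iff[THEN iffD2])
    have "filterlim (\<lambda>x::'a. x - x0) at_infinity at_infinity"
      using tendsto_add_filterlim_at_infinity'[OF filterlim_ident tendsto_const[of "-x0"]] by simp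
    then have "((\<lambda>x. inverse (norm (x - x0))) \<longlongrightarrow> 0) at_infinity"
      by (intro tendsto_inverse_0_at_top filterlim_compose[OF filterlim_norm_at_top])
    then have "((\<lambda>x. t\<^sup>2 * inverse (norm (x - x0))) \<longlongrightarrow> 0) at_infinity"
      by (rule tendsto_mult_right_zero)
    then show "((\<lambda>x. dist (inv0 x) x0) \<longlongrightarrow> 0) at_infinity"
      by (simp add: dist_commute[of _ x0] inv0_dist divide_inverse)
  qed
  have ft_c: "(ft \<longlongrightarrow> ft x0) (nhds x0)"
  proof -
    have "isCont ft x0" using continuous_on_interior[OF ft, of x0] t by simp
    then show ?thesis by (simp add: isCont_def tendsto_at_iff_tendsto_nhds)
  qed
  have "(F \<longlongrightarrow> ft x0) at_infinity"
  proof (rule Lim_transform_eventually)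
    show "((\<lambda>x. ft (inv0 x)) \<longlongrightarrow> ft x0) at_infinity"
      by (rule filterlim_compose[OF ft_c lim_inv0])
    show "\<forall>\<^sub>F x in at_infinity. ft (inv0 x) = F x"
      unfolding eventually_at_infinity
    proof (intro exI[of _ "norm x0 + t + 1"] allI impI)
      fix x :: 'a assume "norm x0 + t + 1 \<le> norm x"
      then have "x \<notin> cball x0 t" using norm_triangle_ineq2[of x x0] by (auto simp: dist_norm norm_minus_commute)
      then show "ft (inv0 x) = F x" by (simp add: F_def)
    qed
  qed
  then have limg: "((\<lambda>x. F (invc x)) \<longlongrightarrow> ft x0) (at c)"
    by (rule filterlim_compose[OF _ lim_invc])
  have "continuous_on (cball c r) g"
  proof (unfold continuous_on_eq_continuous_within, intro ballI)
    fix x assume x: "x \<in> cball c r"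
    show "continuous (at x within cball c r) g"
    proof (cases "x = c")
      case True
      have "(g \<longlongrightarrow> ft x0) (at c)"
        using limg by (rule Lim_transform_eventually) (auto simp: g_def eventually_at intro!: exI[of _ 1])
      then have "isCont g c" by (simp add: isCont_def g_def)
      then show ?thesis using True by (simp add: continuous_at_imp_continuous_at_within)
    next
      case False
      have "continuous_on (cball c r - {c}) (\<lambda>x. F (invc x))"
      proof (rule continuous_on_compose2[OF F_cont])
        show "continuous_on (cball c r - {c}) invc" unfolding invc_def by (intro continuous_intros) auto
      qed (use invc_out in auto)
      then have "continuous_on (cball c r - {c}) g"
        by (rule continuous_on_eq) (auto simp: g_def)
      then have "continuous (at x within cball c r - {c}) g" using x False by (simp add: continuous_on_eq_continuous_within)
      moreover have "at x within cball c r - {c} = at x within cball c r"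
        using False by (intro at_within_nhd[of x "- {c}"]) auto
      ultimately show ?thesis by (simp add: continuous_within)
    qed
  qed
  moreover have "g x = f x" if "x \<in> sphere c r" for x
  proof -
    have "x \<noteq> c" "invc x = x" using that r by (auto simp: invc_def dist_norm norm_minus_commute)
    moreover have "x \<in> cball x0 t" using that sub by (meson ball_subset_cball sphere_cball subsetD)
    ultimately show ?thesis by (simp add: g_def F_def)
  qed
  moreover have "z \<notin> g ` cball c r"
  proof
    assume "z \<in> g ` cball c r"
    then obtain x where x: "x \<in> cball c r" "z = g x" by blast
    show False
    proof (cases "x = c")
      case True then show ?thesis using x ftz[of x0] t by (simp add: g_def)
    next
      case False then show ?thesis using x Fz[OF invc_out[OF x(1) False]] by (simp add: g_def)
    qed
  qed
  ultimately show thesis using that by blast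
qed

section \<open>Lipschitz maps transporting a density to Lebesgue measure\<close>

abbreviation vol :: "'a::euclidean_space set \<Rightarrow> real" where "vol \<equiv> measure lborel"

lemma vol_cball:
  fixes c :: "'a::euclidean_space"
  assumes "r \<ge> 0"
  shows "vol (cball c r) = r ^ DIM('a) * vol (cball (0::'a) 1)"
  using measure_cball_scale[OF assms, of c] by simp

lemma vol_unit_cball_pos: "vol (cball (0::'a::euclidean_space) 1) > 0"
  using content_cball_pos[of 1 "0::'a"] by simp

lemma set_integrable_bounded:
  assumes S: "S \<in> sets lborel" "emeasure lborel S < \<infinity>" and g: "(g :: 'a::euclidean_space \<Rightarrow> real) \<in> borel_measurable borel"
    and b: "\<And>x. x \<in> S \<Longrightarrow> \<bar>g x\<bar> \<le> B"
  shows "set_integrable lborel S g"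
  unfolding set_integrable_def
  by (rule integrableI_bounded_set_indicator[where B=B]) (use S g b in auto)

lemma set_integral_bounds:
  assumes S: "S \<in> sets lborel" "emeasure lborel S < \<infinity>" and g: "(g :: 'a::euclidean_space \<Rightarrow> real) \<in> borel_measurable borel"
    and b: "\<And>x. x \<in> S \<Longrightarrow> a \<le> g x" "\<And>x. x \<in> S \<Longrightarrow> g x \<le> b"
  shows "a * vol S \<le> (LINT x:S|lborel. g x)" "(LINT x:S|lborel. g x) \<le> b * vol S"
proof -
  have i: "set_integrable lborel S g"
    by (rule set_integrable_bounded[OF S g, of "max \<bar>a\<bar> \<bar>b\<bar>"]) (use b in \<open>fastforce simp: abs_if\<close>)
  have c: "set_integrable lborel S (\<lambda>_. k)" for k :: real
    by (rule set_integrable_bounded[OF S, of _ "\<bar>k\<bar>"]) auto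
  have k: "(LINT x:S|lborel. k) = k * vol S" for k :: real
    using set_integral_const[OF S(1), of k] S(2) by (simp add: mult.commute)
  show "a * vol S \<le> (LINT x:S|lborel. g x)" using set_integral_mono[OF c i b(1)] k by simp
  show "(LINT x:S|lborel. g x) \<le> b * vol S" using set_integral_mono[OF i c b(2)] k by simp
qed

lemma compact_sets_lborel: "compact S \<Longrightarrow> S \<in> sets lborel \<and> emeasure lborel S < \<infinity>"
  using emeasure_compact_finite[of S] borel_compact[of S] by (simp only: sets_lborel)

lemma compact_fmeasurable: "compact S \<Longrightarrow> S \<in> fmeasurable lborel"
  by (rule fmeasurableI) (simp_all only: compact_sets_lborel)

lemma vol_mono: "S \<subseteq> T \<Longrightarrow> compact S \<Longrightarrow> compact T \<Longrightarrow> vol S \<le> vol T"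
  by (rule measure_mono_fmeasurable) (simp_all only: compact_fmeasurable compact_sets_lborel)

lemma uniform_scale_finite:
  assumes "finite X" and ex: "\<And>x. x \<in> X \<Longrightarrow> \<exists>d>0::real. P x d"
    and anti: "\<And>x d d'. x \<in> X \<Longrightarrow> P x d \<Longrightarrow> 0 < d' \<Longrightarrow> d' \<le> d \<Longrightarrow> P x d'"
  obtains d where "d > 0" "\<And>x. x \<in> X \<Longrightarrow> P x d"
proof -
  have "\<exists>d>0. \<forall>x\<in>X. P x d"
    using assms
  proof (induction X rule: finite_induct)
    case empty
    then show ?case by (intro exI[of _ 1]) auto
  next
    case (insert x X)
    have "\<exists>d>0. \<forall>x\<in>X. P x d" by (rule insert.IH) (use insert.prems in \<open>blast+\<close>)
    then obtain d where d: "d > 0" "\<forall>x\<in>X. P x d" by blast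
    obtain d' where d': "d' > 0" "P x d'" using insert.prems(1)[of x] by blast
    have "P y (min d d')" if "y \<in> insert x X" for y
    proof (cases "y = x")
      case True
      then show ?thesis using insert.prems(2)[of x d' "min d d'"] d d' by simp
    next
      case False
      then show ?thesis using that insert.prems(2)[of y d "min d d'"] d d' by simp
    qed
    then show ?case using d d' by (intro exI[of _ "min d d'"]) auto
  qed
  then show thesis using that by blast
qed

abbreviation unit_cube :: "'a::euclidean_space set" where "unit_cube \<equiv> cbox 0 One"

lemma separation_scale:
  assumes P: "finite P" and PI: "P \<subseteq> interior unit_cube"
  obtains s where "s > 0" "\<And>x. x \<in> P \<Longrightarrow> cball x s \<subseteq> unit_cube"
    "\<And>x x'. x \<in> P \<Longrightarrow> x' \<in> P \<Longrightarrow> x \<noteq> x' \<Longrightarrow> 2 * s < dist x x'"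
proof -
  obtain s where s: "s > 0" "\<And>x. x \<in> P \<Longrightarrow> cball x s \<subseteq> unit_cube \<and> (\<forall>x'\<in>P. x' \<noteq> x \<longrightarrow> 2 * s < dist x x')"
  proof (rule uniform_scale_finite[OF P, of "\<lambda>x s. cball x s \<subseteq> unit_cube \<and> (\<forall>x'\<in>P. x' \<noteq> x \<longrightarrow> 2 * s < dist x x')"])
    fix x assume x: "x \<in> P"
    have "x \<in> interior unit_cube" using x PI by blast
    then obtain d1 where d1: "d1 > 0" "cball x d1 \<subseteq> interior unit_cube"
      using open_contains_cball[of "interior unit_cube"] open_interior by blast
    obtain d2 where d2: "d2 > 0" "\<forall>x'\<in>P. x' \<noteq> x \<longrightarrow> d2 \<le> dist x x'"
      using finite_set_avoid[OF P, of x] by blast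
    show "\<exists>s>0. cball x s \<subseteq> unit_cube \<and> (\<forall>x'\<in>P. x' \<noteq> x \<longrightarrow> 2 * s < dist x x')"
    proof (intro exI[of _ "min d1 (d2/3)"] conjI ballI impI)
      have "cball x (min d1 (d2/3)) \<subseteq> cball x d1" by (rule subset_cball) simp
      then show "cball x (min d1 (d2/3)) \<subseteq> unit_cube" using d1(2) interior_subset by blast
      fix x' assume "x' \<in> P" "x' \<noteq> x"
      then have "d2 \<le> dist x x'" using d2 by blast
      then show "2 * min d1 (d2/3) < dist x x'" using d2(1) by linarith
    qed (use d1 d2 in auto)
  next
    fix x d d' assume "x \<in> P" "cball x d \<subseteq> unit_cube \<and> (\<forall>x'\<in>P. x' \<noteq> x \<longrightarrow> 2 * d < dist x x')" "0 < d'" "d' \<le> d"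
    then show "cball x d' \<subseteq> unit_cube \<and> (\<forall>x'\<in>P. x' \<noteq> x \<longrightarrow> 2 * d' < dist x x')"
      using subset_cball[of d' d x] by fastforce
  qed (rule that)
  then show thesis using that by metis
qed

text \<open>
  The measure with density \<open>\<rho>\<close> on the unit cube is carried by \<open>f\<close> to Lebesgue measure on \<open>Y\<close>. Only
  compact sets are tested, so that the images and preimages that occur are again compact, hence measurable.
\<close>
locale transport =
  fixes f :: "'a::euclidean_space \<Rightarrow> 'a" and \<rho> :: "'a \<Rightarrow> real" and L :: real and Y :: "'a set"
  assumes lip: "L-lipschitz_on UNIV f"
    and rho_meas: "\<rho> \<in> borel_measurable borel"
    and rho_bounds: "\<And>x. 1/2 \<le> \<rho> x" "\<And>x. \<rho> x \<le> 1"
    and Y: "compact Y"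
    and push: "\<And>E. compact E \<Longrightarrow> (LINT x:(unit_cube \<inter> f -` E)|lborel. \<rho> x) = vol (E \<inter> Y)"
begin

lemma L_nonneg: "L \<ge> 0" using lip by (rule lipschitz_on_nonneg)

lemma f_dist: "dist (f x) (f y) \<le> L * dist x y"
  using lipschitz_onD[OF lip] by blast

lemma f_cont: "continuous_on S f"
  by (rule continuous_on_subset[OF lipschitz_on_continuous_on[OF lip] subset_UNIV])

lemma compact_f_image: "compact S \<Longrightarrow> compact (f ` S)"
  using f_cont by (rule compact_continuous_image)

lemma open_f_vimage: "open U \<Longrightarrow> open (f -` U)"
  by (rule open_vimage[OF _ f_cont])

lemma compact_preimage: "compact E \<Longrightarrow> compact (unit_cube \<inter> f -` E)"
  by (rule compact_Int_closed[OF compact_cbox closed_vimage[OF compact_imp_closed f_cont]])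

lemma vol_preimage_le:
  assumes "compact E"
  shows "vol (unit_cube \<inter> f -` E) \<le> 2 * vol E"
proof -
  have "1/2 * vol (unit_cube \<inter> f -` E) \<le> (LINT x:(unit_cube \<inter> f -` E)|lborel. \<rho> x)"
    using set_integral_bounds(1)[OF _ _ rho_meas rho_bounds] compact_sets_lborel[OF compact_preimage[OF assms]]
    by blast
  also have "\<dots> = vol (E \<inter> Y)" by (rule push[OF assms])
  also have "\<dots> \<le> vol E"
    using assms Y by (intro vol_mono compact_Int) auto
  finally show ?thesis by simp
qed

lemma vol_le_image:
  assumes "compact E" "E \<subseteq> unit_cube"
  shows "vol E \<le> 2 * vol (f ` E)"
proof -
  have "vol E \<le> vol (unit_cube \<inter> f -` (f ` E))"
    using assms(2) by (intro vol_mono assms(1) compact_preimage compact_f_image) blast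
  also have "\<dots> \<le> 2 * vol (f ` E)" by (rule vol_preimage_le[OF compact_f_image[OF assms(1)]])
  finally show ?thesis .
qed

text \<open>
  The disjoint balls of radius \<open>s\<close> around \<open>P\<close> all lie in the preimage of a ball of radius \<open>t + L s\<close>,
  whose volume is at most twice that of the ball because \<open>\<rho> \<ge> 1/2\<close>.
\<close>
lemma packing:
  assumes P: "finite P" and s: "s > 0" and t: "t \<ge> 0"
    and sub: "\<And>x. x \<in> P \<Longrightarrow> cball x s \<subseteq> unit_cube"
    and sep: "\<And>x x'. x \<in> P \<Longrightarrow> x' \<in> P \<Longrightarrow> x \<noteq> x' \<Longrightarrow> 2 * s < dist x x'"
    and im: "\<And>x. x \<in> P \<Longrightarrow> f x \<in> cball y t"
  shows "real (card P) * s ^ DIM('a) \<le> 2 * (t + L * s) ^ DIM('a)"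
proof -
  define \<omega> where "\<omega> = vol (cball (0::'a) 1)"
  have \<omega>: "\<omega> > 0" by (simp add: \<omega>_def vol_unit_cball_pos)
  let ?E = "cball y (t + L * s)"
  have rad: "t + L * s \<ge> 0" using s t L_nonneg by simp
  have disj: "disjoint_family_on (\<lambda>x. cball x s) P"
  proof (unfold disjoint_family_on_def, intro ballI impI)
    fix x x' assume xx: "x \<in> P" "x' \<in> P" "x \<noteq> x'"
    show "cball x s \<inter> cball x' s = {}"
    proof (rule ccontr)
      assume "cball x s \<inter> cball x' s \<noteq> {}"
      then obtain w where "dist x w \<le> s" "dist x' w \<le> s" by auto
      then have "dist x x' \<le> 2 * s" using dist_triangle2[of x x' w] by simp
      then show False using sep[OF xx] by simp
    qed
  qed
  have inE: "cball x s \<subseteq> unit_cube \<inter> f -` ?E" if x: "x \<in> P" for x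
  proof
    fix w assume w: "w \<in> cball x s"
    have "dist y (f w) \<le> dist y (f x) + dist (f x) (f w)" by (rule dist_triangle)
    also have "\<dots> \<le> t + L * s"
      using im[OF x] f_dist[of x w] w mult_left_mono[of "dist x w" s L] L_nonneg by simp
    finally show "w \<in> unit_cube \<inter> f -` ?E" using sub[OF x] w by auto
  qed
  have "real (card P) * (s ^ DIM('a) * \<omega>) = (\<Sum>x\<in>P. vol (cball x s))"
    using vol_cball[of s "_::'a"] s by (simp add: \<omega>_def)
  also have "\<dots> = vol (\<Union>x\<in>P. cball x s)"
    using disj P by (intro measure_finite_Union[symmetric]) (use compact_sets_lborel[OF compact_cball] in \<open>auto simp: less_top\<close>)
  also have "\<dots> \<le> vol (unit_cube \<inter> f -` ?E)"
    using inE P by (intro vol_mono compact_preimage compact_UN) auto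
  also have "\<dots> \<le> 2 * vol ?E" by (rule vol_preimage_le) simp
  also have "\<dots> = 2 * (t + L * s) ^ DIM('a) * \<omega>" using vol_cball[OF rad, of y] by (simp add: \<omega>_def)
  finally show ?thesis using \<omega> by (simp flip: mult.assoc)
qed

text \<open>
  Otherwise a ball around \<open>x\<close>, which has positive mass, would be mapped into the complement of \<open>Y\<close>.
\<close>
lemma interior_image_in_target:
  assumes "x \<in> interior unit_cube"
  shows "f x \<in> Y"
proof (rule ccontr)
  assume "f x \<notin> Y"
  then obtain \<epsilon> where e: "\<epsilon> > 0" "cball (f x) \<epsilon> \<subseteq> - Y"
    using compact_imp_closed[OF Y] open_contains_cball[of "- Y"] by auto
  have "open (interior unit_cube \<inter> f -` ball (f x) \<epsilon>)"
    by (intro open_Int open_interior open_f_vimage open_ball)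
  then obtain \<delta> where d: "\<delta> > 0" "cball x \<delta> \<subseteq> interior unit_cube \<inter> f -` ball (f x) \<epsilon>"
    using assms e open_contains_cball by (metis IntI centre_in_ball vimageI)
  let ?S = "unit_cube \<inter> f -` cball (f x) \<epsilon>"
  have cS: "compact ?S" by (rule compact_preimage) simp
  have "cball x \<delta> \<subseteq> ?S" using d(2) interior_subset ball_subset_cball by fastforce
  then have "vol (cball x \<delta>) \<le> vol ?S"
    by (rule vol_mono[OF _ compact_cball cS])
  moreover have "vol (cball x \<delta>) > 0" using content_cball_pos[OF d(1)] .
  moreover have "1/2 * vol ?S \<le> (LINT x:?S|lborel. \<rho> x)"
    using set_integral_bounds(1)[OF _ _ rho_meas rho_bounds] compact_sets_lborel[OF cS] by blast
  moreover have "(LINT x:?S|lborel. \<rho> x) = 0"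
  proof -
    have "cball (f x) \<epsilon> \<inter> Y = {}" using e(2) by blast
    then show ?thesis using push[of "cball (f x) \<epsilon>"] by simp
  qed
  ultimately show False by simp
qed

text \<open>
  The map \<open>f\<close> does not collapse volume, since a set of small image would have too much mass. Hence
  \<open>affine_part_bounded_below\<close> applies to the nearly affine balls of \<open>lipschitz_near_affine\<close>. The
  tolerance \<open>m/8\<close> is what the covering argument of \<open>near_affine_surjective\<close> needs on both the ball and
  its concentric half.
\<close>
lemma affine_ball:
  assumes O: "open W" "W \<noteq> {}" "W \<subseteq> unit_cube"
  obtains c r M m where "r > 0" "cball c r \<subseteq> W" "linear M" "m > 0" "\<And>u. m * norm u \<le> norm (M u)"
    "\<And>x. x \<in> cball c r \<Longrightarrow> norm (f x - f c - M (x - c)) \<le> m / 8 * r"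
proof -
  obtain x0 R where R: "R > 0" "cball x0 R \<subseteq> W" using O open_contains_cball by blast
  define m where "m = nondegeneracy DIM('a) L"
  have m: "m > 0" by (simp add: m_def nondegeneracy_pos L_nonneg)
  have lipS: "L-lipschitz_on S f" for S using lip lipschitz_on_subset by blast
  obtain c r M where c: "r > 0" "cball c r \<subseteq> cball x0 R" "linear M"
    "\<And>x. x \<in> cball c r \<Longrightarrow> norm (f x - f c - M (x - c)) \<le> m/8 * r"
    using lipschitz_near_affine[OF lipS R(1), of "m/8"] m by (metis half_gt_zero_iff divide_pos_pos zero_less_numeral)
  have "cball c r \<subseteq> unit_cube" using c(2) R(2) O(3) by blast
  then have big: "measure lebesgue (cball c r) \<le> 2 * measure lebesgue (f ` cball c r)"
    using vol_le_image[of "cball c r"] compact_sets_lborel[OF compact_f_image[of "cball c r"]] by simp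
  have "m * norm u \<le> norm (M u)" for u
    unfolding m_def
    by (rule affine_part_bounded_below[OF lipS c(1,3,4) big]) (use m in \<open>simp_all add: m_def\<close>)
  then show thesis using that[of r c M m] c m R(2) by blast
qed

lemma affine_ball_image:
  assumes "r > 0" "linear M" "m > 0" "\<And>u. m * norm u \<le> norm (M u)"
    "\<And>x. x \<in> cball c r \<Longrightarrow> norm (f x - f c - M (x - c)) \<le> m / 8 * r"
  shows "ball (f c) (m * r / 8) \<subseteq> f ` cball c (r/2)"
proof
  fix z assume z: "z \<in> ball (f c) (m * r / 8)"
  show "z \<in> f ` cball c (r/2)"
  proof (rule near_affine_surjective[of "r/2" M m c f "f c"])
    fix x assume "x \<in> sphere c (r/2)"
    then have "x \<in> cball c r" using assms(1) by auto
    then show "norm (f x - f c - M (x - c)) \<le> m * (r/2) / 4" using assms(5) by fastforce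
  qed (use assms z f_cont in \<open>auto simp: dist_norm norm_minus_commute\<close>)
qed

text \<open>
  Disjoint compact sets whose images all contain one open set. The maximal number of members of such a
  family is the number of sheets of \<open>f\<close> over a suitable ball.
\<close>
definition overlapping :: "'a set set \<Rightarrow> bool" where
  "overlapping \<A> \<longleftrightarrow> finite \<A> \<and> pairwise disjnt \<A> \<and> (\<forall>A\<in>\<A>. compact A \<and> A \<subseteq> interior unit_cube) \<and>
     (\<exists>U. open U \<and> U \<noteq> {} \<and> (\<forall>A\<in>\<A>. U \<subseteq> f ` A))"

text \<open>
  Choose one preimage of a common image point in each member. Small disjoint balls around these points
  have their images in one ball of comparable radius, so \<open>packing\<close> applies.
\<close>
lemma overlapping_card:
  assumes "overlapping \<A>"
  shows "real (card \<A>) \<le> 2 * (L + 1) ^ DIM('a)"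
proof -
  have fin: "finite \<A>" and dis: "pairwise disjnt \<A>" and A: "\<And>A. A \<in> \<A> \<Longrightarrow> A \<subseteq> interior unit_cube"
    using assms by (auto simp: overlapping_def)
  obtain U where U: "open U" "U \<noteq> {}" "\<And>A. A \<in> \<A> \<Longrightarrow> U \<subseteq> f ` A"
    using assms unfolding overlapping_def by blast
  obtain y where y: "y \<in> U" using U by blast
  have "\<forall>A\<in>\<A>. \<exists>x\<in>A. f x = y" using U(3) y by fastforce
  then obtain X where X: "\<And>A. A \<in> \<A> \<Longrightarrow> X A \<in> A" "\<And>A. A \<in> \<A> \<Longrightarrow> f (X A) = y" by metis
  have injX: "inj_on X \<A>"
  proof (rule inj_onI, rule ccontr)
    fix A B assume AB: "A \<in> \<A>" "B \<in> \<A>" "X A = X B" "A \<noteq> B"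
    then have "disjnt A B" using dis by (simp add: pairwise_def)
    then show False using X(1)[OF AB(1)] X(1)[OF AB(2)] AB(3) by (simp add: disjnt_iff)
  qed
  define P where "P = X ` \<A>"
  have P: "finite P" "card P = card \<A>" using fin injX by (auto simp: P_def card_image)
  have PI: "P \<subseteq> interior unit_cube" using X(1) A unfolding P_def by blast
  obtain s where s: "s > 0" "\<And>x. x \<in> P \<Longrightarrow> cball x s \<subseteq> unit_cube"
    "\<And>x x'. x \<in> P \<Longrightarrow> x' \<in> P \<Longrightarrow> x \<noteq> x' \<Longrightarrow> 2 * s < dist x x'"
    using separation_scale[OF P(1) PI] by metis
  have "real (card P) * s ^ DIM('a) \<le> 2 * (s + L * s) ^ DIM('a)"
  proof (rule packing[OF P(1) s(1), of s y])
    fix x assume "x \<in> P"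
    then show "f x \<in> cball y s" using X(2) s(1) by (auto simp: P_def)
  qed (use s in \<open>auto simp: P_def\<close>)
  also have "\<dots> = 2 * (L + 1) ^ DIM('a) * s ^ DIM('a)"
    by (simp add: power_mult_distrib[symmetric] algebra_simps)
  finally show ?thesis using s(1) P(2) by simp
qed

lemma overlapping_maximal:
  obtains \<A> where "overlapping \<A>" "\<And>\<B>. overlapping \<B> \<Longrightarrow> card \<B> \<le> card \<A>"
proof -
  have 0: "overlapping {}" unfolding overlapping_def by auto
  obtain n where n: "real n \<ge> 2 * (L + 1) ^ DIM('a)" using real_arch_simple by blast
  have "\<exists>\<A>. overlapping \<A> \<and> (\<forall>\<B>. overlapping \<B> \<longrightarrow> card \<B> \<le> card \<A>)"
  proof (rule ex_has_greatest_nat[where P=overlapping and f=card and k="{}" and b="Suc n", OF 0])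
    show "\<forall>\<B>. overlapping \<B> \<longrightarrow> card \<B> < Suc n"
    proof (intro allI impI)
      fix \<B> assume "overlapping \<B>"
      then have "real (card \<B>) \<le> real n" using overlapping_card n by fastforce
      then show "card \<B> < Suc n" by simp
    qed
  qed
  then show thesis using that by blast
qed

text \<open>
  Replacing \<open>A0\<close> by \<open>K1\<close> and \<open>K2\<close> would give an overlapping family with one more member.
\<close>
lemma overlapping_insert:
  assumes "overlapping \<A>" "\<And>\<B>. overlapping \<B> \<Longrightarrow> card \<B> \<le> card \<A>"
    and "A0 \<in> \<A>"
    and K: "compact K1" "compact K2" "K1 \<subseteq> A0" "K2 \<subseteq> A0" "K1 \<inter> K2 = {}"
    and V: "open V" "V \<noteq> {}" "V \<subseteq> f ` K1" "V \<subseteq> f ` K2" "\<And>A. A \<in> \<A> \<Longrightarrow> V \<subseteq> f ` A"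
  shows False
proof -
  have fin: "finite \<A>" and dis: "pairwise disjnt \<A>" and A: "\<And>A. A \<in> \<A> \<Longrightarrow> compact A \<and> A \<subseteq> interior unit_cube"
    using assms(1) unfolding overlapping_def by blast+
  define \<B> where "\<B> = insert K1 (insert K2 (\<A> - {A0}))"
  have ne: "K1 \<noteq> {}" "K2 \<noteq> {}" using V by auto
  have disA: "disjnt A A'" if "A \<in> \<A>" "A' \<in> \<A>" "A \<noteq> A'" for A A' using dis that by (simp add: pairwise_def)
  have disK: "disjnt K1 A" "disjnt K2 A" if "A \<in> \<A> - {A0}" for A
    using disA[of A A0] that assms(3) K(3,4) by (auto simp: disjnt_iff)
  have K12: "disjnt K1 K2" using K(5) by (simp add: disjnt_def)
  have "pairwise disjnt \<B>"
  proof (rule pairwiseI)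
    fix B C assume BC: "B \<in> \<B>" "C \<in> \<B>" "B \<noteq> C"
    have *: "disjnt B C" if "B = K1 \<or> B = K2" "C \<in> \<B>" "B \<noteq> C" for B C
      using that disK[of C] K12 disjnt_sym[OF K12] unfolding \<B>_def by (elim disjE insertE) auto
    consider "B = K1 \<or> B = K2" | "C = K1 \<or> C = K2" | "B \<in> \<A>" "C \<in> \<A>"
      using BC unfolding \<B>_def by blast
    then show "disjnt B C"
      using *[of B C] *[of C B] disA[of B C] BC disjnt_sym[of C B] by cases auto
  qed
  moreover have "finite \<B>" using fin by (simp add: \<B>_def)
  moreover have "compact B \<and> B \<subseteq> interior unit_cube" if "B \<in> \<B>" for B
    using that A[of B] A[OF assms(3)] K(1-4) unfolding \<B>_def by blast
  moreover have "V \<subseteq> f ` B" if "B \<in> \<B>" for B using that V unfolding \<B>_def by blast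
  ultimately have "overlapping \<B>" unfolding overlapping_def using V(1,2) by blast
  then have "card \<B> \<le> card \<A>" by (rule assms(2))
  moreover have "card \<B> = Suc (card \<A>)"
  proof -
    have n2: "K2 \<notin> \<A> - {A0}" using disK(2)[of K2] ne by (auto simp: disjnt_iff)
    have n1: "K1 \<notin> insert K2 (\<A> - {A0})" using disK(1)[of K1] ne K(5) by (auto simp: disjnt_iff)
    have "card (\<A> - {A0}) = card \<A> - 1" using fin assms(3) by simp
    moreover have "card \<A> > 0" using fin assms(3) card_gt_0_iff by blast
    ultimately show ?thesis using n1 n2 fin unfolding \<B>_def by simp
  qed
  ultimately show False by simp
qed

text \<open>
  Suppose a value \<open>y0\<close> in \<open>V\<close> is missed. Inside the ball there is a nearly affine ball \<open>cball c r\<close>, whose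
  concentric half covers a small open set \<open>V'\<close>. By maximality the annulus around \<open>cball c r\<close> does not cover
  all of \<open>V'\<close>, and for a value \<open>z\<close> in \<open>V'\<close> that it misses, \<open>extend_from_annulus\<close> gives a map on
  \<open>cball c r\<close> that misses \<open>z\<close> but agrees with \<open>f\<close> on the boundary. This contradicts
  \<open>near_affine_surjective\<close>.
\<close>
lemma small_ball_onto:
  assumes ov: "overlapping \<A>" "\<And>\<B>. overlapping \<B> \<Longrightarrow> card \<B> \<le> card \<A>"
    and A0: "A0 \<in> \<A>" "cball x t \<subseteq> A0" and t: "t > 0"
    and V: "open V" "connected V" "f x \<in> V" "V \<inter> f ` sphere x t = {}" "\<And>A. A \<in> \<A> \<Longrightarrow> V \<subseteq> f ` A"
  shows "V \<subseteq> f ` cball x t"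
proof (rule ccontr)
  assume "\<not> V \<subseteq> f ` cball x t"
  then obtain y0 where y0: "y0 \<in> V" "y0 \<notin> f ` cball x t" by blast
  have A0_sub: "A0 \<subseteq> unit_cube"
    using ov(1) A0(1) interior_subset[of unit_cube] unfolding overlapping_def by blast
  define W where "W = ball x t \<inter> f -` V"
  have W: "open W" "x \<in> W" "W \<subseteq> unit_cube"
  proof -
    show "open W" unfolding W_def by (intro open_Int open_ball open_f_vimage V(1))
    show "x \<in> W" using t V(3) by (simp add: W_def)
    show "W \<subseteq> unit_cube" using A0(2) A0_sub ball_subset_cball[of x t] unfolding W_def by blast
  qed
  obtain c r M m where cr: "r > 0" "cball c r \<subseteq> W" "linear M" "m > 0" "\<And>u. m * norm u \<le> norm (M u)"
    "\<And>x. x \<in> cball c r \<Longrightarrow> norm (f x - f c - M (x - c)) \<le> m / 8 * r"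
  proof (rule affine_ball[OF W(1) _ W(3)])
    show "W \<noteq> {}" using W(2) by blast
  qed (rule that)
  define V' where "V' = ball (f c) (m * r / 8) \<inter> V"
  have "c \<in> cball c r" using cr(1) by simp
  then have fc: "f c \<in> V" using cr(2) unfolding W_def by blast
  have "f c \<in> V'" using fc cr(1,4) by (simp add: V'_def)
  then have V'_ne: "V' \<noteq> {}" by blast
  have "open V'" unfolding V'_def by (intro open_Int open_ball V(1))
  note V' = this V'_ne
  have V'1: "V' \<subseteq> f ` cball c (r/2)" using affine_ball_image[OF cr(1,3-6)] unfolding V'_def by blast
  have crx: "cball c r \<subseteq> ball x t" using cr(2) unfolding W_def by blast
  have half: "cball c (r/2) \<subseteq> ball c r" using cr(1) by (auto simp: subset_eq)
  let ?K2 = "cball x t - ball c r"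
  \<comment> \<open>otherwise \<open>cball c (r/2)\<close> and the annulus would be two members in place of \<open>A0\<close>\<close>
  have "\<not> V' \<subseteq> f ` ?K2"
  proof
    assume V'2: "V' \<subseteq> f ` ?K2"
    show False
    proof (rule overlapping_insert[OF ov A0(1), of "cball c (r/2)" ?K2 V'])
      show "compact ?K2" by (intro compact_diff) auto
      show "cball c (r/2) \<subseteq> A0" using half crx A0(2) ball_subset_cball by blast
      show "cball c (r/2) \<inter> ?K2 = {}" using half by blast
      show "?K2 \<subseteq> A0" using A0(2) by blast
      show "V' \<subseteq> f ` A" if "A \<in> \<A>" for A using V(5)[OF that] unfolding V'_def by blast
    qed (use V' V'1 V'2 in simp_all)
  qed
  then obtain z where z: "z \<in> V'" "z \<notin> f ` ?K2" by blast
  obtain g where g: "continuous_on (cball c r) g" "\<And>x. x \<in> sphere c r \<Longrightarrow> g x = f x" "z \<notin> g ` cball c r"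
  proof (rule extend_from_annulus[OF f_cont t cr(1) crx z(2) V(1,2,4) _ y0])
    show "z \<in> V" using z(1) by (simp add: V'_def)
  qed (rule that)
  have "z \<in> g ` cball c r"
  proof (rule near_affine_surjective[OF cr(1,3,4,5) g(1), where y = "f c"])
    fix w assume w: "w \<in> sphere c r"
    then have "norm (f w - f c - M (w - c)) \<le> m / 8 * r" using cr(6)[of w] by simp
    also have "\<dots> \<le> m * r / 4" using cr(1,4) by simp
    finally show "norm (g w - f c - M (w - c)) \<le> m * r / 4" using g(2)[OF w] by simp
  next
    have "norm (z - f c) \<le> m * r / 8" using z(1) by (simp add: V'_def dist_norm norm_minus_commute)
    also have "\<dots> \<le> m * r / 4" using cr(1,4) by simp
    finally show "norm (z - f c) \<le> m * r / 4" .
  qed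
  then show False using g(3) by blast
qed

text \<open>
  By the same packing as in \<open>overlapping_card\<close>, now applied to many points of one fibre.
\<close>
lemma finite_fibre:
  assumes "A \<subseteq> interior unit_cube"
  shows "finite {x \<in> A. f x = y}"
proof (rule ccontr)
  assume inf: "infinite {x \<in> A. f x = y}"
  obtain n where n: "real n > 2 * (L + 1) ^ DIM('a)" using reals_Archimedean2 by blast
  obtain P where P: "P \<subseteq> {x \<in> A. f x = y}" "card P = n" "finite P"
    using infinite_arbitrarily_large[OF inf, of n] by blast
  have PI: "P \<subseteq> interior unit_cube" using P(1) assms by blast
  obtain s where s: "s > 0" "\<And>x. x \<in> P \<Longrightarrow> cball x s \<subseteq> unit_cube"
    "\<And>x x'. x \<in> P \<Longrightarrow> x' \<in> P \<Longrightarrow> x \<noteq> x' \<Longrightarrow> 2 * s < dist x x'"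
    using separation_scale[OF P(3) PI] by metis
  have "real (card P) * s ^ DIM('a) \<le> 2 * (s + L * s) ^ DIM('a)"
    by (rule packing[OF P(3) s(1), of s y]) (use s P(1) in auto)
  also have "\<dots> = 2 * (L + 1) ^ DIM('a) * s ^ DIM('a)"
    by (simp add: power_mult_distrib[symmetric] algebra_simps)
  finally show False using s(1) P(2) n by simp
qed

lemma isolating_radius:
  assumes A: "A \<subseteq> interior unit_cube" and W: "open W" "x \<in> W" "W \<subseteq> A"
  obtains t where "t > 0" "cball x t \<subseteq> W" "f x \<notin> f ` sphere x t"
proof -
  obtain d1 where d1: "d1 > 0" "cball x d1 \<subseteq> W" using W open_contains_cball by blast
  obtain d2 where d2: "d2 > 0" "\<forall>x'\<in>{x' \<in> A. f x' = f x}. x' \<noteq> x \<longrightarrow> d2 \<le> dist x x'"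
    using finite_set_avoid[OF finite_fibre[OF A, of "f x"], of x] by blast
  define t where "t = min d1 (d2/2)"
  have t: "t > 0" "t \<le> d1" "t < d2" using d1(1) d2(1) by (auto simp: t_def)
  have sub: "cball x t \<subseteq> W" using d1(2) t(2) subset_cball by blast
  have "f x \<notin> f ` sphere x t"
  proof
    assume "f x \<in> f ` sphere x t"
    then obtain x' where x': "dist x x' = t" "f x' = f x" by auto
    then have "x' \<in> A" using sub W(3) by auto
    then have "d2 \<le> dist x x'" using d2(2) x' t(1) by auto
    then show False using x' t by simp
  qed
  then show thesis using that t(1) sub by blast
qed

end

section \<open>Sheets over a ball of the target\<close>

text \<open>
  Over the open set \<open>U\<close> the unit cube splits into the disjoint open sheets \<open>T i\<close>, and \<open>G i\<close> is the
  inverse of \<open>f\<close> on the sheet \<open>T i\<close>.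
\<close>
locale sheeted_transport = transport +
  fixes I :: "'i set" and T :: "'i \<Rightarrow> 'a set" and G :: "'i \<Rightarrow> 'a \<Rightarrow> 'a" and C :: real and U :: "'a set"
  assumes I: "finite I" "I \<noteq> {}"
    and U: "open U" "U \<noteq> {}" "U \<subseteq> Y"
    and T: "\<And>i. i \<in> I \<Longrightarrow> open (T i)" "\<And>i. i \<in> I \<Longrightarrow> T i \<subseteq> unit_cube" "disjoint_family_on T I"
    and T_cover: "unit_cube \<inter> f -` U = (\<Union>i\<in>I. T i)"
    and G: "\<And>i y. i \<in> I \<Longrightarrow> y \<in> U \<Longrightarrow> G i y \<in> T i" "\<And>i y. i \<in> I \<Longrightarrow> y \<in> U \<Longrightarrow> f (G i y) = y"
      "\<And>i x. i \<in> I \<Longrightarrow> x \<in> T i \<Longrightarrow> G i (f x) = x"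
    and G_lip: "\<And>i. i \<in> I \<Longrightarrow> C-lipschitz_on U (G i)"

context transport
begin

text \<open>
  Two points of \<open>A\<close> with the same image have disjoint small balls around them. By \<open>small_ball_onto\<close> each
  of these balls covers a neighbourhood of the common image, against maximality.
\<close>
lemma maximal_overlap_injective:
  assumes ov: "overlapping \<A>" "\<And>\<B>. overlapping \<B> \<Longrightarrow> card \<B> \<le> card \<A>"
    and A: "A \<in> \<A>" and U: "open U" "\<And>A. A \<in> \<A> \<Longrightarrow> U \<subseteq> f ` A"
    and T: "T = A \<inter> f -` U" "open T"
  shows "inj_on f T"
proof (rule inj_onI, rule ccontr)
  fix x x' assume x: "x \<in> T" "x' \<in> T" "f x = f x'" "x \<noteq> x'"
  have A_int: "A \<subseteq> interior unit_cube" using ov(1) A unfolding overlapping_def by blast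
  define d where "d = dist x x' / 3"
  have d: "d > 0" using x by (simp add: d_def)
  have 1: "open (T \<inter> ball w d)" "w \<in> T \<Longrightarrow> w \<in> T \<inter> ball w d" "T \<inter> ball w d \<subseteq> A" for w
    using T d by auto
  obtain t where t: "t > 0" "cball x t \<subseteq> T \<inter> ball x d" "f x \<notin> f ` sphere x t"
  proof (rule isolating_radius[of A "T \<inter> ball x d" x])
    show "A \<subseteq> interior unit_cube" by (rule A_int)
    show "open (T \<inter> ball x d)" by (rule 1(1))
    show "x \<in> T \<inter> ball x d" by (rule 1(2)) (rule x(1))
    show "T \<inter> ball x d \<subseteq> A" by (rule 1(3))
  qed (rule that)
  obtain t' where t': "t' > 0" "cball x' t' \<subseteq> T \<inter> ball x' d" "f x' \<notin> f ` sphere x' t'"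
  proof (rule isolating_radius[of A "T \<inter> ball x' d" x'])
    show "A \<subseteq> interior unit_cube" by (rule A_int)
    show "open (T \<inter> ball x' d)" by (rule 1(1))
    show "x' \<in> T \<inter> ball x' d" by (rule 1(2)) (rule x(2))
    show "T \<inter> ball x' d \<subseteq> A" by (rule 1(3))
  qed (rule that)
  have "open (U - f ` sphere x t - f ` sphere x' t')"
    by (intro open_Diff U(1) compact_imp_closed compact_f_image compact_sphere)
  moreover have "f x \<in> U - f ` sphere x t - f ` sphere x' t'" using t(3) t'(3) x T(1) by auto
  ultimately have "\<exists>\<eta>>0. ball (f x) \<eta> \<subseteq> U - f ` sphere x t - f ` sphere x' t'"
    by (rule openE) blast
  then obtain \<eta> where \<eta>: "\<eta> > 0" "ball (f x) \<eta> \<subseteq> U - f ` sphere x t - f ` sphere x' t'" by blast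
  define V where "V = ball (f x) \<eta>"
  have V: "open V" "connected V" "f x \<in> V" "f x' \<in> V" "V \<inter> f ` sphere x t = {}" "V \<inter> f ` sphere x' t' = {}"
    using \<eta> x(3) unfolding V_def by auto
  have VU: "V \<subseteq> f ` A" if "A \<in> \<A>" for A using U(2)[OF that] \<eta>(2) unfolding V_def by blast
  have sub: "cball x t \<subseteq> A" "cball x' t' \<subseteq> A" using t(2) t'(2) T(1) by blast+
  have "V \<subseteq> f ` cball x t" by (rule small_ball_onto[OF ov A sub(1) t(1) V(1,2,3,5) VU])
  moreover have "V \<subseteq> f ` cball x' t'" by (rule small_ball_onto[OF ov A sub(2) t'(1) V(1,2,4,6) VU])
  moreover have "cball x t \<inter> cball x' t' = {}"
  proof (rule ccontr)
    assume "cball x t \<inter> cball x' t' \<noteq> {}"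
    then obtain w where w: "w \<in> ball x d" "w \<in> ball x' d" using t(2) t'(2) by blast
    then have "dist x x' < 2 * d" using dist_triangle2[of x x' w] by simp
    then show False using d by (simp add: d_def)
  qed
  moreover have "V \<noteq> {}" using V(3) by blast
  ultimately show False
    using overlapping_insert[OF ov A compact_cball compact_cball sub _ V(1) _ _ _ VU] by blast
qed

text \<open>
  Let \<open>t = dist y y'\<close> and suppose that \<open>g\<close> moves \<open>y\<close> and \<open>y'\<close> far apart. Along the segment from \<open>y\<close> to
  \<open>y'\<close>, the distance of \<open>g\<close> from its initial value takes all intermediate values, hence all multiples of
  \<open>t\<close> up to \<open>dist (g y) (g y')\<close>. The corresponding points have mutual distance at least \<open>t\<close>, but \<open>f\<close> maps
  all of them into a ball of radius \<open>t\<close>, so \<open>packing\<close> bounds their number.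
\<close>
lemma inverse_branch_lipschitz:
  assumes g: "continuous_on (ball y0 \<delta>) g" "\<And>y. y \<in> ball y0 \<delta> \<Longrightarrow> f (g y) = y"
    and room: "\<And>y. y \<in> ball y0 \<delta> \<Longrightarrow> cball (g y) \<delta> \<subseteq> unit_cube"
  shows "(2 * (3 + L) ^ DIM('a))-lipschitz_on (ball y0 \<delta>) g"
proof (rule lipschitz_onI)
  show "0 \<le> 2 * (3 + L) ^ DIM('a)" using L_nonneg by simp
  fix y y' assume y: "y \<in> ball y0 \<delta>" "y' \<in> ball y0 \<delta>"
  show "dist (g y) (g y') \<le> 2 * (3 + L) ^ DIM('a) * dist y y'"
  proof (cases "y = y'")
    case False
    define t where "t = dist y y'"
    have t: "t > 0" using False by (simp add: t_def)
    have "t < 2 * \<delta>" using y dist_triangle2[of y y' y0] by (simp add: t_def dist_commute)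
    then have t\<delta>: "t/3 \<le> \<delta>" using t by simp
    have seg: "closed_segment y y' \<subseteq> ball y0 \<delta>" using y by (intro closed_segment_subset convex_ball)
    define D where "D = dist (g y) (g y')"
    define n where "n = nat \<lfloor>D/t\<rfloor>"
    have D: "D \<ge> 0" by (simp add: D_def)
    have n: "real n \<le> D/t" "D/t < real n + 1" using D t by (simp_all add: n_def)
    define \<phi> where "\<phi> w = dist (g y) (g w)" for w
    have "continuous_on (closed_segment y y') \<phi>" unfolding \<phi>_def
      by (intro continuous_intros continuous_on_subset[OF g(1) seg])
    then have con: "connected (\<phi> ` closed_segment y y')" by (rule connected_continuous_image) (rule connected_segment)
    have "\<exists>w\<in>closed_segment y y'. \<phi> w = real j * t" if "j \<le> n" for j
    proof -
      have "real j * t \<le> real n * t" using that t by simp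
      also have "\<dots> \<le> D" using n(1) t by (simp add: pos_le_divide_eq)
      finally have le: "real j * t \<le> D" .
      have "\<phi> y \<in> \<phi> ` closed_segment y y'" "\<phi> y' \<in> \<phi> ` closed_segment y y'" by auto
      then have "0 \<in> \<phi> ` closed_segment y y'" "D \<in> \<phi> ` closed_segment y y'"
        by (simp_all add: \<phi>_def D_def)
      then have "real j * t \<in> \<phi> ` closed_segment y y'"
        by (rule connectedD_interval[OF con]) (use le t in simp_all)
      then show ?thesis by force
    qed
    then obtain w where w: "\<And>j. j \<le> n \<Longrightarrow> w j \<in> closed_segment y y'" "\<And>j. j \<le> n \<Longrightarrow> \<phi> (w j) = real j * t" by metis
    define P where "P = (\<lambda>j. g (w j)) ` {..n}"
    have sep: "t \<le> dist (g (w i)) (g (w j))" if "i \<le> n" "j \<le> n" "i \<noteq> j" for i j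
    proof -
      have "\<bar>real i - real j\<bar> * t = \<bar>\<phi> (w i) - \<phi> (w j)\<bar>" using w(2) that t
        by (simp add: abs_mult flip: left_diff_distrib)
      also have "\<dots> \<le> dist (g (w i)) (g (w j))" unfolding \<phi>_def
        using abs_dist_diff_le[of "g (w i)" "g y" "g (w j)"] by (simp add: dist_commute)
      finally have *: "\<bar>real i - real j\<bar> * t \<le> dist (g (w i)) (g (w j))" .
      have "1 * t \<le> \<bar>real i - real j\<bar> * t" using that t by (intro mult_right_mono) auto
      then show ?thesis using * by simp
    qed
    have inj: "inj_on (\<lambda>j. g (w j)) {..n}"
      using sep t by (auto simp: inj_on_def) (metis dist_self not_le)
    have "real (card P) * (t/3) ^ DIM('a) \<le> 2 * (t + L * (t/3)) ^ DIM('a)"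
    proof (rule packing[of _ _ _ y])
      fix x assume "x \<in> P"
      then obtain j where j: "j \<le> n" "x = g (w j)" by (auto simp: P_def)
      have wj: "w j \<in> ball y0 \<delta>" using w(1)[OF j(1)] seg by blast
      show "cball x (t/3) \<subseteq> unit_cube" using room[OF wj] subset_cball[OF t\<delta>] j(2) by blast
      have "f x = w j" using g(2)[OF wj] j(2) by simp
      moreover have "dist y (w j) \<le> t"
        using w(1)[OF j(1)] by (auto simp: t_def dest: dist_in_closed_segment[THEN conjunct1, THEN order_trans[OF _ order_refl], of _ y y'] simp: dist_commute)
      ultimately show "f x \<in> cball y t" by simp
    next
      fix x x' assume "x \<in> P" "x' \<in> P" "x \<noteq> x'"
      then obtain i j where "i \<le> n" "j \<le> n" "i \<noteq> j" "x = g (w i)" "x' = g (w j)" by (auto simp: P_def)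
      then show "2 * (t/3) < dist x x'" using sep[of i j] t by simp
    qed (use t in \<open>auto simp: P_def\<close>)
    also have "card P = n + 1" using inj by (simp add: P_def card_image)
    also have "t + L * (t/3) = (3 + L) * (t/3)" by (simp add: algebra_simps)
    finally have "(real n + 1) * (t/3) ^ DIM('a) \<le> 2 * (3 + L) ^ DIM('a) * (t/3) ^ DIM('a)"
      by (simp only: power_mult_distrib mult.assoc of_nat_add of_nat_1)
    then have "real n + 1 \<le> 2 * (3 + L) ^ DIM('a)" using t by (simp add: mult_le_cancel_right)
    then have "D / t \<le> 2 * (3 + L) ^ DIM('a)" using n(2) by linarith
    then show ?thesis using t by (simp add: D_def t_def pos_divide_le_eq)
  qed simp
qed

text \<open>
  Start from a maximal overlapping family. Over its common image, the family contains every interior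
  point of the cube: otherwise a nearly affine ball in the rest could be added. So over a small ball that
  avoids the image of the boundary of the cube, the members of the family are open, and \<open>f\<close> is injective
  on each of them; invariance of domain and \<open>inverse_branch_lipschitz\<close> give the inverse branches.
\<close>
lemma sheets_exist:
  obtains \<A> :: "'a set set" and T G C U where "sheeted_transport f \<rho> L Y \<A> T G C U"
proof -
  obtain \<A> where ov: "overlapping \<A>" "\<And>\<B>. overlapping \<B> \<Longrightarrow> card \<B> \<le> card \<A>"
    using overlapping_maximal by metis
  have fin: "finite \<A>" and dis: "pairwise disjnt \<A>" and comp: "\<And>A. A \<in> \<A> \<Longrightarrow> compact A"
    and A_int: "\<And>A. A \<in> \<A> \<Longrightarrow> A \<subseteq> interior unit_cube"
    using ov(1) unfolding overlapping_def by blast+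
  obtain U0 where U0: "open U0" "U0 \<noteq> {}" "\<And>A. A \<in> \<A> \<Longrightarrow> U0 \<subseteq> f ` A"
    using ov(1) unfolding overlapping_def by blast
  \<comment> \<open>an uncovered point would leave room for a nearly affine ball that enlarges the family\<close>
  have cover: "x \<in> \<Union>\<A>" if x: "x \<in> interior unit_cube" "f x \<in> U0" for x
  proof (rule ccontr)
    assume x': "x \<notin> \<Union>\<A>"
    define W where "W = (interior unit_cube \<inter> f -` U0) - \<Union>\<A>"
    have "open W" unfolding W_def
      by (intro open_Diff open_Int open_interior open_f_vimage U0(1) closed_Union fin ballI compact_imp_closed comp)
    moreover have "W \<noteq> {}" using x x' by (auto simp: W_def)
    moreover have "W \<subseteq> unit_cube" using interior_subset unfolding W_def by blast
    ultimately obtain c r M m where cr: "r > 0" "cball c r \<subseteq> W" "linear M" "m > 0" "\<And>u. m * norm u \<le> norm (M u)"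
      "\<And>x. x \<in> cball c r \<Longrightarrow> norm (f x - f c - M (x - c)) \<le> m / 8 * r"
      by (rule affine_ball) (rule that)
    have cc: "c \<in> cball c r" using cr(1) by simp
    define V where "V = ball (f c) (m * r / 8) \<inter> U0"
    have "f c \<in> U0" using cr(2) cc unfolding W_def by blast
    then have "f c \<in> V" using cr(1,4) unfolding V_def by simp
    then have V_ne: "V \<noteq> {}" by blast
    have "open V" unfolding V_def by (intro open_Int open_ball U0(1))
    note V = this V_ne
    have "cball c (r/2) \<subseteq> cball c r" using cr(1) by (intro subset_cball) simp
    then have V1: "V \<subseteq> f ` cball c r" using affine_ball_image[OF cr(1,3-6)] unfolding V_def by blast
    have new: "cball c r \<inter> A = {}" if "A \<in> \<A>" for A using cr(2) that unfolding W_def by blast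
    have "overlapping (insert (cball c r) \<A>)" unfolding overlapping_def
    proof (intro conjI ballI exI[of _ V])
      show "finite (insert (cball c r) \<A>)" using fin by simp
      show "pairwise disjnt (insert (cball c r) \<A>)" using dis new by (auto simp: pairwise_insert disjnt_def)
      fix A assume A: "A \<in> insert (cball c r) \<A>"
      show "compact A" using A comp by auto
      show "A \<subseteq> interior unit_cube" using A A_int cr(2) unfolding W_def by blast
      show "V \<subseteq> f ` A" using A V1 U0(3) unfolding V_def by blast
    qed (use V in auto)
    then have "card (insert (cball c r) \<A>) \<le> card \<A>" by (rule ov(2))
    moreover have "cball c r \<notin> \<A>" using new[of "cball c r"] cc by blast
    ultimately show False using fin by simp
  qed
  \<comment> \<open>a target point \<open>y0\<close> off the image of the boundary, so that nearby sheets stay in the interior of the cube\<close>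
  have "negligible (f ` frontier unit_cube)"
  proof (rule negligible_locally_Lipschitz_image)
    show "negligible (frontier (unit_cube :: 'a set))" by (rule negligible_convex_frontier) (rule convex_box)
    fix x show "\<exists>S B. open S \<and> x \<in> S \<and> (\<forall>y\<in>frontier unit_cube \<inter> S. norm (f y - f x) \<le> B * norm (y - x))"
      using f_dist by (intro exI[of _ UNIV] exI[of _ L]) (simp add: dist_norm)
  qed simp
  then have "\<not> U0 \<subseteq> f ` frontier unit_cube"
    using open_not_negligible[OF U0(1,2)] negligible_subset by blast
  then obtain y0 where y0: "y0 \<in> U0 - f ` frontier unit_cube" by blast
  have "open (U0 - f ` frontier unit_cube)"
    by (intro open_Diff U0(1) compact_imp_closed compact_f_image compact_frontier compact_cbox)
  then have "\<exists>\<delta>0>0. ball y0 \<delta>0 \<subseteq> U0 - f ` frontier unit_cube"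
    using y0 by (rule openE) blast
  then obtain \<delta>0 where \<delta>0: "\<delta>0 > 0" "ball y0 \<delta>0 \<subseteq> U0 - f ` frontier unit_cube" by blast
  define S where "S A = A \<inter> f -` ball y0 \<delta>0" for A
  have in_int: "x \<in> interior unit_cube" if "x \<in> unit_cube" "f x \<in> ball y0 \<delta>0" for x
    using that \<delta>0(2) closure_subset[of unit_cube] by (auto simp: frontier_def)
  have S_open: "open (S A)" if A: "A \<in> \<A>" for A
  proof -
    \<comment> \<open>the members are disjoint, closed and cover the preimage of the ball, so removing all others from it leaves an open set\<close>
    have "S A = (interior unit_cube \<inter> f -` ball y0 \<delta>0) - \<Union>(\<A> - {A})"
    proof (intro equalityI subsetI)
      fix x assume "x \<in> S A"
      then show "x \<in> (interior unit_cube \<inter> f -` ball y0 \<delta>0) - \<Union>(\<A> - {A})"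
        using A A_int[OF A] dis unfolding S_def pairwise_def disjnt_iff by blast
    next
      fix x assume x: "x \<in> (interior unit_cube \<inter> f -` ball y0 \<delta>0) - \<Union>(\<A> - {A})"
      then have "x \<in> \<Union>\<A>" using cover[of x] \<delta>0(2) by blast
      then show "x \<in> S A" using x unfolding S_def by blast
    qed
    moreover have "closed (\<Union>(\<A> - {A}))" using fin comp by (intro closed_Union) (auto intro: compact_imp_closed)
    ultimately show ?thesis by (simp only: open_Diff open_Int open_interior open_f_vimage open_ball)
  qed
  have S_im: "f ` S A = ball y0 \<delta>0" if A: "A \<in> \<A>" for A
    using U0(3)[OF A] \<delta>0(2) unfolding S_def by blast
  have U0A: "ball y0 \<delta>0 \<subseteq> f ` A" if "A \<in> \<A>" for A using U0(3)[OF that] \<delta>0(2) by blast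
  have inj: "inj_on f (S A)" if A: "A \<in> \<A>" for A
    by (rule maximal_overlap_injective[OF ov A open_ball U0A S_def S_open[OF A]])
  have "\<exists>g. homeomorphism (S A) (ball y0 \<delta>0) f g" if A: "A \<in> \<A>" for A
    using invariance_of_domain_homeomorphism[OF S_open[OF A] f_cont order_refl inj[OF A]] S_im[OF A] by metis
  then obtain g where g: "\<And>A. A \<in> \<A> \<Longrightarrow> homeomorphism (S A) (ball y0 \<delta>0) f (g A)" by metis
  obtain \<eta> where \<eta>: "\<eta> > 0" "\<And>A. A \<in> \<A> \<Longrightarrow> \<forall>z\<in>g A ` cball y0 (\<delta>0/2). cball z \<eta> \<subseteq> unit_cube"
  proof (rule uniform_scale_finite[OF fin, of "\<lambda>A \<eta>. \<forall>z\<in>g A ` cball y0 (\<delta>0/2). cball z \<eta> \<subseteq> unit_cube"])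
    fix A assume A: "A \<in> \<A>"
    have sub: "cball y0 (\<delta>0/2) \<subseteq> ball y0 \<delta>0" using \<delta>0(1) by auto
    have "continuous_on (ball y0 \<delta>0) (g A)" using g[OF A] by (simp add: homeomorphism_def)
    then have "compact (g A ` cball y0 (\<delta>0/2))"
      by (intro compact_continuous_image continuous_on_subset[OF _ sub]) auto
    moreover have "g A ` cball y0 (\<delta>0/2) \<subseteq> interior unit_cube"
      using sub homeomorphism_image2[OF g[OF A]] A_int[OF A] unfolding S_def by blast
    ultimately obtain e where "e > 0" "(\<Union>z\<in>g A ` cball y0 (\<delta>0/2). cball z e) \<subseteq> interior unit_cube"
      using compact_subset_open_imp_cball_epsilon_subset[OF _ open_interior] by blast
    then show "\<exists>\<eta>>0. \<forall>z\<in>g A ` cball y0 (\<delta>0/2). cball z \<eta> \<subseteq> unit_cube"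
      using interior_subset by (intro exI[of _ e]) blast
  next
    fix A and d d' :: real assume "\<forall>z\<in>g A ` cball y0 (\<delta>0/2). cball z d \<subseteq> unit_cube" "d' \<le> d"
    then show "\<forall>z\<in>g A ` cball y0 (\<delta>0/2). cball z d' \<subseteq> unit_cube" using subset_cball by blast
  qed (rule that)
  define \<delta> where "\<delta> = min (\<delta>0/2) \<eta>"
  have \<delta>: "\<delta> > 0" "\<delta> \<le> \<eta>" "\<delta> \<le> \<delta>0/2" using \<delta>0(1) \<eta>(1) by (auto simp: \<delta>_def)
  have sub: "ball y0 \<delta> \<subseteq> ball y0 \<delta>0" "ball y0 \<delta> \<subseteq> cball y0 (\<delta>0/2)" using \<delta> \<delta>0(1) by auto
  define T where "T A = A \<inter> f -` ball y0 \<delta>" for A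
  have TS: "T A = S A \<inter> f -` ball y0 \<delta>" for A using sub unfolding T_def S_def by blast
  have A_Y: "f ` A \<subseteq> Y" if "A \<in> \<A>" for A using A_int[OF that] interior_image_in_target by blast
  have ne: "\<A> \<noteq> {}"
  proof
    assume e: "\<A> = {}"
    obtain c r M m where cr: "r > 0" "cball c r \<subseteq> interior unit_cube" "linear M" "m > 0" "\<And>u. m * norm u \<le> norm (M u)"
      "\<And>x. x \<in> cball c r \<Longrightarrow> norm (f x - f c - M (x - c)) \<le> m / 8 * r"
    proof (rule affine_ball[OF open_interior _ interior_subset])
      show "interior (unit_cube :: 'a set) \<noteq> {}" by (simp add: interior_cbox box_ne_empty)
    qed (rule that)
    have "cball c (r/2) \<subseteq> cball c r" using cr(1) by (intro subset_cball) simp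
    then have V1: "ball (f c) (m * r / 8) \<subseteq> f ` cball c r" using affine_ball_image[OF cr(1,3-6)] by blast
    have "m * r / 8 > 0" using cr(1,4) by simp
    then have "ball (f c) (m * r / 8) \<noteq> {}" by simp
    then have "overlapping {cball c r}" unfolding overlapping_def
      using cr(2) V1 by (auto intro!: exI[of _ "ball (f c) (m * r / 8)"])
    then have "card {cball c r} \<le> card \<A>" by (rule ov(2))
    then show False using e by simp
  qed
  have "sheeted_transport f \<rho> L Y \<A> T g (2 * (3 + L) ^ DIM('a)) (ball y0 \<delta>)"
  proof (unfold_locales)
    show "ball y0 \<delta> \<noteq> {}" using \<delta>(1) by simp
    obtain A where A: "A \<in> \<A>" using ne by blast
    show "ball y0 \<delta> \<subseteq> Y" using U0A[OF A] A_Y[OF A] sub(1) by blast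
    show "disjoint_family_on T \<A>"
      using dis unfolding disjoint_family_on_def pairwise_def disjnt_def T_def by blast
    show "unit_cube \<inter> f -` ball y0 \<delta> = (\<Union>A\<in>\<A>. T A)"
    proof (intro equalityI subsetI)
      fix x assume x: "x \<in> unit_cube \<inter> f -` ball y0 \<delta>"
      then have "f x \<in> ball y0 \<delta>0" using sub(1) by blast
      then have "x \<in> \<Union>\<A>" using cover[of x] in_int[of x] \<delta>0(2) x by blast
      then show "x \<in> (\<Union>A\<in>\<A>. T A)" using x unfolding T_def by blast
    next
      fix x assume "x \<in> (\<Union>A\<in>\<A>. T A)"
      then show "x \<in> unit_cube \<inter> f -` ball y0 \<delta>"
        using A_int interior_subset[of "unit_cube :: 'a set"] unfolding T_def by blast
    qed
  next
    fix A assume A: "A \<in> \<A>"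
    show "open (T A)" unfolding TS using S_open[OF A] by (intro open_Int open_f_vimage) auto
    show "T A \<subseteq> unit_cube" using A_int[OF A] interior_subset[of "unit_cube :: 'a set"] unfolding T_def by blast
    show "g A (f x) = x" if "x \<in> T A" for x
      using that homeomorphism_apply1[OF g[OF A]] unfolding TS by blast
    show fg: "f (g A y) = y" if "y \<in> ball y0 \<delta>" for y
      using that sub(1) homeomorphism_apply2[OF g[OF A]] by blast
    show "g A y \<in> T A" if "y \<in> ball y0 \<delta>" for y
    proof -
      have "g A y \<in> S A" using that sub(1) homeomorphism_image2[OF g[OF A]] by blast
      then show ?thesis using fg[OF that] that unfolding TS by simp
    qed
    show "(2 * (3 + L) ^ DIM('a))-lipschitz_on (ball y0 \<delta>) (g A)"
    proof (rule inverse_branch_lipschitz[OF _ fg])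
      have "continuous_on (ball y0 \<delta>0) (g A)" using g[OF A] by (simp add: homeomorphism_def)
      then show "continuous_on (ball y0 \<delta>) (g A)" using sub(1) by (rule continuous_on_subset)
      fix y assume "y \<in> ball y0 \<delta>"
      then have "g A y \<in> g A ` cball y0 (\<delta>0/2)" using sub(2) by blast
      then have "cball (g A y) \<eta> \<subseteq> unit_cube" using \<eta>(2)[OF A] by blast
      then show "cball (g A y) \<delta> \<subseteq> unit_cube" using subset_cball[OF \<delta>(2)] by blast
    qed
  qed (use fin ne in auto)
  then show thesis by (rule that)
qed

end

section \<open>A cell on which finitely many maps are nearly translations\<close>

lemma finite_net_cball:
  fixes K \<tau> :: real
  assumes "\<tau> > 0"
  obtains X where "finite X" "X \<subseteq> cball (0::'a::euclidean_space) K" "\<And>z. z \<in> cball 0 K \<Longrightarrow> \<exists>x\<in>X. dist x z < \<tau>"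
proof -
  obtain X where X: "finite X" "X \<subseteq> cball (0::'a) K" "cball 0 K \<subseteq> (\<Union>x\<in>X. ball x \<tau>)"
    using compactE_image[of "cball (0::'a) K" "cball 0 K" "\<lambda>x. ball x \<tau>"] assms
    by (metis UN_I centre_in_ball compact_cball open_ball subsetI)
  show thesis
  proof (rule that[OF X(1,2)])
    fix z :: 'a assume "z \<in> cball 0 K"
    then obtain x where "x \<in> X" "z \<in> ball x \<tau>" using X(3) by blast
    then show "\<exists>x\<in>X. dist x z < \<tau>" by auto
  qed
qed

text \<open>
  The variance identity for the increments \<open>D m\<close>, where \<open>W\<close> is their mean up to an error \<open>\<mu> / N\<close>.
\<close>
lemma variance_along_row:
  fixes D :: "nat \<Rightarrow> 'b::real_inner"
  assumes W: "norm W \<le> w" and end_error: "norm ((\<Sum>m<N. D m) - real N *\<^sub>R W) \<le> \<mu>"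
  shows "(\<Sum>m<N. (norm (D m - W))\<^sup>2) \<le> (\<Sum>m<N. (norm (D m))\<^sup>2) - real N * (norm W)\<^sup>2 + 2 * \<mu> * w"
proof -
  define \<delta> where "\<delta> = (\<Sum>m<N. D m) - real N *\<^sub>R W"
  have "(\<Sum>m<N. (norm (D m - W))\<^sup>2) = (\<Sum>m<N. (norm (D m))\<^sup>2 - 2 * (D m \<bullet> W) + (norm W)\<^sup>2)"
    by (simp add: power2_norm_eq_inner inner_diff inner_commute algebra_simps)
  also have "\<dots> = (\<Sum>m<N. (norm (D m))\<^sup>2) - 2 * ((\<Sum>m<N. D m) \<bullet> W) + real N * (norm W)\<^sup>2"
    by (simp add: sum.distrib sum_subtractf inner_sum_left sum_distrib_left)
  also have "(\<Sum>m<N. D m) \<bullet> W = \<delta> \<bullet> W + real N * (norm W)\<^sup>2"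
    by (simp add: \<delta>_def inner_diff_left power2_norm_eq_inner)
  finally have "(\<Sum>m<N. (norm (D m - W))\<^sup>2) = (\<Sum>m<N. (norm (D m))\<^sup>2) - real N * (norm W)\<^sup>2 - 2 * (\<delta> \<bullet> W)"
    by simp
  moreover have "\<bar>\<delta> \<bullet> W\<bar> \<le> \<mu> * w"
  proof -
    have "\<bar>\<delta> \<bullet> W\<bar> \<le> norm \<delta> * norm W" by (rule Cauchy_Schwarz_ineq2)
    also have "\<dots> \<le> \<mu> * w" using W end_error by (intro mult_mono) (auto simp: \<delta>_def intro: order_trans[OF norm_ge_zero])
    finally show ?thesis .
  qed
  ultimately show ?thesis by linarith
qed

text \<open>
  At least a third of the \<open>N\<close> indices are even, so one of them is no worse than three times the average.
\<close>
lemma even_index_small_term: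
  fixes A :: "nat \<Rightarrow> real"
  assumes A: "\<And>m. A m \<ge> 0" and N: "N \<ge> 2"
  obtains m where "even m" "m < N" "A m * real N \<le> 3 * (\<Sum>m<N. A m)"
proof -
  have "(\<Sum>r<N div 2. A (2*r)) = sum A ((\<lambda>r. 2*r) ` {..<N div 2})"
    by (subst sum.reindex) (auto simp: inj_on_def)
  also have "\<dots> \<le> (\<Sum>m<N. A m)" using A by (intro sum_mono2) auto
  finally have le: "(\<Sum>r<N div 2. A (2*r)) \<le> (\<Sum>m<N. A m)" .
  have "\<exists>r<N div 2. A (2*r) * real (N div 2) \<le> (\<Sum>m<N. A m)"
  proof (rule ccontr)
    assume "\<not> ?thesis"
    then have *: "\<And>r. r < N div 2 \<Longrightarrow> (\<Sum>m<N. A m) / real (N div 2) < A (2*r)"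
      using N by (auto simp: divide_less_eq not_le)
    have "(\<Sum>m<N. A m) = (\<Sum>r<N div 2. (\<Sum>m<N. A m) / real (N div 2))" using N by simp
    also have "\<dots> < (\<Sum>r<N div 2. A (2*r))"
    proof (rule sum_strict_mono)
      have "N div 2 > 0" using N by linarith
      then show "{..<N div 2} \<noteq> {}" by (simp add: lessThan_empty_iff)
    qed (use * in auto)
    finally show False using le by simp
  qed
  then obtain r where r: "r < N div 2" "A (2*r) * real (N div 2) \<le> (\<Sum>m<N. A m)" by blast
  have "N \<le> 3 * (N div 2)" using N by (auto elim!: evenE oddE)
  then have "real N \<le> 3 * real (N div 2)" by linarith
  then have "A (2*r) * real N \<le> A (2*r) * (3 * real (N div 2))" using A by (intro mult_left_mono) auto
  then show thesis using that[of "2*r"] r by auto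
qed

lemma point_on_segment:
  assumes "m \<le> N" "N \<ge> 1" "l > 0"
  shows "a + (real m * (l / real N)) *\<^sub>R e \<in> closed_segment a (a + l *\<^sub>R e)"
proof -
  have "real m / real N \<in> {0..1}" using assms by auto
  moreover have "a + (real m * (l / real N)) *\<^sub>R e = a + (real m / real N) *\<^sub>R ((a + l *\<^sub>R e) - a)" by simp
  ultimately show ?thesis unfolding closed_segment_image_interval
    by (auto simp: algebra_simps intro!: image_eqI[of _ _ "real m / real N"])
qed

text \<open>
  Let \<open>q (a, l)\<close> be the sum over \<open>j\<close> of the squared difference quotients of \<open>h j\<close> along the segment from
  \<open>a\<close> to \<open>a + l e\<close>. It is bounded, and the pair \<open>(a, l)\<close> is chosen in \<open>Dset\<close> with \<open>q (a, l)\<close> almost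
  equal to the supremum. When the segment is cut into \<open>N\<close> steps, no single step exceeds the supremum,
  while the average over the steps is almost as large as the supremum. Hence the increments over the steps
  have small variance. The same holds for the parallel rows through the points of a finite net at distance
  at most \<open>K\<close> steps from the segment, as their endpoints are close to those of the segment, and one even
  step is good for all the points of the net at once.

  The position of the good step depends on \<open>N\<close>, but \<open>(a, l)\<close> does not; this order of choice is essential,
  since \<open>N\<close> will be dictated by the density.
\<close>
lemma row_near_translation:
  fixes h :: "'j \<Rightarrow> 'a::euclidean_space \<Rightarrow> 'b::real_inner"
  assumes J: "finite J" "J \<noteq> {}" and \<rho>: "\<rho> > 0"
    and lip: "\<And>j. j \<in> J \<Longrightarrow> \<Lambda>-lipschitz_on (ball x0 \<rho>) (h j)"
    and e: "norm e = 1"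
    and dense: "\<And>W. open W \<Longrightarrow> W \<noteq> {} \<Longrightarrow> \<exists>d\<in>Dset. d \<in> (W :: ('a \<times> real) set)"
    and \<theta>: "\<theta> > 0" and K: "K \<ge> 0"
  obtains a l r1 N0 where "(a, l) \<in> Dset" "l > 0" "r1 > 0"
    "\<And>z x. z \<in> closed_segment a (a + l *\<^sub>R e) \<Longrightarrow> dist z x \<le> r1 \<Longrightarrow> x \<in> ball x0 \<rho>"
    "\<And>N. N \<ge> N0 \<Longrightarrow> N \<ge> 1 \<and> (\<exists>m w. even m \<and> m < N \<and> (\<forall>j\<in>J. \<forall>x\<in>cball (a + (real m * (l / real N)) *\<^sub>R e) (K * (l / real N)).
        norm (h j (x + (l / real N) *\<^sub>R e) - h j x - w j) \<le> \<theta> * (l / real N)))"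
proof -
  define V where "V = ball x0 \<rho>"
  have \<Lambda>: "\<Lambda> \<ge> 0" using lip J lipschitz_on_nonneg by blast
  have hd: "norm (h j x - h j y) \<le> \<Lambda> * norm (x - y)" if "j \<in> J" "x \<in> V" "y \<in> V" for j x y
    using lipschitz_onD[OF lip[OF that(1)], of x y] that by (simp add: dist_norm V_def)
  have h_cont: "continuous_on V (h j)" if "j \<in> J" for j
    using lipschitz_on_continuous_on[OF lip[OF that]] by (simp add: V_def)
  define Dom where "Dom = {p :: 'a \<times> real. 0 < snd p \<and> fst p \<in> V \<and> fst p + snd p *\<^sub>R e \<in> V}"
  define q where "q p = (\<Sum>j\<in>J. (norm (h j (fst p + snd p *\<^sub>R e) - h j (fst p)))\<^sup>2) / (snd p)\<^sup>2" for p :: "'a \<times> real"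
  have Dom_open: "open Dom"
  proof -
    have "Dom = (snd -` {0<..}) \<inter> (fst -` V) \<inter> ((\<lambda>p. fst p + snd p *\<^sub>R e) -` V)" by (auto simp: Dom_def)
    moreover have "open (snd -` {0<..} :: ('a \<times> real) set)" by (intro open_vimage_snd) simp
    moreover have "open (fst -` V :: ('a \<times> real) set)" by (intro open_vimage_fst) (simp add: V_def)
    moreover have "open ((\<lambda>p::'a \<times> real. fst p + snd p *\<^sub>R e) -` V)"
      by (rule open_vimage) (auto simp: V_def intro!: continuous_intros)
    ultimately show ?thesis by auto
  qed
  have q_cont: "continuous_on Dom q" unfolding q_def
  proof (rule continuous_on_divide)
    have 1: "continuous_on Dom (\<lambda>p. h j (fst p + snd p *\<^sub>R e))" if j: "j \<in> J" for j
    proof (rule continuous_on_compose2[OF h_cont[OF j]])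
      show "continuous_on Dom (\<lambda>p. fst p + snd p *\<^sub>R e)" by (intro continuous_intros)
    qed (auto simp: Dom_def)
    have 2: "continuous_on Dom (\<lambda>p. h j (fst p))" if j: "j \<in> J" for j
    proof (rule continuous_on_compose2[OF h_cont[OF j]])
      show "continuous_on Dom fst" by (intro continuous_intros)
    qed (auto simp: Dom_def)
    show "continuous_on Dom (\<lambda>p. \<Sum>j\<in>J. (norm (h j (fst p + snd p *\<^sub>R e) - h j (fst p)))\<^sup>2)"
      by (intro continuous_on_sum continuous_on_power continuous_on_norm continuous_on_diff 1 2)
    show "continuous_on Dom (\<lambda>p. (snd p)\<^sup>2)" by (intro continuous_intros)
    show "\<forall>p\<in>Dom. (snd p)\<^sup>2 \<noteq> 0" by (simp add: Dom_def)
  qed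
  have q_bound: "q p \<le> real (card J) * \<Lambda>\<^sup>2" if p: "p \<in> Dom" for p
  proof -
    have p0: "snd p > 0" using p by (simp add: Dom_def)
    have "norm (h j (fst p + snd p *\<^sub>R e) - h j (fst p)) \<le> \<Lambda> * snd p" if "j \<in> J" for j
      using hd[OF that, of "fst p + snd p *\<^sub>R e" "fst p"] p e p0 by (simp add: Dom_def)
    then have "(norm (h j (fst p + snd p *\<^sub>R e) - h j (fst p)))\<^sup>2 \<le> (\<Lambda> * snd p)\<^sup>2" if "j \<in> J" for j
      using that by (intro power_mono) auto
    then have "(\<Sum>j\<in>J. (norm (h j (fst p + snd p *\<^sub>R e) - h j (fst p)))\<^sup>2) \<le> real (card J) * (\<Lambda> * snd p)\<^sup>2"
      by (rule sum_bounded_above)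
    then show ?thesis using p0 by (simp add: q_def divide_le_eq power_mult_distrib mult_ac)
  qed
  have Dom_ne: "Dom \<noteq> {}"
  proof -
    have "(x0, \<rho>/2) \<in> Dom" using \<rho> e by (simp add: Dom_def V_def dist_norm)
    then show ?thesis by blast
  qed
  define \<sigma> where "\<sigma> = Sup (q ` Dom)"
  have bdd: "bdd_above (q ` Dom)" using q_bound by (rule bdd_aboveI2)
  have q\<sigma>: "q p \<le> \<sigma>" if "p \<in> Dom" for p unfolding \<sigma>_def using that bdd by (rule cSUP_upper)
  \<comment> \<open>moving both ends of a step to the nearest net point changes its increment by at most \<open>2 \<Lambda> \<tau> s \<le> \<theta> s / 2\<close>\<close>
  define \<tau> where "\<tau> = \<theta> / (4 * (\<Lambda> + 1))"
  have \<tau>: "\<tau> > 0" using \<theta> \<Lambda> by (simp add: \<tau>_def)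
  have \<Lambda>\<tau>: "2 * \<Lambda> * \<tau> \<le> \<theta> / 2"
  proof -
    have "2 * \<Lambda> * \<tau> \<le> 2 * (\<Lambda> + 1) * \<tau>" using \<tau> by (intro mult_right_mono) auto
    also have "\<dots> = \<theta> / 2" using \<Lambda> by (simp add: \<tau>_def field_simps)
    finally show ?thesis .
  qed
  obtain X where X: "finite X" "X \<subseteq> cball (0::'a) K" "\<And>z. z \<in> cball 0 K \<Longrightarrow> \<exists>x\<in>X. dist x z < \<tau>"
    using finite_net_cball[OF \<tau>] by metis
  have Xne: "X \<noteq> {}" using X(3)[of 0] K by auto
  define n0 where "n0 = real (card X)"
  have n0: "n0 \<ge> 1" using X(1) Xne by (simp add: n0_def Suc_le_eq card_gt_0_iff)
  define \<epsilon> where "\<epsilon> = \<theta>\<^sup>2 / (24 * n0)"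
  have \<epsilon>: "\<epsilon> > 0" using \<theta> n0 by (simp add: \<epsilon>_def)
  obtain p0 where p0: "p0 \<in> Dom" "\<sigma> - \<epsilon> < q p0"
  proof -
    have "\<sigma> - \<epsilon> < Sup (q ` Dom)" using \<epsilon> by (simp add: \<sigma>_def)
    then have "\<exists>x\<in>q ` Dom. \<sigma> - \<epsilon> < x" using less_cSup_iff[OF _ bdd] Dom_ne by simp
    then show thesis using that by blast
  qed
  have "open (Dom \<inter> q -` {\<sigma> - \<epsilon><..})" by (rule continuous_open_preimage[OF q_cont Dom_open]) simp
  moreover have "Dom \<inter> q -` {\<sigma> - \<epsilon><..} \<noteq> {}" using p0 by auto
  ultimately obtain d where d: "d \<in> Dset" "d \<in> Dom" "\<sigma> - \<epsilon> < q d" using dense by blast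
  obtain a l where al: "d = (a, l)" by (cases d)
  have l: "l > 0" "a \<in> V" "a + l *\<^sub>R e \<in> V" using d(2) by (simp_all add: al Dom_def)
  let ?seg = "closed_segment a (a + l *\<^sub>R e)"
  have segV: "?seg \<subseteq> V" using l by (simp add: closed_segment_subset V_def)
  obtain r1 where r1: "r1 > 0" "(\<Union>z\<in>?seg. cball z r1) \<subseteq> V"
    using compact_subset_open_imp_cball_epsilon_subset[OF compact_segment _ segV] by (metis V_def open_ball)
  have nearV: "x \<in> V" if "z \<in> ?seg" "dist z x \<le> r1" for z x using r1(2) that by (metis UN_I mem_cball subsetD)
  \<comment> \<open>\<open>B s^2\<close> bounds the errors that arise because the parallel rows have other endpoints than the segment\<close>
  define B where "B = real (card J) * (4 * \<Lambda>\<^sup>2 * K)"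
  have B: "B \<ge> 0" using K by (simp add: B_def)
  define N0 where "N0 = nat \<lceil>24 * n0 * B / \<theta>\<^sup>2\<rceil> + nat \<lceil>(K+2) * l / r1\<rceil> + 2"
  have main: "N \<ge> 1 \<and> (\<exists>m w. even m \<and> m < N \<and> (\<forall>j\<in>J. \<forall>x\<in>cball (a + (real m * (l / real N)) *\<^sub>R e) (K * (l / real N)).
        norm (h j (x + (l / real N) *\<^sub>R e) - h j x - w j) \<le> \<theta> * (l / real N)))" if N: "N \<ge> N0" for N
  proof -
    have N2: "N \<ge> 2" using N by (simp add: N0_def)
    have NB: "24 * n0 * B / \<theta>\<^sup>2 \<le> real N" using N unfolding N0_def by linarith
    have NK: "(K+2) * l / r1 \<le> real N" using N unfolding N0_def by linarith
    define s where "s = l / real N"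
    have s: "s > 0" "real N * s = l" using l N2 by (auto simp: s_def)
    have Ks: "(K + 2) * s \<le> r1" using NK r1(1) N2 by (simp add: s_def field_simps)
    define pt where "pt m z = a + (real m * s) *\<^sub>R e + s *\<^sub>R z" for m :: nat and z :: 'a
    have on_seg: "a + (real m * s) *\<^sub>R e \<in> ?seg" if "m \<le> N" for m
      unfolding s_def by (rule point_on_segment[OF that _ l(1)]) (use N2 in simp)
    have ptV: "pt m z \<in> V" if "m \<le> N" "norm z \<le> K" for m z
    proof (rule nearV[OF on_seg[OF that(1)]])
      have "dist (a + (real m * s) *\<^sub>R e) (pt m z) = s * norm z" using s by (simp add: pt_def dist_norm)
      also have "\<dots> \<le> s * (K + 2)" using that s by (intro mult_left_mono) auto
      finally show "dist (a + (real m * s) *\<^sub>R e) (pt m z) \<le> r1" using Ks by (simp add: mult.commute)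
    qed
    define W where "W j = (1 / real N) *\<^sub>R (h j (a + l *\<^sub>R e) - h j a)" for j
    have Wb: "norm (W j) \<le> \<Lambda> * s" if "j \<in> J" for j
    proof -
      have "norm (h j (a + l *\<^sub>R e) - h j a) \<le> \<Lambda> * l" using hd[OF that l(3,2)] l e by simp
      then have "norm (h j (a + l *\<^sub>R e) - h j a) / real N \<le> \<Lambda> * l / real N" by (rule divide_right_mono) simp
      then show ?thesis by (simp add: W_def s_def)
    qed
    have W2: "(\<Sum>j\<in>J. (norm (W j))\<^sup>2) = q d * s\<^sup>2"
      using l N2 by (simp add: W_def q_def al s_def power_mult_distrib power_divide sum_divide_distrib[symmetric])
    define D where "D j z m = h j (pt (Suc m) z) - h j (pt m z)" for j z m
    have step: "pt (Suc m) z = pt m z + s *\<^sub>R e" for m z by (simp add: pt_def algebra_simps)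
    have D2: "(\<Sum>j\<in>J. (norm (D j z m))\<^sup>2) \<le> \<sigma> * s\<^sup>2" if "m < N" "norm z \<le> K" for z m
    proof -
      have "(pt m z, s) \<in> Dom" using ptV[of m z] ptV[of "Suc m" z] that s step[of m z] by (simp add: Dom_def)
      from q\<sigma>[OF this] show ?thesis using s by (simp add: q_def D_def step divide_le_eq)
    qed
    have var: "(\<Sum>m<N. (norm (D j z m - W j))\<^sup>2) \<le> (\<Sum>m<N. (norm (D j z m))\<^sup>2) - real N * (norm (W j))\<^sup>2 + 4 * \<Lambda>\<^sup>2 * K * s\<^sup>2"
      if j: "j \<in> J" and z: "norm z \<le> K" for j z
    proof -
      have tel: "(\<Sum>m<N. D j z m) = h j (pt N z) - h j (pt 0 z)" unfolding D_def by (rule sum_lessThan_telescope)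
      have "norm (h j (pt N z) - h j (a + l *\<^sub>R e)) \<le> \<Lambda> * norm (pt N z - (a + l *\<^sub>R e))"
        by (rule hd[OF j ptV[OF order_refl z] l(3)])
      also have "norm (pt N z - (a + l *\<^sub>R e)) = s * norm z" using s by (simp add: pt_def)
      also have "\<Lambda> * \<dots> \<le> \<Lambda> * (s * K)" using z s \<Lambda> by (intro mult_left_mono) auto
      finally have 1: "norm (h j (pt N z) - h j (a + l *\<^sub>R e)) \<le> \<Lambda> * (s * K)" .
      have "norm (h j (pt 0 z) - h j a) \<le> \<Lambda> * norm (pt 0 z - a)"
        by (rule hd[OF j ptV[OF _ z] l(2)]) simp
      also have "norm (pt 0 z - a) = s * norm z" using s by (simp add: pt_def)
      also have "\<Lambda> * \<dots> \<le> \<Lambda> * (s * K)" using z s \<Lambda> by (intro mult_left_mono) auto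
      finally have 2: "norm (h j (pt 0 z) - h j a) \<le> \<Lambda> * (s * K)" .
      have "(\<Sum>m<N. D j z m) - real N *\<^sub>R W j = (h j (pt N z) - h j (a + l *\<^sub>R e)) - (h j (pt 0 z) - h j a)"
        using N2 by (simp add: tel W_def)
      then have "norm ((\<Sum>m<N. D j z m) - real N *\<^sub>R W j) \<le> 2 * (\<Lambda> * (s * K))"
        using 1 2 norm_triangle_ineq4[of "h j (pt N z) - h j (a + l *\<^sub>R e)" "h j (pt 0 z) - h j a"] by simp
      from variance_along_row[OF Wb[OF j] this] show ?thesis
        by (simp add: power2_eq_square algebra_simps)
    qed
    define A where "A m = (\<Sum>z\<in>X. \<Sum>j\<in>J. (norm (D j z m - W j))\<^sup>2)" for m
    have A0: "A m \<ge> 0" for m unfolding A_def by (intro sum_nonneg) auto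
    have "(\<Sum>m<N. A m) = (\<Sum>z\<in>X. \<Sum>j\<in>J. \<Sum>m<N. (norm (D j z m - W j))\<^sup>2)"
      unfolding A_def by (subst sum.swap, intro sum.cong refl, subst sum.swap, rule refl)
    also have "\<dots> \<le> (\<Sum>z\<in>X. (real N * \<epsilon> + B) * s\<^sup>2)"
    proof (rule sum_mono)
      fix z assume z: "z \<in> X"
      then have zK: "norm z \<le> K" using X(2) by auto
      have "(\<Sum>j\<in>J. \<Sum>m<N. (norm (D j z m - W j))\<^sup>2)
          \<le> (\<Sum>j\<in>J. (\<Sum>m<N. (norm (D j z m))\<^sup>2) - real N * (norm (W j))\<^sup>2 + 4 * \<Lambda>\<^sup>2 * K * s\<^sup>2)"
        by (intro sum_mono var zK)
      also have "\<dots> = (\<Sum>m<N. \<Sum>j\<in>J. (norm (D j z m))\<^sup>2) - real N * (\<Sum>j\<in>J. (norm (W j))\<^sup>2) + B * s\<^sup>2"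
        by (simp add: sum.distrib sum_subtractf sum_distrib_left B_def sum.swap[of _ J])
      also have "(\<Sum>m<N. \<Sum>j\<in>J. (norm (D j z m))\<^sup>2) \<le> (\<Sum>m<N. \<sigma> * s\<^sup>2)"
        using D2[OF _ zK] by (intro sum_mono) auto
      also have "(\<Sum>m<N. \<sigma> * s\<^sup>2) - real N * (\<Sum>j\<in>J. (norm (W j))\<^sup>2) + B * s\<^sup>2 = (real N * (\<sigma> - q d) + B) * s\<^sup>2"
        by (simp add: W2 algebra_simps)
      also have "\<dots> \<le> (real N * \<epsilon> + B) * s\<^sup>2"
        using d(3) by (intro mult_right_mono add_right_mono mult_left_mono) auto
      finally show "(\<Sum>j\<in>J. \<Sum>m<N. (norm (D j z m - W j))\<^sup>2) \<le> (real N * \<epsilon> + B) * s\<^sup>2" by simp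
    qed
    also have "\<dots> = n0 * ((real N * \<epsilon> + B) * s\<^sup>2)" by (simp add: n0_def)
    finally have sumA: "(\<Sum>m<N. A m) \<le> n0 * ((real N * \<epsilon> + B) * s\<^sup>2)" .
    obtain m where m: "even m" "m < N" "A m * real N \<le> 3 * (\<Sum>m<N. A m)"
      using even_index_small_term[of A N] A0 N2 by metis
    have "A m * real N \<le> 3 * (n0 * ((real N * \<epsilon> + B) * s\<^sup>2))" using m(3) sumA by linarith
    also have "\<dots> = (3 * n0 * \<epsilon> * real N + 3 * n0 * B) * s\<^sup>2" by (simp add: algebra_simps)
    also have "3 * n0 * \<epsilon> * real N = \<theta>\<^sup>2 / 8 * real N" using n0 by (simp add: \<epsilon>_def)
    also have "3 * n0 * B \<le> \<theta>\<^sup>2 / 8 * real N" using NB \<theta> by (simp add: field_simps)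
    finally have "A m * real N \<le> (\<theta>\<^sup>2 / 8 * real N + \<theta>\<^sup>2 / 8 * real N) * s\<^sup>2"
      by (simp add: mult_right_mono)
    then have "A m * real N \<le> ((\<theta> / 2 * s)\<^sup>2) * real N" by (simp add: power2_eq_square algebra_simps)
    then have Am: "A m \<le> (\<theta> / 2 * s)\<^sup>2" using N2 by (simp add: mult_le_cancel_right)
    have net: "norm (D j z m - W j) \<le> \<theta> / 2 * s" if "j \<in> J" "z \<in> X" for j z
    proof -
      have "(norm (D j z m - W j))\<^sup>2 \<le> (\<Sum>j\<in>J. (norm (D j z m - W j))\<^sup>2)"
        by (rule member_le_sum[OF that(1) _ J(1)]) auto
      also have "\<dots> \<le> A m" unfolding A_def
        by (rule member_le_sum[OF that(2) _ X(1)]) (auto intro: sum_nonneg)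
      finally have "(norm (D j z m - W j))\<^sup>2 \<le> (\<theta> / 2 * s)\<^sup>2" using Am by simp
      moreover have "0 \<le> \<theta> / 2 * s" using \<theta> s by simp
      ultimately show ?thesis by (rule power2_le_imp_le)
    qed
    have "norm (h j (x + s *\<^sub>R e) - h j x - W j) \<le> \<theta> * s"
      if j: "j \<in> J" and x: "x \<in> cball (a + (real m * s) *\<^sub>R e) (K * s)" for j x
    proof -
      define z where "z = (1/s) *\<^sub>R (x - (a + (real m * s) *\<^sub>R e))"
      have xz: "x = pt m z" using s by (simp add: z_def pt_def)
      have "norm (x - (a + (real m * s) *\<^sub>R e)) \<le> K * s"
        using x by (simp only: mem_cball dist_norm norm_minus_commute)
      then have zK: "norm z \<le> K" using s by (simp add: z_def pos_divide_le_eq)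
      then obtain z' where z': "z' \<in> X" "dist z' z < \<tau>" using X(3)[of z] by auto
      have z'K: "norm z' \<le> K" using X(2) z' by auto
      have close: "norm (h j (pt i z) - h j (pt i z')) \<le> \<Lambda> * (s * \<tau>)" if "i \<le> N" for i
      proof -
        have "norm (h j (pt i z) - h j (pt i z')) \<le> \<Lambda> * norm (pt i z - pt i z')"
          by (rule hd[OF j ptV[OF that zK] ptV[OF that z'K]])
        also have "norm (pt i z - pt i z') = s * dist z' z"
        proof -
          have "pt i z - pt i z' = s *\<^sub>R (z - z')" by (simp add: pt_def scaleR_diff_right)
          then show ?thesis using s by (simp add: dist_norm norm_minus_commute[of z'])
        qed
        also have "\<Lambda> * \<dots> \<le> \<Lambda> * (s * \<tau>)" using z' s \<Lambda> by (intro mult_left_mono) auto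
        finally show ?thesis .
      qed
      define u v w where "u = D j z' m - W j" and "v = h j (pt (Suc m) z) - h j (pt (Suc m) z')"
        and "w = h j (pt m z) - h j (pt m z')"
      have "h j (x + s *\<^sub>R e) - h j x - W j = u + v - w"
        by (simp add: xz step[symmetric] D_def u_def v_def w_def)
      also have "norm (u + v - w) \<le> norm u + norm v + norm w"
        using norm_triangle_ineq4[of "u + v" w] norm_triangle_ineq[of u v] by linarith
      also have "\<dots> \<le> \<theta> / 2 * s + \<Lambda> * (s * \<tau>) + \<Lambda> * (s * \<tau>)"
        unfolding u_def v_def w_def using m(2) by (intro add_mono net j z' close) auto
      also have "\<dots> = \<theta> / 2 * s + (2 * \<Lambda> * \<tau>) * s" by simp
      also have "\<dots> \<le> \<theta> / 2 * s + \<theta> / 2 * s" using \<Lambda>\<tau> s by (intro add_left_mono mult_right_mono) auto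
      finally show ?thesis by simp
    qed
    then show ?thesis using m N2 unfolding s_def by (intro conjI exI[of _ m] exI[of _ W]) auto
  qed
  show thesis
  proof (rule that[of a l r1 N0])
    show "(a, l) \<in> Dset" using d(1) al by simp
    show "x \<in> ball x0 \<rho>" if "z \<in> ?seg" "dist z x \<le> r1" for z x using nearV[OF that] by (simp add: V_def)
  qed (use l r1 main in auto)
qed

section \<open>Mass balance on two adjacent cells\<close>

text \<open>
  A continuous function with plateaus: it is \<open>1\<close> on the middle half of each interval \<open>[m, m + 1]\<close> with \<open>m\<close>
  even, and \<open>1/2\<close> on that of each with \<open>m\<close> odd.
\<close>
definition wave :: "real \<Rightarrow> real" where "wave t = max (1/2) (min 1 (3/4 + sin (pi * t)))"

lemma wave_bounds: "1/2 \<le> wave t" "wave t \<le> 1" by (auto simp: wave_def)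

lemma wave_cont: "continuous_on S wave"
  unfolding wave_def by (intro continuous_intros)

lemma cos_quarter:
  assumes "\<bar>v\<bar> \<le> 1/4"
  shows "cos (pi * v) \<ge> 1/4"
proof -
  have "cos (pi * \<bar>v\<bar>) \<ge> cos (pi / 4)"
    using assms by (intro cos_monotone_0_pi_le) (auto simp: mult.commute[of pi] intro!: mult_left_le_one_le)
  moreover have "cos (pi * \<bar>v\<bar>) = cos (pi * v)" by (simp add: abs_if)
  moreover have "sqrt 2 \<ge> 1" by simp
  ultimately show ?thesis unfolding cos_45 by linarith
qed

lemma wave_even_cell:
  assumes "even m" "\<bar>t - (real m + 1/2)\<bar> \<le> 1/4"
  shows "wave t = 1"
proof -
  define v where "v = t - (real m + 1/2)"
  have "sin (pi * t) = sin (pi * v + pi / 2 + pi * real m)" by (simp add: v_def algebra_simps)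
  also have "\<dots> = sin (pi * v + pi / 2)" using assms(1) by (simp add: sin_add)
  also have "\<dots> = cos (pi * v)" by (simp add: sin_add)
  finally show ?thesis using cos_quarter[of v] assms(2) by (simp add: wave_def v_def)
qed

lemma wave_odd_cell:
  assumes "odd m" "\<bar>t - (real m + 1/2)\<bar> \<le> 1/4"
  shows "wave t = 1/2"
proof -
  define v where "v = t - (real m + 1/2)"
  have "sin (pi * t) = sin (pi * v + pi / 2 + pi * real m)" by (simp add: v_def algebra_simps)
  also have "\<dots> = - sin (pi * v + pi / 2)" using assms(1) by (simp add: sin_add)
  also have "\<dots> = - cos (pi * v)" by (simp add: sin_add)
  finally show ?thesis using cos_quarter[of v] assms(2) by (simp add: wave_def v_def)
qed

definition cube :: "'a::euclidean_space \<Rightarrow> real \<Rightarrow> 'a set" where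
  "cube c h = cbox (c - h *\<^sub>R One) (c + h *\<^sub>R One)"

lemma mem_cube: "x \<in> cube c h \<longleftrightarrow> (\<forall>b\<in>Basis. \<bar>(x - c) \<bullet> b\<bar> \<le> h)"
  by (auto simp: cube_def mem_box inner_diff_left inner_add_left abs_le_iff algebra_simps)

lemma compact_cube: "compact (cube c h)" by (simp add: cube_def)

lemma vol_cube:
  fixes c :: "'a::euclidean_space"
  assumes "h \<ge> 0"
  shows "vol (cube c h) = (2 * h) ^ DIM('a)"
proof -
  have "vol (cube c h) = (\<Prod>b\<in>Basis. ((c + h *\<^sub>R One) - (c - h *\<^sub>R One)) \<bullet> (b::'a))"
    unfolding cube_def by (rule measure_lborel_cbox) (use assms in \<open>auto simp: inner_diff_left inner_add_left\<close>)
  also have "\<dots> = (\<Prod>b\<in>(Basis::'a set). 2 * h)"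
    by (intro prod.cong refl) (simp add: algebra_simps)
  finally show ?thesis by simp
qed

lemma cube_subset_cball: "cube c h \<subseteq> cball c (real DIM('a) * h)" for c :: "'a::euclidean_space"
proof
  fix x assume x: "x \<in> cube c h"
  have "norm (x - c) \<le> (\<Sum>b\<in>Basis. \<bar>(x - c) \<bullet> b\<bar>)" by (rule norm_le_l1)
  also have "\<dots> \<le> (\<Sum>b\<in>(Basis::'a set). h)" using x by (intro sum_mono) (simp add: mem_cube)
  finally show "x \<in> cball c (real DIM('a) * h)" by (simp add: dist_norm norm_minus_commute)
qed

lemma cube_enlarge:
  assumes "x \<in> cube c h" "dist x y \<le> \<kappa>"
  shows "y \<in> cube c (h + \<kappa>)"
  unfolding mem_cube
proof
  fix b :: 'a assume b: "b \<in> Basis"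
  have "\<bar>(y - x) \<bullet> b\<bar> \<le> \<kappa>"
    using Basis_le_norm[OF b, of "y - x"] assms(2) by (simp add: dist_norm norm_minus_commute)
  moreover have "\<bar>(x - c) \<bullet> b\<bar> \<le> h" using assms(1) b by (simp add: mem_cube)
  ultimately show "\<bar>(y - c) \<bullet> b\<bar> \<le> h + \<kappa>" by (simp add: inner_diff_left)
qed

lemma vol_translation:
  assumes "compact S"
  shows "vol ((+) w ` S) = vol S"
  using measure_translation[of w S] compact_sets_lborel[OF assms] compact_sets_lborel[OF compact_translation[OF assms, of w]]
  by simp

lemma set_integral_upper_except:
  assumes S: "compact S" and g: "(g :: 'a::euclidean_space \<Rightarrow> real) \<in> borel_measurable borel"
    and b: "0 \<le> b" "\<And>x. x \<in> S \<Longrightarrow> x \<notin> Z \<Longrightarrow> g x \<le> b" and g01: "\<And>x. 0 \<le> g x" "\<And>x. g x \<le> 1"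
    and Z: "Z \<in> fmeasurable lborel"
  shows "(LINT x:S|lborel. g x) \<le> b * vol S + vol Z"
proof -
  have S': "S \<in> sets lborel" "emeasure lborel S < \<infinity>" using compact_sets_lborel[OF S] by auto
  have Zm: "Z \<in> sets lborel" using Z by (rule fmeasurableD)
  have gi: "set_integrable lborel S g"
    by (rule set_integrable_bounded[OF S' g, of 1]) (simp add: abs_of_nonneg g01)
  have ci: "set_integrable lborel S (\<lambda>x. b)" by (rule set_integrable_bounded[OF S', of _ "\<bar>b\<bar>"]) auto
  have zi: "set_integrable lborel S (\<lambda>x. indicat_real Z x)"
    by (rule set_integrable_bounded[OF S', of _ 1]) (use Zm in \<open>auto simp: indicator_def\<close>)
  have "(LINT x:S|lborel. g x) \<le> (LINT x:S|lborel. b + indicat_real Z x)"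
  proof (rule set_integral_mono[OF gi])
    show "set_integrable lborel S (\<lambda>x. b + indicat_real Z x)" using ci zi by (rule set_integral_add)
    fix x assume "x \<in> S"
    then show "g x \<le> b + indicat_real Z x" using b g01[of x] by (cases "x \<in> Z") auto
  qed
  also have "\<dots> = (LINT x:S|lborel. b) + (LINT x:S|lborel. indicat_real Z x)" using ci zi by (rule set_integral_add)
  also have "(LINT x:S|lborel. b) = b * vol S" using set_integral_const[OF S'(1), of b] S'(2) by (simp add: mult.commute)
  also have "(LINT x:S|lborel. indicat_real Z x) = vol (S \<inter> Z)"
    using S' Zm by (simp add: set_lebesgue_integral_def flip: indicator_inter_arith)
  also have "vol (S \<inter> Z) \<le> vol Z" using S' Z by (intro measure_mono_fmeasurable) auto
  finally show ?thesis by simp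
qed

lemma set_integral_lower_except:
  assumes S: "compact S" and g: "(g :: 'a::euclidean_space \<Rightarrow> real) \<in> borel_measurable borel"
    and a: "a \<le> 1" "\<And>x. x \<in> S \<Longrightarrow> x \<notin> Z \<Longrightarrow> a \<le> g x" and g01: "\<And>x. 0 \<le> g x" "\<And>x. g x \<le> 1"
    and Z: "Z \<in> fmeasurable lborel"
  shows "a * vol S - vol Z \<le> (LINT x:S|lborel. g x)"
proof -
  have S': "S \<in> sets lborel" "emeasure lborel S < \<infinity>" using compact_sets_lborel[OF S] by auto
  have gi: "set_integrable lborel S g"
    by (rule set_integrable_bounded[OF S' g, of 1]) (simp add: abs_of_nonneg g01)
  have ci: "set_integrable lborel S (\<lambda>x. 1::real)" by (rule set_integrable_bounded[OF S', of _ 1]) auto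
  have 1: "(LINT x:S|lborel. (1::real)) = vol S" using set_integral_const[OF S'(1), of "1::real"] S'(2) by simp
  have "(LINT x:S|lborel. 1 - g x) \<le> (1 - a) * vol S + vol Z"
    by (rule set_integral_upper_except[OF S _ _ _ _ _ Z]) (use g a g01 in \<open>auto simp: algebra_simps\<close>)
  moreover have "(LINT x:S|lborel. 1 - g x) = vol S - (LINT x:S|lborel. g x)"
    using set_integral_diff(2)[OF ci gi] 1 by simp
  ultimately show ?thesis by (simp add: algebra_simps)
qed

text \<open>
  Shrinking a cube of relative side \<open>u\<close> by the width of a thin shell costs at most a quarter of its volume.
\<close>
lemma power_shrink:
  assumes "M \<ge> 2 * D" "D \<ge> 1" "u \<ge> (1/4::real)"
  shows "(u - 1 / (12 * real M)) ^ D \<ge> 3/4 * u ^ D"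
proof -
  have M: "real M \<ge> 2 * real D" "real M > 0" using assms by linarith+
  have u: "u > 0" using assms by simp
  define x where "x = 1 / (12 * real M * u)"
  have "12 * real M * u \<ge> 12 * real M * (1/4)" using M assms(3) by (intro mult_left_mono) auto
  then have "12 * real M * u \<ge> 6 * real D" using M by linarith
  then have x: "x \<le> 1 / (6 * real D)" "x \<ge> 0" unfolding x_def using assms(2) M u by (auto intro!: divide_left_mono mult_pos_pos)
  have "real D * x \<le> real D * (1 / (6 * real D))" using x by (intro mult_left_mono) auto
  then have Dx: "real D * x \<le> 1/6" using assms(2) by simp
  have x1: "x \<le> 1"
  proof -
    have "1 * x \<le> real D * x" using assms(2) x(2) by (intro mult_right_mono) auto
    then show ?thesis using Dx by simp
  qed
  have "3/4 \<le> 1 + real D * (- x)" using Dx by simp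
  also have "\<dots> \<le> (1 + (- x)) ^ D" using x1 by (intro Bernoulli_inequality) auto
  finally have "3/4 * u ^ D \<le> (1 - x) ^ D * u ^ D" using u by (intro mult_right_mono) auto
  also have "\<dots> = (u - 1 / (12 * real M)) ^ D"
  proof -
    have "(1 - x) * u = u - 1 / (12 * real M)" using u M by (simp add: x_def left_diff_distrib)
    then show ?thesis by (simp flip: power_mult_distrib)
  qed
  finally show ?thesis .
qed

context sheeted_transport
begin

lemma rho_nonneg: "0 \<le> \<rho> x" using rho_bounds(1)[of x] by linarith

lemma rho_abs: "\<bar>\<rho> x\<bar> \<le> 1" using rho_nonneg[of x] rho_bounds(2)[of x] by simp

lemma C_nonneg: "C \<ge> 0" using I G_lip lipschitz_on_nonneg by blast

lemma f_in_U: "i \<in> I \<Longrightarrow> x \<in> T i \<Longrightarrow> f x \<in> U" using T_cover by blast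

text \<open>
  The part of the cube over \<open>f ` E\<close> consists of one copy of \<open>E\<close> in each sheet.
\<close>
lemma vol_image_sheets:
  assumes i0: "i0 \<in> I" and E: "compact E" "E \<subseteq> T i0"
  shows "vol (f ` E) = (LINT x:E|lborel. \<rho> x) + (\<Sum>i\<in>I - {i0}. LINT x:(\<lambda>x. G i (f x)) ` E|lborel. \<rho> x)"
proof -
  define g where "g i x = G i (f x)" for i x
  have fE: "f ` E \<subseteq> U" using E(2) f_in_U[OF i0] by blast
  have cg: "compact (g i ` E)" if "i \<in> I" for i
    unfolding g_def using E(1) fE lipschitz_on_continuous_on[OF G_lip[OF that]]
    by (intro compact_continuous_image continuous_on_compose2[OF _ f_cont]) auto
  have sub: "g i ` E \<subseteq> T i" if "i \<in> I" for i using G(1)[OF that] fE unfolding g_def by blast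
  have eq: "unit_cube \<inter> f -` (f ` E) = (\<Union>i\<in>I. g i ` E)"
  proof (intro equalityI subsetI)
    fix x assume x: "x \<in> unit_cube \<inter> f -` (f ` E)"
    then have "x \<in> unit_cube \<inter> f -` U" using fE by blast
    then obtain i where i: "i \<in> I" "x \<in> T i" using T_cover by blast
    obtain y where y: "y \<in> E" "f x = f y" using x by blast
    have "x = g i y" using G(3)[OF i] y(2) by (simp add: g_def)
    then show "x \<in> (\<Union>i\<in>I. g i ` E)" using i(1) y(1) by blast
  next
    fix x assume "x \<in> (\<Union>i\<in>I. g i ` E)"
    then obtain i y where i: "i \<in> I" "y \<in> E" "x = g i y" by blast
    have "f x = f y" using G(2)[OF i(1), of "f y"] i fE by (simp add: g_def image_subset_iff)
    moreover have "x \<in> unit_cube" using sub[OF i(1)] T(2)[OF i(1)] i by blast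
    ultimately show "x \<in> unit_cube \<inter> f -` (f ` E)" using i(2) by auto
  qed
  have "vol (f ` E) = vol (f ` E \<inter> Y)" using fE U(3) by (simp add: Int_absorb2 order_trans)
  also have "\<dots> = (LINT x:(unit_cube \<inter> f -` (f ` E))|lborel. \<rho> x)"
    by (rule push[symmetric]) (rule compact_f_image[OF E(1)])
  also have "\<dots> = (\<Sum>i\<in>I. LINT x:g i ` E|lborel. \<rho> x)"
    unfolding eq
  proof (rule set_integral_finite_Union[OF I(1)])
    show "disjoint_family_on (\<lambda>i. g i ` E) I"
      using T(3) sub unfolding disjoint_family_on_def by blast
    fix i assume i: "i \<in> I"
    show "set_integrable lborel (g i ` E) \<rho>"
      by (rule set_integrable_bounded[of _ _ 1])
        (simp_all only: compact_sets_lborel[OF cg[OF i]] rho_meas rho_abs)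
    show "g i ` E \<in> sets lborel" using compact_sets_lborel[OF cg[OF i]] by blast
  qed
  also have "\<dots> = (LINT x:g i0 ` E|lborel. \<rho> x) + (\<Sum>i\<in>I - {i0}. LINT x:g i ` E|lborel. \<rho> x)"
    by (rule sum.remove[OF I(1) i0])
  also have "g i0 ` E = E"
  proof -
    have "g i0 x = x" if "x \<in> E" for x unfolding g_def using G(3)[OF i0] E(2) that by blast
    then show ?thesis by simp
  qed
  finally show ?thesis by (simp add: g_def)
qed

lemma vol_image_cube_le:
  assumes s: "s > 0" and E: "compact E" "E \<subseteq> cube c (s/4)"
  shows "vol (f ` E) \<le> (L * real DIM('a)) ^ DIM('a) * vol (cball (0::'a) 1) * s ^ DIM('a)"
proof -
  have rad: "L * (real DIM('a) * s) \<ge> 0" using L_nonneg s by simp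
  have "f ` E \<subseteq> cball (f c) (L * (real DIM('a) * s))"
  proof
    fix y assume "y \<in> f ` E"
    then obtain x where x: "x \<in> cube c (s/4)" "y = f x" using E(2) by blast
    have "dist c x \<le> real DIM('a) * (s/4)" using x(1) cube_subset_cball[of c "s/4"] by auto
    also have "\<dots> \<le> real DIM('a) * s" using s by (intro mult_left_mono) auto
    finally have "L * dist c x \<le> L * (real DIM('a) * s)" using L_nonneg by (rule mult_left_mono)
    then show "y \<in> cball (f c) (L * (real DIM('a) * s))" using f_dist[of c x] x(2) by simp
  qed
  then have "vol (f ` E) \<le> vol (cball (f c) (L * (real DIM('a) * s)))"
    by (rule vol_mono) (auto intro: compact_f_image E(1))
  also have "\<dots> = (L * real DIM('a)) ^ DIM('a) * vol (cball (0::'a) 1) * s ^ DIM('a)"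
    unfolding vol_cball[OF rad, of "f c"] by (simp add: power_mult_distrib mult_ac)
  finally show ?thesis .
qed

text \<open>
  The cubes with half side between \<open>s/8\<close> and \<open>s/4\<close> contain \<open>M\<close> disjoint concentric shells. Their images
  are disjoint and lie in one ball, so one of them has at most an \<open>M\<close>-th of the volume of that ball.
\<close>
lemma thin_shell:
  assumes i0: "i0 \<in> I" and s: "s > 0" and M: "M \<ge> 1"
    and R: "cube c (s/4) \<subseteq> T i0"
  obtains h where "s/8 \<le> h - s / (24 * real M)" "h + s / (24 * real M) \<le> s/4"
    "vol (f ` (cube c (h + s / (24 * real M)) - box (c - (h - s / (24 * real M)) *\<^sub>R One) (c + (h - s / (24 * real M)) *\<^sub>R One)))
       \<le> (L * real DIM('a)) ^ DIM('a) * vol (cball (0::'a) 1) * s ^ DIM('a) / real M"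
proof -
  define \<kappa> where "\<kappa> = s / (24 * real M)"
  have \<kappa>: "\<kappa> > 0" "3 * real M * \<kappa> = s / 8" using s M by (auto simp: \<kappa>_def)
  define h where "h r = s/8 + (3 * real r + 1) * \<kappa>" for r :: nat
  define Sh where "Sh r = cube c (h r + \<kappa>) - box (c - (h r - \<kappa>) *\<^sub>R One) (c + (h r - \<kappa>) *\<^sub>R One)" for r
  have h_lo: "s/8 \<le> h r - \<kappa>" for r using \<kappa> by (simp add: h_def algebra_simps)
  have h_hi: "h r + \<kappa> \<le> s/4" if "r < M" for r
  proof -
    have "(3 * real r + 2) * \<kappa> \<le> 3 * real M * \<kappa>" using that \<kappa> by (intro mult_right_mono) auto
    then show ?thesis using \<kappa>(2) by (simp add: h_def algebra_simps)
  qed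
  have Sh_compact: "compact (Sh r)" for r unfolding Sh_def by (intro compact_diff compact_cube open_box)
  have Sh_sub: "Sh r \<subseteq> cube c (s/4)" if "r < M" for r
  proof
    fix x assume "x \<in> Sh r"
    then have "\<forall>b\<in>Basis. \<bar>(x - c) \<bullet> b\<bar> \<le> h r + \<kappa>" by (simp add: Sh_def mem_cube)
    then show "x \<in> cube c (s/4)" using h_hi[OF that] unfolding mem_cube by fastforce
  qed
  have disj: "Sh r \<inter> Sh r' = {}" if "r < r'" for r r'
  proof (rule ccontr)
    assume "Sh r \<inter> Sh r' \<noteq> {}"
    then obtain x where x: "x \<in> cube c (h r + \<kappa>)" "x \<notin> box (c - (h r' - \<kappa>) *\<^sub>R One) (c + (h r' - \<kappa>) *\<^sub>R One)"
      by (auto simp: Sh_def)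
    have "(3 * real r + 2) * \<kappa> < 3 * real r' * \<kappa>" using that \<kappa> by (intro mult_strict_right_mono) auto
    then have lt: "h r + \<kappa> < h r' - \<kappa>" by (simp add: h_def algebra_simps)
    have "x \<in> box (c - (h r' - \<kappa>) *\<^sub>R One) (c + (h r' - \<kappa>) *\<^sub>R One)"
      unfolding mem_box
    proof
      fix b :: 'a assume b: "b \<in> Basis"
      have "\<bar>(x - c) \<bullet> b\<bar> < h r' - \<kappa>" using x(1) b lt unfolding mem_cube by fastforce
      then show "(c - (h r' - \<kappa>) *\<^sub>R One) \<bullet> b < x \<bullet> b \<and> x \<bullet> b < (c + (h r' - \<kappa>) *\<^sub>R One) \<bullet> b"
        using b by (simp add: inner_diff_left inner_add_left abs_less_iff)
    qed
    then show False using x(2) by blast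
  qed
  have inj: "x = y" if "x \<in> cube c (s/4)" "y \<in> cube c (s/4)" "f x = f y" for x y
    using G(3)[OF i0] R that by (metis subsetD)
  have disjf: "disjoint_family_on (\<lambda>r. f ` Sh r) {..<M}"
  proof (unfold disjoint_family_on_def, intro ballI impI)
    fix r r' assume r: "r \<in> {..<M}" "r' \<in> {..<M}" "r \<noteq> r'"
    show "f ` Sh r \<inter> f ` Sh r' = {}"
    proof (rule ccontr)
      assume "f ` Sh r \<inter> f ` Sh r' \<noteq> {}"
      then obtain x y where xy: "x \<in> Sh r" "y \<in> Sh r'" "f x = f y" by blast
      have "x = y" using inj[of x y] xy Sh_sub[of r] Sh_sub[of r'] r by blast
      then show False using xy r disj[of r r'] disj[of r' r] by (cases "r < r'") auto
    qed
  qed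
  define B where "B = (L * real DIM('a)) ^ DIM('a) * vol (cball (0::'a) 1) * s ^ DIM('a)"
  have "(\<Sum>r<M. vol (f ` Sh r)) = vol (\<Union>r<M. f ` Sh r)"
    using disjf compact_sets_lborel[OF compact_f_image[OF Sh_compact]]
    by (intro measure_finite_Union[symmetric]) (auto simp: less_top)
  also have "(\<Union>r<M. f ` Sh r) = f ` (\<Union>r<M. Sh r)" by blast
  also have "vol \<dots> \<le> B" unfolding B_def
    by (rule vol_image_cube_le[OF s, of _ c]) (use Sh_compact Sh_sub in \<open>auto intro: compact_UN\<close>)
  finally have sum: "(\<Sum>r<M. vol (f ` Sh r)) \<le> B" .
  have "\<exists>r<M. vol (f ` Sh r) \<le> B / real M"
  proof (rule ccontr)
    assume "\<not> ?thesis"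
    then have "(\<Sum>r<M. B / real M) < (\<Sum>r<M. vol (f ` Sh r))" using M by (intro sum_strict_mono) (auto simp: not_le lessThan_empty_iff)
    then show False using sum M by simp
  qed
  then obtain r where "r < M" "vol (f ` Sh r) \<le> B / real M" by blast
  then show thesis using that[of "h r"] h_lo[of r] h_hi[of r] unfolding \<kappa>_def[symmetric] Sh_def B_def by blast
qed

lemma branch_lipschitz:
  assumes "i \<in> I" "f x \<in> U" "f y \<in> U"
  shows "dist (G i (f x)) (G i (f y)) \<le> C * L * dist x y"
proof -
  have "dist (G i (f x)) (G i (f y)) \<le> C * dist (f x) (f y)" using lipschitz_onD[OF G_lip] assms by blast
  also have "\<dots> \<le> C * (L * dist x y)" using f_dist C_nonneg by (intro mult_left_mono)
  finally show ?thesis by simp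
qed

text \<open>
  A point within \<open>\<theta>\<close> of \<open>f (x + \<xi>)\<close> has a preimage in the sheet within \<open>C \<theta>\<close> of \<open>x + \<xi>\<close>, by the
  Lipschitz bound for the inverse branch.
\<close>
lemma image_almost_translated:
  assumes i0: "i0 \<in> I" and E: "\<And>x. x \<in> E \<Longrightarrow> x + \<xi> \<in> T i0" and \<theta>: "C * \<theta> \<le> \<kappa>"
    and near: "\<And>x. x \<in> E \<Longrightarrow> norm (f (x + \<xi>) - f x - w) \<le> \<theta>"
    and room: "\<And>x. x \<in> E \<Longrightarrow> cball (f (x + \<xi>)) \<theta> \<subseteq> U"
  shows "(+) w ` f ` E \<subseteq> f ` {y. \<exists>x\<in>E. dist (x + \<xi>) y \<le> \<kappa>}"
proof
  fix z assume "z \<in> (+) w ` f ` E"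
  then obtain x where x: "x \<in> E" "z = w + f x" by blast
  have dz: "dist (f (x + \<xi>)) z \<le> \<theta>" using near[OF x(1)] by (simp add: x(2) dist_norm algebra_simps)
  then have zU: "z \<in> U" using room[OF x(1)] by auto
  have fU: "f (x + \<xi>) \<in> U" by (rule f_in_U[OF i0 E[OF x(1)]])
  have "dist (G i0 (f (x + \<xi>))) (G i0 z) \<le> C * dist (f (x + \<xi>)) z"
    using lipschitz_onD[OF G_lip[OF i0] fU zU] .
  also have "\<dots> \<le> C * \<theta>" using dz C_nonneg by (rule mult_left_mono)
  finally have "dist (x + \<xi>) (G i0 z) \<le> \<kappa>" using \<theta> G(3)[OF i0 E[OF x(1)]] by simp
  then have "f (G i0 z) \<in> f ` {y. \<exists>x\<in>E. dist (x + \<xi>) y \<le> \<kappa>}" using x(1) by blast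
  then show "z \<in> f ` {y. \<exists>x\<in>E. dist (x + \<xi>) y \<le> \<kappa>}" using G(2)[OF i0 zU] by simp
qed

text \<open>
  The counterpart of \<open>image_almost_translated\<close> for the passage \<open>G i o f\<close> to another sheet, whose inverse is
  \<open>G i0 o f\<close>. The translation is undone here because the copies in the other sheets have to be bounded from
  above, whereas the image under \<open>f\<close> is bounded from below.
\<close>
lemma branch_image_almost_translated:
  assumes i0: "i0 \<in> I" and i: "i \<in> I" and E: "E \<subseteq> T i0" and \<theta>: "C * L * \<theta> \<le> \<kappa>"
    and near: "\<And>x. x \<in> E \<Longrightarrow> norm (G i (f (x + \<xi>)) - G i (f x) - w) \<le> \<theta>"
    and room: "\<And>x. x \<in> E \<Longrightarrow> cball (G i (f x)) \<theta> \<subseteq> T i"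
  shows "(+) (- w) ` (\<lambda>x. G i (f x)) ` ((+) \<xi> ` E) \<subseteq> (\<lambda>x. G i (f x)) ` {y. \<exists>x\<in>E. dist x y \<le> \<kappa>}"
proof
  fix z assume "z \<in> (+) (- w) ` (\<lambda>x. G i (f x)) ` ((+) \<xi> ` E)"
  then obtain x where x: "x \<in> E" "z = G i (f (x + \<xi>)) - w" by (auto simp: add.commute)
  have dz: "dist (G i (f x)) z \<le> \<theta>"
    using near[OF x(1)] by (simp add: x(2) dist_norm norm_minus_commute algebra_simps)
  then have zT: "z \<in> T i" using room[OF x(1)] by auto
  have fzU: "f z \<in> U" by (rule f_in_U[OF i zT])
  have xT: "x \<in> T i0" using E x(1) by blast
  have fxU: "f x \<in> U" by (rule f_in_U[OF i0 xT])
  have fGx: "f (G i (f x)) = f x" by (rule G(2)[OF i fxU])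
  have "dist (G i0 (f (G i (f x)))) (G i0 (f z)) \<le> C * L * dist (G i (f x)) z"
    by (rule branch_lipschitz[OF i0]) (simp_all add: fGx fxU fzU)
  also have "\<dots> \<le> C * L * \<theta>" using dz C_nonneg L_nonneg by (intro mult_left_mono) auto
  finally have "dist x (G i0 (f z)) \<le> \<kappa>" using \<theta> G(3)[OF i0 xT] by (simp add: fGx)
  moreover have "G i (f (G i0 (f z))) = z" using G(2)[OF i0 fzU] G(3)[OF i zT] by simp
  ultimately show "z \<in> (\<lambda>x. G i (f x)) ` {y. \<exists>x\<in>E. dist x y \<le> \<kappa>}" using x(1) by (intro image_eqI[of _ _ "G i0 (f z)"]) auto
qed

lemma branch_volume_le:
  assumes i: "i \<in> I" and E: "compact E" "f ` E \<subseteq> U"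
  shows "compact ((\<lambda>x. G i (f x)) ` E)" "vol ((\<lambda>x. G i (f x)) ` E) \<le> 2 * vol (f ` E)"
proof -
  show c: "compact ((\<lambda>x. G i (f x)) ` E)"
    using E lipschitz_on_continuous_on[OF G_lip[OF i]]
    by (intro compact_continuous_image continuous_on_compose2[OF _ f_cont]) auto
  have "(\<lambda>x. G i (f x)) ` E \<subseteq> unit_cube \<inter> f -` (f ` E)"
  proof
    fix y assume "y \<in> (\<lambda>x. G i (f x)) ` E"
    then obtain x where x: "x \<in> E" "y = G i (f x)" by blast
    have "f x \<in> U" using x E(2) by blast
    then have "y \<in> T i" "f y = f x" using G(1,2)[OF i] x(2) by auto
    then show "y \<in> unit_cube \<inter> f -` (f ` E)" using T(2)[OF i] x(1) by auto
  qed
  then have "vol ((\<lambda>x. G i (f x)) ` E) \<le> vol (unit_cube \<inter> f -` (f ` E))"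
    by (rule vol_mono) (intro c compact_preimage compact_f_image E(1))+
  also have "\<dots> \<le> 2 * vol (f ` E)" by (intro vol_preimage_le compact_f_image E(1))
  finally show "vol ((\<lambda>x. G i (f x)) ` E) \<le> 2 * vol (f ` E)" .
qed

text \<open>
  Let \<open>E1\<close>, \<open>C0\<close> and \<open>Cp\<close> be the concentric cubes of half sides \<open>h - \<kappa>\<close>, \<open>h\<close> and \<open>h + \<kappa>\<close> in the first cell
  and \<open>C'\<close> the translate of \<open>C0\<close> by \<open>\<xi>\<close> in the second one. Up to translation, \<open>f\<close> maps \<open>E1\<close> into
  \<open>f ` C'\<close>, so the mass over \<open>f ` E1\<close> is at most the mass over \<open>f ` C'\<close>. In the other sheets, the copy of
  \<open>C'\<close> is a translate of a subset of the copy of \<open>Cp\<close>, hence hardly larger than the copy of \<open>E1\<close>: the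
  difference of \<open>Cp\<close> and \<open>E1\<close> is a shell, which is chosen thin by \<open>thin_shell\<close>. Since \<open>\<rho>\<close> is nearly the
  constant \<open>q i\<close> on both copies, the masses in the other sheets nearly cancel. Therefore the mass of \<open>E1\<close>,
  nearly its volume, is at most slightly more than the mass of \<open>C'\<close>, nearly half the volume of \<open>C'\<close>.

  The conclusion fails for large \<open>M\<close> and \<open>k\<close>, and this is how it is used.
\<close>
lemma cell_comparison:
  fixes M k :: nat
  assumes i0: "i0 \<in> I" and s: "s > 0" and M: "M \<ge> 2 * DIM('a)" and k: "k \<ge> 2"
    and R: "\<And>x. x \<in> cube c (s/4) \<Longrightarrow> x \<in> T i0 \<and> x + \<xi> \<in> T i0"
    and \<theta>: "C * (L + 1) * \<theta> \<le> s / (24 * real M)"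
    and near_f: "\<And>x. x \<in> cube c (s/4) \<Longrightarrow> norm (f (x + \<xi>) - f x - w) \<le> \<theta>"
    and near_g: "\<And>i x. i \<in> I \<Longrightarrow> x \<in> cube c (s/4) \<Longrightarrow> norm (G i (f (x + \<xi>)) - G i (f x) - v i) \<le> \<theta>"
    and room_f: "\<And>x. x \<in> cube c (s/4) \<Longrightarrow> cball (f (x + \<xi>)) \<theta> \<subseteq> U"
    and room_g: "\<And>i x. i \<in> I \<Longrightarrow> x \<in> cube c (s/4) \<Longrightarrow> cball (G i (f x)) \<theta> \<subseteq> T i"
    and Z: "Z \<in> fmeasurable lborel" "vol Z \<le> s ^ DIM('a) / real k"
    and dense_cell: "\<And>x. x \<in> cube c (s/4) \<Longrightarrow> x \<notin> Z \<Longrightarrow> \<rho> x = 1"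
    and thin_cell: "\<And>x. x \<in> cube c (s/4) \<Longrightarrow> x + \<xi> \<notin> Z \<Longrightarrow> \<rho> (x + \<xi>) = 1/2"
    and flat: "\<And>i. i \<in> I \<Longrightarrow> i \<noteq> i0 \<Longrightarrow> 1/2 \<le> q i \<and> q i \<le> 1"
      "\<And>i x. i \<in> I \<Longrightarrow> i \<noteq> i0 \<Longrightarrow> x \<in> cube c (s/4) \<Longrightarrow> G i (f x) \<notin> Z \<Longrightarrow> \<bar>\<rho> (G i (f x)) - q i\<bar> \<le> 1 / real k"
      "\<And>i x. i \<in> I \<Longrightarrow> i \<noteq> i0 \<Longrightarrow> x \<in> cube c (s/4) \<Longrightarrow> G i (f (x + \<xi>)) \<notin> Z \<Longrightarrow> \<bar>\<rho> (G i (f (x + \<xi>))) - q i\<bar> \<le> 1 / real k"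
    and Bf: "Bf = (L * real DIM('a)) ^ DIM('a) * vol (cball (0::'a) 1)"
  shows "(1/4) ^ (DIM('a) + 1) \<le> real (card I) * (2 * Bf / real M + (4 * Bf + 2) / real k) + 2 / real k"
proof -
  define D where "D = DIM('a)"
  have D1: "D \<ge> 1" by (simp add: D_def Suc_le_eq)
  have M1: "M \<ge> 1" using M D1 unfolding D_def by linarith
  define \<kappa> where "\<kappa> = s / (24 * real M)"
  have \<kappa>: "\<kappa> > 0" using s M1 by (simp add: \<kappa>_def)
  have RT: "cube c (s/4) \<subseteq> T i0" using R by blast
  obtain h where h: "s/8 \<le> h - \<kappa>" "h + \<kappa> \<le> s/4"
    and shell: "vol (f ` (cube c (h + \<kappa>) - box (c - (h - \<kappa>) *\<^sub>R One) (c + (h - \<kappa>) *\<^sub>R One))) \<le> Bf * s ^ D / real M"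
    unfolding Bf D_def \<kappa>_def by (rule thin_shell[OF i0 s M1 RT])
  define E1 C0 Cp C' Sh where "E1 = cube c (h - \<kappa>)" and "C0 = cube c h" and "Cp = cube c (h + \<kappa>)"
    and "C' = (+) \<xi> ` C0" and "Sh = Cp - box (c - (h - \<kappa>) *\<^sub>R One) (c + (h - \<kappa>) *\<^sub>R One)"
  note sets_def = E1_def C0_def Cp_def C'_def Sh_def
  have cmono: "cube c t \<subseteq> cube c t'" if "t \<le> t'" for t t'
    using that by (meson mem_cube order_trans subsetI)
  have sub: "E1 \<subseteq> C0" "C0 \<subseteq> Cp" "Cp \<subseteq> cube c (s/4)" "Sh \<subseteq> Cp"
  proof -
    show "E1 \<subseteq> C0" "C0 \<subseteq> Cp" "Cp \<subseteq> cube c (s/4)" unfolding sets_def using \<kappa> h by (intro cmono; simp)+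
    show "Sh \<subseteq> Cp" unfolding Sh_def by blast
  qed
  have E1s: "E1 \<subseteq> cube c (s/4)" and C0s: "C0 \<subseteq> cube c (s/4)" using sub by blast+
  have comp: "compact E1" "compact C0" "compact Cp" "compact C'" "compact Sh"
    unfolding sets_def by (auto intro!: compact_cube compact_diff compact_translation)
  have C'R: "\<exists>x\<in>cube c (s/4). y = x + \<xi>" if "y \<in> C'" for y using that C0s by (auto simp: C'_def add.commute)
  have inT: "E1 \<subseteq> T i0" "C' \<subseteq> T i0" "Cp \<subseteq> T i0" "Sh \<subseteq> T i0"
    using R C'R sub RT E1s by blast+
  have fU: "f ` E \<subseteq> U" if "E \<subseteq> T i0" for E using that f_in_U[OF i0] by blast
  have \<theta>0: "\<theta> \<ge> 0"
  proof -
    have "c \<in> cube c (s/4)" using s by (simp add: mem_cube)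
    then show ?thesis using near_f[of c] norm_ge_zero order_trans by blast
  qed
  have CL: "C * \<theta> \<le> \<kappa>" "C * L * \<theta> \<le> \<kappa>"
  proof -
    have "C * (L + 1) * \<theta> = C * \<theta> + C * L * \<theta>" by (simp add: algebra_simps)
    moreover have "0 \<le> C * \<theta>" "0 \<le> C * L * \<theta>" using C_nonneg L_nonneg \<theta>0 by auto
    ultimately show "C * \<theta> \<le> \<kappa>" "C * L * \<theta> \<le> \<kappa>" using \<theta> by (auto simp: \<kappa>_def)
  qed
  have i: "vol (f ` E1) \<le> vol (f ` C')"
  proof -
    have "(+) w ` f ` E1 \<subseteq> f ` {y. \<exists>x\<in>E1. dist (x + \<xi>) y \<le> \<kappa>}"
      by (rule image_almost_translated[OF i0 _ CL(1)]) (use R near_f room_f E1s in blast)+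
    also have "{y. \<exists>x\<in>E1. dist (x + \<xi>) y \<le> \<kappa>} \<subseteq> C'"
    proof
      fix y assume "y \<in> {y. \<exists>x\<in>E1. dist (x + \<xi>) y \<le> \<kappa>}"
      then obtain x where x: "x \<in> E1" "dist (x + \<xi>) y \<le> \<kappa>" by blast
      have "dist x (y - \<xi>) \<le> \<kappa>" using x(2) by (simp add: dist_norm algebra_simps)
      then have "y - \<xi> \<in> cube c (h - \<kappa> + \<kappa>)" using x(1) unfolding E1_def by (rule cube_enlarge[rotated])
      then have "\<xi> + (y - \<xi>) \<in> C'" unfolding C'_def C0_def by (intro imageI) simp
      then show "y \<in> C'" by simp
    qed
    finally have "(+) w ` f ` E1 \<subseteq> f ` C'" by blast
    then have "vol ((+) w ` f ` E1) \<le> vol (f ` C')"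
      by (rule vol_mono) (intro compact_translation compact_f_image comp)+
    then show ?thesis by (simp add: vol_translation compact_f_image comp)
  qed
  have volE: "vol (f ` E) \<le> Bf * s ^ D" if "compact E" "E \<subseteq> cube c (s/4)" for E
    unfolding Bf D_def by (rule vol_image_cube_le[OF s that])
  have Bf0: "Bf \<ge> 0" unfolding Bf using L_nonneg by simp
  define \<gamma> where "\<gamma> = 2 * (Bf * s ^ D / real M) + 4 * Bf * s ^ D / real k + 2 * s ^ D / real k"
  have other: "(LINT x:(\<lambda>x. G i (f x)) ` C'|lborel. \<rho> x) - (LINT x:(\<lambda>x. G i (f x)) ` E1|lborel. \<rho> x) \<le> \<gamma>"
    if i: "i \<in> I" "i \<noteq> i0" for i
  proof -
    define g where "g x = G i (f x)" for x
    have cg: "compact (g ` E)" and vg: "vol (g ` E) \<le> 2 * vol (f ` E)" if "compact E" "E \<subseteq> T i0" for E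
      unfolding g_def using branch_volume_le[OF i(1) that(1) fU[OF that(2)]] by auto
    define a b where "a = vol (g ` E1)" and "b = vol (g ` C')"
    have "(+) (- v i) ` g ` C' \<subseteq> g ` {y. \<exists>x\<in>C0. dist x y \<le> \<kappa>}"
      unfolding g_def C'_def
      by (rule branch_image_almost_translated[OF i0 i(1) _ CL(2)]) (use inT sub near_g[OF i(1)] room_g[OF i(1)] C0s in blast)+
    also have "{y. \<exists>x\<in>C0. dist x y \<le> \<kappa>} \<subseteq> Cp" unfolding C0_def Cp_def using cube_enlarge by blast
    finally have "(+) (- v i) ` g ` C' \<subseteq> g ` Cp" by blast
    then have "vol ((+) (- v i) ` g ` C') \<le> vol (g ` Cp)"
      by (rule vol_mono) (intro compact_translation cg comp inT)+
    then have b1: "b \<le> vol (g ` Cp)" unfolding vol_translation[OF cg[OF comp(4) inT(2)]] b_def .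
    have "Cp \<subseteq> E1 \<union> Sh"
    proof
      fix x assume x: "x \<in> Cp"
      show "x \<in> E1 \<union> Sh"
      proof (cases "x \<in> box (c - (h - \<kappa>) *\<^sub>R One) (c + (h - \<kappa>) *\<^sub>R One)")
        case True then show ?thesis unfolding E1_def cube_def using box_subset_cbox by blast
      next
        case False then show ?thesis using x unfolding Sh_def by blast
      qed
    qed
    then have "vol (g ` Cp) \<le> vol (g ` E1 \<union> g ` Sh)"
      by (intro vol_mono compact_Un cg comp inT) blast
    also have "\<dots> \<le> a + vol (g ` Sh)" unfolding a_def
      by (intro measure_Un_le) (simp_all add: compact_sets_lborel cg comp inT del: sets_lborel)
    also have "vol (g ` Sh) \<le> 2 * (Bf * s ^ D / real M)"
      using vg[OF comp(5) inT(4)] shell unfolding Sh_def Cp_def by linarith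
    finally have ba: "b - a \<le> 2 * (Bf * s ^ D / real M)" using b1 by linarith
    have bB: "b \<le> 2 * (Bf * s ^ D)" using b1 vg[OF comp(3) inT(3)] volE[OF comp(3) sub(3)] by linarith
    have aB: "a \<le> 2 * (Bf * s ^ D)" using vg[OF comp(1) inT(1)] volE[OF comp(1) E1s] by (simp add: a_def)
    have a0: "a \<ge> 0" "b \<ge> 0" by (auto simp: a_def b_def)
    have q: "1/2 \<le> q i" "q i \<le> 1" using flat(1)[OF i] by auto
    have k': "1 / real k \<le> 1/2" using k by simp
    have up: "(LINT x:g ` C'|lborel. \<rho> x) \<le> (q i + 1 / real k) * b + vol Z"
      unfolding b_def
    proof (rule set_integral_upper_except[OF cg rho_meas])
      fix y assume y: "y \<in> g ` C'" "y \<notin> Z"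
      then obtain x where x: "x \<in> cube c (s/4)" "y = G i (f (x + \<xi>))" using C'R unfolding g_def by blast
      then show "\<rho> y \<le> q i + 1 / real k" using flat(3)[OF i x(1)] y(2) by (simp add: abs_le_iff algebra_simps)
    qed (use comp inT q Z rho_nonneg rho_bounds in \<open>auto\<close>)
    have lo: "(q i - 1 / real k) * a - vol Z \<le> (LINT x:g ` E1|lborel. \<rho> x)"
      unfolding a_def
    proof (rule set_integral_lower_except[OF cg rho_meas])
      fix y assume y: "y \<in> g ` E1" "y \<notin> Z"
      then obtain x where x: "x \<in> cube c (s/4)" "y = G i (f x)" using E1s unfolding g_def by blast
      then show "q i - 1 / real k \<le> \<rho> y" using flat(2)[OF i x(1)] y(2) by (simp add: abs_le_iff algebra_simps)
    next
      have "1 / real k \<ge> 0" by simp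
      then show "q i - 1 / real k \<le> 1" using q by linarith
    qed (use comp inT Z rho_nonneg rho_bounds in \<open>auto\<close>)
    have "(q i + 1 / real k) * b - (q i - 1 / real k) * a = q i * (b - a) + (a + b) / real k"
      by (simp add: algebra_simps add_divide_distrib)
    also have "\<dots> \<le> 2 * (Bf * s ^ D / real M) + 4 * Bf * s ^ D / real k"
    proof (rule add_mono)
      have "q i * (b - a) \<le> q i * (2 * (Bf * s ^ D / real M))" using ba q by (intro mult_left_mono) auto
      also have "\<dots> \<le> 1 * (2 * (Bf * s ^ D / real M))" using q Bf0 s by (intro mult_right_mono) auto
      finally show "q i * (b - a) \<le> 2 * (Bf * s ^ D / real M)" by simp
      show "(a + b) / real k \<le> 4 * Bf * s ^ D / real k" using aB bB by (intro divide_right_mono) auto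
    qed
    finally have "(q i + 1 / real k) * b - (q i - 1 / real k) * a \<le> 2 * (Bf * s ^ D / real M) + 4 * Bf * s ^ D / real k" .
    moreover have "2 * vol Z \<le> 2 * s ^ D / real k" using Z(2) by (simp add: D_def)
    ultimately show ?thesis using up lo unfolding \<gamma>_def g_def by linarith
  qed
  have "(LINT x:E1|lborel. \<rho> x) - (LINT x:C'|lborel. \<rho> x)
      \<le> (\<Sum>i\<in>I - {i0}. (LINT x:(\<lambda>x. G i (f x)) ` C'|lborel. \<rho> x) - (LINT x:(\<lambda>x. G i (f x)) ` E1|lborel. \<rho> x))"
    using i unfolding vol_image_sheets[OF i0 comp(1) inT(1)] vol_image_sheets[OF i0 comp(4) inT(2)]
    by (simp add: sum_subtractf)
  also have "\<dots> \<le> (\<Sum>i\<in>I - {i0}. \<gamma>)" using other by (intro sum_mono) auto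
  also have "\<dots> \<le> real (card I) * \<gamma>"
  proof -
    have "\<gamma> \<ge> 0" unfolding \<gamma>_def using Bf0 s by simp
    moreover have "card (I - {i0}) \<le> card I" using I(1) by (intro card_mono) auto
    ultimately show ?thesis by (simp add: mult_right_mono)
  qed
  finally have diff: "(LINT x:E1|lborel. \<rho> x) - (LINT x:C'|lborel. \<rho> x) \<le> real (card I) * \<gamma>" .
  \<comment> \<open>so \<open>E1\<close> has hardly more mass than \<open>C'\<close>; now compare with the actual densities\<close>
  have low: "1 * vol E1 - vol Z \<le> (LINT x:E1|lborel. \<rho> x)"
  proof (rule set_integral_lower_except[OF comp(1) rho_meas])
    fix x assume "x \<in> E1" "x \<notin> Z"
    then show "1 \<le> \<rho> x" using dense_cell[of x] E1s by auto
  qed (use Z rho_nonneg rho_bounds in auto)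
  have high: "(LINT x:C'|lborel. \<rho> x) \<le> 1/2 * vol C' + vol Z"
  proof (rule set_integral_upper_except[OF comp(4) rho_meas])
    fix y assume y: "y \<in> C'" "y \<notin> Z"
    then obtain x where "x \<in> cube c (s/4)" "y = x + \<xi>" using C'R by blast
    then show "\<rho> y \<le> 1/2" using thin_cell[of x] y(2) by simp
  qed (use Z rho_nonneg rho_bounds in auto)
  have vC': "vol C' = (2 * h) ^ D" unfolding C'_def D_def
    using vol_translation[OF comp(2)] vol_cube[of h c] h \<kappa> s by (simp add: C0_def)
  have vE1: "vol E1 = (2 * (h - \<kappa>)) ^ D" unfolding E1_def D_def using vol_cube[of "h - \<kappa>" c] h s by simp
  define u where "u = 2 * h / s"
  have u: "u \<ge> 1/4" using h(1) \<kappa> s by (simp add: u_def field_simps)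
  have hu: "2 * h = u * s" using s by (simp add: u_def)
  have "2 * (h - \<kappa>) = (u - 1 / (12 * real M)) * s" using hu by (simp add: \<kappa>_def left_diff_distrib right_diff_distrib)
  then have vE1': "vol E1 = (u - 1 / (12 * real M)) ^ D * s ^ D" using vE1 by (simp add: power_mult_distrib)
  have "3/4 * u ^ D * s ^ D \<le> vol E1" unfolding vE1'
    using power_shrink[OF M[folded D_def] D1 u] s by (intro mult_right_mono) auto
  moreover have "vol C' = u ^ D * s ^ D" using vC' hu by (simp add: power_mult_distrib)
  ultimately have "1/4 * u ^ D * s ^ D \<le> vol E1 - 1/2 * vol C'" by (simp add: mult_ac)
  also have "\<dots> \<le> real (card I) * \<gamma> + 2 * vol Z" using diff low high by linarith
  also have "\<dots> \<le> real (card I) * \<gamma> + 2 * (s ^ D / real k)" using Z(2) by (simp add: D_def)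
  also have "\<dots> = (real (card I) * (2 * Bf / real M + (4 * Bf + 2) / real k) + 2 / real k) * s ^ D"
    unfolding \<gamma>_def by (simp add: algebra_simps add_divide_distrib)
  finally have "1/4 * u ^ D * s ^ D \<le> (real (card I) * (2 * Bf / real M + (4 * Bf + 2) / real k) + 2 / real k) * s ^ D" .
  then have "1/4 * u ^ D \<le> real (card I) * (2 * Bf / real M + (4 * Bf + 2) / real k) + 2 / real k"
    using s by (simp add: mult_le_cancel_right)
  moreover have "(1/4) ^ D \<le> u ^ D" using u by (intro power_mono) auto
  ultimately show ?thesis by (simp add: D_def)
qed

end

section \<open>Checkered densities admit no Lipschitz transport\<close>

text \<open>
  The row consists of \<open>N\<close> cells of side \<open>l/N\<close> along the segment from \<open>a\<close> to \<open>a + l e\<close>. The background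
  density \<open>\<sigma>\<close> is nearly constant at that scale, \<open>Z\<close> is an exceptional set of small volume compared with a
  cell, and nothing is said about \<open>\<rho>\<close> in the zone between one and two times the distance \<open>d l/N\<close>.
\<close>
definition checkered_row :: "'a::euclidean_space \<Rightarrow> 'a \<Rightarrow> real \<Rightarrow> nat \<Rightarrow> nat \<Rightarrow> ('a \<Rightarrow> real) \<Rightarrow> bool" where
  "checkered_row e a l k N \<rho> \<longleftrightarrow> (\<exists>\<sigma> Z.
     (\<forall>x. 1/2 \<le> \<sigma> x \<and> \<sigma> x \<le> 1) \<and>
     (\<forall>x\<in>unit_cube. \<forall>y\<in>unit_cube. dist x y \<le> real k * (l / real N) \<longrightarrow> \<bar>\<sigma> x - \<sigma> y\<bar> \<le> 1 / real k) \<and>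
     Z \<in> fmeasurable lborel \<and> vol Z \<le> (l / real N) ^ DIM('a) / real k \<and>
     (\<forall>x. x \<notin> Z \<longrightarrow> infdist x (closed_segment a (a + l *\<^sub>R e)) > 2 * real DIM('a) * (l / real N) \<longrightarrow> \<rho> x = \<sigma> x) \<and>
     (\<forall>x. x \<notin> Z \<longrightarrow> infdist x (closed_segment a (a + l *\<^sub>R e)) \<le> real DIM('a) * (l / real N) \<longrightarrow>
        \<rho> x = wave (((x - a) \<bullet> e) / (l / real N))))"

definition checkered :: "'a::euclidean_space \<Rightarrow> ('a \<times> real) set \<Rightarrow> ('a \<Rightarrow> real) \<Rightarrow> bool" where
  "checkered e Dset \<rho> \<longleftrightarrow> (\<forall>(a, l)\<in>Dset. l > 0 \<longrightarrow> (\<forall>k\<ge>1. \<exists>N\<ge>k. checkered_row e a l k N \<rho>))"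

text \<open>
  The lemma \<open>row_near_translation\<close> is applied to \<open>f\<close> and the passages \<open>G i o f\<close> from one sheet to all the
  others, in a small ball \<open>V\<close> in the sheet \<open>T i0\<close>. The row of \<open>\<rho>\<close> along the resulting segment lies in \<open>V\<close>,
  so it does not meet the other sheets, and there \<open>\<rho>\<close> is nearly constant at the scale of the cells. The
  constants are fixed in the order \<open>M\<close>, \<open>\<theta>\<close>, segment, \<open>k\<close>, \<open>N\<close>.
\<close>
lemma (in sheeted_transport) not_checkered:
  assumes e: "e \<in> Basis" and dense: "\<And>W. open W \<Longrightarrow> W \<noteq> {} \<Longrightarrow> \<exists>d\<in>Dset. d \<in> (W :: ('a \<times> real) set)"
    and ch: "checkered e Dset \<rho>"
  shows False
proof -
  define D where "D = real DIM('a)"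
  have D1: "D \<ge> 1" by (simp add: D_def Suc_le_eq)
  have ne: "norm e = 1" using e by simp
  define Bf where "Bf = (L * real DIM('a)) ^ DIM('a) * vol (cball (0::'a) 1)"
  have Bf0: "Bf \<ge> 0" unfolding Bf_def using L_nonneg by simp
  define \<delta> :: real where "\<delta> = (1/4) ^ (DIM('a) + 1)"
  have \<delta>: "\<delta> > 0" by (simp add: \<delta>_def)
  define p where "p = real (card I)"
  have p0: "p \<ge> 0" by (simp add: p_def)
  obtain M0 where M0: "real M0 \<ge> 8 * p * Bf / \<delta>" using real_arch_simple by blast
  define M where "M = M0 + 2 * DIM('a) + 1"
  have M: "M \<ge> 2 * DIM('a)" "real M > 0" "8 * p * Bf / \<delta> \<le> real M" using M0 by (auto simp: M_def)
  have CL: "C * (L + 1) \<ge> 0" using C_nonneg L_nonneg by simp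
  define \<theta> where "\<theta> = 1 / (24 * real M * (C * (L + 1) + 1))"
  have \<theta>: "\<theta> > 0" using M CL by (simp add: \<theta>_def)
  have \<theta>M: "C * (L + 1) * \<theta> \<le> 1 / (24 * real M)"
  proof -
    have "C * (L + 1) * \<theta> \<le> (C * (L + 1) + 1) * \<theta>" using \<theta> by (intro mult_right_mono) auto
    also have "\<dots> = 1 / (24 * real M)" using CL by (simp add: \<theta>_def)
    finally show ?thesis .
  qed
  obtain i0 y where i0: "i0 \<in> I" and y: "y \<in> U" using I(2) U(2) by blast
  define x0 where "x0 = G i0 y"
  have fx0: "f x0 = y" using G(2)[OF i0 y] by (simp add: x0_def)
  define g where "g i x = G i (f x)" for i x
  have gT: "g i x0 \<in> T i" if "i \<in> I" for i using G(1)[OF that y] by (simp add: g_def fx0)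
  have gi0: "g i0 x = x" if "x \<in> T i0" for x using G(3)[OF i0 that] by (simp add: g_def)
  have x0T: "x0 \<in> T i0" using G(1)[OF i0 y] by (simp add: x0_def)
  obtain \<eta>1 where \<eta>1: "\<eta>1 > 0" "cball y \<eta>1 \<subseteq> U" using U(1) y by (rule open_contains_cball[THEN iffD1, THEN bspec, THEN exE]) blast
  obtain \<eta>2 where \<eta>2: "\<eta>2 > 0" "\<And>i. i \<in> I \<Longrightarrow> cball (g i x0) \<eta>2 \<subseteq> T i"
  proof (rule uniform_scale_finite[OF I(1), of "\<lambda>i d. cball (g i x0) d \<subseteq> T i"])
    fix i assume i: "i \<in> I"
    show "\<exists>d>0. cball (g i x0) d \<subseteq> T i" using T(1)[OF i] gT[OF i] open_contains_cball by metis
  next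
    fix i d d' assume "cball (g i x0) d \<subseteq> T i" "d' \<le> d"
    then show "cball (g i x0) d' \<subseteq> T i" using subset_cball by (meson order_trans)
  qed (rule that)
  define \<eta> where "\<eta> = min \<eta>1 \<eta>2 / 2"
  have \<eta>: "\<eta> > 0" "2 * \<eta> \<le> \<eta>1" "2 * \<eta> \<le> \<eta>2" using \<eta>1(1) \<eta>2(1) by (auto simp: \<eta>_def)
  define \<Lambda> where "\<Lambda> = L + C * L"
  have \<Lambda>: "\<Lambda> \<ge> 0" "L \<le> \<Lambda>" "C * L \<le> \<Lambda>" using L_nonneg C_nonneg by (auto simp: \<Lambda>_def)
  define \<rho>0 where "\<rho>0 = \<eta> / (\<Lambda> + 1)"
  have r0: "\<rho>0 > 0" "\<rho>0 \<le> \<eta>" using \<eta>(1) \<Lambda> by (auto simp: \<rho>0_def divide_le_eq mult_le_cancel_left1)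
  have r0\<Lambda>: "\<Lambda> * \<rho>0 \<le> \<eta>"
  proof -
    have "\<Lambda> * \<rho>0 \<le> (\<Lambda> + 1) * \<rho>0" using r0 by (intro mult_right_mono) auto
    also have "\<dots> = \<eta>" using \<Lambda> by (simp add: \<rho>0_def)
    finally show ?thesis .
  qed
  define V where "V = ball x0 \<rho>0"
  have VT: "V \<subseteq> T i0"
  proof
    fix x assume "x \<in> V"
    then have "x \<in> cball (g i0 x0) \<eta>2" using r0 \<eta> gi0[OF x0T] by (simp add: V_def)
    then show "x \<in> T i0" using \<eta>2(2)[OF i0] by blast
  qed
  have fU: "f x \<in> U" if "x \<in> V" for x using f_in_U[OF i0] VT that by blast
  have g_dist: "dist (g i x) (g i x') \<le> C * L * dist x x'" if "i \<in> I" "x \<in> V" "x' \<in> V" for i x x'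
    unfolding g_def by (rule branch_lipschitz[OF that(1) fU[OF that(2)] fU[OF that(3)]])
  have x0V: "x0 \<in> V" using r0 by (simp add: V_def)
  have f_near: "dist y (f x) \<le> \<eta>" if "x \<in> V" for x
  proof -
    have "dist (f x0) (f x) \<le> L * dist x0 x" by (rule f_dist)
    also have "\<dots> \<le> \<Lambda> * \<rho>0" using that \<Lambda> L_nonneg r0 by (intro mult_mono) (auto simp: V_def)
    finally show ?thesis using r0\<Lambda> fx0 by simp
  qed
  have g_near: "dist (g i x0) (g i x) \<le> \<eta>" if "i \<in> I" "x \<in> V" for i x
  proof -
    have "dist (g i x0) (g i x) \<le> C * L * dist x0 x" by (rule g_dist[OF that(1) x0V that(2)])
    also have "\<dots> \<le> \<Lambda> * \<rho>0" using that \<Lambda> L_nonneg C_nonneg r0 by (intro mult_mono) (auto simp: V_def)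
    finally show ?thesis using r0\<Lambda> by simp
  qed
  define J where "J = insert None (Some ` I)"
  define h where "h j = (case j of None \<Rightarrow> f | Some i \<Rightarrow> g i)" for j
  have hlip: "\<Lambda>-lipschitz_on (ball x0 \<rho>0) (h j)" if j: "j \<in> J" for j
  proof (rule lipschitz_onI[OF _ \<Lambda>(1)])
    fix x x' assume x: "x \<in> ball x0 \<rho>0" "x' \<in> ball x0 \<rho>0"
    consider "j = None" | i where "i \<in> I" "j = Some i" using j unfolding J_def by blast
    then show "dist (h j x) (h j x') \<le> \<Lambda> * dist x x'"
    proof cases
      case 1
      then have "dist (h j x) (h j x') \<le> L * dist x x'" using f_dist by (simp add: h_def)
      also have "\<dots> \<le> \<Lambda> * dist x x'" using \<Lambda> by (intro mult_right_mono) auto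
      finally show ?thesis .
    next
      case 2
      then have "dist (h j x) (h j x') \<le> C * L * dist x x'" using g_dist[OF 2(1)] x by (simp add: h_def V_def)
      also have "\<dots> \<le> \<Lambda> * dist x x'" using \<Lambda> by (intro mult_right_mono) auto
      finally show ?thesis .
    qed
  qed
  obtain a l r1 N0 where al: "(a, l) \<in> Dset" "l > 0" "r1 > 0"
    and tube: "\<And>z x. z \<in> closed_segment a (a + l *\<^sub>R e) \<Longrightarrow> dist z x \<le> r1 \<Longrightarrow> x \<in> ball x0 \<rho>0"
    and row: "\<And>N. N \<ge> N0 \<Longrightarrow> N \<ge> 1 \<and> (\<exists>m w. even m \<and> m < N \<and> (\<forall>j\<in>J. \<forall>x\<in>cball (a + (real m * (l / real N)) *\<^sub>R e) (D * (l / real N)).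
        norm (h j (x + (l / real N) *\<^sub>R e) - h j x - w j) \<le> \<theta> * (l / real N)))"
  proof (rule row_near_translation[of J \<rho>0 \<Lambda> x0 h e Dset \<theta> D])
    show "finite J" "J \<noteq> {}" using I(1) by (auto simp: J_def)
    show "\<exists>d\<in>Dset. d \<in> W" if "open W" "W \<noteq> {}" for W using dense that .
    show "D \<ge> 0" using D1 by simp
    show "\<rho>0 > 0" by (rule r0(1))
    show "norm e = 1" by (rule ne)
    show "\<theta> > 0" by (rule \<theta>)
    show "\<Lambda>-lipschitz_on (ball x0 \<rho>0) (h j)" if "j \<in> J" for j using that by (rule hlip)
  qed (rule that)
  let ?seg = "closed_segment a (a + l *\<^sub>R e)"
  obtain k0 where k0: "real k0 \<ge> 8 * (p * (4 * Bf + 2) + 2) / \<delta> + 2 * D * l / r1 + \<theta> * l / \<eta> + C * L * (D + 1) + 1"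
    using real_arch_simple by blast
  define k where "k = k0 + N0 + 2"
  have nn: "0 \<le> 8 * (p * (4 * Bf + 2) + 2) / \<delta>" "0 \<le> 2 * D * l / r1" "0 \<le> \<theta> * l / \<eta>" "0 \<le> C * L * (D + 1)"
    using p0 Bf0 \<delta> D1 al \<theta> \<eta> C_nonneg L_nonneg by auto
  have k: "k \<ge> 2" "k \<ge> N0" "8 * (p * (4 * Bf + 2) + 2) / \<delta> \<le> real k" "2 * D * l / r1 \<le> real k"
    "\<theta> * l / \<eta> \<le> real k" "C * L * (D + 1) \<le> real k"
    using k0 nn by (auto simp: k_def)
  obtain N where N: "N \<ge> k" "checkered_row e a l k N \<rho>"
  proof -
    have "\<forall>k\<ge>1. \<exists>N\<ge>k. checkered_row e a l k N \<rho>" using bspec[OF ch[unfolded checkered_def] al(1)] al(2) by simp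
    moreover have "k \<ge> 1" using k(1) by simp
    ultimately show thesis using that by blast
  qed
  define s where "s = l / real N"
  have N1: "N \<ge> 1" "real N > 0" using N(1) k(1) by auto
  have s: "s > 0" using al N1 by (simp add: s_def)
  have sk: "2 * D * s \<le> r1" "\<theta> * s \<le> \<eta>"
  proof -
    have "2 * D * l / r1 \<le> real N" using k(4) N(1) by linarith
    then show "2 * D * s \<le> r1" using al N1 by (simp add: s_def field_simps)
    have "\<theta> * l / \<eta> \<le> real N" using k(5) N(1) by linarith
    then show "\<theta> * s \<le> \<eta>" using \<eta> N1 by (simp add: s_def field_simps)
  qed
  obtain \<sigma> Z where \<sigma>: "\<And>x. 1/2 \<le> \<sigma> x" "\<And>x. \<sigma> x \<le> 1"
    and osc: "\<And>x y. x \<in> unit_cube \<Longrightarrow> y \<in> unit_cube \<Longrightarrow> dist x y \<le> real k * s \<Longrightarrow> \<bar>\<sigma> x - \<sigma> y\<bar> \<le> 1 / real k"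
    and Z: "Z \<in> fmeasurable lborel" "vol Z \<le> s ^ DIM('a) / real k"
    and off: "\<And>x. x \<notin> Z \<Longrightarrow> infdist x ?seg > 2 * D * s \<Longrightarrow> \<rho> x = \<sigma> x"
    and on: "\<And>x. x \<notin> Z \<Longrightarrow> infdist x ?seg \<le> D * s \<Longrightarrow> \<rho> x = wave (((x - a) \<bullet> e) / s)"
    using N(2) unfolding checkered_row_def s_def[symmetric] D_def[symmetric] by blast
  obtain m w where m: "even m" "m < N"
    and tr: "\<And>j x. j \<in> J \<Longrightarrow> x \<in> cball (a + (real m * s) *\<^sub>R e) (D * s) \<Longrightarrow> norm (h j (x + s *\<^sub>R e) - h j x - w j) \<le> \<theta> * s"
    using row[of N] N(1) k(2) unfolding s_def by (meson le_trans)
  define c where "c = a + ((real m + 1/2) * s) *\<^sub>R e"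
  have on_seg: "a + (real n * s) *\<^sub>R e \<in> ?seg" if "n \<le> N" for n
    unfolding s_def by (rule point_on_segment[OF that N1(1) al(2)])
  \<comment> \<open>the tube of the row stays in \<open>V\<close>, hence in the sheet \<open>T i0\<close>\<close>
  have far: "2 * D * s < infdist x ?seg" if "x \<notin> V" for x
  proof (rule ccontr)
    assume "\<not> ?thesis"
    moreover obtain z where "z \<in> ?seg" "infdist x ?seg = dist x z"
      using infdist_attains_inf[OF closed_segment, of a "a + l *\<^sub>R e" x] by auto
    ultimately show False using tube[of z x] sk(1) that by (simp add: V_def dist_commute)
  qed
  have cell: "dist (a + (real m * s) *\<^sub>R e) x \<le> D * s" "dist (a + (real (Suc m) * s) *\<^sub>R e) (x + s *\<^sub>R e) \<le> D * s"
    if x: "x \<in> cube c (s/4)" for x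
  proof -
    have "dist c x \<le> D * (s/4)" using x cube_subset_cball[of c "s/4"] by (auto simp: D_def)
    moreover have "dist (a + (real m * s) *\<^sub>R e) c = s/2"
    proof -
      have "c - (a + (real m * s) *\<^sub>R e) = (s/2) *\<^sub>R e" by (simp add: c_def algebra_simps)
      then show ?thesis using ne s by (simp add: dist_norm norm_minus_commute[of _ c])
    qed
    moreover have "D * (s/4) + s/2 \<le> D * s"
    proof -
      have "1 * s \<le> D * s" using D1 s by (intro mult_right_mono) auto
      then show ?thesis using s by linarith
    qed
    ultimately show 1: "dist (a + (real m * s) *\<^sub>R e) x \<le> D * s"
      using dist_triangle[of "a + (real m * s) *\<^sub>R e" x c] by linarith
    have "a + (real (Suc m) * s) *\<^sub>R e = (a + (real m * s) *\<^sub>R e) + s *\<^sub>R e" by (simp add: algebra_simps)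
    then show "dist (a + (real (Suc m) * s) *\<^sub>R e) (x + s *\<^sub>R e) \<le> D * s" using 1 by (simp add: dist_norm)
  qed
  have "0 \<le> D * s" using s D1 by simp
  then have Ds: "D * s \<le> r1" using sk(1) by linarith
  have cellV: "x \<in> V" "x + s *\<^sub>R e \<in> V" if x: "x \<in> cube c (s/4)" for x
  proof -
    show "x \<in> V" unfolding V_def
      by (rule tube[OF on_seg[of m]]) (use m cell(1)[OF x] Ds in auto)
    show "x + s *\<^sub>R e \<in> V" unfolding V_def
      by (rule tube[OF on_seg[of "Suc m"]]) (use m cell(2)[OF x] Ds in auto)
  qed
  have inf_le: "infdist x ?seg \<le> D * s" if "n \<le> N" "dist (a + (real n * s) *\<^sub>R e) x \<le> D * s" for x n
    using infdist_le[OF on_seg[OF that(1)], of x] that(2) by (simp add: dist_commute)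
  have cV: "c \<in> V" by (rule cellV(1)) (use s in \<open>simp add: mem_cube\<close>)
  have coord: "\<bar>((x - a) \<bullet> e) / s - (real m + 1/2)\<bar> \<le> 1/4" if x: "x \<in> cube c (s/4)" for x
  proof -
    have "e \<bullet> e = 1" using ne by (simp add: dot_square_norm)
    then have "(x - a) \<bullet> e = (x - c) \<bullet> e + (real m + 1/2) * s"
      by (simp add: c_def inner_diff_left inner_add_left)
    then have "((x - a) \<bullet> e) / s - (real m + 1/2) = ((x - c) \<bullet> e) / s" using s by (simp add: field_simps)
    moreover have "\<bar>(x - c) \<bullet> e\<bar> \<le> s/4" using x e by (simp add: mem_cube)
    ultimately show ?thesis using s by (simp add: abs_div_pos[symmetric] divide_le_eq)
  qed
  have disj: "x \<notin> V" if "i \<in> I" "i \<noteq> i0" "x \<in> T i" for i x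
    using T(3) that i0 VT unfolding disjoint_family_on_def by blast
  have sk2: "C * L * dist x x' \<le> real k * s" if "dist x x' \<le> (D + 1) * s" for x x' :: 'a
  proof -
    have "C * L * dist x x' \<le> C * L * ((D + 1) * s)" using that C_nonneg L_nonneg by (intro mult_left_mono) auto
    also have "\<dots> \<le> real k * s" using mult_right_mono[OF k(6), of s] s by (simp add: mult.assoc)
    finally show ?thesis .
  qed
  have flat: "\<bar>\<rho> (g i x) - \<sigma> (g i c)\<bar> \<le> 1 / real k"
    if i: "i \<in> I" "i \<noteq> i0" and x: "x \<in> V" "dist x c \<le> (D + 1) * s" "g i x \<notin> Z" for i x
  proof -
    have giT: "g i x \<in> T i" "g i c \<in> T i" using G(1)[OF i(1)] fU[OF x(1)] fU[OF cV] by (simp_all add: g_def)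
    then have "\<rho> (g i x) = \<sigma> (g i x)" using off[OF x(3) far[OF disj[OF i]]] by simp
    moreover have "dist (g i x) (g i c) \<le> real k * s" using g_dist[OF i(1) x(1) cV] sk2[OF x(2)] by linarith
    moreover have "g i x \<in> unit_cube" "g i c \<in> unit_cube" using giT T(2)[OF i(1)] by blast+
    ultimately show ?thesis using osc by simp
  qed
  have cell_c: "dist x c \<le> (D + 1) * s" "dist (x + s *\<^sub>R e) c \<le> (D + 1) * s" if x: "x \<in> cube c (s/4)" for x
  proof -
    have "dist c x \<le> D * (s/4)" using x cube_subset_cball[of c "s/4"] by (auto simp: D_def)
    moreover have "D * (s/4) \<le> D * s" using D1 s by (intro mult_left_mono) auto
    ultimately have 1: "dist x c \<le> D * s" by (simp add: dist_commute)
    then show "dist x c \<le> (D + 1) * s" using s by (simp add: algebra_simps)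
    have "dist (x + s *\<^sub>R e) x = s" using ne s by (simp add: dist_norm)
    then show "dist (x + s *\<^sub>R e) c \<le> (D + 1) * s"
      using 1 dist_triangle[of "x + s *\<^sub>R e" c x] by (simp add: algebra_simps)
  qed
  have incball: "x \<in> cball (a + (real m * s) *\<^sub>R e) (D * s)" if "x \<in> cube c (s/4)" for x using cell(1)[OF that] by simp
  have "(1/4) ^ (DIM('a) + 1) \<le> real (card I) * (2 * Bf / real M + (4 * Bf + 2) / real k) + 2 / real k"
  proof (rule cell_comparison[OF i0 s M(1) k(1), where c = c and \<xi> = "s *\<^sub>R e" and \<theta> = "\<theta> * s" and w = "w None"
        and v = "\<lambda>i. w (Some i)" and Z = Z and q = "\<lambda>i. \<sigma> (g i c)"])
    fix x assume x: "x \<in> cube c (s/4)"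
    show "x \<in> T i0 \<and> x + s *\<^sub>R e \<in> T i0" using cellV[OF x] VT by blast
    show "norm (f (x + s *\<^sub>R e) - f x - w None) \<le> \<theta> * s" using tr[of None x] incball[OF x] by (simp add: J_def h_def)
    show "cball (f (x + s *\<^sub>R e)) (\<theta> * s) \<subseteq> U"
    proof
      fix z assume "z \<in> cball (f (x + s *\<^sub>R e)) (\<theta> * s)"
      then have "dist y z \<le> 2 * \<eta>"
        using f_near[OF cellV(2)[OF x]] sk(2) dist_triangle[of y z "f (x + s *\<^sub>R e)"] by simp
      then show "z \<in> U" using \<eta>(2) \<eta>1(2) by (auto simp: subset_eq)
    qed
    show "\<rho> x = 1" if "x \<notin> Z"
      using on[OF that inf_le[of m x]] m cell(1)[OF x] wave_even_cell[OF m(1) coord[OF x]] by simp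
    show "\<rho> (x + s *\<^sub>R e) = 1/2" if "x + s *\<^sub>R e \<notin> Z"
    proof -
      have "e \<bullet> e = 1" using ne by (simp add: dot_square_norm)
      then have "((x + s *\<^sub>R e - a) \<bullet> e) / s = ((x - a) \<bullet> e) / s + 1"
        using s by (simp add: inner_diff_left inner_add_left field_simps)
      then have "\<bar>((x + s *\<^sub>R e - a) \<bullet> e) / s - (real (Suc m) + 1/2)\<bar> \<le> 1/4" using coord[OF x] by (simp add: algebra_simps)
      then have "wave (((x + s *\<^sub>R e - a) \<bullet> e) / s) = 1/2" by (rule wave_odd_cell[rotated]) (use m(1) in simp)
      then show ?thesis using on[OF that inf_le[of "Suc m"]] m cell(2)[OF x] by simp
    qed
    fix i assume i: "i \<in> I"
    show "norm (G i (f (x + s *\<^sub>R e)) - G i (f x) - w (Some i)) \<le> \<theta> * s"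
      using tr[of "Some i" x] incball[OF x] i by (simp add: J_def h_def g_def)
    show "cball (G i (f x)) (\<theta> * s) \<subseteq> T i"
    proof
      fix z assume "z \<in> cball (G i (f x)) (\<theta> * s)"
      then have "dist (g i x) z \<le> \<theta> * s" by (simp add: g_def)
      then have "dist (g i x0) z \<le> 2 * \<eta>"
        using g_near[OF i cellV(1)[OF x]] sk(2) dist_triangle[of "g i x0" z "g i x"] by linarith
      then show "z \<in> T i" using \<eta>(3) \<eta>2(2)[OF i] by (auto simp: subset_eq)
    qed
    assume ii: "i \<noteq> i0"
    show "\<bar>\<rho> (G i (f x)) - \<sigma> (g i c)\<bar> \<le> 1 / real k" if "G i (f x) \<notin> Z"
      using flat[OF i ii cellV(1)[OF x] cell_c(1)[OF x]] that by (simp add: g_def)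
    show "\<bar>\<rho> (G i (f (x + s *\<^sub>R e))) - \<sigma> (g i c)\<bar> \<le> 1 / real k" if "G i (f (x + s *\<^sub>R e)) \<notin> Z"
      using flat[OF i ii cellV(2)[OF x] cell_c(2)[OF x]] that by (simp add: g_def)
  next
    show "C * (L + 1) * (\<theta> * s) \<le> s / (24 * real M)"
      using mult_right_mono[OF \<theta>M, of s] s by (simp add: mult.assoc)
  qed (use Z \<sigma> Bf_def in auto)
  moreover have "p * (2 * Bf / real M) \<le> \<delta> / 4"
    using M(2,3) \<delta> by (simp add: field_simps)
  moreover have "p * ((4 * Bf + 2) / real k) + 2 / real k \<le> \<delta> / 8"
  proof -
    have "8 * (p * (4 * Bf + 2) + 2) \<le> real k * \<delta>" using k(3) \<delta> by (simp add: pos_divide_le_eq)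
    then have "(p * (4 * Bf + 2) + 2) / real k \<le> \<delta> / 8" using k(1) by (simp add: field_simps)
    then show ?thesis by (simp only: times_divide_eq_right add_divide_distrib[symmetric])
  qed
  ultimately show False using \<delta> unfolding \<delta>_def[symmetric] p_def[symmetric] distrib_left by linarith
qed

section \<open>Existence of checkered densities\<close>

lemma segment_null:
  fixes a :: "'a::euclidean_space"
  assumes e: "e \<in> Basis" and dim: "DIM('a) \<ge> 2"
  shows "emeasure lborel (closed_segment a (a + l *\<^sub>R e)) = 0"
proof -
  obtain b :: 'a where b: "b \<in> Basis" "b \<noteq> e"
  proof -
    have "\<not> Basis \<subseteq> {e}" using card_mono[of "{e}" Basis] dim by auto
    then show thesis using that by blast
  qed
  have be: "b \<bullet> e = 0" using b e by (simp add: inner_not_same_Basis)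
  have "closed_segment a (a + l *\<^sub>R e) \<subseteq> {x. b \<bullet> x = b \<bullet> a}"
    unfolding closed_segment_def by (auto simp: inner_add_right be algebra_simps)
  moreover have "negligible {x. b \<bullet> x = b \<bullet> a}" using b by (intro negligible_hyperplane) auto
  ultimately have "negligible (closed_segment a (a + l *\<^sub>R e))" using negligible_subset by blast
  then have "emeasure lebesgue (closed_segment a (a + l *\<^sub>R e)) = 0"
    by (simp add: negligible_iff_emeasure0 lmeasurable_compact fmeasurableD)
  then show ?thesis using compact_sets_lborel[OF compact_segment, of a "a + l *\<^sub>R e"]
    by (simp add: emeasure_completion)
qed

text \<open>
  The tubes decrease to the segment, which is a null set in dimension at least two.
\<close>
lemma thin_tube:
  fixes a :: "'a::euclidean_space"
  assumes e: "e \<in> Basis" and dim: "DIM('a) \<ge> 2" and \<epsilon>: "\<epsilon> > 0" and c: "c > 0"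
  shows "\<forall>\<^sub>F N in sequentially. emeasure lborel {x. infdist x (closed_segment a (a + l *\<^sub>R e)) \<le> c / real N} < ennreal \<epsilon>"
proof -
  let ?S = "closed_segment a (a + l *\<^sub>R e)"
  define A where "A n = {x. infdist x ?S \<le> c / real (Suc n)}" for n
  have cA: "compact (A n)" for n unfolding A_def using c by (intro compact_infdist_le) auto
  have "(\<lambda>n. emeasure lborel (A n)) \<longlonglongrightarrow> emeasure lborel (\<Inter>n. A n)"
  proof (rule Lim_emeasure_decseq)
    show "range A \<subseteq> sets lborel" using compact_sets_lborel[OF cA] by blast
    show "decseq A"
    proof (rule decseq_SucI, rule subsetI)
      fix n x assume "x \<in> A (Suc n)"
      moreover have "c / real (Suc (Suc n)) \<le> c / real (Suc n)" using c by (intro divide_left_mono) auto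
      ultimately show "x \<in> A n" by (auto simp: A_def)
    qed
    show "emeasure lborel (A i) \<noteq> \<infinity>" for i using compact_sets_lborel[OF cA[of i]] by auto
  qed
  moreover have "(\<Inter>n. A n) \<subseteq> ?S"
  proof
    fix x assume x: "x \<in> (\<Inter>n. A n)"
    have "infdist x ?S \<le> 0"
    proof (rule field_le_epsilon)
      fix d :: real assume d: "d > 0"
      obtain n where n: "c / d \<le> real n" using real_arch_simple by blast
      have "c \<le> real n * d" using n d by (simp add: pos_divide_le_eq)
      also have "\<dots> \<le> d * real (Suc n)" using d by (simp add: algebra_simps)
      finally have "c / real (Suc n) \<le> d" by (simp add: pos_divide_le_eq)
      moreover have "infdist x ?S \<le> c / real (Suc n)" using x by (auto simp: A_def)
      ultimately show "infdist x ?S \<le> 0 + d" by simp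
    qed
    then have "infdist x ?S = 0" using infdist_nonneg[of x ?S] by simp
    then show "x \<in> ?S" using in_closed_iff_infdist_zero[OF closed_segment, of a "a + l *\<^sub>R e" x] by simp
  qed
  then have "emeasure lborel (\<Inter>n. A n) = 0"
    using emeasure_mono[of "\<Inter>n. A n" ?S lborel] segment_null[OF e dim, of a l] by simp
  ultimately have "(\<lambda>n. emeasure lborel (A n)) \<longlonglongrightarrow> 0" by simp
  moreover have "ennreal \<epsilon> > 0" using \<epsilon> by simp
  ultimately have "\<forall>\<^sub>F n in sequentially. emeasure lborel (A n) < ennreal \<epsilon>" by (rule order_tendstoD(2))
  then show ?thesis unfolding A_def by (subst eventually_sequentially_Suc[symmetric])
qed

text \<open>
  For large \<open>N\<close> the tube around the segment has small volume and \<open>\<sigma>\<close> varies little at the scale \<open>l/N\<close>; a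
  cut-off function interpolates between the wave and \<open>\<sigma>\<close> inside the tube.
\<close>
lemma insert_row:
  fixes \<sigma> :: "'a::euclidean_space \<Rightarrow> real"
  assumes e: "e \<in> Basis" and dim: "DIM('a) \<ge> 2" and \<epsilon>: "\<epsilon> > 0" and l: "l > 0" and k: "k \<ge> (1::nat)"
    and \<sigma>: "continuous_on UNIV \<sigma>" "\<And>x. 1/2 \<le> \<sigma> x" "\<And>x. \<sigma> x \<le> 1"
  obtains N \<sigma>' R where "N \<ge> k" "continuous_on UNIV \<sigma>'" "\<And>x. 1/2 \<le> \<sigma>' x" "\<And>x. \<sigma>' x \<le> 1"
    "compact R" "emeasure lborel R \<le> ennreal \<epsilon>" "\<And>x. x \<notin> R \<Longrightarrow> \<sigma>' x = \<sigma> x"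
    "\<And>x. infdist x (closed_segment a (a + l *\<^sub>R e)) > 2 * real DIM('a) * (l / real N) \<Longrightarrow> \<sigma>' x = \<sigma> x"
    "\<And>x. infdist x (closed_segment a (a + l *\<^sub>R e)) \<le> real DIM('a) * (l / real N) \<Longrightarrow> \<sigma>' x = wave (((x - a) \<bullet> e) / (l / real N))"
    "\<And>x y. x \<in> unit_cube \<Longrightarrow> y \<in> unit_cube \<Longrightarrow> dist x y \<le> real k * (l / real N) \<Longrightarrow> \<bar>\<sigma> x - \<sigma> y\<bar> \<le> 1 / real k"
proof -
  define D where "D = real DIM('a)"
  have D1: "D \<ge> 1" by (simp add: D_def Suc_le_eq)
  let ?S = "closed_segment a (a + l *\<^sub>R e)"
  have "uniformly_continuous_on (unit_cube :: 'a set) \<sigma>"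
    using continuous_on_subset[OF \<sigma>(1)] by (intro compact_uniformly_continuous) auto
  then obtain d where d: "d > 0" "\<And>x y. x \<in> unit_cube \<Longrightarrow> y \<in> unit_cube \<Longrightarrow> dist y x < d \<Longrightarrow> dist (\<sigma> y) (\<sigma> x) < 1 / real k"
    unfolding uniformly_continuous_on_def using k by (metis of_nat_0_less_iff zero_less_divide_1_iff less_le_trans zero_less_one)
  have "\<forall>\<^sub>F N in sequentially. emeasure lborel {x. infdist x ?S \<le> (2 * D * l) / real N} < ennreal \<epsilon>"
    by (rule thin_tube[OF e dim \<epsilon>]) (use D1 l in simp)
  moreover have "\<forall>\<^sub>F N in sequentially. real N > real k * l / d"
  proof -
    obtain n where "real k * l / d < real n" using reals_Archimedean2 by blast
    then show ?thesis unfolding eventually_sequentially by (meson less_le_trans of_nat_le_iff)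
  qed
  moreover have "\<forall>\<^sub>F N in sequentially. N \<ge> k" by (rule eventually_ge_at_top)
  ultimately have "\<forall>\<^sub>F N in sequentially. emeasure lborel {x. infdist x ?S \<le> (2 * D * l) / real N} < ennreal \<epsilon>
      \<and> real N > real k * l / d \<and> N \<ge> k"
    by eventually_elim auto
  then obtain N where N: "emeasure lborel {x. infdist x ?S \<le> (2 * D * l) / real N} < ennreal \<epsilon>"
    "real N > real k * l / d" "N \<ge> k"
    using eventually_happens'[OF sequentially_bot] by blast
  define s where "s = l / real N"
  have s: "s > 0" using N(3) k l by (simp add: s_def)
  define R where "R = {x. infdist x ?S \<le> 2 * D * s}"
  have ReqN: "R = {x. infdist x ?S \<le> (2 * D * l) / real N}" by (simp add: R_def s_def)
  define \<zeta> where "\<zeta> x = max 0 (min 1 (2 - infdist x ?S / (D * s)))" for x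
  have \<zeta>: "0 \<le> \<zeta> x" "\<zeta> x \<le> 1" for x by (auto simp: \<zeta>_def)
  define \<omega> where "\<omega> x = wave (((x - a) \<bullet> e) / s)" for x
  define \<sigma>' where "\<sigma>' x = (1 - \<zeta> x) * \<sigma> x + \<zeta> x * \<omega> x" for x
  have Ds: "D * s > 0" using D1 s by simp
  have off: "\<sigma>' x = \<sigma> x" if "infdist x ?S > 2 * D * s" for x
  proof -
    have "infdist x ?S / (D * s) > 2" using that Ds by (simp add: pos_less_divide_eq)
    then have "\<zeta> x = 0" by (simp add: \<zeta>_def)
    then show ?thesis by (simp add: \<sigma>'_def)
  qed
  show thesis
  proof (rule that[of N \<sigma>' R], unfold s_def[symmetric] D_def[symmetric])
    show "N \<ge> k" by (rule N)
    show "continuous_on UNIV \<sigma>'"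
    proof -
      have "continuous_on UNIV \<zeta>" unfolding \<zeta>_def using Ds by (intro continuous_intros) auto
      moreover have "continuous_on UNIV \<omega>" unfolding \<omega>_def
        by (rule continuous_on_compose2[OF wave_cont[of UNIV]]) (use s in \<open>auto intro!: continuous_intros\<close>)
      ultimately show ?thesis unfolding \<sigma>'_def using \<sigma>(1) by (intro continuous_intros)
    qed
    fix x
    have w: "1/2 \<le> \<omega> x" "\<omega> x \<le> 1" using wave_bounds by (auto simp: \<omega>_def)
    have "(1 - \<zeta> x) * (1/2) + \<zeta> x * (1/2) \<le> \<sigma>' x" unfolding \<sigma>'_def
      using \<zeta>[of x] \<sigma>(2)[of x] w by (intro add_mono mult_left_mono) auto
    then show "1/2 \<le> \<sigma>' x" by (simp add: diff_divide_distrib)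
    have "\<sigma>' x \<le> (1 - \<zeta> x) * 1 + \<zeta> x * 1" unfolding \<sigma>'_def
      using \<zeta>[of x] \<sigma>(3)[of x] w by (intro add_mono mult_left_mono) auto
    then show "\<sigma>' x \<le> 1" by simp
    show "\<sigma>' x = \<sigma> x" if "x \<notin> R" using off that by (auto simp: R_def)
    show "\<sigma>' x = \<sigma> x" if "infdist x ?S > 2 * D * s" using off[OF that] .
    show "\<sigma>' x = wave (((x - a) \<bullet> e) / s)" if "infdist x ?S \<le> D * s"
    proof -
      have "infdist x ?S / (D * s) \<le> 1" using that Ds by (simp add: pos_divide_le_eq)
      then have "\<zeta> x = 1" by (simp add: \<zeta>_def)
      then show ?thesis by (simp add: \<sigma>'_def \<omega>_def)
    qed
  next
    show "compact R" unfolding R_def using Ds by (intro compact_infdist_le) auto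
    show "emeasure lborel R \<le> ennreal \<epsilon>" using N(1) unfolding ReqN by simp
    fix x y :: 'a assume xy: "x \<in> unit_cube" "y \<in> unit_cube" "dist x y \<le> real k * s"
    have "real k * s < d" using N(2,3) d(1) k by (simp add: s_def field_simps)
    then show "\<bar>\<sigma> x - \<sigma> y\<bar> \<le> 1 / real k" using d(2)[OF xy(2,1)] xy(3) by (simp add: dist_real_def)
  qed
qed

text \<open>
  There are countably many tasks \<open>(a, l, k)\<close>, carried out one after another by \<open>insert_row\<close>, each time
  starting from the density \<open>\<sigma> n\<close> obtained so far. A later row may cross an earlier one and spoil it. To
  limit the damage, every step \<open>n\<close> sets a bound \<open>\<epsilon> (Suc n)\<close> for the total volume of all later tubes: half
  of the previous bound, and at most the volume \<open>(l/N)^d / k\<close> that the definition of a checkered row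
  tolerates as exceptional set. So the background of the row of step \<open>n\<close> is \<open>\<sigma> n\<close>, and its
  exceptional set is the union \<open>W (Suc n)\<close> of the later tubes.
\<close>
lemma checkered_density_exists:
  fixes e :: "'a::euclidean_space" and Dset :: "('a \<times> real) set"
  assumes e: "e \<in> Basis" and dim: "DIM('a) \<ge> 2"
    and Dset: "countable Dset" "\<And>W. open W \<Longrightarrow> W \<noteq> {} \<Longrightarrow> \<exists>d\<in>Dset. d \<in> W"
  obtains \<rho> \<sigma> W where "\<rho> \<in> borel_measurable borel" "\<And>x. 1/2 \<le> \<rho> x" "\<And>x. \<rho> x \<le> 1" "checkered e Dset \<rho>"
    "\<And>n. continuous_on UNIV (\<sigma> n)" "\<And>n x. 1/2 \<le> \<sigma> n x" "\<And>n x. \<sigma> n x \<le> 1"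
    "\<And>n. W n \<in> fmeasurable lborel" "\<And>n. vol (W n) \<le> (1/2) ^ n" "\<And>n x. x \<notin> W n \<Longrightarrow> \<rho> x = \<sigma> n x"
proof -
  define Tasks where "Tasks = {(a, l, k). (a, l) \<in> Dset \<and> l > 0 \<and> k \<ge> (1::nat)}"
  have cT: "countable Tasks"
  proof -
    have "Tasks \<subseteq> (\<lambda>((a, l), k). (a, l, k)) ` (Dset \<times> UNIV)" by (force simp: Tasks_def)
    moreover have "countable ((\<lambda>((a, l), k). (a, l, k)) ` (Dset \<times> (UNIV :: nat set)))"
      using Dset(1) by (intro countable_image countable_SIGMA) auto
    ultimately show ?thesis by (rule countable_subset)
  qed
  have "open (UNIV \<times> {0<..} :: ('a \<times> real) set)" by (intro open_Times) auto
  then obtain d where "d \<in> Dset" "d \<in> UNIV \<times> {0<..}" using Dset(2)[of "UNIV \<times> {0<..}"] by auto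
  then have "(fst d, snd d, 1) \<in> Tasks" by (auto simp: Tasks_def)
  then have neT: "Tasks \<noteq> {}" by blast
  define task where "task = from_nat_into Tasks"
  have taskT: "task n \<in> Tasks" for n unfolding task_def using neT by (rule from_nat_into)
  have task_surj: "\<exists>n. task n = t" if "t \<in> Tasks" for t unfolding task_def using from_nat_into_surj[OF cT that] .
  \<comment> \<open>a state consists of the density, the bound for the volume of all later tubes, the last tube and its number of cells\<close>
  define P where "P x \<longleftrightarrow> (case x of (\<sigma> :: 'a \<Rightarrow> real, \<epsilon> :: real, R :: 'a set, N :: nat) \<Rightarrow>
      continuous_on UNIV \<sigma> \<and> (\<forall>x. 1/2 \<le> \<sigma> x) \<and> (\<forall>x. \<sigma> x \<le> 1) \<and> \<epsilon> > 0)" for x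
  define Q where "Q n x y \<longleftrightarrow> (case (task n, x, y) of
      ((a, l, k), (\<sigma> :: 'a \<Rightarrow> real, \<epsilon> :: real, _ :: 'a set, _ :: nat), (\<sigma>' :: 'a \<Rightarrow> real, \<epsilon>' :: real, R :: 'a set, N :: nat)) \<Rightarrow>
      N \<ge> k \<and> compact R \<and> emeasure lborel R \<le> ennreal (\<epsilon>/2) \<and> (\<forall>x. x \<notin> R \<longrightarrow> \<sigma>' x = \<sigma> x) \<and>
      (\<forall>x. infdist x (closed_segment a (a + l *\<^sub>R e)) > 2 * real DIM('a) * (l / real N) \<longrightarrow> \<sigma>' x = \<sigma> x) \<and>
      (\<forall>x. infdist x (closed_segment a (a + l *\<^sub>R e)) \<le> real DIM('a) * (l / real N) \<longrightarrow> \<sigma>' x = wave (((x - a) \<bullet> e) / (l / real N))) \<and>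
      (\<forall>x\<in>unit_cube. \<forall>y\<in>unit_cube. dist x y \<le> real k * (l / real N) \<longrightarrow> \<bar>\<sigma> x - \<sigma> y\<bar> \<le> 1 / real k) \<and>
      \<epsilon>' \<le> \<epsilon>/2 \<and> \<epsilon>' \<le> (l / real N) ^ DIM('a) / real k)" for n :: nat and x y
  have "\<exists>F. (\<forall>n. P (F n)) \<and> (\<forall>n. Q n (F n) (F (Suc n))) \<and> F 0 = ((\<lambda>x. 1), 1, {}, 0)"
  proof -
    have "\<exists>F. \<forall>n. (P (F n) \<and> (n = 0 \<longrightarrow> F n = ((\<lambda>x. 1), 1, {}, 0))) \<and> Q n (F n) (F (Suc n))"
    proof (rule dependent_nat_choice)
      show "\<exists>x. P x \<and> (0 = (0::nat) \<longrightarrow> x = ((\<lambda>x. 1), 1, {}, 0))" by (auto simp: P_def)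
      fix x and n :: nat assume "P x \<and> (n = 0 \<longrightarrow> x = ((\<lambda>x. 1), 1, {}, 0))"
      then have Px: "P x" by blast
      obtain \<sigma> \<epsilon> R0 N0 where x: "x = (\<sigma>, \<epsilon>, R0, N0)" by (cases x)
      obtain a l k where t: "task n = (a, l, k)" by (cases "task n")
      have lk: "l > 0" "k \<ge> 1" using taskT[of n] by (auto simp: t Tasks_def)
      have \<sigma>: "continuous_on UNIV \<sigma>" "\<And>x. 1/2 \<le> \<sigma> x" "\<And>x. \<sigma> x \<le> 1" "\<epsilon>/2 > 0" using Px by (auto simp: P_def x)
      obtain N \<sigma>' R where N: "N \<ge> k" "continuous_on UNIV \<sigma>'" "\<And>x. 1/2 \<le> \<sigma>' x" "\<And>x. \<sigma>' x \<le> 1"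
        "compact R" "emeasure lborel R \<le> ennreal (\<epsilon>/2)" "\<And>x. x \<notin> R \<Longrightarrow> \<sigma>' x = \<sigma> x"
        "\<And>x. infdist x (closed_segment a (a + l *\<^sub>R e)) > 2 * real DIM('a) * (l / real N) \<Longrightarrow> \<sigma>' x = \<sigma> x"
        "\<And>x. infdist x (closed_segment a (a + l *\<^sub>R e)) \<le> real DIM('a) * (l / real N) \<Longrightarrow> \<sigma>' x = wave (((x - a) \<bullet> e) / (l / real N))"
        "\<And>x y. x \<in> unit_cube \<Longrightarrow> y \<in> unit_cube \<Longrightarrow> dist x y \<le> real k * (l / real N) \<Longrightarrow> \<bar>\<sigma> x - \<sigma> y\<bar> \<le> 1 / real k"
        by (rule insert_row[OF e dim \<sigma>(4) lk \<sigma>(1-3), where a = a]) (rule that)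
      define \<epsilon>' where "\<epsilon>' = min (\<epsilon>/2) ((l / real N) ^ DIM('a) / real k)"
      have "\<epsilon>' > 0" using \<sigma>(4) lk N(1) by (simp add: \<epsilon>'_def)
      then have "P (\<sigma>', \<epsilon>', R, N)" using N(2-4) by (simp add: P_def)
      moreover have "\<epsilon>' \<le> \<epsilon>/2" "\<epsilon>' \<le> (l / real N) ^ DIM('a) / real k"
        unfolding \<epsilon>'_def by (rule min.cobounded1, rule min.cobounded2)
      then have "Q n x (\<sigma>', \<epsilon>', R, N)" unfolding Q_def t x using N(1,5-10) by simp
      ultimately show "\<exists>y. (P y \<and> (Suc n = 0 \<longrightarrow> y = ((\<lambda>x. 1), 1, {}, 0))) \<and> Q n x y" by blast
    qed
    then show ?thesis by blast
  qed
  then obtain F where F: "\<And>n. P (F n)" "\<And>n. Q n (F n) (F (Suc n))" "F 0 = ((\<lambda>x. 1), 1, {}, 0)" by blast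
  define \<sigma> where "\<sigma> n = fst (F n)" for n
  define \<epsilon> where "\<epsilon> n = fst (snd (F n))" for n
  define R where "R n = fst (snd (snd (F (Suc n))))" for n
  define N where "N n = snd (snd (snd (F (Suc n))))" for n
  have \<sigma>: "continuous_on UNIV (\<sigma> n)" "1/2 \<le> \<sigma> n x" "\<sigma> n x \<le> 1" "\<epsilon> n > 0" for n x
    using F(1)[of n] by (simp_all add: P_def \<sigma>_def \<epsilon>_def split: prod.splits)
  have Qn: "N n \<ge> k" "compact (R n)" "emeasure lborel (R n) \<le> ennreal (\<epsilon> n/2)" "\<And>x. x \<notin> R n \<Longrightarrow> \<sigma> (Suc n) x = \<sigma> n x"
      "\<And>x. infdist x (closed_segment a (a + l *\<^sub>R e)) > 2 * real DIM('a) * (l / real (N n)) \<Longrightarrow> \<sigma> (Suc n) x = \<sigma> n x"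
      "\<And>x. infdist x (closed_segment a (a + l *\<^sub>R e)) \<le> real DIM('a) * (l / real (N n)) \<Longrightarrow> \<sigma> (Suc n) x = wave (((x - a) \<bullet> e) / (l / real (N n)))"
      "\<And>x y. x \<in> unit_cube \<Longrightarrow> y \<in> unit_cube \<Longrightarrow> dist x y \<le> real k * (l / real (N n)) \<Longrightarrow> \<bar>\<sigma> n x - \<sigma> n y\<bar> \<le> 1 / real k"
      "\<epsilon> (Suc n) \<le> \<epsilon> n / 2" "\<epsilon> (Suc n) \<le> (l / real (N n)) ^ DIM('a) / real k"
    if t: "task n = (a, l, k)" for n a l k
    using F(2)[of n] by (simp_all add: Q_def t case_prod_beta \<sigma>_def \<epsilon>_def R_def N_def)
  have R: "compact (R n)" "emeasure lborel (R n) \<le> ennreal (\<epsilon> n/2)" "\<And>x. x \<notin> R n \<Longrightarrow> \<sigma> (Suc n) x = \<sigma> n x"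
    "\<epsilon> (Suc n) \<le> \<epsilon> n / 2" for n
  proof -
    obtain a l k where t: "task n = (a, l, k)" by (cases "task n")
    show "compact (R n)" "emeasure lborel (R n) \<le> ennreal (\<epsilon> n/2)" "\<epsilon> (Suc n) \<le> \<epsilon> n / 2"
      by (rule Qn(2)[OF t], rule Qn(3)[OF t], rule Qn(8)[OF t])
    show "\<And>x. x \<notin> R n \<Longrightarrow> \<sigma> (Suc n) x = \<sigma> n x" by (rule Qn(4)[OF t])
  qed
  define W where "W n = (\<Union>i. R (n + i))" for n
  have Wm: "W n \<in> sets lborel" for n unfolding W_def using compact_sets_lborel[OF R(1)] by (intro sets.countable_UN) auto
  have eps: "\<epsilon> (n + i) \<le> \<epsilon> n * (1/2) ^ i" for n i
  proof (induction i)
    case (Suc i)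
    then show ?case using R(4)[of "n + i"] by simp
  qed simp
  have We: "emeasure lborel (W n) \<le> ennreal (\<epsilon> n)" for n
  proof -
    have "emeasure lborel (W n) \<le> (\<Sum>i. emeasure lborel (R (n + i)))" unfolding W_def
      using compact_sets_lborel[OF R(1)] by (intro emeasure_subadditive_countably) auto
    also have "\<dots> \<le> (\<Sum>i. ennreal (\<epsilon> n * (1/2) ^ Suc i))"
    proof (intro suminf_le summableI)
      fix i
      have "emeasure lborel (R (n + i)) \<le> ennreal (\<epsilon> (n + i)/2)" by (rule R(2))
      also have "\<dots> \<le> ennreal (\<epsilon> n * (1/2) ^ Suc i)" using eps[of n i] by (intro ennreal_leI) simp
      finally show "emeasure lborel (R (n + i)) \<le> ennreal (\<epsilon> n * (1/2) ^ Suc i)" .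
    qed
    also have "\<dots> = ennreal (\<epsilon> n)"
    proof -
      have "(\<lambda>i. \<epsilon> n * (1/2) ^ Suc i) sums (\<epsilon> n * 1)" by (intro sums_mult power_half_series)
      then have "(\<lambda>i. ennreal (\<epsilon> n * (1/2) ^ Suc i)) sums ennreal (\<epsilon> n * 1)"
        using \<sigma>(4)[of n] by (subst sums_ennreal) auto
      then show ?thesis by (simp add: sums_iff)
    qed
    finally show ?thesis .
  qed
  have Wf: "W n \<in> fmeasurable lborel" for n
    by (rule fmeasurableI[OF Wm]) (use We[of n] in \<open>simp add: le_less_trans\<close>)
  have Wvol: "vol (W n) \<le> \<epsilon> n" for n
    using enn2real_mono[OF We[of n]] \<sigma>(4)[of n] by (simp add: measure_def)
  \<comment> \<open>the limit exists off a null set; clamping also gives the other points a value in the required range\<close>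
  define \<rho> where "\<rho> x = max (1/2) (min 1 (lim (\<lambda>n. \<sigma> n x)))" for x
  have \<rho>W: "\<rho> x = \<sigma> n x" if "x \<notin> W n" for x n
  proof -
    have "\<sigma> (n + i) x = \<sigma> n x" for i
    proof (induction i)
      case (Suc i)
      have "x \<notin> R (n + i)" using that by (auto simp: W_def)
      then show ?case using R(3)[of x "n + i"] Suc by simp
    qed simp
    then have "(\<lambda>i. \<sigma> (i + n) x) \<longlonglongrightarrow> \<sigma> n x" by (simp add: add.commute)
    then have "(\<lambda>i. \<sigma> i x) \<longlonglongrightarrow> \<sigma> n x" by (rule LIMSEQ_offset)
    then have "lim (\<lambda>n. \<sigma> n x) = \<sigma> n x" by (rule limI)
    then show ?thesis using \<sigma>(2,3)[of n x] by (simp add: \<rho>_def)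
  qed
  show thesis
  proof (rule that[of \<rho> \<sigma> W])
    show "\<rho> \<in> borel_measurable borel" unfolding \<rho>_def
      using borel_measurable_continuous_onI[OF \<sigma>(1)] by measurable
    show "1/2 \<le> \<rho> x" "\<rho> x \<le> 1" for x by (auto simp: \<rho>_def)
    show "checkered e Dset \<rho>" unfolding checkered_def
    proof (clarify)
      fix a l and k :: nat assume al: "(a, l) \<in> Dset" "l > 0" "1 \<le> k"
      then have "(a, l, k) \<in> Tasks" by (simp add: Tasks_def)
      then obtain n where t: "task n = (a, l, k)" using task_surj by blast
      have Wsub: "\<rho> x = \<sigma> (Suc n) x" if "x \<notin> W (Suc n)" for x by (rule \<rho>W[OF that])
      have "checkered_row e a l k (N n) \<rho>" unfolding checkered_row_def
      proof (intro exI[of _ "\<sigma> n"] exI[of _ "W (Suc n)"] conjI allI ballI impI)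
        show "vol (W (Suc n)) \<le> (l / real (N n)) ^ DIM('a) / real k"
          using Wvol[of "Suc n"] Qn(9)[OF t] by linarith
        fix x
        show "\<rho> x = \<sigma> n x" if "x \<notin> W (Suc n)" "2 * real DIM('a) * (l / real (N n)) < infdist x (closed_segment a (a + l *\<^sub>R e))"
          using Wsub[OF that(1)] Qn(5)[OF t that(2)] by simp
        show "\<rho> x = wave (((x - a) \<bullet> e) / (l / real (N n)))"
          if "x \<notin> W (Suc n)" "infdist x (closed_segment a (a + l *\<^sub>R e)) \<le> real DIM('a) * (l / real (N n))"
          using Wsub[OF that(1)] Qn(6)[OF t that(2)] by simp
      qed (use \<sigma> Wf Qn(7)[OF t] in auto)
      then show "\<exists>N\<ge>k. checkered_row e a l k N \<rho>" using Qn(1)[OF t] by blast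
    qed
    show "vol (W n) \<le> (1/2) ^ n" for n
    proof -
      have "\<epsilon> 0 = 1" using F(3) by (simp add: \<epsilon>_def)
      then show ?thesis using Wvol[of n] eps[of 0 n] by simp
    qed
  qed (use \<sigma> Wf \<rho>W in auto)
qed

section \<open>Rounding masses and extending Lipschitz maps\<close>

text \<open>
  From each block (a fibre of \<open>\<beta>\<close>) keep as many points as its total weight, rounded down. A test function
  that is nearly constant on blocks sees only the number of points kept, which is wrong by at most one for
  each block.
\<close>
lemma block_rounding:
  fixes \<sigma> :: "'a \<Rightarrow> real" and \<beta> :: "'a \<Rightarrow> 'b"
  assumes X: "finite X" and \<sigma>: "\<And>x. x \<in> X \<Longrightarrow> 0 \<le> \<sigma> x" "\<And>x. x \<in> X \<Longrightarrow> \<sigma> x \<le> 1"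
  obtains S where "S \<subseteq> X" "\<And>(\<phi> :: 'a \<Rightarrow> real) B \<omega>. (\<And>x. x \<in> X \<Longrightarrow> \<bar>\<phi> x\<bar> \<le> B) \<Longrightarrow>
     (\<And>x y. x \<in> X \<Longrightarrow> y \<in> X \<Longrightarrow> \<beta> x = \<beta> y \<Longrightarrow> \<bar>\<phi> x - \<phi> y\<bar> \<le> \<omega>) \<Longrightarrow>
     \<bar>(\<Sum>x\<in>S. \<phi> x) - (\<Sum>x\<in>X. \<phi> x * \<sigma> x)\<bar> \<le> B * real (card (\<beta> ` X)) + 2 * \<omega> * real (card X)"
proof -
  define blk where "blk b = {x \<in> X. \<beta> x = b}" for b
  have fb: "finite (blk b)" for b using X by (simp add: blk_def)
  have "\<exists>T. T \<subseteq> blk b \<and> card T = nat \<lfloor>\<Sum>x\<in>blk b. \<sigma> x\<rfloor>" for b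
  proof -
    have "(\<Sum>x\<in>blk b. \<sigma> x) \<le> (\<Sum>x\<in>blk b. 1)" using \<sigma>(2) by (intro sum_mono) (auto simp: blk_def)
    then have "nat \<lfloor>\<Sum>x\<in>blk b. \<sigma> x\<rfloor> \<le> card (blk b)" by simp linarith
    then show ?thesis using obtain_subset_with_card_n by metis
  qed
  then obtain T where T: "\<And>b. T b \<subseteq> blk b" "\<And>b. card (T b) = nat \<lfloor>\<Sum>x\<in>blk b. \<sigma> x\<rfloor>" by metis
  have fT: "finite (T b)" for b using T(1) fb finite_subset by blast
  have near: "\<bar>real (card (T b)) - (\<Sum>x\<in>blk b. \<sigma> x)\<bar> \<le> 1" for b
  proof -
    have "(\<Sum>x\<in>blk b. \<sigma> x) \<ge> 0" using \<sigma>(1) by (intro sum_nonneg) (auto simp: blk_def)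
    then have "real (card (T b)) = of_int \<lfloor>\<Sum>x\<in>blk b. \<sigma> x\<rfloor>" unfolding T(2) by simp
    then show ?thesis by linarith
  qed
  define S where "S = (\<Union>b\<in>\<beta> ` X. T b)"
  show thesis
  proof (rule that[of S])
    show "S \<subseteq> X" using T(1) unfolding S_def blk_def by blast
    fix \<phi> :: "'a \<Rightarrow> real" and B \<omega> :: real
    assume B: "\<And>x. x \<in> X \<Longrightarrow> \<bar>\<phi> x\<bar> \<le> B"
      and \<omega>: "\<And>x y. x \<in> X \<Longrightarrow> y \<in> X \<Longrightarrow> \<beta> x = \<beta> y \<Longrightarrow> \<bar>\<phi> x - \<phi> y\<bar> \<le> \<omega>"
    have sumS: "(\<Sum>x\<in>S. \<phi> x) = (\<Sum>b\<in>\<beta> ` X. \<Sum>x\<in>T b. \<phi> x)"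
      unfolding S_def
    proof (rule sum.UNION_disjoint)
      show "\<forall>b\<in>\<beta> ` X. \<forall>b'\<in>\<beta> ` X. b \<noteq> b' \<longrightarrow> T b \<inter> T b' = {}"
      proof -
        have "\<beta> x = b" if "x \<in> T b" for x b using T(1)[of b] that unfolding blk_def by blast
        then show ?thesis by (intro ballI impI) (metis disjoint_iff)
      qed
    qed (use X fT in auto)
    have sumX: "(\<Sum>x\<in>X. \<phi> x * \<sigma> x) = (\<Sum>b\<in>\<beta> ` X. \<Sum>x\<in>blk b. \<phi> x * \<sigma> x)"
      using sum.image_gen[OF X, of "\<lambda>x. \<phi> x * \<sigma> x" \<beta>] by (simp add: blk_def)
    have cardX: "real (card X) = (\<Sum>b\<in>\<beta> ` X. real (card (blk b)))"
      using sum.image_gen[OF X, of "\<lambda>x. 1::real" \<beta>] by (simp add: blk_def)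
    have one: "\<bar>(\<Sum>x\<in>T b. \<phi> x) - (\<Sum>x\<in>blk b. \<phi> x * \<sigma> x)\<bar> \<le> B + 2 * \<omega> * real (card (blk b))"
      if b: "b \<in> \<beta> ` X" for b
    proof -
      obtain z where z: "z \<in> X" "\<beta> z = b" using b by blast
      have close: "\<bar>\<phi> x - \<phi> z\<bar> \<le> \<omega>" if "x \<in> blk b" for x using \<omega> that z by (simp add: blk_def)
      have \<omega>0: "\<omega> \<ge> 0" using \<omega>[OF z(1) z(1)] by simp
      have cT: "card (T b) \<le> card (blk b)" using T(1) fb by (rule card_mono[rotated])
      have "\<bar>(\<Sum>x\<in>T b. \<phi> x - \<phi> z)\<bar> \<le> (\<Sum>x\<in>T b. \<omega>)"
        using close T(1) by (intro order_trans[OF sum_abs] sum_mono) blast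
      also have "\<dots> \<le> \<omega> * real (card (blk b))" using cT \<omega>0 by (simp add: mult.commute mult_left_mono)
      finally have 1: "\<bar>(\<Sum>x\<in>T b. \<phi> x - \<phi> z)\<bar> \<le> \<omega> * real (card (blk b))" .
      have "\<bar>(\<Sum>x\<in>blk b. (\<phi> x - \<phi> z) * \<sigma> x)\<bar> \<le> (\<Sum>x\<in>blk b. \<omega>)"
      proof (intro order_trans[OF sum_abs] sum_mono)
        fix x assume x: "x \<in> blk b"
        then have "0 \<le> \<sigma> x" "\<sigma> x \<le> 1" using \<sigma> by (auto simp: blk_def)
        then have "\<bar>\<phi> x - \<phi> z\<bar> * \<bar>\<sigma> x\<bar> \<le> \<omega> * 1" using close[OF x] by (intro mult_mono) auto
        then show "\<bar>(\<phi> x - \<phi> z) * \<sigma> x\<bar> \<le> \<omega>" by (simp add: abs_mult)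
      qed
      then have 2: "\<bar>(\<Sum>x\<in>blk b. (\<phi> x - \<phi> z) * \<sigma> x)\<bar> \<le> \<omega> * real (card (blk b))" by (simp add: mult.commute)
      have "\<bar>\<phi> z\<bar> * \<bar>real (card (T b)) - (\<Sum>x\<in>blk b. \<sigma> x)\<bar> \<le> B * 1"
        using B[OF z(1)] near by (intro mult_mono) auto
      then have 3: "\<bar>\<phi> z * (real (card (T b)) - (\<Sum>x\<in>blk b. \<sigma> x))\<bar> \<le> B" by (simp add: abs_mult)
      have "(\<Sum>x\<in>T b. \<phi> x) - (\<Sum>x\<in>blk b. \<phi> x * \<sigma> x)
        = (\<Sum>x\<in>T b. \<phi> x - \<phi> z) - (\<Sum>x\<in>blk b. (\<phi> x - \<phi> z) * \<sigma> x) + \<phi> z * (real (card (T b)) - (\<Sum>x\<in>blk b. \<sigma> x))"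
        by (simp add: sum_subtractf left_diff_distrib right_diff_distrib sum_distrib_left)
      then show ?thesis using 1 2 3 by linarith
    qed
    have "\<bar>(\<Sum>x\<in>S. \<phi> x) - (\<Sum>x\<in>X. \<phi> x * \<sigma> x)\<bar>
        = \<bar>\<Sum>b\<in>\<beta> ` X. (\<Sum>x\<in>T b. \<phi> x) - (\<Sum>x\<in>blk b. \<phi> x * \<sigma> x)\<bar>"
      by (simp add: sumS sumX sum_subtractf)
    also have "\<dots> \<le> (\<Sum>b\<in>\<beta> ` X. B + 2 * \<omega> * real (card (blk b)))"
      using one by (intro order_trans[OF sum_abs] sum_mono)
    also have "\<dots> = B * real (card (\<beta> ` X)) + 2 * \<omega> * real (card X)"
      by (simp add: sum.distrib cardX sum_distrib_left)
    finally show "\<bar>(\<Sum>x\<in>S. \<phi> x) - (\<Sum>x\<in>X. \<phi> x * \<sigma> x)\<bar> \<le> B * real (card (\<beta> ` X)) + 2 * \<omega> * real (card X)" .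
  qed
qed

text \<open>
  The extension of McShane: the largest \<open>L\<close>-Lipschitz function with the prescribed values.
\<close>
lemma lipschitz_extension_real:
  fixes h :: "'a::metric_space \<Rightarrow> real"
  assumes S: "finite S" "S \<noteq> {}" and lip: "L-lipschitz_on S h"
  obtains H where "L-lipschitz_on UNIV H" "\<And>x. x \<in> S \<Longrightarrow> H x = h x"
proof -
  have L: "L \<ge> 0" using lip by (rule lipschitz_on_nonneg)
  define H where "H x = Min ((\<lambda>s. h s + L * dist x s) ` S)" for x
  have fin: "finite ((\<lambda>s. h s + L * dist x s) ` S)" "(\<lambda>s. h s + L * dist x s) ` S \<noteq> {}" for x using S by auto
  have le: "H x \<le> H y + L * dist x y" for x y
  proof -
    obtain s where s: "s \<in> S" "H y = h s + L * dist y s" using Min_in[OF fin[of y]] unfolding H_def by blast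
    have "H x \<le> h s + L * dist x s" unfolding H_def using s(1) fin by (intro Min_le) auto
    also have "\<dots> \<le> h s + L * (dist x y + dist y s)" using L dist_triangle[of x s y] by (intro add_left_mono mult_left_mono)
    finally show ?thesis using s(2) by (simp add: algebra_simps)
  qed
  have "L-lipschitz_on UNIV H"
  proof (rule lipschitz_onI[OF _ L])
    fix x y :: 'a
    show "dist (H x) (H y) \<le> L * dist x y" using le[of x y] le[of y x] by (simp add: dist_real_def dist_commute abs_le_iff)
  qed
  moreover have "H x = h x" if x: "x \<in> S" for x
  proof (rule antisym)
    have "H x \<le> h x + L * dist x x" unfolding H_def by (rule Min_le[OF fin(1)]) (use x in blast)
    then show "H x \<le> h x" by simp
    show "h x \<le> H x" unfolding H_def
    proof (rule Min.boundedI[OF fin])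
      fix v assume "v \<in> (\<lambda>s. h s + L * dist x s) ` S"
      then obtain s where s: "s \<in> S" "v = h s + L * dist x s" by blast
      have "\<bar>h x - h s\<bar> \<le> L * dist x s" using lipschitz_onD[OF lip x s(1)] by (simp add: dist_real_def)
      then show "h x \<le> v" using s(2) by linarith
    qed
  qed
  ultimately show thesis using that by blast
qed

lemma lipschitz_extension:
  fixes h :: "'a::metric_space \<Rightarrow> 'b::euclidean_space"
  assumes S: "finite S" "S \<noteq> {}" and lip: "L-lipschitz_on S h"
  obtains H where "(real DIM('b) * L)-lipschitz_on UNIV H" "\<And>x. x \<in> S \<Longrightarrow> H x = h x"
proof -
  have L: "L \<ge> 0" using lip by (rule lipschitz_on_nonneg)
  have "\<exists>H. L-lipschitz_on UNIV H \<and> (\<forall>x\<in>S. H x = h x \<bullet> b)" if b: "b \<in> Basis" for b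
  proof -
    have "L-lipschitz_on S (\<lambda>x. h x \<bullet> b)"
    proof (rule lipschitz_onI[OF _ L])
      fix x y assume xy: "x \<in> S" "y \<in> S"
      have "\<bar>(h x - h y) \<bullet> b\<bar> \<le> norm (h x - h y)" by (rule Basis_le_norm[OF b])
      also have "\<dots> \<le> L * dist x y" using lipschitz_onD[OF lip xy] by (simp add: dist_norm)
      finally show "dist (h x \<bullet> b) (h y \<bullet> b) \<le> L * dist x y" by (simp add: dist_real_def inner_diff_left)
    qed
    from lipschitz_extension_real[OF S this] show ?thesis by metis
  qed
  then obtain H where H: "\<And>b. b \<in> Basis \<Longrightarrow> L-lipschitz_on UNIV (H b)" "\<And>b x. b \<in> Basis \<Longrightarrow> x \<in> S \<Longrightarrow> H b x = h x \<bullet> b"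
    by metis
  define K where "K x = (\<Sum>b\<in>Basis. H b x *\<^sub>R b)" for x
  have Kb: "K x \<bullet> b = H b x" if "b \<in> Basis" for x b
    using that by (simp add: K_def inner_sum_left inner_Basis if_distrib cong: if_cong)
  have "(real DIM('b) * L)-lipschitz_on UNIV K"
  proof (rule lipschitz_onI)
    fix x y :: 'a
    have "dist (K x) (K y) \<le> (\<Sum>b\<in>Basis. \<bar>(K x - K y) \<bullet> b\<bar>)" unfolding dist_norm by (rule norm_le_l1)
    also have "\<dots> \<le> (\<Sum>b\<in>(Basis :: 'b set). L * dist x y)"
    proof (rule sum_mono)
      fix b :: 'b assume b: "b \<in> Basis"
      show "\<bar>(K x - K y) \<bullet> b\<bar> \<le> L * dist x y"
        using lipschitz_onD[OF H(1)[OF b], of x y] b by (simp add: inner_diff_left Kb dist_real_def)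
    qed
    finally show "dist (K x) (K y) \<le> real DIM('b) * L * dist x y" by simp
  qed (use L in simp)
  moreover have "K x = h x" if "x \<in> S" for x
    by (rule euclidean_eqI) (simp add: Kb H(2)[OF _ that])
  ultimately show thesis using that by blast
qed

lemma largest_power_below:
  fixes c d :: nat
  assumes "d \<ge> 1" "c \<le> N ^ d"
  obtains m where "m ^ d \<le> c" "c < (m + 1) ^ d" "m \<le> N"
proof -
  define m where "m = (GREATEST m. m ^ d \<le> c)"
  have b: "y \<le> c" if "y ^ d \<le> c" for y using self_le_power[of y d] that assms(1) by (cases "y = 0") auto
  have 0: "0 ^ d \<le> c" using assms(1) by (simp add: zero_power)
  have m: "m ^ d \<le> c" unfolding m_def using GreatestI_nat[of "\<lambda>m. m ^ d \<le> c" 0 c] 0 b by blast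
  have "c < (m + 1) ^ d"
  proof (rule ccontr)
    assume "\<not> c < (m + 1) ^ d"
    then have "m + 1 \<le> m" unfolding m_def using Greatest_le_nat[of "\<lambda>m. m ^ d \<le> c" "m + 1" c] b by (simp add: m_def)
    then show False by simp
  qed
  moreover have "m \<le> N"
  proof (rule ccontr)
    assume "\<not> m \<le> N"
    then have "N ^ d < m ^ d" using assms(1) by (intro power_strict_mono) auto
    then show False using m assms(2) by simp
  qed
  ultimately show thesis using that m by blast
qed

text \<open>
  The next smaller \<open>d\<close>-th power is close on the scale of \<open>N^d\<close>, so that few points have to be deleted from
  a set in order to reach a cardinality that is a \<open>d\<close>-th power.
\<close>
lemma power_gap:
  fixes m N d :: nat
  assumes "m \<le> N" "N \<ge> 1"
  shows "(real (m + 1) ^ d - real m ^ d) / real N ^ d \<le> 2 ^ d * real d / real N"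
proof -
  \<comment> \<open>dividing by \<open>2 N\<close> brings \<open>m + 1\<close>, which may exceed \<open>N\<close>, into the unit interval\<close>
  define a b where "a = real (m + 1) / (2 * real N)" and "b = real m / (2 * real N)"
  have ab: "0 \<le> b" "b \<le> a" "a \<le> 1" "a - b = 1 / (2 * real N)"
    using assms by (auto simp: a_def b_def field_simps)
  have "norm (a ^ d - b ^ d) \<le> real d * norm (a - b)" by (rule norm_power_diff) (use ab in auto)
  then have "a ^ d - b ^ d \<le> real d * (1 / (2 * real N))" using ab by simp
  also have "\<dots> \<le> real d / real N" using assms(2) by (simp add: field_simps)
  finally have 1: "2 ^ d * (a ^ d - b ^ d) \<le> 2 ^ d * (real d / real N)" by (intro mult_left_mono) auto
  have e: "2 ^ d * (real x / (2 * real N)) ^ d = real x ^ d / real N ^ d" for x :: nat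
    by (simp add: power_divide power_mult_distrib)
  have "(real (m + 1) ^ d - real m ^ d) / real N ^ d = 2 ^ d * (a ^ d - b ^ d)"
    unfolding a_def b_def right_diff_distrib e by (simp add: diff_divide_distrib)
  then show ?thesis using 1 by simp
qed

section \<open>Limits of transports\<close>

text \<open>
  The integral of \<open>\<phi>\<close> over the cube \<open>[0, M]^d\<close>, written over the fixed unit cube so that its continuity in
  \<open>M\<close> is easy, also at \<open>M = 0\<close>.
\<close>
definition scaled_integral :: "real \<Rightarrow> ('a::euclidean_space \<Rightarrow> real) \<Rightarrow> real" where
  "scaled_integral M \<phi> = M ^ DIM('a) * (LINT x:unit_cube|lborel. \<phi> (M *\<^sub>R x))"

lemma unit_cube_sets: "(unit_cube :: 'a::euclidean_space set) \<in> sets lborel" "emeasure lborel (unit_cube :: 'a::euclidean_space set) < \<infinity>"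
  using compact_sets_lborel[OF compact_cbox] by auto

lemma vol_unit_cube: "vol (unit_cube :: 'a::euclidean_space set) = 1"
proof -
  have "vol (unit_cube :: 'a set) = (\<Prod>b\<in>Basis. (One - 0) \<bullet> (b::'a))"
    by (rule measure_lborel_cbox) auto
  then show ?thesis by simp
qed

lemma set_integral_unit_cube_const: "(LINT x:(unit_cube :: 'a::euclidean_space set)|lborel. k) = (k :: real)"
  using set_integral_const[OF unit_cube_sets(1)[where 'a='a], of k] unit_cube_sets(2)[where 'a='a] vol_unit_cube[where 'a='a]
  by simp

lemma unit_cube_norm: "x \<in> (unit_cube :: 'a::euclidean_space set) \<Longrightarrow> norm x \<le> real DIM('a)"
proof -
  assume x: "x \<in> (unit_cube :: 'a set)"
  have "norm x \<le> (\<Sum>b\<in>Basis. \<bar>x \<bullet> b\<bar>)" by (rule norm_le_l1)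
  also have "\<dots> \<le> (\<Sum>b\<in>(Basis::'a set). 1)" using x by (intro sum_mono) (auto simp: mem_box)
  finally show ?thesis by simp
qed

lemma set_integrable_unit_cube:
  assumes "continuous_on UNIV (\<phi> :: 'a::euclidean_space \<Rightarrow> real)"
  shows "set_integrable lborel unit_cube \<phi>"
  by (rule borel_integrable_compact[OF compact_cbox, unfolded set_integrable_def[symmetric]])
     (use assms continuous_on_subset in blast)

lemma continuous_bounded_unit_cube:
  assumes "continuous_on UNIV (\<phi> :: 'a::euclidean_space \<Rightarrow> real)"
  obtains B where "\<And>x. x \<in> unit_cube \<Longrightarrow> \<bar>\<phi> x\<bar> \<le> B"
proof -
  have "compact (\<phi> ` unit_cube)" using continuous_on_subset[OF assms] by (intro compact_continuous_image) auto
  then show thesis using that compact_imp_bounded bounded_real by (metis image_eqI)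
qed

lemma set_integral_close:
  fixes \<phi> \<psi> :: "'a::euclidean_space \<Rightarrow> real"
  assumes i: "set_integrable lborel unit_cube \<phi>" "set_integrable lborel unit_cube \<psi>"
    and c: "\<And>x. x \<in> unit_cube \<Longrightarrow> \<bar>\<phi> x - \<psi> x\<bar> \<le> \<epsilon>"
  shows "\<bar>(LINT x:unit_cube|lborel. \<phi> x) - (LINT x:unit_cube|lborel. \<psi> x)\<bar> \<le> \<epsilon>"
proof -
  have ci: "set_integrable lborel (unit_cube :: 'a set) (\<lambda>_. k)" for k :: real
    by (rule set_integrable_unit_cube) (rule continuous_on_const)
  have di: "set_integrable lborel unit_cube (\<lambda>x. \<phi> x - \<psi> x)" using i by (rule set_integral_diff(1))
  have "(LINT x:unit_cube|lborel. \<phi> x) - (LINT x:unit_cube|lborel. \<psi> x) = (LINT x:unit_cube|lborel. \<phi> x - \<psi> x)"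
    using set_integral_diff(2)[OF i] by simp
  moreover have "(LINT x:unit_cube|lborel. \<phi> x - \<psi> x) \<le> (LINT x:(unit_cube :: 'a set)|lborel. \<epsilon>)"
    by (rule set_integral_mono[OF di ci]) (use c in \<open>auto simp: abs_le_iff\<close>)
  moreover have "(LINT x:(unit_cube :: 'a set)|lborel. -\<epsilon>) \<le> (LINT x:unit_cube|lborel. \<phi> x - \<psi> x)"
    by (rule set_integral_mono[OF ci di]) (use c in \<open>auto simp: abs_le_iff algebra_simps\<close>)
  ultimately show ?thesis unfolding set_integral_unit_cube_const by linarith
qed

lemma uniformly_continuous_cball:
  fixes \<phi> :: "'a::euclidean_space \<Rightarrow> real"
  assumes "continuous_on UNIV \<phi>" "\<epsilon> > 0"
  obtains \<delta> where "\<delta> > 0" "\<And>x y. norm x \<le> B \<Longrightarrow> norm y \<le> B \<Longrightarrow> dist x y < \<delta> \<Longrightarrow> \<bar>\<phi> x - \<phi> y\<bar> < \<epsilon>"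
proof -
  have "uniformly_continuous_on (cball 0 B) \<phi>"
    using continuous_on_subset[OF assms(1)] by (intro compact_uniformly_continuous) auto
  then obtain \<delta> where "\<delta> > 0" "\<And>x y. x \<in> cball 0 B \<Longrightarrow> y \<in> cball 0 B \<Longrightarrow> dist y x < \<delta> \<Longrightarrow> dist (\<phi> y) (\<phi> x) < \<epsilon>"
    unfolding uniformly_continuous_on_def using assms(2) by metis
  then show thesis by (intro that[of \<delta>]) (auto simp: dist_real_def dist_commute)
qed

lemma scaled_integral_tendsto:
  fixes \<phi> :: "'a::euclidean_space \<Rightarrow> real"
  assumes \<phi>: "continuous_on UNIV \<phi>" and M: "M \<longlonglongrightarrow> m" "\<And>n. 0 \<le> M n \<and> M n \<le> 1"
  shows "(\<lambda>n. scaled_integral (M n) \<phi>) \<longlonglongrightarrow> scaled_integral m \<phi>"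
  unfolding scaled_integral_def
proof (intro tendsto_mult tendsto_power M(1))
  have m: "0 \<le> m" "m \<le> 1" using M LIMSEQ_le_const[OF M(1)] LIMSEQ_le_const2[OF M(1)] by auto
  have int: "set_integrable lborel unit_cube (\<lambda>x. \<phi> (c *\<^sub>R x))" for c
    by (rule set_integrable_unit_cube) (intro continuous_on_compose2[OF \<phi>] continuous_intros subset_UNIV)
  show "(\<lambda>n. LINT x:unit_cube|lborel. \<phi> (M n *\<^sub>R x)) \<longlonglongrightarrow> (LINT x:unit_cube|lborel. \<phi> (m *\<^sub>R x))"
  proof (rule LIMSEQ_I)
    fix \<epsilon> :: real assume \<epsilon>: "\<epsilon> > 0"
    obtain \<delta> where \<delta>: "\<delta> > 0" "\<And>x y. norm x \<le> real DIM('a) \<Longrightarrow> norm y \<le> real DIM('a) \<Longrightarrow> dist x y < \<delta> \<Longrightarrow> \<bar>\<phi> x - \<phi> y\<bar> < \<epsilon>/2"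
      using uniformly_continuous_cball[OF \<phi>, of "\<epsilon>/2"] \<epsilon> by (metis half_gt_zero)
    have "\<delta> / (real DIM('a) + 1) > 0" using \<delta>(1) by (simp add: add_nonneg_pos)
    then obtain n0 where n0: "\<And>n. n \<ge> n0 \<Longrightarrow> norm (M n - m) < \<delta> / (real DIM('a) + 1)" using LIMSEQ_D[OF M(1)] by metis
    have "norm ((LINT x:unit_cube|lborel. \<phi> (M n *\<^sub>R x)) - (LINT x:unit_cube|lborel. \<phi> (m *\<^sub>R x))) < \<epsilon>" if n: "n \<ge> n0" for n
    proof -
      have "\<bar>(LINT x:unit_cube|lborel. \<phi> (M n *\<^sub>R x)) - (LINT x:unit_cube|lborel. \<phi> (m *\<^sub>R x))\<bar> \<le> \<epsilon>/2"
      proof (rule set_integral_close[OF int int])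
        fix x :: 'a assume "x \<in> unit_cube"
        then have x: "norm x \<le> real DIM('a)" by (rule unit_cube_norm)
        have b: "norm (c *\<^sub>R x) \<le> real DIM('a)" if "0 \<le> c" "c \<le> 1" for c
          using mult_left_le_one_le[of "norm x" c] that x by simp
        have "dist (M n *\<^sub>R x) (m *\<^sub>R x) = \<bar>M n - m\<bar> * norm x" by (simp add: dist_norm flip: scaleR_diff_left)
        also have "\<dots> \<le> \<bar>M n - m\<bar> * (real DIM('a) + 1)" using x by (intro mult_left_mono) auto
        also have "\<dots> < \<delta>" using n0[OF n] by (simp add: pos_less_divide_eq add_nonneg_pos)
        finally show "\<bar>\<phi> (M n *\<^sub>R x) - \<phi> (m *\<^sub>R x)\<bar> \<le> \<epsilon>/2" using \<delta>(2)[of "M n *\<^sub>R x" "m *\<^sub>R x"] b M(2)[of n] m by fastforce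
      qed
      then show ?thesis using \<epsilon> by simp
    qed
    then show "\<exists>no. \<forall>n\<ge>no. norm ((LINT x:unit_cube|lborel. \<phi> (M n *\<^sub>R x)) - (LINT x:unit_cube|lborel. \<phi> (m *\<^sub>R x))) < \<epsilon>" by blast
  qed
qed

text \<open>
  The weak form of the condition in the locale \<open>transport\<close>: it is tested against continuous functions,
  and therefore survives limits.
\<close>
definition transports_to_cube :: "('a::euclidean_space \<Rightarrow> 'a) \<Rightarrow> ('a \<Rightarrow> real) \<Rightarrow> real \<Rightarrow> bool" where
  "transports_to_cube f \<rho> M \<longleftrightarrow> (\<forall>\<phi>. continuous_on UNIV \<phi> \<longrightarrow> (LINT x:unit_cube|lborel. \<phi> (f x) * \<rho> x) = scaled_integral M \<phi>)"

text \<open>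
  The functionals \<open>\<Phi> n\<close> stand for measures on the unit cube that converge to the measure with density \<open>\<rho>\<close>,
  and \<open>F n\<close> carries \<open>\<Phi> n\<close> to the cube of side \<open>M n\<close>, up to a vanishing error. By Arzela-Ascoli a
  subsequence of \<open>F n\<close> converges uniformly and the sides converge as well. The maps in \<open>\<phi> (F n x)\<close> may be
  replaced by their limit, because \<open>\<Phi> n\<close> is continuous for uniform convergence, uniformly in \<open>n\<close>. The
  statement is used both for counting measures and for densities.
\<close>
lemma transport_limit:
  fixes F :: "nat \<Rightarrow> 'a::euclidean_space \<Rightarrow> 'a" and \<Phi> :: "nat \<Rightarrow> ('a \<Rightarrow> real) \<Rightarrow> real"
  assumes lip: "\<And>n. L-lipschitz_on UNIV (F n)" and bnd: "\<And>n x. x \<in> unit_cube \<Longrightarrow> norm (F n x) \<le> B"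
    and M: "\<And>n. 0 \<le> M n \<and> M n \<le> 1"
    and close: "\<And>n \<phi> \<psi> \<epsilon>. continuous_on UNIV \<phi> \<Longrightarrow> continuous_on UNIV \<psi> \<Longrightarrow>
        (\<And>x. x \<in> unit_cube \<Longrightarrow> \<bar>\<phi> x - \<psi> x\<bar> \<le> \<epsilon>) \<Longrightarrow> \<bar>\<Phi> n \<phi> - \<Phi> n \<psi>\<bar> \<le> \<epsilon>"
    and lim: "\<And>\<psi>. continuous_on UNIV \<psi> \<Longrightarrow> (\<lambda>n. \<Phi> n \<psi>) \<longlonglongrightarrow> (LINT x:unit_cube|lborel. \<psi> x * \<rho> x)"
    and target: "\<And>\<phi>. continuous_on UNIV \<phi> \<Longrightarrow> (\<lambda>n. \<Phi> n (\<lambda>x. \<phi> (F n x)) - scaled_integral (M n) \<phi>) \<longlonglongrightarrow> 0"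
  obtains f m where "L-lipschitz_on UNIV f" "\<And>x. x \<in> unit_cube \<Longrightarrow> norm (f x) \<le> B" "0 \<le> m" "m \<le> 1" "transports_to_cube f \<rho> m"
proof -
  have L: "L \<ge> 0" using lip lipschitz_on_nonneg by blast
  have lipQ: "L-lipschitz_on unit_cube (F n)" for n using lipschitz_on_subset[OF lip] by blast
  obtain g k where gk: "continuous_on unit_cube g" "strict_mono (k :: nat \<Rightarrow> nat)"
    "\<And>e. 0 < e \<Longrightarrow> \<exists>N. \<forall>n x. n \<ge> N \<and> x \<in> unit_cube \<longrightarrow> norm (F (k n) x - g x) < e"
  proof (rule Arzela_Ascoli[of "unit_cube :: 'a set" F B])
    show "\<exists>d. 0 < d \<and> (\<forall>n y. y \<in> unit_cube \<and> norm (x - y) < d \<longrightarrow> norm (F n x - F n y) < e)"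
      if "x \<in> unit_cube" "0 < e" for x e using lipschitz_on_imp_equicont[OF lipQ that] .
  qed (use bnd in auto)
  have "seq_compact {0..1::real}" by (intro compact_imp_seq_compact) simp
  then obtain m r where mr: "m \<in> {0..1}" "strict_mono (r :: nat \<Rightarrow> nat)" "((\<lambda>n. M (k n)) \<circ> r) \<longlonglongrightarrow> m"
    unfolding seq_compact_def using M by (metis atLeastAtMost_iff)
  define q where "q n = k (r n)" for n
  have q: "strict_mono q" using gk(2) mr(2) by (simp add: q_def strict_mono_def)
  have Mq: "(\<lambda>n. M (q n)) \<longlonglongrightarrow> m" using mr(3) by (simp add: q_def o_def)
  have unif: "\<exists>N. \<forall>n x. n \<ge> N \<and> x \<in> unit_cube \<longrightarrow> norm (F (q n) x - g x) < e" if e: "e > 0" for e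
  proof -
    obtain N where N: "\<forall>n x. n \<ge> N \<and> x \<in> unit_cube \<longrightarrow> norm (F (k n) x - g x) < e" using gk(3)[OF e] by blast
    show ?thesis using N seq_suble[OF mr(2)] order_trans unfolding q_def by blast
  qed
  have ptw: "(\<lambda>n. F (q n) x) \<longlonglongrightarrow> g x" if "x \<in> unit_cube" for x
    using unif that by (intro LIMSEQ_I) blast
  \<comment> \<open>outside the cube the limit is continued by the nearest-point projection, which does not increase distances\<close>
  define f where "f x = g (closest_point unit_cube x)" for x
  have cp: "closest_point unit_cube x \<in> (unit_cube :: 'a set)" for x
    by (rule closest_point_in_set) (auto simp: box_ne_empty)
  have fg: "f x = g x" if "x \<in> unit_cube" for x using that by (simp add: f_def closest_point_self)
  have lipf: "L-lipschitz_on UNIV f"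
  proof (rule lipschitz_onI[OF _ L])
    fix x y :: 'a
    let ?x = "closest_point unit_cube x" and ?y = "closest_point unit_cube y"
    have "(\<lambda>n. dist (F (q n) ?x) (F (q n) ?y)) \<longlonglongrightarrow> dist (g ?x) (g ?y)" by (intro tendsto_dist ptw cp)
    moreover have "dist (F (q n) ?x) (F (q n) ?y) \<le> L * dist ?x ?y" for n using lipschitz_onD[OF lip] by blast
    ultimately have "dist (g ?x) (g ?y) \<le> L * dist ?x ?y" using LIMSEQ_le_const2 by blast
    also have "\<dots> \<le> L * dist x y"
      using L closest_point_lipschitz[of "unit_cube :: 'a set" x y] by (intro mult_left_mono) (auto simp: box_ne_empty convex_box)
    finally show "dist (f x) (f y) \<le> L * dist x y" by (simp add: f_def)
  qed
  have bndf: "norm (f x) \<le> B" if x: "x \<in> unit_cube" for x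
    using LIMSEQ_le_const2[OF tendsto_norm[OF ptw[OF x]]] bnd[OF x] fg[OF x] by auto
  have fc: "continuous_on UNIV f" using lipf by (rule lipschitz_on_continuous_on)
  have Fc: "continuous_on UNIV (F n)" for n using lip by (rule lipschitz_on_continuous_on)
  have "transports_to_cube f \<rho> m" unfolding transports_to_cube_def
  proof (intro allI impI)
    fix \<phi> :: "'a \<Rightarrow> real" assume \<phi>: "continuous_on UNIV \<phi>"
    have \<phi>f: "continuous_on UNIV (\<lambda>x. \<phi> (f x))" by (rule continuous_on_compose2[OF \<phi> fc]) simp
    have \<phi>F: "continuous_on UNIV (\<lambda>x. \<phi> (F n x))" for n by (rule continuous_on_compose2[OF \<phi> Fc]) simp
    have 1: "(\<lambda>n. \<Phi> (q n) (\<lambda>x. \<phi> (f x))) \<longlonglongrightarrow> (LINT x:unit_cube|lborel. \<phi> (f x) * \<rho> x)"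
      using LIMSEQ_subseq_LIMSEQ[OF lim[OF \<phi>f] q] by (simp add: o_def)
    have 2: "(\<lambda>n. \<Phi> (q n) (\<lambda>x. \<phi> (F (q n) x)) - scaled_integral (M (q n)) \<phi>) \<longlonglongrightarrow> 0"
      using LIMSEQ_subseq_LIMSEQ[OF target[OF \<phi>] q] by (simp add: o_def)
    have 3: "(\<lambda>n. scaled_integral (M (q n)) \<phi>) \<longlonglongrightarrow> scaled_integral m \<phi>"
      by (rule scaled_integral_tendsto[OF \<phi> Mq]) (rule M)
    have 4: "(\<lambda>n. \<Phi> (q n) (\<lambda>x. \<phi> (F (q n) x)) - \<Phi> (q n) (\<lambda>x. \<phi> (f x))) \<longlonglongrightarrow> 0"
    proof (rule LIMSEQ_I)
      fix \<epsilon> :: real assume \<epsilon>: "\<epsilon> > 0"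
      obtain \<delta> where \<delta>: "\<delta> > 0" "\<And>x y. norm x \<le> B \<Longrightarrow> norm y \<le> B \<Longrightarrow> dist x y < \<delta> \<Longrightarrow> \<bar>\<phi> x - \<phi> y\<bar> < \<epsilon>/2"
        using uniformly_continuous_cball[OF \<phi>, of "\<epsilon>/2"] \<epsilon> by (metis half_gt_zero)
      obtain N where N: "\<And>n x. n \<ge> N \<Longrightarrow> x \<in> unit_cube \<Longrightarrow> norm (F (q n) x - g x) < \<delta>" using unif[OF \<delta>(1)] by blast
      have "\<bar>\<Phi> (q n) (\<lambda>x. \<phi> (F (q n) x)) - \<Phi> (q n) (\<lambda>x. \<phi> (f x))\<bar> \<le> \<epsilon>/2" if n: "n \<ge> N" for n
      proof (rule close[OF \<phi>F \<phi>f])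
        fix x :: 'a assume x: "x \<in> unit_cube"
        have "dist (F (q n) x) (f x) < \<delta>" using N[OF n x] fg[OF x] by (simp add: dist_norm)
        then show "\<bar>\<phi> (F (q n) x) - \<phi> (f x)\<bar> \<le> \<epsilon>/2" using \<delta>(2)[OF bnd[OF x] bndf[OF x]] by (simp add: less_imp_le)
      qed
      then show "\<exists>no. \<forall>n\<ge>no. norm (\<Phi> (q n) (\<lambda>x. \<phi> (F (q n) x)) - \<Phi> (q n) (\<lambda>x. \<phi> (f x)) - 0) < \<epsilon>"
        using \<epsilon> by (intro exI[of _ N]) force
    qed
    have "(\<lambda>n. \<Phi> (q n) (\<lambda>x. \<phi> (f x))) \<longlonglongrightarrow> 0 + scaled_integral m \<phi> - 0"
      using tendsto_diff[OF tendsto_add[OF 2 3] 4] by simp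
    then show "(LINT x:unit_cube|lborel. \<phi> (f x) * \<rho> x) = scaled_integral m \<phi>"
      using LIMSEQ_unique[OF 1] by simp
  qed
  then show thesis using that[of f m] lipf bndf mr(1) by auto
qed

text \<open>
  The indicator function of a compact set is the pointwise limit of the continuous functions
  \<open>max 0 (1 - n * infdist y E)\<close>, and dominated convergence applies on both sides.
\<close>
lemma transport_of_transports_to_cube:
  fixes f :: "'a::euclidean_space \<Rightarrow> 'a"
  assumes lip: "L-lipschitz_on UNIV f" and \<rho>: "\<rho> \<in> borel_measurable borel" "\<And>x. 1/2 \<le> \<rho> x" "\<And>x. \<rho> x \<le> 1"
    and M: "0 \<le> M" and tr: "transports_to_cube f \<rho> M"
  shows "transport f \<rho> L (cbox 0 (M *\<^sub>R One))"
proof (unfold_locales)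
  have \<rho>0: "0 \<le> \<rho> x" for x using \<rho>(2)[of x] by linarith
  have fc: "continuous_on UNIV f" using lip by (rule lipschitz_on_continuous_on)
  fix E :: "'a set" assume E: "compact E"
  have cE: "closed E" using E by (rule compact_imp_closed)
  have one: "(LINT x:unit_cube|lborel. \<rho> x) = M ^ DIM('a)"
  proof -
    have "(LINT x:unit_cube|lborel. \<rho> x) = scaled_integral M (\<lambda>x::'a. 1)"
      using tr[unfolded transports_to_cube_def, rule_format, of "\<lambda>x. 1"] by simp
    also have "\<dots> = M ^ DIM('a)"
      by (simp add: scaled_integral_def set_integral_unit_cube_const)
    finally show ?thesis .
  qed
  have "1/2 * vol (unit_cube :: 'a set) \<le> (LINT x:unit_cube|lborel. \<rho> x)"
    by (rule set_integral_bounds(1)[OF unit_cube_sets \<rho>(1)]) (use \<rho> in auto)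
  then have "M ^ DIM('a) > 0" using one vol_unit_cube[where 'a='a] by simp
  then have M0: "M > 0" using M by (cases "M = 0") (auto simp: zero_power)
  show "(LINT x:(unit_cube \<inter> f -` E)|lborel. \<rho> x) = vol (E \<inter> cbox 0 (M *\<^sub>R One))"
  proof (cases "E = {}")
    case False
    define \<phi> where "\<phi> n y = max 0 (1 - real n * infdist y E)" for n y
    have \<phi>c: "continuous_on UNIV (\<phi> n)" for n unfolding \<phi>_def by (intro continuous_intros)
    have \<phi>b: "0 \<le> \<phi> n y" "\<phi> n y \<le> 1" for n y
      using infdist_nonneg[of y E] by (auto simp: \<phi>_def)
    have \<phi>lim: "(\<lambda>n. \<phi> n y) \<longlonglongrightarrow> indicat_real E y" for y
    proof (cases "y \<in> E")
      case True then show ?thesis by (simp add: \<phi>_def)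
    next
      case F: False
      then have d: "infdist y E > 0" using cE False infdist_pos_not_in_closed by blast
      obtain n0 where n0: "1 / infdist y E \<le> real n0" using real_arch_simple by blast
      have "\<phi> n y = 0" if "n \<ge> n0" for n
      proof -
        have "1 / infdist y E \<le> real n" using n0 that by linarith
        then have "1 \<le> real n * infdist y E" using d by (simp add: pos_divide_le_eq)
        then show ?thesis by (simp add: \<phi>_def)
      qed
      then have "\<forall>\<^sub>F n in sequentially. \<phi> n y = 0" unfolding eventually_sequentially by blast
      then show ?thesis using F by (simp add: tendsto_eventually)
    qed
    have \<phi>m: "\<phi> n \<in> borel_measurable borel" for n using \<phi>c by (rule borel_measurable_continuous_onI)
    have fm: "f \<in> borel_measurable borel" using fc by (rule borel_measurable_continuous_onI)
    have Em: "indicat_real E \<in> borel_measurable borel" using cE by (intro borel_measurable_indicator) auto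
    have meas: "(\<lambda>x. indicat_real unit_cube x *\<^sub>R (g (h x) * k x)) \<in> borel_measurable lborel"
      if "g \<in> borel_measurable borel" "h \<in> borel_measurable borel" "k \<in> borel_measurable borel"
      for g k :: "'a \<Rightarrow> real" and h :: "'a \<Rightarrow> 'a"
    proof -
      have "(\<lambda>x. indicat_real unit_cube x *\<^sub>R (g (h x) * k x)) \<in> borel_measurable borel"
        using that by (intro borel_measurable_scaleR borel_measurable_times borel_measurable_indicator measurable_compose[OF that(2,1)]) auto
      then show ?thesis by simp
    qed
    have Mm: "(\<lambda>x. M *\<^sub>R x) \<in> borel_measurable (borel :: 'a measure)"
      by (intro borel_measurable_continuous_onI continuous_intros)
    have w: "integrable lborel (indicat_real (unit_cube :: 'a set))" using unit_cube_sets by (simp add: integrable_indicator_iff)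
    have L1: "(\<lambda>n. LINT x:unit_cube|lborel. \<phi> n (f x) * \<rho> x) \<longlonglongrightarrow> (LINT x:unit_cube|lborel. indicat_real E (f x) * \<rho> x)"
      unfolding set_lebesgue_integral_def
    proof (rule integral_dominated_convergence[OF _ _ w])
      show "(\<lambda>x. indicat_real unit_cube x *\<^sub>R (indicat_real E (f x) * \<rho> x)) \<in> borel_measurable lborel"
        by (rule meas[OF Em fm \<rho>(1)])
      show "(\<lambda>x. indicat_real unit_cube x *\<^sub>R (\<phi> n (f x) * \<rho> x)) \<in> borel_measurable lborel" for n
        by (rule meas[OF \<phi>m fm \<rho>(1)])
      show "AE x in lborel. (\<lambda>n. indicat_real unit_cube x *\<^sub>R (\<phi> n (f x) * \<rho> x)) \<longlonglongrightarrow> indicat_real unit_cube x *\<^sub>R (indicat_real E (f x) * \<rho> x)"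
        by (intro AE_I2 tendsto_intros \<phi>lim)
      show "AE x in lborel. norm (indicat_real unit_cube x *\<^sub>R (\<phi> n (f x) * \<rho> x)) \<le> indicat_real unit_cube x" for n
      proof (rule AE_I2)
        fix x :: 'a
        have "\<phi> n (f x) * \<rho> x \<le> 1 * 1" using \<phi>b \<rho>(3) \<rho>0 by (intro mult_mono) auto
        then show "norm (indicat_real unit_cube x *\<^sub>R (\<phi> n (f x) * \<rho> x)) \<le> indicat_real unit_cube x"
          using \<phi>b(1)[of n "f x"] \<rho>0[of x] by (simp add: indicator_def)
      qed
    qed
    have L2: "(\<lambda>n. scaled_integral M (\<phi> n)) \<longlonglongrightarrow> M ^ DIM('a) * (LINT x:unit_cube|lborel. indicat_real E (M *\<^sub>R x))"
      unfolding scaled_integral_def set_lebesgue_integral_def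
    proof (intro tendsto_mult tendsto_const, rule integral_dominated_convergence[OF _ _ w])
      show "(\<lambda>x. indicat_real unit_cube x *\<^sub>R indicat_real E (M *\<^sub>R x)) \<in> borel_measurable lborel"
        using meas[OF Em Mm, of "\<lambda>x. 1"] by simp
      show "(\<lambda>x. indicat_real unit_cube x *\<^sub>R \<phi> n (M *\<^sub>R x)) \<in> borel_measurable lborel" for n
        using meas[OF \<phi>m Mm, of "\<lambda>x. 1"] by simp
      show "AE x in lborel. (\<lambda>n. indicat_real unit_cube x *\<^sub>R \<phi> n (M *\<^sub>R x)) \<longlonglongrightarrow> indicat_real unit_cube x *\<^sub>R indicat_real E (M *\<^sub>R x)"
        by (intro AE_I2 tendsto_intros \<phi>lim)
      show "AE x in lborel. norm (indicat_real unit_cube x *\<^sub>R \<phi> n (M *\<^sub>R x)) \<le> indicat_real unit_cube x" for n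
        using \<phi>b by (intro AE_I2) (simp add: indicator_def)
    qed
    have "(\<lambda>n. LINT x:unit_cube|lborel. \<phi> n (f x) * \<rho> x) = (\<lambda>n. scaled_integral M (\<phi> n))"
      using tr \<phi>c unfolding transports_to_cube_def by blast
    then have eq: "(LINT x:unit_cube|lborel. indicat_real E (f x) * \<rho> x) = M ^ DIM('a) * (LINT x:unit_cube|lborel. indicat_real E (M *\<^sub>R x))"
      using L1 L2 LIMSEQ_unique by metis
    have lhs: "(LINT x:(unit_cube \<inter> f -` E)|lborel. \<rho> x) = (LINT x:unit_cube|lborel. indicat_real E (f x) * \<rho> x)"
      unfolding set_lebesgue_integral_def by (intro Bochner_Integration.integral_cong refl) (simp add: indicator_def)
    define P where "P = {x \<in> unit_cube. M *\<^sub>R x \<in> E}"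
    have cP: "compact P"
    proof -
      have "P = unit_cube \<inter> (\<lambda>x. M *\<^sub>R x) -` E" by (auto simp: P_def)
      moreover have "closed ((\<lambda>x. M *\<^sub>R x) -` E)" by (rule closed_vimage[OF cE]) (intro continuous_intros)
      ultimately show ?thesis by (simp add: compact_Int_closed)
    qed
    have "(LINT x:unit_cube|lborel. indicat_real E (M *\<^sub>R x)) = (LINT x|lborel. indicat_real P x)"
      unfolding set_lebesgue_integral_def by (intro Bochner_Integration.integral_cong refl) (simp add: indicator_def P_def)
    also have "\<dots> = vol P" by simp
    finally have rhs: "(LINT x:unit_cube|lborel. indicat_real E (M *\<^sub>R x)) = vol P" .
    have "(\<lambda>x. M *\<^sub>R x) ` P = E \<inter> cbox 0 (M *\<^sub>R One)"
    proof (intro equalityI subsetI)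
      fix y assume "y \<in> (\<lambda>x. M *\<^sub>R x) ` P"
      then obtain x where x: "x \<in> unit_cube" "M *\<^sub>R x \<in> E" "y = M *\<^sub>R x" by (auto simp: P_def)
      have "M * (x \<bullet> b) \<le> M * 1 \<and> 0 \<le> M * (x \<bullet> b)" if "b \<in> Basis" for b
        using x(1) that M0 by (auto simp: mem_box intro!: mult_left_le)
      then show "y \<in> E \<inter> cbox 0 (M *\<^sub>R One)" using x by (simp add: mem_box)
    next
      fix y assume y: "y \<in> E \<inter> cbox 0 (M *\<^sub>R One)"
      have "(1/M) *\<^sub>R y \<in> P" using y M0 by (auto simp: P_def mem_box divide_le_eq)
      moreover have "y = M *\<^sub>R ((1/M) *\<^sub>R y)" using M0 by simp
      ultimately show "y \<in> (\<lambda>x. M *\<^sub>R x) ` P" by blast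
    qed
    moreover have "vol ((\<lambda>x. M *\<^sub>R x) ` P) = M ^ DIM('a) * vol P"
    proof -
      have c: "compact ((\<lambda>x. M *\<^sub>R x) ` P)" using cP by (intro compact_continuous_image continuous_intros)
      have "measure lebesgue ((\<lambda>x. M *\<^sub>R x) ` P) = \<bar>M\<bar> ^ DIM('a) * measure lebesgue P" 
        using measure_lebesgue_affine[of M 0 P] by simp
      then show ?thesis using M0 compact_sets_lborel[OF c] compact_sets_lborel[OF cP] by simp
    qed
    ultimately show ?thesis using eq lhs rhs by simp
  qed (simp add: set_lebesgue_integral_def)
qed (use lip \<rho> in auto)

section \<open>Discretising a density by lattice points\<close>

lemma grid_iff_Basis:
  fixes y :: "real ^ 'd::finite"
  shows "y \<in> grid n \<longleftrightarrow> (\<forall>b\<in>Basis. y \<bullet> b \<in> real ` {1..n})"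
proof -
  have B: "(Basis :: (real ^ 'd) set) = range (\<lambda>i. axis i 1)" by (auto simp: Basis_vec_def)
  show ?thesis unfolding grid_def B by (simp add: inner_axis)
qed

lemma finite_grid: "finite (grid n :: (real ^ 'd::finite) set)"
proof (cases "n = 0")
  case True then show ?thesis by (simp add: grid_def)
next
  case False
  then have "card (grid n :: (real ^ 'd) set) > 0" by (simp add: card_grid)
  then show ?thesis by (rule card_ge_0_finite)
qed

lemma grid_scaled_in_unit_cube:
  assumes "y \<in> grid m" "m \<le> n" "n \<ge> 1"
  shows "(1 / real n) *\<^sub>R y \<in> unit_cube"
proof -
  have "0 \<le> y \<bullet> b / real n \<and> y \<bullet> b / real n \<le> 1" if "b \<in> Basis" for b
    using assms that unfolding grid_iff_Basis by (auto dest!: bspec)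
  then show ?thesis by (simp add: mem_box)
qed

text \<open>
  The half-open cube of side \<open>1/m\<close> whose largest corner is \<open>y/m\<close>; these cells tile the half-open unit cube.
\<close>
definition grid_cell :: "nat \<Rightarrow> real ^ 'd::finite \<Rightarrow> (real ^ 'd) set" where
  "grid_cell m y = {x. \<forall>b\<in>Basis. y \<bullet> b - 1 < real m * (x \<bullet> b) \<and> real m * (x \<bullet> b) \<le> y \<bullet> b}"

lemma grid_cell_measure:
  fixes y :: "real ^ 'd::finite"
  assumes m: "m \<ge> 1"
  shows "grid_cell m y \<in> sets lborel" "emeasure lborel (grid_cell m y) < \<infinity>" "vol (grid_cell m y) = (1 / real m) ^ CARD('d)"
proof -
  define lo hi where "lo = (1 / real m) *\<^sub>R (y - One)" and "hi = (1 / real m) *\<^sub>R y"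
  have "grid_cell m y = (\<Inter>b\<in>Basis. {x. y \<bullet> b - 1 < real m * (x \<bullet> b)} \<inter> {x. real m * (x \<bullet> b) \<le> y \<bullet> b})"
    by (auto simp: grid_cell_def)
  moreover have "{x. y \<bullet> b - 1 < real m * (x \<bullet> b)} \<in> sets borel" for b
    by (intro borel_open open_Collect_less continuous_intros)
  moreover have "{x. real m * (x \<bullet> b) \<le> y \<bullet> b} \<in> sets borel" for b
    by (intro borel_closed closed_Collect_le continuous_intros)
  ultimately show s: "grid_cell m y \<in> sets lborel" by (auto intro!: sets.finite_INT)
  have sub: "box lo hi \<subseteq> grid_cell m y" "grid_cell m y \<subseteq> cbox lo hi"
  proof -
    have lo: "lo \<bullet> b < t \<longleftrightarrow> y \<bullet> b - 1 < real m * t" "lo \<bullet> b \<le> t \<longleftrightarrow> y \<bullet> b - 1 \<le> real m * t" if "b \<in> Basis" for b t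
      using that m by (simp_all add: lo_def inner_diff_left field_simps)
    have hi: "t < hi \<bullet> b \<longleftrightarrow> real m * t < y \<bullet> b" "t \<le> hi \<bullet> b \<longleftrightarrow> real m * t \<le> y \<bullet> b" for b t
      using m by (simp_all add: hi_def field_simps)
    show "box lo hi \<subseteq> grid_cell m y" "grid_cell m y \<subseteq> cbox lo hi"
      by (auto simp: grid_cell_def mem_box lo hi less_imp_le)
  qed
  have le: "\<forall>b\<in>Basis. lo \<bullet> b \<le> hi \<bullet> b" using m by (simp add: lo_def hi_def inner_diff_left divide_right_mono)
  have e: "(\<Prod>b\<in>Basis. (hi - lo) \<bullet> b) = (1 / real m) ^ CARD('d)"
  proof -
    have "(hi - lo) \<bullet> b = 1 / real m" if "b \<in> Basis" for b
      using that by (simp add: hi_def lo_def inner_diff_left diff_divide_distrib)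
    then show ?thesis by simp
  qed
  have vb: "vol (box lo hi) = (1 / real m) ^ CARD('d)" unfolding measure_lborel_box_eq using le e by simp
  have vc: "vol (cbox lo hi) = (1 / real m) ^ CARD('d)" unfolding measure_lborel_cbox_eq using le e by simp
  have fc: "cbox lo hi \<in> fmeasurable lborel" by (rule compact_fmeasurable) simp
  have fg: "grid_cell m y \<in> fmeasurable lborel" by (rule fmeasurableI2[OF fc sub(2) s])
  then show "emeasure lborel (grid_cell m y) < \<infinity>" by (simp add: fmeasurable_def)
  have "vol (box lo hi) \<le> vol (grid_cell m y)" by (rule measure_mono_fmeasurable[OF sub(1) _ fg]) simp
  moreover have "vol (grid_cell m y) \<le> vol (cbox lo hi)" by (rule measure_mono_fmeasurable[OF sub(2) s fc])
  ultimately show "vol (grid_cell m y) = (1 / real m) ^ CARD('d)" using vb vc by simp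
qed

lemma grid_cells_disjoint: "disjoint_family_on (grid_cell m) (grid m :: (real ^ 'd::finite) set)"
proof (unfold disjoint_family_on_def, intro ballI impI, rule ccontr)
  fix y y' :: "real ^ 'd" assume y: "y \<in> grid m" "y' \<in> grid m" "y \<noteq> y'" "grid_cell m y \<inter> grid_cell m y' \<noteq> {}"
  then obtain x where x: "x \<in> grid_cell m y" "x \<in> grid_cell m y'" by blast
  have "y \<bullet> b = y' \<bullet> b" if b: "b \<in> Basis" for b
  proof -
    obtain i j :: nat where ij: "y \<bullet> b = real i" "y' \<bullet> b = real j" using y(1,2) b unfolding grid_iff_Basis by blast
    have "real i - 1 < real m * (x \<bullet> b)" "real m * (x \<bullet> b) \<le> real i" "real j - 1 < real m * (x \<bullet> b)" "real m * (x \<bullet> b) \<le> real j"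
      using x b ij unfolding grid_cell_def by auto
    then have "i = j" by linarith
    then show ?thesis using ij by simp
  qed
  then show False using y(3) euclidean_eqI by blast
qed

lemma grid_cells_cover:
  assumes m: "m \<ge> 1"
  shows "(\<Union>y\<in>grid m. grid_cell m y) = {x :: real ^ 'd::finite. \<forall>b\<in>Basis. 0 < x \<bullet> b \<and> x \<bullet> b \<le> 1}"
proof (intro equalityI subsetI)
  fix x :: "real ^ 'd" assume "x \<in> (\<Union>y\<in>grid m. grid_cell m y)"
  then obtain y where y: "y \<in> grid m" "x \<in> grid_cell m y" by blast
  have "0 < x \<bullet> b \<and> x \<bullet> b \<le> 1" if b: "b \<in> Basis" for b
  proof -
    obtain i where i: "i \<in> {1..m}" "y \<bullet> b = real i" using y(1) b unfolding grid_iff_Basis by blast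
    have "real i - 1 < real m * (x \<bullet> b)" "real m * (x \<bullet> b) \<le> real i" using y(2) b i unfolding grid_cell_def by auto
    moreover have "1 \<le> real i" "real i \<le> real m" using i by auto
    ultimately have "0 < real m * (x \<bullet> b)" "real m * (x \<bullet> b) \<le> real m * 1" by linarith+
    moreover have "real m > 0" using m by simp
    ultimately show ?thesis by (meson mult_left_le_imp_le zero_less_mult_pos)
  qed
  then show "x \<in> {x. \<forall>b\<in>Basis. 0 < x \<bullet> b \<and> x \<bullet> b \<le> 1}" by blast
next
  fix x :: "real ^ 'd" assume "x \<in> {x. \<forall>b\<in>Basis. 0 < x \<bullet> b \<and> x \<bullet> b \<le> 1}"
  then have x: "\<And>b. b \<in> Basis \<Longrightarrow> 0 < x \<bullet> b \<and> x \<bullet> b \<le> 1" by blast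
  define y where "y = (\<Sum>b\<in>Basis. of_int \<lceil>real m * (x \<bullet> b)\<rceil> *\<^sub>R b)"
  have yb: "y \<bullet> b = of_int \<lceil>real m * (x \<bullet> b)\<rceil>" if "b \<in> Basis" for b
    using that by (simp add: y_def inner_sum_left inner_Basis if_distrib cong: if_cong)
  have "y \<bullet> b \<in> real ` {1..m}" if b: "b \<in> Basis" for b
  proof -
    have "0 < real m * (x \<bullet> b)" using x[OF b] m by simp
    then have 1: "\<lceil>real m * (x \<bullet> b)\<rceil> \<ge> 1" by linarith
    have "real m * (x \<bullet> b) \<le> real m * 1" using x[OF b] by (intro mult_left_mono) auto
    then have 2: "\<lceil>real m * (x \<bullet> b)\<rceil> \<le> int m" by (simp add: ceiling_le_iff)
    have "y \<bullet> b = real (nat \<lceil>real m * (x \<bullet> b)\<rceil>)" using yb[OF b] 1 by simp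
    moreover have "nat z \<in> {1..m}" if "z \<ge> 1" "z \<le> int m" for z using that by auto
    then have "nat \<lceil>real m * (x \<bullet> b)\<rceil> \<in> {1..m}" using 1 2 by blast
    ultimately show ?thesis by blast
  qed
  then have "y \<in> grid m" unfolding grid_iff_Basis by blast
  moreover have "x \<in> grid_cell m y" unfolding grid_cell_def using yb by (auto simp: of_int_ceiling_diff_one_le) linarith+
  ultimately show "x \<in> (\<Union>y\<in>grid m. grid_cell m y)" by blast
qed

lemma grid_riemann_sum:
  fixes \<phi> :: "real ^ 'd::finite \<Rightarrow> real"
  assumes m: "m \<ge> 1" and \<phi>: "continuous_on UNIV \<phi>"
    and \<omega>: "\<And>x y. x \<in> unit_cube \<Longrightarrow> y \<in> unit_cube \<Longrightarrow> dist x y \<le> real CARD('d) / real m \<Longrightarrow> \<bar>\<phi> x - \<phi> y\<bar> \<le> \<omega>"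
  shows "\<bar>(\<Sum>y\<in>grid m. \<phi> ((1 / real m) *\<^sub>R y)) / real m ^ CARD('d) - (LINT x:unit_cube|lborel. \<phi> x)\<bar> \<le> \<omega>"
proof -
  define H where "H = {x :: real ^ 'd. \<forall>b\<in>Basis. 0 < x \<bullet> b \<and> x \<bullet> b \<le> 1}"
  have Hcov: "H = (\<Union>y\<in>grid m. grid_cell m y)" by (simp only: H_def grid_cells_cover[OF m])
  have Hm: "H \<in> sets lborel" unfolding Hcov by (intro sets.finite_UN finite_grid grid_cell_measure(1) m)
  have Hsub: "H \<subseteq> unit_cube" "box 0 One \<subseteq> H" by (auto simp: H_def mem_box less_imp_le)
  have \<phi>m: "\<phi> \<in> borel_measurable borel" using \<phi> by (rule borel_measurable_continuous_onI)
  obtain B where B: "\<And>x. x \<in> unit_cube \<Longrightarrow> \<bar>\<phi> x\<bar> \<le> B" using continuous_bounded_unit_cube[OF \<phi>] by metis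
  have N: "unit_cube - H \<in> sets lborel" "emeasure lborel (unit_cube - H) < \<infinity>" "vol (unit_cube - H) = 0"
  proof -
    show s: "unit_cube - H \<in> sets lborel" using Hm by auto
    have "vol (unit_cube - H) \<le> vol (unit_cube - box 0 One :: (real ^ 'd) set)"
      using Hsub s by (intro measure_mono_fmeasurable) (auto intro!: compact_fmeasurable compact_diff)
    also have "\<dots> = vol (unit_cube :: (real ^ 'd) set) - vol (box 0 One :: (real ^ 'd) set)"
      using box_subset_cbox compact_sets_lborel[OF compact_cbox[of "0 :: real ^ 'd" One]] by (intro measure_Diff) auto
    also have "\<dots> = 0" by (simp add: measure_lborel_cbox_eq measure_lborel_box_eq)
    finally show "vol (unit_cube - H) = 0" using measure_nonneg[of lborel "unit_cube - H"] by linarith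
    show "emeasure lborel (unit_cube - H) < \<infinity>"
      using emeasure_mono[of "unit_cube - H" unit_cube lborel] compact_sets_lborel[OF compact_cbox[of "0 :: real ^ 'd" One]]
      by (auto intro: le_less_trans)
  qed
  have i1: "set_integrable lborel H \<phi>"
    by (rule set_integrable_subset[OF set_integrable_unit_cube[OF \<phi>] Hm Hsub(1)])
  have i2: "set_integrable lborel (unit_cube - H) \<phi>"
    by (rule set_integrable_subset[OF set_integrable_unit_cube[OF \<phi>] N(1)]) blast
  have "(LINT x:(unit_cube - H)|lborel. \<phi> x) = 0"
    using set_integral_bounds[OF N(1,2) \<phi>m, of "-B" B] B N(3) by (fastforce simp: abs_le_iff)
  moreover have "unit_cube = H \<union> (unit_cube - H)" using Hsub by blast
  ultimately have LH: "(LINT x:unit_cube|lborel. \<phi> x) = (LINT x:H|lborel. \<phi> x)"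
    using set_integral_Un[of H "unit_cube - H" lborel \<phi>] i1 i2 by auto
  have "(LINT x:H|lborel. \<phi> x) = (\<Sum>y\<in>grid m. LINT x:grid_cell m y|lborel. \<phi> x)"
    unfolding Hcov
  proof (rule set_integral_finite_Union[OF finite_grid grid_cells_disjoint])
    fix y :: "real ^ 'd" assume y: "y \<in> grid m"
    show "set_integrable lborel (grid_cell m y) \<phi>"
      by (rule set_integrable_subset[OF i1 grid_cell_measure(1)[OF m]]) (use y Hcov in blast)
  qed (rule grid_cell_measure(1)[OF m])
  moreover have cell: "\<bar>\<phi> ((1 / real m) *\<^sub>R y) * (1 / real m) ^ CARD('d) - (LINT x:grid_cell m y|lborel. \<phi> x)\<bar> \<le> \<omega> * (1 / real m) ^ CARD('d)"
    if y: "y \<in> grid m" for y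
  proof -
    have osc: "\<bar>\<phi> x - \<phi> ((1 / real m) *\<^sub>R y)\<bar> \<le> \<omega>" if x: "x \<in> grid_cell m y" for x
    proof (rule \<omega>)
      show "x \<in> unit_cube" using x y Hcov Hsub(1) by blast
      show "(1 / real m) *\<^sub>R y \<in> unit_cube" by (rule grid_scaled_in_unit_cube[OF y order_refl m])
      have "dist x ((1 / real m) *\<^sub>R y) \<le> (\<Sum>b\<in>Basis. \<bar>(x - (1 / real m) *\<^sub>R y) \<bullet> b\<bar>)" unfolding dist_norm by (rule norm_le_l1)
      also have "\<dots> \<le> (\<Sum>b\<in>(Basis :: (real ^ 'd) set). 1 / real m)"
      proof (rule sum_mono)
        fix b :: "real ^ 'd" assume b: "b \<in> Basis"
        have "y \<bullet> b - 1 < real m * (x \<bullet> b)" "real m * (x \<bullet> b) \<le> y \<bullet> b" using x b by (auto simp: grid_cell_def)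
        then have "\<bar>real m * (x \<bullet> b) - y \<bullet> b\<bar> / real m \<le> 1 / real m" by (intro divide_right_mono) auto
        moreover have "(x - (1 / real m) *\<^sub>R y) \<bullet> b = (real m * (x \<bullet> b) - y \<bullet> b) / real m"
          using m by (simp add: inner_diff_left diff_divide_distrib)
        ultimately show "\<bar>(x - (1 / real m) *\<^sub>R y) \<bullet> b\<bar> \<le> 1 / real m" by (simp add: abs_divide)
      qed
      finally show "dist x ((1 / real m) *\<^sub>R y) \<le> real CARD('d) / real m" by simp
    qed
    have o': "\<phi> ((1 / real m) *\<^sub>R y) - \<omega> \<le> \<phi> x" "\<phi> x \<le> \<phi> ((1 / real m) *\<^sub>R y) + \<omega>" if "x \<in> grid_cell m y" for x
      using osc[OF that] by (auto simp: abs_le_iff)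
    have "(\<phi> ((1 / real m) *\<^sub>R y) - \<omega>) * vol (grid_cell m y) \<le> (LINT x:grid_cell m y|lborel. \<phi> x)"
      "(LINT x:grid_cell m y|lborel. \<phi> x) \<le> (\<phi> ((1 / real m) *\<^sub>R y) + \<omega>) * vol (grid_cell m y)"
      by (rule set_integral_bounds[OF grid_cell_measure(1,2)[OF m] \<phi>m o'], assumption+)+
    then show ?thesis unfolding grid_cell_measure(3)[OF m] by (simp add: abs_le_iff algebra_simps)
  qed
  ultimately have "\<bar>(\<Sum>y\<in>grid m. \<phi> ((1 / real m) *\<^sub>R y) * (1 / real m) ^ CARD('d)) - (LINT x:H|lborel. \<phi> x)\<bar>
      = \<bar>\<Sum>y\<in>grid m. \<phi> ((1 / real m) *\<^sub>R y) * (1 / real m) ^ CARD('d) - (LINT x:grid_cell m y|lborel. \<phi> x)\<bar>"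
    by (simp add: sum_subtractf)
  also have "\<dots> \<le> (\<Sum>y\<in>(grid m :: (real ^ 'd) set). \<omega> * (1 / real m) ^ CARD('d))"
    using cell by (intro order_trans[OF sum_abs] sum_mono)
  also have "\<dots> = \<omega>" using m by (simp add: card_grid power_divide)
  finally show ?thesis unfolding LH by (simp add: sum_divide_distrib power_divide)
qed

text \<open>
  The points of the grid with \<open>N = k^2\<close> are grouped into about \<open>k^d\<close> blocks of side \<open>k\<close>. Rounding costs one
  point for each block, negligible against \<open>N^d\<close>, and the blocks have diameter of order \<open>1/k\<close> after
  rescaling. Deleting a few more points makes the cardinality a \<open>d\<close>-th power.
\<close>
lemma discretise_density:
  fixes \<sigma> :: "real ^ 'd::finite \<Rightarrow> real"
  assumes \<sigma>: "\<And>x. 1/2 \<le> \<sigma> x" "\<And>x. \<sigma> x \<le> 1" and k: "k \<ge> 1" and N: "N = k * k"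
  obtains S :: "(real ^ 'd) set" and m where "S \<subseteq> grid N" "m \<le> N" "S \<in> lattice_sets m"
    "\<And>\<phi> B \<omega>. (\<And>x. x \<in> unit_cube \<Longrightarrow> \<bar>\<phi> x\<bar> \<le> B) \<Longrightarrow>
       (\<And>x y. x \<in> unit_cube \<Longrightarrow> y \<in> unit_cube \<Longrightarrow> dist x y \<le> real CARD('d) / real k \<Longrightarrow> \<bar>\<phi> x - \<phi> y\<bar> \<le> \<omega>) \<Longrightarrow>
       \<bar>(\<Sum>x\<in>S. \<phi> ((1 / real N) *\<^sub>R x)) - (\<Sum>x\<in>grid N. \<phi> ((1 / real N) *\<^sub>R x) * \<sigma> ((1 / real N) *\<^sub>R x))\<bar> / real N ^ CARD('d)
         \<le> B * (2 ^ CARD('d) * real CARD('d) / real N + 2 ^ CARD('d) / real k) + 2 * \<omega>"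
proof -
  define X where "X = (grid N :: (real ^ 'd) set)"
  have N1: "N \<ge> 1" using k N by simp
  define \<beta> where "\<beta> x = (\<lambda>b\<in>Basis. \<lfloor>x \<bullet> b / real k\<rfloor>)" for x :: "real ^ 'd"
  have fX: "finite X" by (simp add: X_def finite_grid)
  have cX: "card X = N ^ CARD('d)" by (simp add: X_def card_grid)
  have blocks: "card (\<beta> ` X) \<le> (k + 1) ^ CARD('d)"
  proof -
    have "\<beta> ` X \<subseteq> PiE Basis (\<lambda>_. {0..int k})"
    proof
      fix g assume "g \<in> \<beta> ` X"
      then obtain x where x: "x \<in> X" "g = \<beta> x" by blast
      have "\<lfloor>x \<bullet> b / real k\<rfloor> \<in> {0..int k}" if b: "b \<in> Basis" for b
      proof -
        obtain i where i: "i \<in> {1..N}" "x \<bullet> b = real i" using x(1) b unfolding X_def grid_iff_Basis by blast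
        have "real i \<le> real (k * k)" unfolding of_nat_le_iff using i N by simp
        then have "real i / real k \<le> real (k * k) / real k" by (rule divide_right_mono) simp
        then have "real i / real k \<le> real k" using k by simp
        then have "\<lfloor>real i / real k\<rfloor> \<le> int k" by linarith
        then show ?thesis using i by simp
      qed
      then show "g \<in> PiE Basis (\<lambda>_. {0..int k})" by (auto simp: x(2) \<beta>_def)
    qed
    moreover have "finite (PiE (Basis :: (real ^ 'd) set) (\<lambda>_. {0..int k}))" by (intro finite_PiE) auto
    ultimately have "card (\<beta> ` X) \<le> card (PiE (Basis :: (real ^ 'd) set) (\<lambda>_. {0..int k}))" by (rule card_mono[rotated])
    also have "\<dots> = (k + 1) ^ CARD('d)" by (simp add: card_PiE nat_add_distrib)
    finally show ?thesis .
  qed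
  have block_dist: "dist ((1 / real N) *\<^sub>R x) ((1 / real N) *\<^sub>R y) \<le> real CARD('d) / real k" if xy: "\<beta> x = \<beta> y" for x y
  proof -
    have "dist ((1 / real N) *\<^sub>R x) ((1 / real N) *\<^sub>R y) = norm ((1 / real N) *\<^sub>R (x - y))"
      by (simp only: dist_norm scaleR_diff_right)
    also have "\<dots> \<le> (\<Sum>b\<in>Basis. \<bar>((1 / real N) *\<^sub>R (x - y)) \<bullet> b\<bar>)" by (rule norm_le_l1)
    also have "\<dots> \<le> (\<Sum>b\<in>(Basis :: (real ^ 'd) set). 1 / real k)"
    proof (rule sum_mono)
      fix b :: "real ^ 'd" assume b: "b \<in> Basis"
      have "\<lfloor>x \<bullet> b / real k\<rfloor> = \<lfloor>y \<bullet> b / real k\<rfloor>" using fun_cong[OF xy, of b] b by (simp add: \<beta>_def)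
      then have "\<bar>x \<bullet> b / real k - y \<bullet> b / real k\<bar> \<le> 1" by linarith
      then have "\<bar>(x - y) \<bullet> b\<bar> / real k \<le> 1" using k by (simp add: inner_diff_left abs_divide flip: diff_divide_distrib)
      then have "\<bar>(x - y) \<bullet> b\<bar> / real k / real k \<le> 1 / real k" by (rule divide_right_mono) simp
      then show "\<bar>((1 / real N) *\<^sub>R (x - y)) \<bullet> b\<bar> \<le> 1 / real k" by (simp add: N abs_mult abs_divide)
    qed
    finally show ?thesis by simp
  qed
  have s01: "0 \<le> \<sigma> x" for x using \<sigma>(1)[of x] by linarith
  obtain S0 where S0: "S0 \<subseteq> X" and S0e: "\<And>(\<phi> :: real ^ 'd \<Rightarrow> real) B \<omega>. (\<And>x. x \<in> X \<Longrightarrow> \<bar>\<phi> x\<bar> \<le> B) \<Longrightarrow>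
     (\<And>x y. x \<in> X \<Longrightarrow> y \<in> X \<Longrightarrow> \<beta> x = \<beta> y \<Longrightarrow> \<bar>\<phi> x - \<phi> y\<bar> \<le> \<omega>) \<Longrightarrow>
     \<bar>(\<Sum>x\<in>S0. \<phi> x) - (\<Sum>x\<in>X. \<phi> x * \<sigma> ((1 / real N) *\<^sub>R x))\<bar> \<le> B * real (card (\<beta> ` X)) + 2 * \<omega> * real (card X)"
    by (rule block_rounding[OF fX, of "\<lambda>x. \<sigma> ((1 / real N) *\<^sub>R x)" \<beta>]) (use s01 \<sigma> in \<open>blast+\<close>)
  have fS0: "finite S0" using S0 fX by (rule finite_subset)
  have "card S0 \<le> N ^ CARD('d)" using card_mono[OF fX S0] cX by simp
  moreover have "CARD('d) \<ge> 1" by (simp add: Suc_le_eq)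
  ultimately obtain m where m: "m ^ CARD('d) \<le> card S0" "card S0 < (m + 1) ^ CARD('d)" "m \<le> N"
    using largest_power_below by metis
  obtain S where S: "S \<subseteq> S0" "card S = m ^ CARD('d)" using obtain_subset_with_card_n[OF m(1)] by blast
  show thesis
  proof (rule that[of S m])
    show SN: "S \<subseteq> grid N" using S(1) S0 by (simp add: X_def)
    show "m \<le> N" by (rule m)
    have "x \<in> int_lattice" if "x \<in> grid N" for x :: "real ^ 'd"
    proof -
      have "x $ i \<in> real ` {1..N}" for i using that by (simp add: grid_def)
      then have "x $ i \<in> \<int>" for i by (metis Ints_of_nat imageE)
      then show ?thesis by (simp add: int_lattice_def)
    qed
    then show "S \<in> lattice_sets m" using SN S(2) by (auto simp: lattice_sets_def)
    fix \<phi> :: "real ^ 'd \<Rightarrow> real" and B \<omega> :: real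
    assume B: "\<And>x. x \<in> unit_cube \<Longrightarrow> \<bar>\<phi> x\<bar> \<le> B"
      and \<omega>: "\<And>x y. x \<in> unit_cube \<Longrightarrow> y \<in> unit_cube \<Longrightarrow> dist x y \<le> real CARD('d) / real k \<Longrightarrow> \<bar>\<phi> x - \<phi> y\<bar> \<le> \<omega>"
    define \<psi> where "\<psi> x = \<phi> ((1 / real N) *\<^sub>R x)" for x
    have inQ: "(1 / real N) *\<^sub>R x \<in> unit_cube" if "x \<in> X" for x
      using that unfolding X_def by (rule grid_scaled_in_unit_cube[OF _ order_refl N1])
    have \<psi>B: "\<bar>\<psi> x\<bar> \<le> B" if "x \<in> X" for x using B inQ[OF that] by (simp add: \<psi>_def)
    have B0: "B \<ge> 0" using B[of 0] by (simp add: mem_box) 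
    have e1: "\<bar>(\<Sum>x\<in>S0. \<psi> x) - (\<Sum>x\<in>X. \<psi> x * \<sigma> ((1 / real N) *\<^sub>R x))\<bar> \<le> B * real (card (\<beta> ` X)) + 2 * \<omega> * real (card X)"
      by (rule S0e[OF \<psi>B]) (use \<omega> inQ block_dist in \<open>auto simp: \<psi>_def\<close>)
    have "real (card (\<beta> ` X)) \<le> real ((k + 1) ^ CARD('d))" using blocks by (simp only: of_nat_le_iff)
    then have "B * real (card (\<beta> ` X)) \<le> B * real (k + 1) ^ CARD('d)" using B0 by (intro mult_left_mono) auto
    then have e1': "\<bar>(\<Sum>x\<in>S0. \<psi> x) - (\<Sum>x\<in>X. \<psi> x * \<sigma> ((1 / real N) *\<^sub>R x))\<bar> \<le> B * real (k + 1) ^ CARD('d) + 2 * \<omega> * real N ^ CARD('d)"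
      using e1 cX by simp
    have "\<bar>(\<Sum>x\<in>S0. \<psi> x) - (\<Sum>x\<in>S. \<psi> x)\<bar> = \<bar>\<Sum>x\<in>S0 - S. \<psi> x\<bar>" using sum_diff[OF fS0 S(1), of \<psi>] by simp
    also have "\<dots> \<le> (\<Sum>x\<in>S0 - S. B)" using \<psi>B S0 by (intro order_trans[OF sum_abs] sum_mono) blast
    also have "\<dots> = B * (real (card S0) - real (m ^ CARD('d)))"
      using card_Diff_subset[OF finite_subset[OF S(1) fS0] S(1)] S(2) m(1) by (simp add: of_nat_diff)
    also have "\<dots> \<le> B * (real (m + 1) ^ CARD('d) - real m ^ CARD('d))"
    proof (rule mult_left_mono[OF _ B0])
      have "real (card S0) \<le> real ((m + 1) ^ CARD('d))" using m(2) by (simp only: of_nat_le_iff)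
      then show "real (card S0) - real (m ^ CARD('d)) \<le> real (m + 1) ^ CARD('d) - real m ^ CARD('d)"
        by (simp only: of_nat_power)
    qed
    finally have e2: "\<bar>(\<Sum>x\<in>S0. \<psi> x) - (\<Sum>x\<in>S. \<psi> x)\<bar> \<le> B * (real (m + 1) ^ CARD('d) - real m ^ CARD('d))" .
    have "\<bar>(\<Sum>x\<in>S. \<psi> x) - (\<Sum>x\<in>X. \<psi> x * \<sigma> ((1 / real N) *\<^sub>R x))\<bar>
        \<le> B * (real (m + 1) ^ CARD('d) - real m ^ CARD('d)) + B * real (k + 1) ^ CARD('d) + 2 * \<omega> * real N ^ CARD('d)"
      using e1' e2 by linarith
    then have "\<bar>(\<Sum>x\<in>S. \<psi> x) - (\<Sum>x\<in>X. \<psi> x * \<sigma> ((1 / real N) *\<^sub>R x))\<bar> / real N ^ CARD('d)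
        \<le> (B * (real (m + 1) ^ CARD('d) - real m ^ CARD('d)) + B * real (k + 1) ^ CARD('d) + 2 * \<omega> * real N ^ CARD('d)) / real N ^ CARD('d)"
      by (rule divide_right_mono) simp
    also have "\<dots> = B * ((real (m + 1) ^ CARD('d) - real m ^ CARD('d)) / real N ^ CARD('d) + real (k + 1) ^ CARD('d) / real N ^ CARD('d)) + 2 * \<omega>"
    proof -
      have "(B * a + B * b + 2 * \<omega> * Q) / Q = B * (a / Q + b / Q) + 2 * \<omega>" if "Q > 0" for a b Q :: real
        using that by (simp add: field_simps)
      then show ?thesis using N1 by simp
    qed
    also have "\<dots> \<le> B * (2 ^ CARD('d) * real CARD('d) / real N + 2 ^ CARD('d) / real k) + 2 * \<omega>"
    proof (intro add_right_mono mult_left_mono[OF _ B0] add_mono)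
      show "(real (m + 1) ^ CARD('d) - real m ^ CARD('d)) / real N ^ CARD('d) \<le> 2 ^ CARD('d) * real CARD('d) / real N"
        by (rule power_gap[OF m(3) N1])
      have "real (k + 1) / real N \<le> 2 / real k" using k by (simp add: N field_simps)
      then have "(real (k + 1) / real N) ^ CARD('d) \<le> (2 / real k) ^ CARD('d)" by (intro power_mono) auto
      also have "\<dots> = 2 ^ CARD('d) * (1 / real k) ^ CARD('d)" by (simp add: power_divide)
      also have "\<dots> \<le> 2 ^ CARD('d) * (1 / real k)"
      proof (rule mult_left_mono)
        have "(1 / real k) ^ CARD('d) \<le> (1 / real k) ^ 1" using k by (intro power_decreasing) (auto simp: Suc_le_eq)
        then show "(1 / real k) ^ CARD('d) \<le> 1 / real k" by simp
      qed simp
      finally show "real (k + 1) ^ CARD('d) / real N ^ CARD('d) \<le> 2 ^ CARD('d) / real k" by (simp add: power_divide)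
    qed
    finally show "\<bar>(\<Sum>x\<in>S. \<phi> ((1 / real N) *\<^sub>R x)) - (\<Sum>x\<in>grid N. \<phi> ((1 / real N) *\<^sub>R x) * \<sigma> ((1 / real N) *\<^sub>R x))\<bar> / real N ^ CARD('d)
         \<le> B * (2 ^ CARD('d) * real CARD('d) / real N + 2 ^ CARD('d) / real k) + 2 * \<omega>"
      unfolding \<psi>_def X_def .
  qed
qed

section \<open>From lattice bijections to transports\<close>

text \<open>
  The bijection \<open>f\<close> onto the grid of side \<open>m\<close> is extended to the whole space and conjugated by the scaling
  with factor \<open>N\<close>. Its values on the unit cube are bounded because \<open>m \<le> N\<close>. For \<open>m = 0\<close> both sums are
  empty.
\<close>
lemma rescaled_extension:
  fixes S :: "(real ^ 'd::finite) set"
  assumes L: "L \<ge> 0" and N: "N \<ge> 1" "m \<le> N" and S: "S \<subseteq> grid N" "S \<in> lattice_sets m"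
    and H: "m \<ge> 1 \<Longrightarrow> \<exists>f :: real ^ 'd \<Rightarrow> real ^ 'd. bij_betw f S (grid m) \<and> L-lipschitz_on S f"
  obtains F :: "real ^ 'd \<Rightarrow> real ^ 'd" where "(real CARD('d) * L)-lipschitz_on UNIV F"
    "\<And>x. x \<in> unit_cube \<Longrightarrow> norm (F x) \<le> real CARD('d) * (1 + 2 * real CARD('d) * L)"
    "\<And>\<phi> :: real ^ 'd \<Rightarrow> real. (\<Sum>x\<in>S. \<phi> (F ((1 / real N) *\<^sub>R x))) = (\<Sum>y\<in>grid m. \<phi> ((1 / real N) *\<^sub>R y))"
proof (cases "m = 0")
  case True
  have "finite S" using S(1) finite_grid by (rule finite_subset)
  then have "S = {}" using S(2) True by (simp add: lattice_sets_def zero_power)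
  moreover have "grid m = ({} :: (real ^ 'd) set)" using True by (simp add: grid_def)
  ultimately show thesis
    using L by (intro that[of "\<lambda>_. 0"] lipschitz_onI) auto
next
  case False
  define D where "D = real CARD('d)"
  obtain f :: "real ^ 'd \<Rightarrow> real ^ 'd" where f: "bij_betw f S (grid m)" "L-lipschitz_on S f" using H False by auto
  have fin: "finite S" using S(1) finite_grid by (rule finite_subset)
  have "card S > 0" using S(2) False by (simp add: lattice_sets_def)
  then have ne: "S \<noteq> {}" by auto
  obtain g where g: "(D * L)-lipschitz_on UNIV g" "\<And>x. x \<in> S \<Longrightarrow> g x = f x"
    using lipschitz_extension[OF fin ne f(2)] unfolding D_def by auto
  define F where "F x = (1 / real N) *\<^sub>R g (real N *\<^sub>R x)" for x
  have FS: "F ((1 / real N) *\<^sub>R x) = (1 / real N) *\<^sub>R f x" if "x \<in> S" for x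
    using N g(2)[OF that] by (simp add: F_def)
  have Flip: "dist (F x) (F y) \<le> D * L * dist x y" for x y
  proof -
    have "dist (F x) (F y) = (1 / real N) * dist (g (real N *\<^sub>R x)) (g (real N *\<^sub>R y))"
      by (simp add: F_def dist_norm flip: scaleR_diff_right)
    also have "\<dots> \<le> (1 / real N) * (D * L * dist (real N *\<^sub>R x) (real N *\<^sub>R y))"
      using lipschitz_onD[OF g(1)] by (intro mult_left_mono) auto
    also have "dist (real N *\<^sub>R x) (real N *\<^sub>R y) = real N * dist x y"
      by (simp add: dist_norm flip: scaleR_diff_right)
    finally show ?thesis using N by simp
  qed
  show thesis
  proof (rule that[of F])
    show "(real CARD('d) * L)-lipschitz_on UNIV F" using Flip L by (intro lipschitz_onI) (auto simp: D_def)
    show "(\<Sum>x\<in>S. \<phi> (F ((1 / real N) *\<^sub>R x))) = (\<Sum>y\<in>grid m. \<phi> ((1 / real N) *\<^sub>R y))" for \<phi> :: "real ^ 'd \<Rightarrow> real"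
    proof -
      have "(\<Sum>x\<in>S. \<phi> (F ((1 / real N) *\<^sub>R x))) = (\<Sum>x\<in>S. \<phi> ((1 / real N) *\<^sub>R f x))"
        by (intro sum.cong refl) (simp add: FS)
      also have "\<dots> = (\<Sum>y\<in>grid m. \<phi> ((1 / real N) *\<^sub>R y))"
        by (rule sum.reindex_bij_betw[OF f(1)])
      finally show ?thesis .
    qed
    fix x :: "real ^ 'd" assume x: "x \<in> unit_cube"
    obtain z where z: "z \<in> S" using ne by blast
    define w where "w = (1 / real N) *\<^sub>R z"
    have "z \<in> grid N" using z S(1) by blast
    then have w: "w \<in> unit_cube" unfolding w_def by (rule grid_scaled_in_unit_cube[OF _ order_refl N(1)])
    have "f z \<in> grid m" using f(1) z by (auto simp: bij_betw_def)
    then have "F w \<in> unit_cube" unfolding w_def FS[OF z] by (rule grid_scaled_in_unit_cube[OF _ N(2,1)])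
    then have 1: "norm (F w) \<le> D" using unit_cube_norm[of "F w"] by (simp add: D_def)
    have "dist x w \<le> 2 * D"
      using unit_cube_norm[OF x] unit_cube_norm[OF w] norm_triangle_ineq4[of x w] by (simp add: dist_norm D_def)
    then have "D * L * dist x w \<le> D * L * (2 * D)" using L by (intro mult_left_mono) (auto simp: D_def)
    then have "dist (F x) (F w) \<le> D * L * (2 * D)" using Flip[of x w] by linarith
    then have "norm (F x) \<le> D + D * L * (2 * D)" using 1 norm_triangle_sub[of "F x" "F w"] by (simp add: dist_norm)
    then show "norm (F x) \<le> real CARD('d) * (1 + 2 * real CARD('d) * L)" by (simp add: D_def algebra_simps)
  qed
qed

lemma eventually_small_oscillation:
  fixes \<phi> :: "'a::euclidean_space \<Rightarrow> real"
  assumes "continuous_on UNIV \<phi>" "\<epsilon> > 0"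
  obtains k0 where "\<And>k x y. k \<ge> k0 \<Longrightarrow> x \<in> unit_cube \<Longrightarrow> y \<in> unit_cube \<Longrightarrow> dist x y \<le> real DIM('a) / real k \<Longrightarrow> \<bar>\<phi> x - \<phi> y\<bar> \<le> \<epsilon>"
proof -
  obtain \<delta> where \<delta>: "\<delta> > 0" "\<And>x y. norm x \<le> real DIM('a) \<Longrightarrow> norm y \<le> real DIM('a) \<Longrightarrow> dist x y < \<delta> \<Longrightarrow> \<bar>\<phi> x - \<phi> y\<bar> < \<epsilon>"
    using uniformly_continuous_cball[OF assms] by metis
  obtain k0 where k0: "real DIM('a) / \<delta> < real k0" using reals_Archimedean2 by blast
  show thesis
  proof (rule that[of k0])
    fix k and x y :: 'a assume k: "k \<ge> k0" and xy: "x \<in> unit_cube" "y \<in> unit_cube" "dist x y \<le> real DIM('a) / real k"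
    have "real DIM('a) / \<delta> < real k" using k0 k by linarith
    moreover have "0 \<le> real DIM('a) / \<delta>" using \<delta>(1) by simp
    ultimately have "real k > 0" by linarith
    then have "real DIM('a) / real k < \<delta>"
      using \<open>real DIM('a) / \<delta> < real k\<close> \<delta>(1) by (simp add: field_simps)
    then show "\<bar>\<phi> x - \<phi> y\<bar> \<le> \<epsilon>" using \<delta>(2)[OF unit_cube_norm[OF xy(1)] unit_cube_norm[OF xy(2)]] xy(3) by (simp add: less_imp_le)
  qed
qed

text \<open>
  Normalised by \<open>N^d\<close>, the counting measures of the lattice sets from \<open>discretise_density\<close> converge to the
  measure with density \<open>\<sigma>\<close>. The bijections carry them to the counting measures of grids, which are Riemann
  sums for the integral over the cube of side \<open>m/N\<close>.
\<close>
lemma transport_continuous_density: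
  fixes \<sigma> :: "real ^ 'd::finite \<Rightarrow> real"
  assumes L: "L \<ge> 0"
    and H: "\<And>n (S :: (real ^ 'd) set). n \<ge> 1 \<Longrightarrow> S \<in> lattice_sets n \<Longrightarrow> \<exists>f :: real ^ 'd \<Rightarrow> real ^ 'd. bij_betw f S (grid n) \<and> L-lipschitz_on S f"
    and \<sigma>: "continuous_on UNIV \<sigma>" "\<And>x. 1/2 \<le> \<sigma> x" "\<And>x. \<sigma> x \<le> 1"
  obtains f M where "(real CARD('d) * L)-lipschitz_on UNIV f"
    "\<And>x. x \<in> unit_cube \<Longrightarrow> norm (f x) \<le> real CARD('d) * (1 + 2 * real CARD('d) * L)" "0 \<le> M" "M \<le> 1" "transports_to_cube f \<sigma> M"
proof -
  define B0 where "B0 = real CARD('d) * (1 + 2 * real CARD('d) * L)"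
  define K where "K n = Suc n" for n :: nat
  define N where "N n = K n * K n" for n
  have K1: "K n \<ge> 1" "N n \<ge> 1" "K n \<le> N n" for n by (auto simp: K_def N_def)
  define good where "good n S m \<longleftrightarrow> S \<subseteq> grid (N n) \<and> m \<le> N n \<and> S \<in> lattice_sets m \<and>
     (\<forall>\<phi> B \<omega>. (\<forall>x\<in>unit_cube. \<bar>\<phi> x\<bar> \<le> B) \<longrightarrow>
       (\<forall>x\<in>unit_cube. \<forall>y\<in>unit_cube. dist x y \<le> real CARD('d) / real (K n) \<longrightarrow> \<bar>\<phi> x - \<phi> y\<bar> \<le> \<omega>) \<longrightarrow>
       \<bar>(\<Sum>x\<in>S. \<phi> ((1 / real (N n)) *\<^sub>R x)) - (\<Sum>x\<in>grid (N n). \<phi> ((1 / real (N n)) *\<^sub>R x) * \<sigma> ((1 / real (N n)) *\<^sub>R x))\<bar> / real (N n) ^ CARD('d)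
         \<le> B * (2 ^ CARD('d) * real CARD('d) / real (N n) + 2 ^ CARD('d) / real (K n)) + 2 * \<omega>)"
    for n and S :: "(real ^ 'd) set" and m
  have "\<exists>S m. good n S m" for n
  proof (rule discretise_density[of \<sigma> "K n" "N n", OF \<sigma>(2,3) K1(1) N_def])
    fix S :: "(real ^ 'd) set" and m
    assume a: "S \<subseteq> grid (N n)" "m \<le> N n" "S \<in> lattice_sets m"
      and b: "\<And>\<phi> B \<omega>. (\<And>x. x \<in> unit_cube \<Longrightarrow> \<bar>\<phi> x\<bar> \<le> B) \<Longrightarrow>
       (\<And>x y. x \<in> unit_cube \<Longrightarrow> y \<in> unit_cube \<Longrightarrow> dist x y \<le> real CARD('d) / real (K n) \<Longrightarrow> \<bar>\<phi> x - \<phi> y\<bar> \<le> \<omega>) \<Longrightarrow>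
       \<bar>(\<Sum>x\<in>S. \<phi> ((1 / real (N n)) *\<^sub>R x)) - (\<Sum>x\<in>grid (N n). \<phi> ((1 / real (N n)) *\<^sub>R x) * \<sigma> ((1 / real (N n)) *\<^sub>R x))\<bar> / real (N n) ^ CARD('d)
         \<le> B * (2 ^ CARD('d) * real CARD('d) / real (N n) + 2 ^ CARD('d) / real (K n)) + 2 * \<omega>"
    have "good n S m" unfolding good_def
    proof (intro conjI a allI impI)
      fix \<phi> :: "real ^ 'd \<Rightarrow> real" and B \<omega>
      assume 1: "\<forall>x\<in>unit_cube. \<bar>\<phi> x\<bar> \<le> B"
        and 2: "\<forall>x\<in>unit_cube. \<forall>y\<in>unit_cube. dist x y \<le> real CARD('d) / real (K n) \<longrightarrow> \<bar>\<phi> x - \<phi> y\<bar> \<le> \<omega>"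
      show "\<bar>(\<Sum>x\<in>S. \<phi> ((1 / real (N n)) *\<^sub>R x)) - (\<Sum>x\<in>grid (N n). \<phi> ((1 / real (N n)) *\<^sub>R x) * \<sigma> ((1 / real (N n)) *\<^sub>R x))\<bar> / real (N n) ^ CARD('d)
         \<le> B * (2 ^ CARD('d) * real CARD('d) / real (N n) + 2 ^ CARD('d) / real (K n)) + 2 * \<omega>"
        by (rule b) (simp_all only: 1 2 simp_thms)
    qed
    then show "\<exists>S m. good n S m" by blast
  qed
  then obtain S m where Sm: "\<And>n. good n (S n) (m n)" by metis
  have S: "S n \<subseteq> grid (N n)" "m n \<le> N n" "S n \<in> lattice_sets (m n)" for n using Sm[of n] by (auto simp: good_def)
  have "\<exists>F :: real ^ 'd \<Rightarrow> real ^ 'd. (real CARD('d) * L)-lipschitz_on UNIV F \<and>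
    (\<forall>x\<in>unit_cube. norm (F x) \<le> B0) \<and>
    (\<forall>\<phi> :: real ^ 'd \<Rightarrow> real. (\<Sum>x\<in>S n. \<phi> (F ((1 / real (N n)) *\<^sub>R x))) = (\<Sum>y\<in>grid (m n). \<phi> ((1 / real (N n)) *\<^sub>R y)))" for n
    by (rule rescaled_extension[OF L K1(2) S(2) S(1) S(3) H[OF _ S(3)]]) (auto simp: B0_def)
  then obtain F :: "nat \<Rightarrow> real ^ 'd \<Rightarrow> real ^ 'd" where F: "\<And>n. (real CARD('d) * L)-lipschitz_on UNIV (F n)"
    "\<And>n x. x \<in> unit_cube \<Longrightarrow> norm (F n x) \<le> B0"
    "\<And>n (\<phi> :: real ^ 'd \<Rightarrow> real). (\<Sum>x\<in>S n. \<phi> (F n ((1 / real (N n)) *\<^sub>R x))) = (\<Sum>y\<in>grid (m n). \<phi> ((1 / real (N n)) *\<^sub>R y))"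
    by metis
  define \<Phi> where "\<Phi> n \<phi> = (\<Sum>x\<in>S n. \<phi> ((1 / real (N n)) *\<^sub>R x)) / real (N n) ^ CARD('d)" for n and \<phi> :: "real ^ 'd \<Rightarrow> real"
  define M where "M n = real (m n) / real (N n)" for n
  have M01: "0 \<le> M n \<and> M n \<le> 1" for n using S(2)[of n] K1[of n] by (simp add: M_def)
  have inQ: "(1 / real (N n)) *\<^sub>R x \<in> unit_cube" if "x \<in> S n" for n x
    using S(1)[of n] that by (intro grid_scaled_in_unit_cube[OF _ order_refl K1(2)]) blast
  obtain f M' where fM: "(real CARD('d) * L)-lipschitz_on UNIV f" "\<And>x. x \<in> unit_cube \<Longrightarrow> norm (f x) \<le> B0" "0 \<le> M'" "M' \<le> 1"
    "transports_to_cube f \<sigma> M'"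
  proof (rule transport_limit[of "real CARD('d) * L" F B0 M \<Phi> \<sigma>])
    show "(real CARD('d) * L)-lipschitz_on UNIV (F n)" for n by (rule F(1))
    show "norm (F n x) \<le> B0" if "x \<in> unit_cube" for n x by (rule F(2)[OF that])
    show "0 \<le> M n \<and> M n \<le> 1" for n by (rule M01)
  next
    fix n and \<phi> \<psi> :: "real ^ 'd \<Rightarrow> real" and \<epsilon> assume c: "\<And>x. x \<in> unit_cube \<Longrightarrow> \<bar>\<phi> x - \<psi> x\<bar> \<le> \<epsilon>"
    have \<epsilon>0: "\<epsilon> \<ge> 0" using c[of 0] by (simp add: mem_box)
    have "\<bar>\<Phi> n \<phi> - \<Phi> n \<psi>\<bar> = \<bar>\<Sum>x\<in>S n. \<phi> ((1 / real (N n)) *\<^sub>R x) - \<psi> ((1 / real (N n)) *\<^sub>R x)\<bar> / real (N n) ^ CARD('d)"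
      by (simp add: \<Phi>_def sum_subtractf flip: diff_divide_distrib)
    also have "\<dots> \<le> (\<Sum>x\<in>S n. \<epsilon>) / real (N n) ^ CARD('d)"
      using c inQ by (intro divide_right_mono order_trans[OF sum_abs] sum_mono) auto
    also have "\<dots> = \<epsilon> * (real (m n) ^ CARD('d) / real (N n) ^ CARD('d))"
      using S(3)[of n] by (simp add: lattice_sets_def)
    also have "\<dots> = \<epsilon> * M n ^ CARD('d)" by (simp add: M_def power_divide)
    also have "\<dots> \<le> \<epsilon> * 1" using M01[of n] \<epsilon>0 by (intro mult_left_mono power_le_one) auto
    finally show "\<bar>\<Phi> n \<phi> - \<Phi> n \<psi>\<bar> \<le> \<epsilon>" by simp
  next
    fix \<psi> :: "real ^ 'd \<Rightarrow> real" assume \<psi>: "continuous_on UNIV \<psi>"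
    have \<psi>\<sigma>: "continuous_on UNIV (\<lambda>x. \<psi> x * \<sigma> x)" using \<psi> \<sigma>(1) by (intro continuous_intros)
    obtain B where B: "\<And>x. x \<in> unit_cube \<Longrightarrow> \<bar>\<psi> x\<bar> \<le> B" using continuous_bounded_unit_cube[OF \<psi>] by metis
    have B00: "B \<ge> 0" using B[of 0] by (simp add: mem_box)
    show "(\<lambda>n. \<Phi> n \<psi>) \<longlonglongrightarrow> (LINT x:unit_cube|lborel. \<psi> x * \<sigma> x)"
    proof (rule LIMSEQ_I)
      fix \<epsilon> :: real assume \<epsilon>: "\<epsilon> > 0"
      have \<epsilon>8: "\<epsilon>/8 > 0" using \<epsilon> by simp
      obtain k1 where k1: "\<And>k x y. k \<ge> k1 \<Longrightarrow> x \<in> unit_cube \<Longrightarrow> y \<in> unit_cube \<Longrightarrow> dist x y \<le> real CARD('d) / real k \<Longrightarrow> \<bar>\<psi> x - \<psi> y\<bar> \<le> \<epsilon>/8"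
        using eventually_small_oscillation[OF \<psi> \<epsilon>8] by auto
      obtain k2 where k2: "\<And>k x y. k \<ge> k2 \<Longrightarrow> x \<in> unit_cube \<Longrightarrow> y \<in> unit_cube \<Longrightarrow> dist x y \<le> real CARD('d) / real k \<Longrightarrow> \<bar>\<psi> x * \<sigma> x - \<psi> y * \<sigma> y\<bar> \<le> \<epsilon>/8"
        using eventually_small_oscillation[OF \<psi>\<sigma> \<epsilon>8] by auto
      define c where "c = B * (2 ^ CARD('d) * real CARD('d) + 2 ^ CARD('d))"
      have c0: "c \<ge> 0" using B00 by (simp add: c_def)
      obtain k3 where k3: "8 * c / \<epsilon> < real k3" using reals_Archimedean2 by blast
      have "norm (\<Phi> n \<psi> - (LINT x:unit_cube|lborel. \<psi> x * \<sigma> x)) < \<epsilon>" if n: "n \<ge> max k1 (max k2 k3)" for n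
      proof -
        have Kn: "K n \<ge> k1" "K n \<ge> k2" "K n \<ge> k3" "N n \<ge> k2" using n K1[of n] by (auto simp: K_def N_def)
        define R where "R = (\<Sum>x\<in>grid (N n). \<psi> ((1 / real (N n)) *\<^sub>R x) * \<sigma> ((1 / real (N n)) *\<^sub>R x))"
        have 1: "\<bar>(\<Sum>x\<in>S n. \<psi> ((1 / real (N n)) *\<^sub>R x)) - R\<bar> / real (N n) ^ CARD('d)
            \<le> B * (2 ^ CARD('d) * real CARD('d) / real (N n) + 2 ^ CARD('d) / real (K n)) + 2 * (\<epsilon>/8)"
          using Sm[of n] B k1[OF Kn(1)] unfolding good_def R_def by blast
        have "B * (2 ^ CARD('d) * real CARD('d) / real (N n) + 2 ^ CARD('d) / real (K n)) \<le> c / real (K n)"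
        proof -
          have "2 ^ CARD('d) * real CARD('d) / real (N n) \<le> 2 ^ CARD('d) * real CARD('d) / real (K n)"
            using K1[of n] by (intro divide_left_mono) auto
          then have "B * (2 ^ CARD('d) * real CARD('d) / real (N n) + 2 ^ CARD('d) / real (K n)) \<le> B * (2 ^ CARD('d) * real CARD('d) / real (K n) + 2 ^ CARD('d) / real (K n))"
            using B00 by (intro mult_left_mono add_right_mono)
          then show ?thesis by (simp add: c_def add_divide_distrib distrib_left)
        qed
        also have "\<dots> \<le> \<epsilon>/8"
        proof -
          have "8 * c / \<epsilon> \<le> real (K n)" using k3 Kn(3) by linarith
          then have "8 * c \<le> real (K n) * \<epsilon>" using \<epsilon> by (simp add: pos_divide_le_eq)
          then show ?thesis using K1[of n] by (simp add: pos_divide_le_eq mult.commute)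
        qed
        finally have 2: "\<bar>(\<Sum>x\<in>S n. \<psi> ((1 / real (N n)) *\<^sub>R x)) - R\<bar> / real (N n) ^ CARD('d) \<le> 3 * \<epsilon>/8" using 1 by linarith
        have 3: "\<bar>R / real (N n) ^ CARD('d) - (LINT x:unit_cube|lborel. \<psi> x * \<sigma> x)\<bar> \<le> \<epsilon>/8"
          unfolding R_def by (rule grid_riemann_sum[OF K1(2) \<psi>\<sigma> k2[OF Kn(4)]])
        have "\<bar>\<Phi> n \<psi> - R / real (N n) ^ CARD('d)\<bar> \<le> 3 * \<epsilon>/8"
          using 2 unfolding \<Phi>_def by (simp add: abs_divide flip: diff_divide_distrib)
        then show ?thesis using 3 \<epsilon> unfolding real_norm_def by linarith
      qed
      then show "\<exists>no. \<forall>n\<ge>no. norm (\<Phi> n \<psi> - (LINT x:unit_cube|lborel. \<psi> x * \<sigma> x)) < \<epsilon>" by blast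
    qed
  next
    fix \<phi> :: "real ^ 'd \<Rightarrow> real" assume \<phi>: "continuous_on UNIV \<phi>"
    show "(\<lambda>n. \<Phi> n (\<lambda>x. \<phi> (F n x)) - scaled_integral (M n) \<phi>) \<longlonglongrightarrow> 0"
    proof (rule LIMSEQ_I)
      fix \<epsilon> :: real assume \<epsilon>: "\<epsilon> > 0"
      obtain k1 where k1: "\<And>k x y. k \<ge> k1 \<Longrightarrow> x \<in> unit_cube \<Longrightarrow> y \<in> unit_cube \<Longrightarrow> dist x y \<le> real CARD('d) / real k \<Longrightarrow> \<bar>\<phi> x - \<phi> y\<bar> \<le> \<epsilon>/2"
        using eventually_small_oscillation[OF \<phi>, of "\<epsilon>/2"] \<epsilon> by auto
      have "norm (\<Phi> n (\<lambda>x. \<phi> (F n x)) - scaled_integral (M n) \<phi> - 0) < \<epsilon>" if n: "n \<ge> k1" for n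
      proof (cases "m n = 0")
        case True
        then have "\<Phi> n (\<lambda>x. \<phi> (F n x)) = 0" unfolding \<Phi>_def F(3) by (simp add: grid_def)
        moreover have "scaled_integral (M n) \<phi> = 0" using True by (simp add: scaled_integral_def M_def)
        ultimately show ?thesis using \<epsilon> by simp
      next
        case False
        then have m1: "m n \<ge> 1" by simp
        have Nk: "N n \<ge> k1" using n K1[of n] by (simp add: K_def N_def)
        define \<psi> where "\<psi> x = \<phi> (M n *\<^sub>R x)" for x
        have \<psi>: "continuous_on UNIV \<psi>" unfolding \<psi>_def
          by (intro continuous_on_compose2[OF \<phi>] continuous_intros subset_UNIV)
        have MQ: "M n *\<^sub>R x \<in> unit_cube" if "x \<in> unit_cube" for x :: "real ^ 'd"
        proof -
          have "0 \<le> M n * (x \<bullet> b) \<and> M n * (x \<bullet> b) \<le> 1" if "b \<in> Basis" for b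
          proof -
            have "0 \<le> x \<bullet> b" "x \<bullet> b \<le> 1" using \<open>x \<in> unit_cube\<close> that by (auto simp: mem_box)
            then show ?thesis using M01[of n] by (simp add: mult_le_one)
          qed
          then show ?thesis by (simp add: mem_box)
        qed
        have "\<bar>(\<Sum>y\<in>grid (m n). \<psi> ((1 / real (m n)) *\<^sub>R y)) / real (m n) ^ CARD('d) - (LINT x:unit_cube|lborel. \<psi> x)\<bar> \<le> \<epsilon>/2"
        proof (rule grid_riemann_sum[OF m1 \<psi>])
          fix x y :: "real ^ 'd" assume xy: "x \<in> unit_cube" "y \<in> unit_cube" "dist x y \<le> real CARD('d) / real (m n)"
          have "dist (M n *\<^sub>R x) (M n *\<^sub>R y) = M n * dist x y" using M01[of n] by (simp add: dist_norm flip: scaleR_diff_right)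
          also have "\<dots> \<le> M n * (real CARD('d) / real (m n))" using xy(3) M01[of n] by (intro mult_left_mono) auto
          also have "\<dots> = real CARD('d) / real (N n)" using m1 by (simp add: M_def)
          finally show "\<bar>\<psi> x - \<psi> y\<bar> \<le> \<epsilon>/2" unfolding \<psi>_def by (rule k1[OF Nk MQ[OF xy(1)] MQ[OF xy(2)]])
        qed
        then have "M n ^ CARD('d) * \<bar>(\<Sum>y\<in>grid (m n). \<psi> ((1 / real (m n)) *\<^sub>R y)) / real (m n) ^ CARD('d) - (LINT x:unit_cube|lborel. \<psi> x)\<bar> \<le> 1 * (\<epsilon>/2)"
          using M01[of n] by (intro mult_mono power_le_one) auto
        moreover have "M n ^ CARD('d) * ((\<Sum>y\<in>grid (m n). \<psi> ((1 / real (m n)) *\<^sub>R y)) / real (m n) ^ CARD('d) - (LINT x:unit_cube|lborel. \<psi> x))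
            = \<Phi> n (\<lambda>x. \<phi> (F n x)) - scaled_integral (M n) \<phi>"
        proof -
          have "M n *\<^sub>R ((1 / real (m n)) *\<^sub>R y) = (1 / real (N n)) *\<^sub>R y" for y :: "real ^ 'd" using m1 by (simp add: M_def)
          then have "(\<Sum>y\<in>grid (m n). \<psi> ((1 / real (m n)) *\<^sub>R y)) = (\<Sum>y\<in>grid (m n). \<phi> ((1 / real (N n)) *\<^sub>R y))"
            by (simp only: \<psi>_def)
          moreover have "M n ^ CARD('d) * (a / real (m n) ^ CARD('d)) = a / real (N n) ^ CARD('d)" for a
            using m1 by (simp add: M_def power_divide)
          ultimately show ?thesis unfolding \<Phi>_def F(3) scaled_integral_def \<psi>_def by (simp add: right_diff_distrib)
        qed
        moreover have "M n ^ CARD('d) * \<bar>X\<bar> = \<bar>M n ^ CARD('d) * X\<bar>" for X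
          using M01[of n] by (simp add: abs_mult)
        ultimately have "\<bar>\<Phi> n (\<lambda>x. \<phi> (F n x)) - scaled_integral (M n) \<phi>\<bar> \<le> 1 * (\<epsilon>/2)"
          by (simp only:)
        then show ?thesis using \<epsilon> by simp
      qed
      then show "\<exists>no. \<forall>n\<ge>no. norm (\<Phi> n (\<lambda>x. \<phi> (F n x)) - scaled_integral (M n) \<phi> - 0) < \<epsilon>" by blast
    qed
  qed (rule that)
  show thesis by (rule that[OF fM(1) fM(2)[unfolded B0_def] fM(3-5)])
qed

text \<open>
  Off \<open>W n\<close> the densities \<open>\<rho>\<close> and \<open>\<sigma> n\<close> agree, so the integrals against a test function bounded by \<open>B\<close>
  differ by at most \<open>B / 2^n\<close>.
\<close>
lemma transport_limit_density:
  fixes \<rho> :: "real ^ 'd::finite \<Rightarrow> real"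
  assumes L: "L \<ge> 0"
    and H: "\<And>n (S :: (real ^ 'd) set). n \<ge> 1 \<Longrightarrow> S \<in> lattice_sets n \<Longrightarrow> \<exists>f :: real ^ 'd \<Rightarrow> real ^ 'd. bij_betw f S (grid n) \<and> L-lipschitz_on S f"
    and \<rho>: "\<rho> \<in> borel_measurable borel" "\<And>x. 1/2 \<le> \<rho> x" "\<And>x. \<rho> x \<le> 1"
    and \<sigma>: "\<And>n. continuous_on UNIV (\<sigma> n)" "\<And>n x. 1/2 \<le> \<sigma> n x" "\<And>n x. \<sigma> n x \<le> 1"
    and W: "\<And>n. W n \<in> fmeasurable lborel" "\<And>n. vol (W n) \<le> (1/2) ^ n" "\<And>n x. x \<notin> W n \<Longrightarrow> \<rho> x = \<sigma> n x"
  obtains f M where "(real CARD('d) * L)-lipschitz_on UNIV f" "0 \<le> M" "transports_to_cube f \<rho> M"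
proof -
  define B0 where "B0 = real CARD('d) * (1 + 2 * real CARD('d) * L)"
  have "\<exists>f M. (real CARD('d) * L)-lipschitz_on UNIV f \<and> (\<forall>x\<in>unit_cube. norm (f x) \<le> B0) \<and> 0 \<le> M \<and> M \<le> 1 \<and> transports_to_cube f (\<sigma> n) M" for n
    by (rule transport_continuous_density[OF L H \<sigma>]) (auto simp: B0_def)
  then obtain F M where F: "\<And>n. (real CARD('d) * L)-lipschitz_on UNIV (F n)" "\<And>n x. x \<in> unit_cube \<Longrightarrow> norm (F n x) \<le> B0"
    "\<And>n. 0 \<le> M n \<and> M n \<le> 1" "\<And>n. transports_to_cube (F n) (\<sigma> n) (M n)" by metis
  define \<Phi> where "\<Phi> n \<phi> = (LINT x:unit_cube|lborel. \<phi> x * \<sigma> n x)" for n and \<phi> :: "real ^ 'd \<Rightarrow> real"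
  have i\<sigma>: "set_integrable lborel unit_cube (\<lambda>x. \<phi> x * \<sigma> n x)" if "continuous_on UNIV \<phi>" for \<phi> n
    using that \<sigma>(1)[of n] by (intro set_integrable_unit_cube continuous_intros)
  have s0: "0 \<le> \<sigma> n x" "0 \<le> \<rho> x" for n x using \<sigma>(2)[of n x] \<rho>(2)[of x] by linarith+
  obtain f M' where fM: "(real CARD('d) * L)-lipschitz_on UNIV f" "\<And>x. x \<in> unit_cube \<Longrightarrow> norm (f x) \<le> B0" "0 \<le> M'" "M' \<le> 1"
    "transports_to_cube f \<rho> M'"
  proof (rule transport_limit[of "real CARD('d) * L" F B0 M \<Phi> \<rho>])
    show "(real CARD('d) * L)-lipschitz_on UNIV (F n)" for n by (rule F(1))
    show "norm (F n x) \<le> B0" if "x \<in> unit_cube" for n x by (rule F(2)[OF that])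
    show "0 \<le> M n \<and> M n \<le> 1" for n by (rule F(3))
  next
    fix n and \<phi> \<psi> :: "real ^ 'd \<Rightarrow> real" and \<epsilon> assume c: "continuous_on UNIV \<phi>" "continuous_on UNIV \<psi>" "\<And>x. x \<in> unit_cube \<Longrightarrow> \<bar>\<phi> x - \<psi> x\<bar> \<le> \<epsilon>"
    show "\<bar>\<Phi> n \<phi> - \<Phi> n \<psi>\<bar> \<le> \<epsilon>" unfolding \<Phi>_def
    proof (rule set_integral_close[OF i\<sigma>[OF c(1)] i\<sigma>[OF c(2)]])
      fix x :: "real ^ 'd" assume x: "x \<in> unit_cube"
      have "\<bar>\<phi> x - \<psi> x\<bar> * \<bar>\<sigma> n x\<bar> \<le> \<epsilon> * 1" using c(3)[OF x] s0(1)[of n x] \<sigma>(3)[of n x] by (intro mult_mono) auto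
      then show "\<bar>\<phi> x * \<sigma> n x - \<psi> x * \<sigma> n x\<bar> \<le> \<epsilon>" by (simp flip: left_diff_distrib add: abs_mult)
    qed
  next
    fix \<psi> :: "real ^ 'd \<Rightarrow> real" assume \<psi>: "continuous_on UNIV \<psi>"
    obtain B where B: "\<And>x. x \<in> unit_cube \<Longrightarrow> \<bar>\<psi> x\<bar> \<le> B" using continuous_bounded_unit_cube[OF \<psi>] by metis
    have B00: "B \<ge> 0" using B[of 0] by (simp add: mem_box)
    have \<psi>m: "\<psi> \<in> borel_measurable borel" using \<psi> by (rule borel_measurable_continuous_onI)
    have i\<rho>: "set_integrable lborel unit_cube (\<lambda>x. \<psi> x * \<rho> x)"
    proof (rule set_integrable_bounded[OF unit_cube_sets, of _ B])
      show "(\<lambda>x. \<psi> x * \<rho> x) \<in> borel_measurable borel" using \<psi>m \<rho>(1) by (rule borel_measurable_times)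
      fix x :: "real ^ 'd" assume "x \<in> unit_cube"
      then have "\<bar>\<psi> x\<bar> * \<bar>\<rho> x\<bar> \<le> B * 1" using B s0(2)[of x] \<rho>(3)[of x] B00 by (intro mult_mono) auto
      then show "\<bar>\<psi> x * \<rho> x\<bar> \<le> B" by (simp add: abs_mult)
    qed
    have iW: "set_integrable lborel unit_cube (\<lambda>x. c * indicat_real (W n) x)" for n c
      by (rule set_integrable_bounded[OF unit_cube_sets, of _ "\<bar>c\<bar>"]) (use fmeasurableD[OF W(1)] in \<open>auto simp: indicator_def\<close>)
    have bd: "\<bar>\<Phi> n \<psi> - (LINT x:unit_cube|lborel. \<psi> x * \<rho> x)\<bar> \<le> B * (1/2) ^ n" for n
    proof -
      have d: "\<bar>\<psi> x * \<sigma> n x - \<psi> x * \<rho> x\<bar> \<le> B * indicat_real (W n) x" if x: "x \<in> unit_cube" for x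
      proof (cases "x \<in> W n")
        case True
        have "\<bar>\<sigma> n x - \<rho> x\<bar> \<le> 1" using s0(1)[of n x] s0(2)[of x] \<sigma>(3)[of n x] \<rho>(3)[of x] by (simp add: abs_le_iff)
        then have "\<bar>\<psi> x\<bar> * \<bar>\<sigma> n x - \<rho> x\<bar> \<le> B * 1" using B[OF x] B00 by (intro mult_mono) auto
        then show ?thesis using True by (simp flip: right_diff_distrib add: abs_mult)
      next
        case False then show ?thesis using W(3)[OF False] by simp
      qed
      have lW: "(LINT x:unit_cube|lborel. c * indicat_real (W n) x) = c * vol (unit_cube \<inter> W n)" for c
      proof -
        have "(LINT x:unit_cube|lborel. c * indicat_real (W n) x) = (LINT x|lborel. c * indicat_real (unit_cube \<inter> W n) x)"
          unfolding set_lebesgue_integral_def by (intro Bochner_Integration.integral_cong refl) (simp add: indicator_def)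
        then show ?thesis by simp
      qed
      have "vol (unit_cube \<inter> W n) \<le> vol (W n)"
        using fmeasurableD[OF W(1)] W(1) by (intro measure_mono_fmeasurable) auto
      then have vW: "vol (unit_cube \<inter> W n) \<le> (1/2) ^ n" using W(2)[of n] by linarith
      have "\<Phi> n \<psi> - (LINT x:unit_cube|lborel. \<psi> x * \<rho> x) = (LINT x:unit_cube|lborel. \<psi> x * \<sigma> n x - \<psi> x * \<rho> x)"
        unfolding \<Phi>_def by (rule set_integral_diff(2)[OF i\<sigma>[OF \<psi>] i\<rho>, symmetric])
      moreover have "(LINT x:unit_cube|lborel. \<psi> x * \<sigma> n x - \<psi> x * \<rho> x) \<le> (LINT x:unit_cube|lborel. B * indicat_real (W n) x)"
        by (rule set_integral_mono[OF set_integral_diff(1)[OF i\<sigma>[OF \<psi>] i\<rho>] iW]) (use d in \<open>force simp: abs_le_iff\<close>)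
      moreover have "(LINT x:unit_cube|lborel. (-B) * indicat_real (W n) x) \<le> (LINT x:unit_cube|lborel. \<psi> x * \<sigma> n x - \<psi> x * \<rho> x)"
        by (rule set_integral_mono[OF iW set_integral_diff(1)[OF i\<sigma>[OF \<psi>] i\<rho>]]) (use d in \<open>force simp: abs_le_iff\<close>)
      moreover have "B * vol (unit_cube \<inter> W n) \<le> B * (1/2) ^ n" using vW B00 by (rule mult_left_mono)
      ultimately show ?thesis unfolding lW by (simp add: abs_le_iff)
    qed
    have null: "(\<lambda>n. B * (1/2) ^ n) \<longlonglongrightarrow> 0" by (intro tendsto_mult_right_zero LIMSEQ_power_zero) simp
    have "\<forall>\<^sub>F n in sequentially. norm (\<Phi> n \<psi> - (LINT x:unit_cube|lborel. \<psi> x * \<rho> x)) \<le> B * (1/2) ^ n"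
      unfolding real_norm_def by (intro always_eventually allI bd)
    then have "(\<lambda>n. \<Phi> n \<psi> - (LINT x:unit_cube|lborel. \<psi> x * \<rho> x)) \<longlonglongrightarrow> 0"
      by (rule Lim_null_comparison[OF _ null])
    then show "(\<lambda>n. \<Phi> n \<psi>) \<longlonglongrightarrow> (LINT x:unit_cube|lborel. \<psi> x * \<rho> x)" by (rule LIM_zero_cancel)
  next
    fix \<phi> :: "real ^ 'd \<Rightarrow> real" assume "continuous_on UNIV \<phi>"
    then have "\<Phi> n (\<lambda>x. \<phi> (F n x)) = scaled_integral (M n) \<phi>" for n
      using F(4)[of n] unfolding \<Phi>_def transports_to_cube_def by blast
    then show "(\<lambda>n. \<Phi> n (\<lambda>x. \<phi> (F n x)) - scaled_integral (M n) \<phi>) \<longlonglongrightarrow> 0" by simp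
  qed (rule that)
  show thesis by (rule that[OF fM(1,3,5)])
qed

lemma no_uniform_lipschitz_bijections:
  assumes dim: "CARD('d::finite) \<ge> 2"
    and H: "\<And>n (S :: (real ^ 'd) set). n \<ge> 1 \<Longrightarrow> S \<in> lattice_sets n \<Longrightarrow> \<exists>f :: real ^ 'd \<Rightarrow> real ^ 'd. bij_betw f S (grid n) \<and> L-lipschitz_on S f"
  shows False
proof -
  have L: "L \<ge> 0"
  proof -
    obtain S :: "(real ^ 'd) set" where "S \<in> lattice_sets 1" using lattice_sets_nonempty by blast
    then show ?thesis using H[of 1 S] lipschitz_on_nonneg by blast
  qed
  obtain e :: "real ^ 'd" where e: "e \<in> Basis" using nonempty_Basis by blast
  have dim': "DIM(real ^ 'd) \<ge> 2" using dim by simp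
  obtain Dset :: "((real ^ 'd) \<times> real) set" where D: "countable Dset" "\<And>W. open W \<Longrightarrow> W \<noteq> {} \<Longrightarrow> \<exists>d\<in>Dset. d \<in> W"
    using countable_dense_exists by metis
  show False
  proof (rule checkered_density_exists[OF e dim' D])
    fix \<rho> \<sigma> W
    assume \<rho>: "\<rho> \<in> borel_measurable borel" "\<And>x. 1/2 \<le> \<rho> x" "\<And>x. \<rho> x \<le> 1" "checkered e Dset \<rho>"
      and \<sigma>: "\<And>n. continuous_on UNIV (\<sigma> n)" "\<And>n x. 1/2 \<le> \<sigma> n x" "\<And>n x. \<sigma> n x \<le> 1"
      and W: "\<And>n::nat. W n \<in> fmeasurable lborel" "\<And>n. vol (W n) \<le> (1/2) ^ n" "\<And>n x. x \<notin> W n \<Longrightarrow> \<rho> x = \<sigma> n x"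
    obtain f M where f: "(real CARD('d) * L)-lipschitz_on UNIV f" "0 \<le> M" "transports_to_cube f \<rho> M"
      by (rule transport_limit_density[OF L H \<rho>(1-3) \<sigma> W])
    interpret transport f \<rho> "real CARD('d) * L" "cbox 0 (M *\<^sub>R One)"
      by (rule transport_of_transports_to_cube[OF f(1) \<rho>(1-3) f(2,3)])
    obtain \<A> T G C U where "sheeted_transport f \<rho> (real CARD('d) * L) (cbox 0 (M *\<^sub>R One)) (\<A> :: (real ^ 'd) set set) T G C U"
      by (rule sheets_exist)
    then show False by (rule sheeted_transport.not_checkered[OF _ e D(2) \<rho>(4)])
  qed
qed

theorem theorem1p2:
  assumes "CARD('d::finite) \<ge> 2"
  shows "\<not> bounded (worst_Lip TYPE('d) ` {1..})"
proof
  assume "bounded (worst_Lip TYPE('d) ` {1..})"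
  then obtain B where "\<forall>x\<in>worst_Lip TYPE('d) ` {1..}. \<bar>x\<bar> \<le> B" unfolding bounded_real by blast
  then have B: "\<bar>worst_Lip TYPE('d) n\<bar> \<le> B" if "n \<ge> 1" for n using that by simp
  have "\<exists>f :: real ^ 'd \<Rightarrow> real ^ 'd. bij_betw f S (grid n) \<and> (B + 1)-lipschitz_on S f"
    if n: "n \<ge> 1" and S: "S \<in> lattice_sets n" for n and S :: "(real ^ 'd) set"
  proof -
    have "best_Lip n S \<le> worst_Lip TYPE('d) n" unfolding worst_Lip_def
      using S bdd_above_best_Lip[OF n] by (intro cSup_upper) auto
    then have "Inf {Lip S f |f. bij_betw f S (grid n)} < B + 1" using B[OF n] unfolding best_Lip_def by linarith
    moreover have "{Lip S f |f. bij_betw f S (grid n)} \<noteq> {}" using bijection_to_grid_exists[OF n S] by blast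
    ultimately have "\<exists>v\<in>{Lip S f |f. bij_betw f S (grid n)}. v < B + 1" by (rule cInf_lessD[rotated])
    then obtain f where f: "bij_betw f S (grid n)" "Lip S f < B + 1" by blast
    have "(Lip S f)-lipschitz_on S f" by (rule lipschitz_on_Lip[OF bijection_to_grid_lipschitz[OF S f(1)]])
    then have "(B + 1)-lipschitz_on S f" by (rule lipschitz_on_le) (use f(2) in simp)
    then show ?thesis using f(1) by blast
  qed
  then show False by (rule no_uniform_lipschitz_bijections[OF assms])
qed

end
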